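(* Suppose that: (a) $p(x,\cdot)$, $x\in\mathbb{Z}$, is a sequence of independent identically distributed random vectors; (b) there is an $\varepsilon>0$ such that $p(1)\ge\varepsilon$, $p(-1)\ge\varepsilon$, $p(m)\ge\varepsilon$ and $p(-m)\ge\varepsilon$ for any $p(\cdot)\in\tilde{\mathcal{J}}_0$; (c) for $\mathbb{P}$-almost all environments $\omega$ the corresponding one-dimensional random walk $\xi(\cdot)$ is recurrent; (d) $\tilde{\mathcal{J}}_0\not\subset\tilde{\mathcal{J}}_{al}$. Then there is a weakly converging (as $t\to\infty$) sequence of random variables $b_t=b_t(\omega)$, $t=1,2,\dots$, such that for any $\epsilon>0$ $$\mathbb{P}\left\{\omega : Pr_{\omega}\left(\left|\frac{\xi(t)}{(\log t)^2}-b_t(\omega)\right|\le\epsilon\right)\ge 1-\epsilon\right\}\to 1\quad\text{as } t\to\infty .$$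
   Context: Fix an integer $m>1$. $\tilde{\mathcal{J}}$ is the set of all $(2m+1)$-dimensional probability vectors $(p(j))_{-m\le j\le m}$, $p(\cdot)\ge0$, $\sum_{j=-m}^m p(j)=1$. An environment is a random sequence $\omega=(p(x,\cdot))_{x\in\mathbb{Z}}$ with $p(x,\cdot)\in\tilde{\mathcal{J}}$; its law is $\mathbb{P}$. For fixed $\omega$, the one-dimensional random walk with bounded jumps $\xi(t)$, $t=0,1,2,\dots$, on $\mathbb{Z}$ is the Markov chain with $\xi(0)=0$ and $Pr_\omega(\xi(t+1)=n+k\mid\xi(t)=n)=p(n,k)$ for $n\in\mathbb{Z}$, $-m\le k\le m$; $Pr_\omega$ denotes its law. $\tilde{\mathcal{J}}_0\subset\tilde{\mathcal{J}}$ is the support of the distribution of the random vector $p(0,\cdot)$, and $$\tilde{\mathcal{J}}_{al}=\Big\{p(\cdot)\in\tilde{\mathcal{J}}:\ \sum_{j=-m}^m j\,p(j)=0\Big\}.$$ *)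

theory Defs
  imports "HOL-Probability.Probability"
begin

text \<open>
  A vector \<open>(p(j))\<close> with \<open>-m \<le> j \<le> m\<close> is encoded as a function \<open>int \<Rightarrow> real\<close> vanishing outside
  \<open>{-m..m}\<close>.  On such functions the product topology of \<open>int \<Rightarrow> real\<close> (and hence its Borel
  sigma-algebra) is the Euclidean one of dimension \<open>2 m + 1\<close>.
\<close>

definition jump_vectors :: "int \<Rightarrow> (int \<Rightarrow> real) set" where
  "jump_vectors m =
     {p. (\<forall>j. 0 \<le> p j) \<and> (\<forall>j. j \<notin> {-m..m} \<longrightarrow> p j = 0) \<and> (\<Sum>j\<in>{-m..m}. p j) = 1}"

definition balanced_jump_vectors :: "int \<Rightarrow> (int \<Rightarrow> real) set" where
  "balanced_jump_vectors m = {p \<in> jump_vectors m. (\<Sum>j\<in>{-m..m}. of_int j * p j) = 0}"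

definition env_space :: "int \<Rightarrow> (int \<Rightarrow> int \<Rightarrow> real) measure" where
  "env_space m = (\<Pi>\<^sub>M x\<in>UNIV. restrict_space borel (jump_vectors m))"

text \<open>Topological support; in a second countable space this is the least closed set of full measure.\<close>

definition dist_support :: "'a::topological_space measure \<Rightarrow> 'a set" where
  "dist_support M = {x. \<forall>U. open U \<longrightarrow> x \<in> U \<longrightarrow> 0 < emeasure M U}"


text \<open>
  The law of the walk in a fixed environment \<open>\<omega>\<close> is a measure on trajectories \<open>nat \<Rightarrow> int\<close>, built by
  the Ionescu Tulcea extension from the conditional law of each coordinate given the previous ones.
  Lemma \<open>measure_walk_law_cylinder\<close> below identifies its finite-dimensional distributions.
\<close>

definition walk_step :: "(int \<Rightarrow> int \<Rightarrow> real) \<Rightarrow> int \<Rightarrow> int pmf" where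
  "walk_step \<omega> n = embed_pmf (\<lambda>y. \<omega> n (y - n))"

fun walk_kernel :: "(int \<Rightarrow> int \<Rightarrow> real) \<Rightarrow> nat \<Rightarrow> (nat \<Rightarrow> int) \<Rightarrow> int measure" where
  "walk_kernel \<omega> 0 \<xi> = measure_pmf (return_pmf 0)"
| "walk_kernel \<omega> (Suc t) \<xi> = measure_pmf (walk_step \<omega> (\<xi> t))"

definition walk_law :: "(int \<Rightarrow> int \<Rightarrow> real) \<Rightarrow> (nat \<Rightarrow> int) measure" where
  "walk_law \<omega> = projective_family.lim UNIV
     (Ionescu_Tulcea.CI (walk_kernel \<omega>) (\<lambda>_. count_space UNIV)) (\<lambda>_. count_space UNIV)"

definition recurrent_walk :: "(int \<Rightarrow> int \<Rightarrow> real) \<Rightarrow> bool" where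
  "recurrent_walk \<omega> \<longleftrightarrow> (AE \<xi> in walk_law \<omega>. infinite {t. \<xi> t = 0})"


lemma space_env_space: "space (env_space m) = {\<omega>. \<forall>x. \<omega> x \<in> jump_vectors m}"
  by (auto simp: env_space_def space_PiM space_restrict_space)

lemma pmf_walk_step:
  assumes "\<omega> n \<in> jump_vectors m"
  shows "pmf (walk_step \<omega> n) y = \<omega> n (y - n)"
proof -
  have nonneg: "\<And>j. 0 \<le> \<omega> n j" and out: "\<And>j. j \<notin> {-m..m} \<Longrightarrow> \<omega> n j = 0"
    and total: "(\<Sum>j\<in>{-m..m}. \<omega> n j) = 1"
    using assms by (auto simp: jump_vectors_def)
  have "(\<integral>\<^sup>+y. ennreal (\<omega> n (y - n)) \<partial>count_space UNIV)
      = (\<integral>\<^sup>+j. ennreal (\<omega> n j) \<partial>count_space UNIV)"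
    by (rule nn_integral_bij_count_space) (auto intro!: bij_betwI[of _ _ _ "\<lambda>j. j + n"])
  also have "\<dots> = (\<Sum>j\<in>{-m..m}. ennreal (\<omega> n j))"
    using out by (intro nn_integral_count_space'[OF finite_atLeastAtMost_int]) (auto; fail)+
  also have "\<dots> = 1"
    using nonneg total by (simp add: sum_ennreal)
  finally show ?thesis
    unfolding walk_step_def using nonneg by (subst pmf_embed_pmf) auto
qed

lemma Ionescu_Tulcea_walk_kernel:
  "Ionescu_Tulcea (walk_kernel \<omega>) (\<lambda>_. count_space UNIV)"
proof (rule Ionescu_Tulcea.intro)
  fix i
  show "walk_kernel \<omega> i \<in>
      (\<Pi>\<^sub>M x\<in>{0..<i}. count_space UNIV) \<rightarrow>\<^sub>M subprob_algebra (count_space UNIV)"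
  proof (cases i)
    case 0
    have "walk_kernel \<omega> 0 = (\<lambda>_. measure_pmf (return_pmf 0))"
      by (rule ext) simp
    then show ?thesis
      using 0 by (simp add: measure_pmf_in_subprob_algebra)
  next
    case (Suc t)
    have "(\<lambda>\<xi>. \<xi> t) \<in> (\<Pi>\<^sub>M x\<in>{0..<Suc t}. count_space UNIV) \<rightarrow>\<^sub>M count_space (UNIV :: int set)"
      by (rule measurable_component_singleton) simp
    then have "(\<lambda>\<xi>. measure_pmf (walk_step \<omega> (\<xi> t))) \<in>
        (\<Pi>\<^sub>M x\<in>{0..<Suc t}. count_space UNIV) \<rightarrow>\<^sub>M subprob_algebra (count_space UNIV)"
      by (rule measurable_compose) (simp add: measure_pmf_in_subprob_algebra)
    moreover have "walk_kernel \<omega> (Suc t) = (\<lambda>\<xi>. measure_pmf (walk_step \<omega> (\<xi> t)))"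
      by (rule ext) simp
    ultimately show ?thesis
      using Suc by simp
  qed
next
  fix i \<xi>
  show "prob_space (walk_kernel \<omega> i \<xi>)"
    by (cases i) (auto intro: measure_pmf.prob_space_axioms)
qed

lemma sets_walk_law: "sets (walk_law \<omega>) = sets (\<Pi>\<^sub>M t\<in>UNIV. count_space UNIV)"
proof -
  interpret IT: Ionescu_Tulcea "walk_kernel \<omega>" "\<lambda>_. count_space UNIV"
    by (rule Ionescu_Tulcea_walk_kernel)
  show ?thesis
    by (simp add: walk_law_def)
qed

lemma space_walk_law: "space (walk_law \<omega>) = UNIV"
  using sets_eq_imp_space_eq[OF sets_walk_law] by (simp add: space_PiM)

lemma prob_space_walk_law: "prob_space (walk_law \<omega>)"
proof -
  interpret IT: Ionescu_Tulcea "walk_kernel \<omega>" "\<lambda>_. count_space UNIV"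
    by (rule Ionescu_Tulcea_walk_kernel)
  have "emeasure IT.PF.lim (IT.PF.emb UNIV {} {\<lambda>x. undefined}) = emeasure (IT.CI {}) {\<lambda>x. undefined}"
    by (rule IT.lim) (auto simp: PiM_empty)
  also have "\<dots> = 1"
    using prob_space.emeasure_space_1[OF IT.PF.prob_space_P[of "{}"]]
    by (simp add: IT.CI_def space_PiM)
  also have "IT.PF.emb UNIV {} {\<lambda>x. undefined} = UNIV"
    by (auto simp: prod_emb_def space_PiM)
  finally show ?thesis
    using space_walk_law[of \<omega>] by (intro prob_spaceI) (simp add: walk_law_def)
qed

lemma measure_walk_law_cylinder:
  assumes \<omega>: "\<omega> \<in> space (env_space m)"
  shows "measure (walk_law \<omega>) {\<xi>. \<forall>i\<le>t. \<xi> i = x i}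
       = (if x 0 = 0 then \<Prod>i<t. \<omega> (x i) (x (Suc i) - x i) else 0)"
proof -
  interpret IT: Ionescu_Tulcea "walk_kernel \<omega>" "\<lambda>_. count_space UNIV"
    by (rule Ionescu_Tulcea_walk_kernel)
  let ?M = "\<lambda>n. \<Pi>\<^sub>M i\<in>{0..<n}. count_space (UNIV :: int set)"
  let ?x = "\<lambda>n. restrict x {0..<n}"
  let ?u = "\<lambda>_. undefined :: int"
  let ?k = "\<lambda>n. emeasure (walk_kernel \<omega> n (?x n)) {x n}"
  have sing: "{?x n} \<in> sets (?M n)" for n
  proof -
    have "{?x n} = PiE {0..<n} (\<lambda>i. {x i})"
      by (auto simp: PiE_iff extensional_def fun_eq_iff)
    then show ?thesis
      by (simp only:) (auto intro!: sets_PiM_I_finite)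
  qed
  have C: "emeasure (IT.C 0 n ?u) {?x n} = (\<Prod>i<n. ?k i)" for n
  proof (induction n)
    case 0
    have "?x 0 = ?u" by (auto simp: restrict_def)
    then show ?case using sing[of 0] by simp
  next
    case (Suc n)
    have u: "?u \<in> space (?M 0)" by (simp add: space_PiM PiE_iff extensional_def)
    have "emeasure (IT.C 0 (Suc n) ?u) {?x (Suc n)}
        = (\<integral>\<^sup>+\<xi>. emeasure (IT.eP n \<xi>) {?x (Suc n)} \<partial>IT.C 0 n ?u)"
    proof -
      have "space (IT.C 0 n ?u) \<noteq> {}"
        using prob_space.not_empty[OF IT.prob_space_C[OF u]] .
      moreover have "IT.eP n \<in> IT.C 0 n ?u \<rightarrow>\<^sub>M subprob_algebra (?M (Suc n))"
        using IT.measurable_eP[of n] IT.sets_C[OF u, of n]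
        by (simp cong: measurable_cong_sets)
      ultimately show ?thesis
        using sing[of "Suc n"] by (simp add: emeasure_bind)
    qed
    also have "\<dots> = (\<integral>\<^sup>+\<xi>. ?k n * indicator {?x n} \<xi> \<partial>IT.C 0 n ?u)"
    proof (rule nn_integral_cong)
      fix \<xi> assume "\<xi> \<in> space (IT.C 0 n ?u)"
      then have \<xi>: "\<xi> \<in> space (?M n)" by (simp add: IT.space_C[OF u])
      then have ext: "\<xi> \<in> extensional {0..<n}" by (simp add: space_PiM PiE_iff)
      have eq: "fun_upd \<xi> n y = ?x (Suc n) \<longleftrightarrow> \<xi> = ?x n \<and> y = x n" for y
      proof
        assume *: "fun_upd \<xi> n y = ?x (Suc n)"
        have "\<xi> i = ?x n i" for i
          using fun_cong[OF *, of i] ext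
          by (cases "i < n"; cases "i = n") (auto simp: extensional_def split: if_splits)
        then show "\<xi> = ?x n \<and> y = x n"
          using fun_cong[OF *, of n] by auto
      qed (auto simp: fun_eq_iff less_Suc_eq)
      have "fun_upd \<xi> n -` {?x (Suc n)} = (if \<xi> = ?x n then {x n} else {})"
        using eq by auto
      then show "emeasure (IT.eP n \<xi>) {?x (Suc n)} = ?k n * indicator {?x n} \<xi>"
        by (simp add: IT.emeasure_eP[OF \<xi> sing] split: split_indicator)
    qed
    also have "\<dots> = ?k n * emeasure (IT.C 0 n ?u) {?x n}"
      using sing[of n] IT.sets_C[OF u, of n] by (subst nn_integral_cmult_indicator) auto
    finally show ?case
      by (simp only: Suc prod.lessThan_Suc mult.commute)
  qed
  have k0: "?k 0 = (if x 0 = 0 then 1 else 0)"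
    by (simp add: indicator_def)
  have kS: "?k (Suc i) = ennreal (\<omega> (x i) (x (Suc i) - x i))" for i
    using \<omega> by (simp add: emeasure_pmf_single pmf_walk_step[of _ _ m] space_env_space)
  have nonneg: "0 \<le> \<omega> i j" for i j
    using \<omega> by (auto simp: space_env_space jump_vectors_def)
  have cyl: "{\<xi>. \<forall>i\<le>t. \<xi> i = x i} = IT.PF.emb UNIV {0..<Suc t} {?x (Suc t)}"
    by (auto simp: prod_emb_def space_PiM fun_eq_iff restrict_def less_Suc_eq_le; metis)
  have "emeasure (walk_law \<omega>) {\<xi>. \<forall>i\<le>t. \<xi> i = x i} = emeasure (IT.CI {0..<Suc t}) {?x (Suc t)}"
    unfolding cyl walk_law_def by (rule IT.lim) (use sing in auto)
  also have "\<dots> = emeasure (IT.C 0 (Suc t) ?u) (IT.PF.emb {0..<Suc t} {0..<Suc t} {?x (Suc t)})"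
    by (rule IT.emeasure_CI) (use sing in auto)
  also have "\<dots> = emeasure (IT.C 0 (Suc t) ?u) {?x (Suc t)}"
    using sets.sets_into_space[OF sing[of "Suc t"]] by (subst prod_emb_id) (auto simp: space_PiM)
  also have "\<dots> = (if x 0 = 0 then 1 else 0) * (\<Prod>i<t. ennreal (\<omega> (x i) (x (Suc i) - x i)))"
    by (simp only: C prod.lessThan_Suc_shift k0 kS)
  also have "\<dots> = ennreal (if x 0 = 0 then \<Prod>i<t. \<omega> (x i) (x (Suc i) - x i) else 0)"
    using nonneg by (simp add: prod_ennreal)
  finally show ?thesis
    using nonneg by (simp add: measure_def prod_nonneg)
qed

end

theory Submission
  imports Defs
begin

text \<open>
  On a window \<open>[a, b]\<close> the walk with jumps clipped to the window has an invariant measure \<open>\<pi>\<close>, and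
  \<open>u = - ln \<pi>\<close> serves as the potential, although the chain is not reversible.  A maximum principle shows
  that \<open>u x - u y\<close> depends, up to a bounded error, only on the environment between \<open>x\<close> and \<open>y\<close>.  So the
  potential is a quasi-additive functional of an i.i.d. field: it obeys a central limit theorem and fourth
  moment bounds.  Recurrence forces its mean to be bounded, and an unbalanced vector in the support forces a
  positive variance \<open>\<sigma>\<close>.

  With \<open>T = ln t\<close>, the potential on the scale \<open>T\<^sup>2\<close> divided by \<open>T\<close> is, on a fine grid and after rounding,
  close to a Gaussian random walk.  With high probability such a path has no near ties, and then it has a
  valley of depth larger than \<open>1\<close> around the origin with an essentially unique bottom.  A Dirichlet form
  estimate for Green functions shows that at time \<open>t\<close> the walk sits near the bottom of this valley.  The
  bottom is a function of the rounded increments, whose law converges, so for every accuracy there are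
  finitely valued centres with convergent laws; a diagonal choice among them yields \<open>b\<^sub>t\<close>.
\<close>

text \<open>For jumps of length up to m there is no detailed balance, hence no product formula for
  exit probabilities. Two facts about invariant measures replace it. Invariance alone makes the form
  \<Sum> \<pi> f (f - P f) control the nearest-neighbour increments of f, and truncation then yields
  Green function bounds of the shape \<pi> y * \<Sum> 1 / \<pi>, as for a birth and death chain. And
  measures of nested windows agree up to a constant factor, which is a bounded error in u; such
  errors vanish after division by ln t.

  No invariance principle in path space is invoked. Rounding makes the valley a function of finitely
  many independent integers, so the probability of every event about them converges and the bottom
  may be picked in any way, even discontinuously. The price is that the Gaussian estimates must not
  deteriorate as the grid is refined, since its fineness is chosen after the margins. This is why
  ties are excluded only between blocks of cells that are not adjacent: the increments between such
  blocks have a variance that does not depend on the fineness. The bottom is then known up to two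
  blocks, a small length.\<close>

type_synonym env = "int \<Rightarrow> int \<Rightarrow> real"
type_synonym path = "int \<Rightarrow> real"

section \<open>The walk clipped to a window and its excursion measure\<close>

definition clip :: "int \<Rightarrow> int \<Rightarrow> int \<Rightarrow> int" where
 "clip a b z = max a (min b z)"

definition clip_op :: "int \<Rightarrow> env \<Rightarrow> int \<Rightarrow> int \<Rightarrow> path \<Rightarrow> int \<Rightarrow> real" where
 "clip_op m w a b f x = (\<Sum>j\<in>{-m..m}. w x j * f (clip a b (x + j)))"

text \<open>Invariance is tested against functions: in this weak form it passes through reflection
  and into the Dirichlet form without any transition kernel.\<close>

definition invariant_on :: "int \<Rightarrow> env \<Rightarrow> int \<Rightarrow> int \<Rightarrow> path \<Rightarrow> bool" where
 "invariant_on m w a b \<pi> \<longleftrightarrow> (\<forall>x\<in>{a..b}. 0 < \<pi> x) \<and>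
   (\<forall>f. (\<Sum>x\<in>{a..b}. \<pi> x * clip_op m w a b f x) = (\<Sum>x\<in>{a..b}. \<pi> x * f x))"

text \<open>Mass at \<open>y\<close> after \<open>k\<close> steps of the clipped chain that starts
  at \<open>a\<close> and is killed on its return to \<open>a\<close>. The sum over \<open>k\<close>
  below is the expected number of visits to \<open>y\<close> in one excursion, the classical cycle
  formula for an invariant measure. Its terms are polynomials in the environment inside the window,
  which later gives measurability and locality.\<close>

primrec excursion_mass :: "int \<Rightarrow> env \<Rightarrow> int \<Rightarrow> int \<Rightarrow> nat \<Rightarrow> int \<Rightarrow> real" where
 "excursion_mass m w a b 0 y = (if y = a then 1 else 0)"
| "excursion_mass m w a b (Suc k) y = (if y = a then 0 else
   (\<Sum>x\<in>{a..b}. excursion_mass m w a b k x * clip_op m w a b (\<lambda>z. if z = y then 1 else 0) x))"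

definition excursion_measure :: "int \<Rightarrow> env \<Rightarrow> int \<Rightarrow> int \<Rightarrow> int \<Rightarrow> real" where
 "excursion_measure m w a b y = (\<Sum>k. excursion_mass m w a b k y)"

lemma clip_mem: "a \<le> b \<Longrightarrow> clip a b z \<in> {a..b}"
 by (auto simp: clip_def)

lemma clip_id: "z \<in> {a..b} \<Longrightarrow> clip a b z = z"
 by (auto simp: clip_def)

lemma invariant_onD:
 assumes "invariant_on m w a b \<pi>"
 shows "x \<in> {a..b} \<Longrightarrow> 0 < \<pi> x"
  and "(\<Sum>x\<in>{a..b}. \<pi> x * clip_op m w a b f x) = (\<Sum>x\<in>{a..b}. \<pi> x * f x)"
 using assms by (auto simp: invariant_on_def)

locale elliptic_env =
 fixes m :: int and \<epsilon> :: real and w :: env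
 assumes m_pos: "1 \<le> m" and eps_pos: "0 < \<epsilon>"
  and jumps: "\<And>x. w x \<in> jump_vectors m"
  and right: "\<And>x. \<epsilon> \<le> w x 1" and left: "\<And>x. \<epsilon> \<le> w x (-1)"
begin

abbreviation "Pop \<equiv> clip_op m w"

lemma nonneg: "0 \<le> w x j"
 using jumps[of x] by (auto simp: jump_vectors_def)

lemma total: "(\<Sum>j\<in>{-m..m}. w x j) = 1"
 using jumps[of x] by (auto simp: jump_vectors_def)

lemma outside: "j \<notin> {-m..m} \<Longrightarrow> w x j = 0"
 using jumps[of x] by (auto simp: jump_vectors_def)

lemma Pop_mono:
 assumes "a \<le> b" "\<And>z. z \<in> {a..b} \<Longrightarrow> f z \<le> g z"
 shows "Pop a b f x \<le> Pop a b g x"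
 unfolding clip_op_def by (intro sum_mono mult_left_mono assms(2) clip_mem assms(1) nonneg)

lemma Pop_cong:
 assumes "a \<le> b" "\<And>z. z \<in> {a..b} \<Longrightarrow> f z = g z"
 shows "Pop a b f x = Pop a b g x"
 unfolding clip_op_def by (intro sum.cong refl arg_cong2[where f="(*)"] assms(2) clip_mem assms(1))

lemma Pop_const: "Pop a b (\<lambda>_. c) x = c"
 unfolding clip_op_def by (simp add: total flip: sum_distrib_right)

lemma Pop_nonneg: "a \<le> b \<Longrightarrow> (\<And>z. z \<in> {a..b} \<Longrightarrow> 0 \<le> f z) \<Longrightarrow> 0 \<le> Pop a b f x"
 using Pop_mono[of a b "\<lambda>_. 0" f x] by (simp add: Pop_const)

lemma Pop_add: "Pop a b (\<lambda>z. f z + g z) x = Pop a b f x + Pop a b g x"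
 by (simp add: clip_op_def distrib_left sum.distrib)

lemma Pop_diff: "Pop a b (\<lambda>z. f z - g z) x = Pop a b f x - Pop a b g x"
 by (simp add: clip_op_def right_diff_distrib sum_subtractf)

lemma Pop_cmult: "Pop a b (\<lambda>z. c * f z) x = c * Pop a b f x"
 unfolding clip_op_def sum_distrib_left by (intro sum.cong) (auto simp: mult_ac)

lemma Pop_sum: "Pop a b (\<lambda>z. \<Sum>i\<in>I. f i z) x = (\<Sum>i\<in>I. Pop a b (f i) x)"
 unfolding clip_op_def sum_distrib_left by (subst sum.swap) auto

lemma Pop_ge_single:
 assumes "a \<le> b" "\<And>z. z \<in> {a..b} \<Longrightarrow> 0 \<le> f z" "j \<in> {-m..m}"
 shows "w x j * f (clip a b (x + j)) \<le> Pop a b f x"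
 unfolding clip_op_def by (rule member_le_sum[where f="\<lambda>j. w x j * f (clip a b (x + j))"])
  (auto intro!: mult_nonneg_nonneg nonneg assms clip_mem assms(3) simp del: atLeastAtMost_iff)

lemma Pop_indicator_expand:
 assumes "a \<le> b"
 shows "Pop a b f x = (\<Sum>y\<in>{a..b}. f y * Pop a b (\<lambda>z. if z = y then 1 else 0) x)"
proof -
 have "Pop a b f x = Pop a b (\<lambda>z. \<Sum>y\<in>{a..b}. f y * (if z = y then 1 else 0)) x"
  by (rule Pop_cong[OF assms]) (simp add: if_distrib cong: if_cong)
 also have "... = (\<Sum>y\<in>{a..b}. f y * Pop a b (\<lambda>z. if z = y then 1 else 0) x)"
  by (simp add: Pop_sum Pop_cmult)
 finally show ?thesis .
qed

lemma eps_le_1: "\<epsilon> \<le> 1 / 2"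
proof -
 have "w 0 (-1) + w 0 1 = sum (w 0) {-1, 1}" by simp
 also have "... \<le> sum (w 0) {-m..m}" by (rule sum_mono2) (use m_pos in \<open>auto simp: nonneg\<close>)
 finally show ?thesis using total[of 0] right[of 0] left[of 0] by simp
qed

subsection \<open>Existence of the invariant measure\<close>

context
 fixes a b :: int
 assumes ab: "a \<le> b"
begin

abbreviation "em \<equiv> excursion_mass m w a b"

lemma em_nonneg: "0 \<le> em k y"
 by (induction k arbitrary: y) (auto intro!: sum_nonneg mult_nonneg_nonneg Pop_nonneg ab)

text \<open>Pushing the killed mass one step differs from applying \<open>Pop\<close> to the test
  function only by the mass that lands on \<open>a\<close>, which is discarded.\<close>

lemma em_step:
 "(\<Sum>y\<in>{a..b}. em (Suc k) y * f y)
  = (\<Sum>x\<in>{a..b}. em k x * Pop a b f x) - f a * (\<Sum>x\<in>{a..b}. em k x * Pop a b (\<lambda>z. if z = a then 1 else 0) x)"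
proof -
 let ?K = "\<lambda>x y. Pop a b (\<lambda>z. if z = y then 1 else 0) x"
 have a: "a \<in> {a..b}" using ab by simp
 have "(\<Sum>x\<in>{a..b}. em k x * Pop a b f x) = (\<Sum>x\<in>{a..b}. \<Sum>y\<in>{a..b}. em k x * (f y * ?K x y))"
  by (subst Pop_indicator_expand[OF ab]) (simp add: sum_distrib_left)
 also have "... = (\<Sum>y\<in>{a..b}. f y * (\<Sum>x\<in>{a..b}. em k x * ?K x y))"
  by (subst sum.swap) (simp add: sum_distrib_left mult_ac)
 also have "... = f a * (\<Sum>x\<in>{a..b}. em k x * ?K x a) + (\<Sum>y\<in>{a..b} - {a}. f y * (\<Sum>x\<in>{a..b}. em k x * ?K x y))"
  by (subst sum.remove[OF _ a]) auto
 also have "(\<Sum>y\<in>{a..b} - {a}. f y * (\<Sum>x\<in>{a..b}. em k x * ?K x y)) = (\<Sum>y\<in>{a..b} - {a}. em (Suc k) y * f y)"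
  by (intro sum.cong) auto
 also have "... = (\<Sum>y\<in>{a..b}. em (Suc k) y * f y)" by (intro sum.mono_neutral_left) auto
 finally show ?thesis by simp
qed

abbreviation "esc k \<equiv> (\<Sum>x\<in>{a..b}. em k x * Pop a b (\<lambda>z. if z = a then 1 else 0) x)"

lemma em_mass_Suc: "(\<Sum>y\<in>{a..b}. em (Suc k) y) = (\<Sum>y\<in>{a..b}. em k y) - esc k"
 using em_step[of k "\<lambda>_. 1"] by (simp add: Pop_const)

lemma esc_nonneg: "0 \<le> esc k"
 by (intro sum_nonneg mult_nonneg_nonneg Pop_nonneg em_nonneg ab) auto

lemma em_mass_le_1: "(\<Sum>y\<in>{a..b}. em k y) \<le> 1"
proof (induction k)
 case 0 then show ?case using ab by simp
next
 case (Suc k) then show ?case using em_mass_Suc[of k] esc_nonneg[of k] by linarith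
qed

text \<open>Excursions are short on average: with q = \<epsilon> / 2 the function \<psi> x = q ^ (x
  - a) at least doubles under \<open>Pop\<close> off \<open>a\<close>, because the step to the left
  alone contributes \<epsilon> / q = 2 times its value. The weighted mass \<open>W\<close> is
  therefore dominated by its own increment plus the mass lost at \<open>a\<close>, and both
  telescope.\<close>

lemma em_summable: assumes y: "y \<in> {a..b}" shows "summable (\<lambda>k. em k y)"
proof -
 define q where "q = \<epsilon> / 2"
 define \<psi> where "\<psi> = (\<lambda>x. q ^ nat (x - a))"
 have q: "0 < q" "q < 1" using eps_pos eps_le_1 by (auto simp: q_def)
 have psi: "0 < \<psi> x" "\<psi> x \<le> 1" for x using q by (auto simp: \<psi>_def power_le_one)
 have P2: "2 * \<psi> x \<le> Pop a b \<psi> x" if "x \<in> {a..b}" "x \<noteq> a" for x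
 proof -
  have "nat (x - a) = Suc (nat (x - 1 - a))" using that by auto
  then have "2 * \<psi> x = \<epsilon> * \<psi> (x - 1)" by (simp add: \<psi>_def q_def)
  also have "... \<le> w x (-1) * \<psi> (x + -1)" using left[of x] psi[of "x-1"] by (simp add: mult_right_mono)
  also have "... = w x (-1) * \<psi> (clip a b (x + -1))" using that by (subst clip_id) auto
  also have "... \<le> Pop a b \<psi> x" by (rule Pop_ge_single) (use ab m_pos psi in \<open>auto simp: less_imp_le\<close>)
  finally show ?thesis .
 qed
 define W where "W = (\<lambda>k. \<Sum>y\<in>{a..b}. em k y * \<psi> y)"
 define M where "M = (\<lambda>k. \<Sum>y\<in>{a..b}. em k y)"
 have W0: "0 \<le> W k" for k unfolding W_def using psi by (auto intro!: sum_nonneg mult_nonneg_nonneg em_nonneg simp: less_imp_le)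
 have WM: "W k \<le> M k" for k unfolding W_def M_def using psi by (intro sum_mono) (auto intro!: mult_left_le em_nonneg)
 have M: "M k \<le> 1" "0 \<le> M k" for k using em_mass_le_1[of k] W0[of k] WM[of k] by (auto simp: M_def)
 \<comment> \<open>The time index starts at \<open>Suc k\<close>: at time 0 all mass sits at
   \<open>a\<close>, where \<psi> need not double.\<close>
 have step: "W (Suc k) \<le> (W (Suc (Suc k)) - W (Suc k)) + (M (Suc k) - M (Suc (Suc k)))" for k
 proof -
  have "2 * W (Suc k) = (\<Sum>x\<in>{a..b}. em (Suc k) x * (2 * \<psi> x))" by (simp add: W_def sum_distrib_left mult_ac)
  also have "... \<le> (\<Sum>x\<in>{a..b}. em (Suc k) x * Pop a b \<psi> x)"
  proof (rule sum_mono)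
   fix x assume "x \<in> {a..b}"
   then show "em (Suc k) x * (2 * \<psi> x) \<le> em (Suc k) x * Pop a b \<psi> x"
    using P2[of x] em_nonneg[of "Suc k" x] excursion_mass.simps(2)[of m w a b k a]
    by (cases "x = a") (auto intro!: mult_left_mono simp del: excursion_mass.simps(2))
  qed
  also have "... = W (Suc (Suc k)) + \<psi> a * esc (Suc k)" using em_step[of "Suc k" \<psi>] by (simp add: W_def)
  also have "\<psi> a * esc (Suc k) \<le> esc (Suc k)"
   using psi[of a] esc_nonneg[of "Suc k"] by (simp add: mult_left_le_one_le)
  also have "esc (Suc k) = M (Suc k) - M (Suc (Suc k))" using em_mass_Suc[of "Suc k"] by (simp add: M_def)
  finally show ?thesis by simp
 qed
 have tele: "(\<Sum>k<n. W (Suc k)) \<le> W (Suc n) - W 1 + (M 1 - M (Suc n))" for n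
 proof (induction n)
  case (Suc n) then show ?case using step[of n] by simp
 qed simp
 have bd: "(\<Sum>k<n. em (Suc k) y) \<le> 2 / \<psi> y" for n
 proof -
  have "(\<Sum>k<n. em (Suc k) y) * \<psi> y = (\<Sum>k<n. em (Suc k) y * \<psi> y)" by (simp add: sum_distrib_right)
  also have "... \<le> (\<Sum>k<n. W (Suc k))" unfolding W_def using y psi
   by (intro sum_mono member_le_sum[where f="\<lambda>y. em _ y * \<psi> y"]) (auto intro!: mult_nonneg_nonneg em_nonneg simp: less_imp_le simp del: excursion_mass.simps)
  also have "... \<le> 2" using tele[of n] W0[of 1] WM[of "Suc n"] M[of 1] M(1)[of "Suc n"] M(2)[of "Suc n"] by linarith
  finally show ?thesis using psi[of y] by (simp add: field_simps)
 qed
 have "summable (\<lambda>k. em (Suc k) y)" by (rule summableI_nonneg_bounded[OF em_nonneg bd])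
 then show ?thesis by (subst (asm) summable_Suc_iff)
qed

lemma excursion_measure_at_start: "excursion_measure m w a b a = 1"
proof -
 have "(\<lambda>k. em k a) sums (\<Sum>k\<in>{0}. em k a)"
  by (rule sums_finite) (auto simp: gr0_conv_Suc elim!: not_None_eq[THEN iffD1] dest!: gr0_implies_Suc)
 then show ?thesis by (simp add: excursion_measure_def sums_iff)
qed

lemma excursion_measure_pairing:
 "(\<Sum>x\<in>{a..b}. excursion_measure m w a b x * f x) = (\<Sum>k. \<Sum>x\<in>{a..b}. em k x * f x)"
 "summable (\<lambda>k. \<Sum>x\<in>{a..b}. em k x * f x)" unfolding excursion_measure_def
 by (subst suminf_sum) (auto intro!: sum.cong suminf_mult2 summable_sum summable_mult2 em_summable)

lemma excursion_measure_balance: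
 "(\<Sum>x\<in>{a..b}. excursion_measure m w a b x * Pop a b f x) = (\<Sum>x\<in>{a..b}. excursion_measure m w a b x * f x)"
proof -
 let ?\<pi> = "excursion_measure m w a b"
 have *: "(\<Sum>x\<in>{a..b}. ?\<pi> x * f x) - f a = (\<Sum>x\<in>{a..b}. ?\<pi> x * Pop a b f x) - f a * (\<Sum>k. esc k)" for f
 proof -
  have "(\<Sum>x\<in>{a..b}. ?\<pi> x * f x) = (\<Sum>k. \<Sum>x\<in>{a..b}. em (Suc k) x * f x) + (\<Sum>x\<in>{a..b}. em 0 x * f x)"
   unfolding excursion_measure_pairing(1) by (subst suminf_split_head[OF excursion_measure_pairing(2)]) simp
  also have "(\<Sum>x\<in>{a..b}. em 0 x * f x) = f a" using ab by (simp add: mult_delta_left)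
  also have "(\<Sum>k. \<Sum>x\<in>{a..b}. em (Suc k) x * f x) = (\<Sum>x\<in>{a..b}. ?\<pi> x * Pop a b f x) - f a * (\<Sum>k. esc k)"
   unfolding em_step excursion_measure_pairing(1)
   by (subst suminf_diff[symmetric]) (auto intro!: excursion_measure_pairing(2) summable_mult simp: suminf_mult[OF excursion_measure_pairing(2)])
  finally show ?thesis by simp
 qed
 \<comment> \<open>With f = 1 the identity above shows that the returning mass adds up to 1; the two
   corrections at \<open>a\<close> then cancel for every f.\<close>
 have "(\<Sum>k. esc k) = 1" using *[of "\<lambda>_. 1"] by (simp add: Pop_const)
 then show ?thesis using *[of f] by simp
qed

end
end

section \<open>Auxiliary inequalities and reflection of environments\<close>

lemma sum_telescope_int:
 fixes g :: path
 assumes "a \<le> b"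
 shows "(\<Sum>k\<in>{a..<b}. g k - g (k + 1)) = g a - g b"
 using assms
proof (induction b rule: int_ge_induct)
 case (step i)
 then have "{a..<i + 1} = insert i {a..<i}" by auto
 then show ?case using step by simp
qed simp

lemma Cauchy_Schwarz_weighted:
 fixes p d :: "'a \<Rightarrow> real"
 assumes "\<And>i. i \<in> I \<Longrightarrow> 0 < p i"
 shows "(\<Sum>i\<in>I. \<bar>d i\<bar>)\<^sup>2 \<le> (\<Sum>i\<in>I. 1 / p i) * (\<Sum>i\<in>I. p i * (d i)\<^sup>2)"
proof -
 have "(\<Sum>i\<in>I. \<bar>d i\<bar>) = (\<Sum>i\<in>I. (1 / sqrt (p i)) * (sqrt (p i) * \<bar>d i\<bar>))"
  using assms by (intro sum.cong) (auto simp: less_imp_neq[symmetric])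
 also have "...\<^sup>2 \<le> (\<Sum>i\<in>I. (1 / sqrt (p i))\<^sup>2) * (\<Sum>i\<in>I. (sqrt (p i) * \<bar>d i\<bar>)\<^sup>2)"
  by (rule Cauchy_Schwarz_ineq_sum)
 also have "(\<Sum>i\<in>I. (1 / sqrt (p i))\<^sup>2) = (\<Sum>i\<in>I. 1 / p i)"
  using assms by (intro sum.cong) (auto simp: power_divide less_imp_le)
 also have "(\<Sum>i\<in>I. (sqrt (p i) * \<bar>d i\<bar>)\<^sup>2) = (\<Sum>i\<in>I. p i * (d i)\<^sup>2)"
  using assms by (intro sum.cong) (auto simp: power_mult_distrib less_imp_le)
 finally show ?thesis .
qed

definition reflect_env :: "env \<Rightarrow> int \<Rightarrow> int \<Rightarrow> real" where
 "reflect_env w x j = w (- x) (- j)"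

lemma clip_uminus: "clip (- b) (- a) (- z) = - clip a b z" if "a \<le> b"
 using that by (auto simp: clip_def max_def min_def)

lemma clip_op_reflect:
 assumes "a \<le> b"
 shows "clip_op m (reflect_env w) (- b) (- a) f (- x) = clip_op m w a b (\<lambda>z. f (- z)) x"
 unfolding clip_op_def
proof (rule sum.reindex_bij_witness[of _ uminus uminus])
 fix j assume "j \<in> {- m..m}"
 have "f (clip (- b) (- a) (- x + j)) = f (- clip a b (x + - j))" using clip_uminus[OF assms, of "x + - j"] by simp
 then show "w x (- j) * f (- clip a b (x + - j)) = reflect_env w (- x) j * f (clip (- b) (- a) (- x + j))"
  by (simp add: reflect_env_def)
qed auto

lemma sum_uminus_int: "(\<Sum>x\<in>{- b..- a}. f x) = (\<Sum>x\<in>{a..b}. f (- x))" for a b :: int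
 by (rule sum.reindex_bij_witness[of _ uminus uminus]) auto

lemma invariant_on_reflect:
 assumes "a \<le> b" "invariant_on m w a b \<pi>"
 shows "invariant_on m (reflect_env w) (- b) (- a) (\<lambda>x. \<pi> (- x))"
 unfolding invariant_on_def
proof (intro conjI ballI allI)
 fix x assume "x \<in> {- b..- a}"
 then show "0 < \<pi> (- x)" by (intro invariant_onD(1)[OF assms(2)]) auto
next
 fix f
 show "(\<Sum>x\<in>{- b..- a}. \<pi> (- x) * clip_op m (reflect_env w) (- b) (- a) f x) = (\<Sum>x\<in>{- b..- a}. \<pi> (- x) * f x)"
  unfolding sum_uminus_int clip_op_reflect[OF assms(1)] using invariant_onD(2)[OF assms(2)] by simp
qed

lemma elliptic_env_reflect:
 assumes "elliptic_env m \<epsilon> w" shows "elliptic_env m \<epsilon> (reflect_env w)"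
proof -
 interpret elliptic_env m \<epsilon> w by fact
 have "(\<Sum>j\<in>{-m..m}. reflect_env w x j) = 1" for x
  using total[of "- x"] sum_uminus_int[of "w (- x)" m "- m"] by (simp add: reflect_env_def)
 moreover have "reflect_env w x j = 0" if "j \<notin> {-m..m}" for x j
  unfolding reflect_env_def by (rule outside) (use that in auto)
 ultimately have "reflect_env w x \<in> jump_vectors m" for x by (auto simp: jump_vectors_def reflect_env_def nonneg)
 then show ?thesis using m_pos eps_pos right left by unfold_locales (auto simp: reflect_env_def)
qed

section \<open>Harnack inequality\<close>

context elliptic_env begin

text \<open>The balance equation at \<open>y\<close> keeps the contribution of the single step from
  \<open>x\<close>, which has probability at least \<epsilon>. Only \<pi> \<ge> 0 is assumed, since
  this inequality is what makes the excursion measure strictly positive.\<close>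

lemma balance_Harnack:
 assumes "a \<le> b" "\<And>x. x \<in> {a..b} \<Longrightarrow> 0 \<le> \<pi> x"
  and bal: "\<And>f. (\<Sum>x\<in>{a..b}. \<pi> x * Pop a b f x) = (\<Sum>x\<in>{a..b}. \<pi> x * f x)"
  and x: "x \<in> {a..b}" and y: "y \<in> {a..b}" and xy: "y = x + 1 \<or> y = x - 1"
 shows "\<epsilon> * \<pi> x \<le> \<pi> y"
proof -
 define f where "f = (\<lambda>z. if z = y then 1 else 0 :: real)"
 have "\<epsilon> \<le> w x (y - x) * f (clip a b (x + (y - x)))"
  using xy right[of x] left[of x] y by (auto simp: f_def clip_id)
 also have "... \<le> Pop a b f x" by (rule Pop_ge_single) (use assms(1) xy m_pos in \<open>auto simp: f_def\<close>)
 finally have "\<epsilon> * \<pi> x \<le> \<pi> x * Pop a b f x"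
  using mult_left_mono[of \<epsilon> "Pop a b f x" "\<pi> x"] assms(2)[OF x] by (simp add: mult.commute)
 also have "... \<le> (\<Sum>x\<in>{a..b}. \<pi> x * Pop a b f x)"
  by (rule member_le_sum[where f="\<lambda>x. \<pi> x * Pop a b f x"])
   (use x assms(1,2) in \<open>auto intro!: mult_nonneg_nonneg Pop_nonneg simp: f_def\<close>)
 also have "... = \<pi> y" unfolding bal f_def using y by (simp add: if_distrib cong: if_cong)
 finally show ?thesis .
qed

lemma balance_Harnack_iter:
 assumes "a \<le> b" "\<And>x. x \<in> {a..b} \<Longrightarrow> 0 \<le> \<pi> x"
  and bal: "\<And>f. (\<Sum>x\<in>{a..b}. \<pi> x * Pop a b f x) = (\<Sum>x\<in>{a..b}. \<pi> x * f x)"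
  and "x \<in> {a..b}" "y \<in> {a..b}" "\<bar>x - y\<bar> = int n"
 shows "\<epsilon> ^ n * \<pi> x \<le> \<pi> y"
 using assms(4-6)
proof (induction n arbitrary: y)
 case (Suc n)
 define y' where "y' = (if x \<le> y then y - 1 else y + 1)"
 have y': "y' \<in> {a..b}" "\<bar>x - y'\<bar> = int n" "y = y' + 1 \<or> y = y' - 1" using Suc.prems by (auto simp: y'_def)
 have "\<epsilon> ^ Suc n * \<pi> x \<le> \<epsilon> * \<pi> y'" using Suc.IH[OF Suc.prems(1) y'(1,2)] eps_pos by simp
 also have "... \<le> \<pi> y" by (rule balance_Harnack[OF assms(1,2) bal y'(1) Suc.prems(2) y'(3)])
 finally show ?case .
qed simp

lemma excursion_measure_invariant:
 assumes "a \<le> b"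
 shows "invariant_on m w a b (excursion_measure m w a b)"
 unfolding invariant_on_def
proof (intro conjI ballI allI)
 let ?\<pi> = "excursion_measure m w a b"
 fix x assume x: "x \<in> {a..b}"
 have nn: "0 \<le> ?\<pi> z" if "z \<in> {a..b}" for z
  unfolding excursion_measure_def by (intro suminf_nonneg em_summable em_nonneg assms that)
 have "\<epsilon> ^ nat (x - a) * ?\<pi> a \<le> ?\<pi> x"
  by (rule balance_Harnack_iter[OF assms nn excursion_measure_balance[OF assms]]) (use x in auto)
 moreover have "0 < \<epsilon> ^ nat (x - a)" using eps_pos by simp
 ultimately show "0 < ?\<pi> x" by (simp add: excursion_measure_at_start[OF assms])
qed (rule excursion_measure_balance[OF assms])

lemma Harnack:
 assumes inv: "invariant_on m w a b \<pi>" and "x \<in> {a..b}" "y \<in> {a..b}" "\<bar>x - y\<bar> \<le> int n"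
 shows "\<epsilon> ^ n * \<pi> x \<le> \<pi> y"
proof -
 have "\<epsilon> ^ n * \<pi> x \<le> \<epsilon> ^ nat \<bar>x - y\<bar> * \<pi> x"
  using assms eps_pos eps_le_1 invariant_onD(1)[OF inv, of x] by (intro mult_right_mono power_decreasing) auto
 also have "... \<le> \<pi> y"
  by (rule balance_Harnack_iter[OF _ _ invariant_onD(2)[OF inv]]) (use assms in \<open>auto intro!: less_imp_le[OF invariant_onD(1)[OF inv]]\<close>)
 finally show ?thesis .
qed

subsection \<open>Locality of the invariant measure\<close>

text \<open>The negative part \<open>u\<close> of \<open>g\<close> is subinvariant for the chain on
  [a, y] off the layer of width \<open>m\<close>, the reach of a jump, and vanishes on that layer.
  It is tested with 1 - \<psi>, where \<psi> x = (\<epsilon> / 2) ^ (y + 1 - x) strictly increases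
  under \<open>Pop\<close> off the layer; if \<open>u\<close> did not vanish, the pairing would be
  strictly smaller than itself.\<close>

lemma balance_min_principle:
 assumes "a \<le> y"
  and bal: "\<And>z. z \<in> {a..y - m} \<Longrightarrow> g z = (\<Sum>x\<in>{a..y}. g x * Pop a y (\<lambda>v. if v = z then 1 else 0) x)"
  and layer: "\<And>z. z \<in> {a..y} \<Longrightarrow> y - m < z \<Longrightarrow> 0 \<le> g z"
  and z: "z \<in> {a..y}"
 shows "0 \<le> g z"
proof (rule ccontr)
 assume neg: "\<not> 0 \<le> g z"
 define u where "u x = max 0 (- g x)" for x
 define q where "q = \<epsilon> / 2"
 define \<psi> where "\<psi> x = q ^ nat (y + 1 - x)" for x
 define K where "K x v = Pop a y (\<lambda>u. if u = v then 1 else 0) x" for x v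
 have q: "0 < q" "q < 1" using eps_pos eps_le_1 by (auto simp: q_def)
 have psi: "0 < \<psi> x" "\<psi> x \<le> 1" for x using q by (auto simp: \<psi>_def power_le_one)
 have u0: "0 \<le> u x" for x by (simp add: u_def)
 have uD: "u x = 0" if "x \<in> {a..y}" "x \<notin> {a..y - m}" for x using layer[of x] that by (auto simp: u_def)
 have K0: "0 \<le> K x v" for x v unfolding K_def by (rule Pop_nonneg[OF assms(1)]) auto
 have usub: "u v \<le> (\<Sum>x\<in>{a..y}. u x * K x v)" if "v \<in> {a..y - m}" for v
 proof -
  have "- g v = (\<Sum>x\<in>{a..y}. - g x * K x v)" using bal[OF that] by (simp add: K_def sum_negf)
  also have "... \<le> (\<Sum>x\<in>{a..y}. u x * K x v)" by (intro sum_mono mult_right_mono K0) (simp add: u_def)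
  finally show ?thesis using sum_nonneg[of "{a..y}" "\<lambda>x. u x * K x v"] u0 K0 by (auto simp: u_def)
 qed
 have P\<psi>: "\<psi> x < Pop a y \<psi> x" if x: "x \<in> {a..y - m}" for x
 proof -
  have e: "nat (y + 1 - x) = Suc (nat (y + 1 - (x + 1)))" using x m_pos by auto
  have "\<psi> x < 2 * \<psi> x" using psi[of x] by simp
  also have "... = \<epsilon> * \<psi> (x + 1)" unfolding \<psi>_def e by (simp add: q_def)
  also have "... \<le> w x 1 * \<psi> (x + 1)" using right[of x] psi[of "x+1"] by (simp add: mult_right_mono)
  also have "... = w x 1 * \<psi> (clip a y (x + 1))" using x m_pos by (subst clip_id) auto
  also have "... \<le> Pop a y \<psi> x" by (rule Pop_ge_single) (use assms(1) m_pos psi in \<open>auto simp: less_imp_le\<close>)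
  finally show ?thesis .
 qed
 have "(\<Sum>v\<in>{a..y}. u v * (1 - \<psi> v)) = (\<Sum>v\<in>{a..y - m}. u v * (1 - \<psi> v))"
  using uD m_pos by (intro sum.mono_neutral_right) auto
 also have "... \<le> (\<Sum>v\<in>{a..y - m}. (\<Sum>x\<in>{a..y}. u x * K x v) * (1 - \<psi> v))"
  using psi by (intro sum_mono mult_right_mono usub) auto
 also have "... \<le> (\<Sum>v\<in>{a..y}. (\<Sum>x\<in>{a..y}. u x * K x v) * (1 - \<psi> v))"
  using psi m_pos by (intro sum_mono2) (auto intro!: mult_nonneg_nonneg sum_nonneg u0 K0)
 also have "... = (\<Sum>x\<in>{a..y}. u x * (\<Sum>v\<in>{a..y}. (1 - \<psi> v) * K x v))"
  unfolding sum_distrib_right sum_distrib_left by (subst sum.swap) (simp add: mult_ac)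
 also have "... = (\<Sum>x\<in>{a..y}. u x * (1 - Pop a y \<psi> x))"
  unfolding K_def by (simp add: Pop_indicator_expand[OF assms(1), symmetric] Pop_diff Pop_const)
 also have "... < (\<Sum>x\<in>{a..y}. u x * (1 - \<psi> x))"
 proof (rule sum_strict_mono_ex1)
  show "\<forall>x\<in>{a..y}. u x * (1 - Pop a y \<psi> x) \<le> u x * (1 - \<psi> x)"
   using uD P\<psi> u0 by (metis diff_left_mono less_imp_le mult_left_mono mult_zero_left order_refl)
  have "z \<in> {a..y - m}" using layer[OF z] neg z by auto
  moreover have "0 < u z" using neg by (simp add: u_def)
  ultimately show "\<exists>x\<in>{a..y}. u x * (1 - Pop a y \<psi> x) < u x * (1 - \<psi> x)"
   using P\<psi>[of z] z by (intro bexI[of _ z]) auto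
 qed simp
 finally show False by simp
qed

text \<open>A point z \<le> y - m is entered only from sites up to \<open>y\<close>, and such an
  entry does not see where the window ends on the right. Hence the balance equation at
  \<open>z\<close> is the same for all windows that start at \<open>a\<close>.\<close>

lemma Pop_indicator_cut:
 assumes "y \<le> b" "z \<in> {a..y - m}" "a \<le> x"
 shows "Pop a b (\<lambda>v. if v = z then 1 else 0) x = (if x \<le> y then Pop a y (\<lambda>v. if v = z then 1 else 0) x else 0)"
proof -
 have "clip a b (x + j) = z \<longleftrightarrow> x \<le> y \<and> clip a y (x + j) = z" if "j \<in> {-m..m}" for j
  using that assms m_pos by (auto simp: clip_def max_def min_def)
 then have "Pop a b (\<lambda>v. if v = z then 1 else 0) x = (\<Sum>j\<in>{-m..m}. w x j * (if x \<le> y \<and> clip a y (x + j) = z then 1 else 0))"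
  unfolding clip_op_def by (intro sum.cong) auto
 then show ?thesis by (simp add: clip_op_def)
qed

lemma invariant_cut_balance:
 assumes inv: "invariant_on m w a b \<pi>" and "y \<le> b" and z: "z \<in> {a..y - m}"
 shows "\<pi> z = (\<Sum>x\<in>{a..y}. \<pi> x * Pop a y (\<lambda>v. if v = z then 1 else 0) x)"
proof -
 let ?K = "\<lambda>c x. Pop a c (\<lambda>v. if v = z then 1 else 0) x"
 have "\<pi> z = (\<Sum>x\<in>{a..b}. \<pi> x * (if x = z then 1 else 0))"
  using z assms(2) m_pos by (simp add: if_distrib cong: if_cong)
 also have "... = (\<Sum>x\<in>{a..b}. \<pi> x * ?K b x)" by (rule invariant_onD(2)[OF inv, symmetric])
 also have "... = (\<Sum>x\<in>{a..b}. if x \<le> y then \<pi> x * ?K y x else 0)"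
  using assms by (intro sum.cong refl) (simp add: Pop_indicator_cut)
 also have "... = (\<Sum>x\<in>{a..y}. \<pi> x * ?K y x)" using assms(2) by (intro sum.mono_neutral_cong_right) auto
 finally show ?thesis .
qed

text \<open>The combination \<open>g\<close> of the two measures satisfies the balance equations on
  [a, y - m]. On the remaining sites Harnack over a distance of at most m, once for each measure,
  makes it nonnegative; this is the origin of the exponent 2 m. The minimum principle extends the
  sign to [a, y].\<close>

lemma right_cut:
 assumes inv: "invariant_on m w a b \<pi>" and inv': "invariant_on m w a b' \<pi>'"
  and y: "a \<le> y" "y \<le> b" "y \<le> b'" and x: "x \<in> {a..y}"
 shows "\<epsilon> ^ nat (2 * m) * (\<pi> x * \<pi>' y) \<le> \<pi>' x * \<pi> y"
proof -
 define g where "g x = \<pi>' x * \<pi> y - \<epsilon> ^ nat (2 * m) * (\<pi> x * \<pi>' y)" for x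
 have "0 \<le> g x"
 proof (rule balance_min_principle[OF y(1) _ _ x])
  fix z assume z: "z \<in> {a..y - m}"
  define K where "K = Pop a y (\<lambda>v. if v = z then 1 else 0)"
  have "(\<Sum>x\<in>{a..y}. g x * K x) = (\<Sum>x\<in>{a..y}. \<pi>' x * K x * \<pi> y - \<epsilon> ^ nat (2 * m) * (\<pi> x * K x * \<pi>' y))"
   by (intro sum.cong refl) (simp add: g_def algebra_simps)
  also have "... = (\<Sum>x\<in>{a..y}. \<pi>' x * K x) * \<pi> y - \<epsilon> ^ nat (2 * m) * ((\<Sum>x\<in>{a..y}. \<pi> x * K x) * \<pi>' y)"
   by (simp only: sum_subtractf sum_distrib_left sum_distrib_right)
  also have "... = g z"
   using invariant_cut_balance[OF inv y(2) z] invariant_cut_balance[OF inv' y(3) z] by (simp add: g_def K_def)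
  finally show "g z = (\<Sum>x\<in>{a..y}. g x * Pop a y (\<lambda>v. if v = z then 1 else 0) x)" by (simp add: K_def)
 next
  fix z assume z: "z \<in> {a..y}" "y - m < z"
  have p: "0 < \<pi> y" "0 < \<pi>' y" "0 < \<pi> z" "0 < \<pi>' z" using y z by (auto intro!: invariant_onD(1)[OF inv] invariant_onD(1)[OF inv'])
  have 1: "\<epsilon> ^ nat m * \<pi> z \<le> \<pi> y" by (rule Harnack[OF inv]) (use y z in auto)
  have 2: "\<epsilon> ^ nat m * \<pi>' y \<le> \<pi>' z" by (rule Harnack[OF inv']) (use y z in auto)
  have "nat (2 * m) = nat m + nat m" using m_pos by arith
  then have "\<epsilon> ^ nat (2 * m) * (\<pi> z * \<pi>' y) = (\<epsilon> ^ nat m * \<pi>' y) * (\<epsilon> ^ nat m * \<pi> z)"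
   by (simp only: power_add mult_ac)
  also have "... \<le> \<pi>' z * \<pi> y" using 1 2 p eps_pos by (intro mult_mono) auto
  finally show "0 \<le> g z" by (simp add: g_def)
 qed
 then show ?thesis by (simp add: g_def)
qed

end

lemma (in elliptic_env) left_cut:
 assumes inv: "invariant_on m w a b \<pi>" and inv': "invariant_on m w a' b \<pi>'"
  and y: "a \<le> y" "a' \<le> y" "y \<le> b" and x: "x \<in> {y..b}"
 shows "\<epsilon> ^ nat (2 * m) * (\<pi> x * \<pi>' y) \<le> \<pi>' x * \<pi> y"
proof -
 interpret R: elliptic_env m \<epsilon> "reflect_env w" by (rule elliptic_env_reflect) unfold_locales
 show ?thesis
  using R.right_cut[OF invariant_on_reflect[OF _ inv] invariant_on_reflect[OF _ inv'], of "- y" "- x"] y x by simp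
qed

context elliptic_env begin

definition loc_const :: real where "loc_const = - 4 * of_int m * ln \<epsilon>"

lemma loc_const_eq: "loc_const = - 2 * ln (\<epsilon> ^ nat (2 * m))"
 using m_pos eps_pos by (simp add: loc_const_def ln_realpow)

text \<open>The window [a, y] shares its left end with [a, b] and its right end with [x, y], so one
  right cut and one left cut connect the two measures. Each costs a factor \<epsilon> ^ (2 m) in
  either direction, hence \<open>loc_const\<close>.\<close>

lemma locality:
 assumes inv: "invariant_on m w a b \<pi>" and inv': "invariant_on m w x y \<pi>'"
  and xy: "a \<le> x" "x \<le> y" "y \<le> b"
 shows "\<bar>ln (\<pi> x / \<pi> y) - ln (\<pi>' x / \<pi>' y)\<bar> \<le> loc_const"
proof -
 define \<rho> where "\<rho> = excursion_measure m w a y"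
 have inv'': "invariant_on m w a y \<rho>" unfolding \<rho>_def using xy by (intro excursion_measure_invariant) auto
 define c where "c = \<epsilon> ^ nat (2 * m)"
 have c: "0 < c" using eps_pos by (simp add: c_def)
 have pos: "0 < \<pi> x" "0 < \<pi> y" "0 < \<pi>' x" "0 < \<pi>' y" "0 < \<rho> x" "0 < \<rho> y"
  using xy by (auto intro!: invariant_onD(1)[OF inv] invariant_onD(1)[OF inv'] invariant_onD(1)[OF inv''])
 have L: "ln c + (ln p + ln q) \<le> ln r + ln s" if "c * (p * q) \<le> r * s" "0 < p" "0 < q" "0 < r" "0 < s" for p q r s
 proof -
  have "ln (c * (p * q)) \<le> ln (r * s)" using that c by (subst ln_le_cancel_iff) auto
  then show ?thesis using that c by (simp add: ln_mult)
 qed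
 have 1: "ln c + (ln (\<pi> x) + ln (\<rho> y)) \<le> ln (\<rho> x) + ln (\<pi> y)"
  by (rule L) (use right_cut[OF inv inv'', of y x] xy pos in \<open>auto simp: c_def\<close>)
 have 2: "ln c + (ln (\<rho> x) + ln (\<pi> y)) \<le> ln (\<pi> x) + ln (\<rho> y)"
  by (rule L) (use right_cut[OF inv'' inv, of y x] xy pos in \<open>auto simp: c_def\<close>)
 have 3: "ln c + (ln (\<rho> y) + ln (\<pi>' x)) \<le> ln (\<pi>' y) + ln (\<rho> x)"
  by (rule L) (use left_cut[OF inv'' inv', of x y] xy pos in \<open>auto simp: c_def\<close>)
 have 4: "ln c + (ln (\<pi>' y) + ln (\<rho> x)) \<le> ln (\<rho> y) + ln (\<pi>' x)"
  by (rule L) (use left_cut[OF inv' inv'', of x y] xy pos in \<open>auto simp: c_def\<close>)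
 show ?thesis unfolding loc_const_eq c_def[symmetric] using 1 2 3 4 pos by (simp add: ln_div)
qed

subsection \<open>Green function bound\<close>

text \<open>\<open>E x\<close> is the mean squared increment of f in one step from \<open>x\<close>.
  Summed against \<pi>, the squares of f cancel by invariance alone and twice the form remains,
  although the chain is not symmetric. Keeping only the step +1 gives the lower bound.\<close>

lemma dirichlet_form:
 assumes inv: "invariant_on m w a b \<pi>" and ab: "a \<le> b"
 shows "\<epsilon> / 2 * (\<Sum>x\<in>{a..<b}. \<pi> x * (f x - f (x + 1))\<^sup>2) \<le> (\<Sum>x\<in>{a..b}. \<pi> x * (f x * (f x - Pop a b f x)))"
proof -
 define E where "E x = (\<Sum>j\<in>{-m..m}. w x j * (f x - f (clip a b (x + j)))\<^sup>2)" for x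
 have E: "E x = 2 * (f x * (f x - Pop a b f x)) + (Pop a b (\<lambda>z. (f z)\<^sup>2) x - (f x)\<^sup>2)" for x
 proof -
  have "E x = (\<Sum>j\<in>{-m..m}. w x j * (f x)\<^sup>2 - 2 * f x * (w x j * f (clip a b (x + j))) + w x j * (f (clip a b (x + j)))\<^sup>2)"
   unfolding E_def by (intro sum.cong) (auto simp: power2_eq_square algebra_simps)
  also have "... = (f x)\<^sup>2 - 2 * f x * Pop a b f x + Pop a b (\<lambda>z. (f z)\<^sup>2) x"
   by (simp add: sum.distrib sum_subtractf clip_op_def total flip: sum_distrib_left sum_distrib_right)
  finally show ?thesis by (simp add: power2_eq_square algebra_simps)
 qed
 have "(\<Sum>x\<in>{a..b}. \<pi> x * E x) = 2 * (\<Sum>x\<in>{a..b}. \<pi> x * (f x * (f x - Pop a b f x)))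
   + ((\<Sum>x\<in>{a..b}. \<pi> x * Pop a b (\<lambda>z. (f z)\<^sup>2) x) - (\<Sum>x\<in>{a..b}. \<pi> x * (f x)\<^sup>2))"
  unfolding E by (simp add: distrib_left right_diff_distrib sum.distrib sum_subtractf sum_distrib_left mult_ac)
 also have "... = 2 * (\<Sum>x\<in>{a..b}. \<pi> x * (f x * (f x - Pop a b f x)))" by (simp add: invariant_onD(2)[OF inv])
 finally have eq: "(\<Sum>x\<in>{a..b}. \<pi> x * E x) = ..." .
 have E0: "0 \<le> E x" for x unfolding E_def by (intro sum_nonneg mult_nonneg_nonneg nonneg zero_le_power2)
 have "\<epsilon> * (\<Sum>x\<in>{a..<b}. \<pi> x * (f x - f (x + 1))\<^sup>2) = (\<Sum>x\<in>{a..<b}. \<pi> x * (\<epsilon> * (f x - f (x + 1))\<^sup>2))"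
  by (simp add: sum_distrib_left mult_ac)
 also have "... \<le> (\<Sum>x\<in>{a..<b}. \<pi> x * E x)"
 proof (intro sum_mono mult_left_mono)
  fix x assume x: "x \<in> {a..<b}"
  have "\<epsilon> * (f x - f (x + 1))\<^sup>2 \<le> w x 1 * (f x - f (x + 1))\<^sup>2"
   using right[of x] by (simp add: mult_right_mono)
  also have "... = w x 1 * (f x - f (clip a b (x + 1)))\<^sup>2" using x by (subst clip_id) auto
  also have "... \<le> E x" unfolding E_def
   by (rule member_le_sum[where f="\<lambda>j. w x j * (f x - f (clip a b (x + j)))\<^sup>2"]) (use m_pos nonneg in auto)
  finally show "\<epsilon> * (f x - f (x + 1))\<^sup>2 \<le> E x" .
  show "0 \<le> \<pi> x" using invariant_onD(1)[OF inv, of x] x by auto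
 qed
 also have "... \<le> (\<Sum>x\<in>{a..b}. \<pi> x * E x)"
  using E0 by (intro sum_mono2) (auto intro!: mult_nonneg_nonneg less_imp_le[OF invariant_onD(1)[OF inv]])
 finally show ?thesis using eq by simp
qed

context
 fixes a b \<pi> v B \<beta> y
 assumes inv: "invariant_on m w a b \<pi>" and ab: "a \<le> b"
  and v0: "\<And>x. x \<in> {a..b} \<Longrightarrow> 0 \<le> v x"
  and vB: "\<And>x. x \<in> {a..b} \<Longrightarrow> x \<in> B \<Longrightarrow> v x = 0"
  and green: "\<And>x. x \<in> {a..b} \<Longrightarrow> x \<notin> B \<Longrightarrow> v x \<le> (if x = y then 1 else 0) + Pop a b v x"
  and \<beta>: "\<beta> \<in> {a..b}" "\<beta> \<in> B" and y: "y \<in> {a..b}"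
begin

text \<open>The model for \<open>v\<close> is the expected number of visits to \<open>y\<close>
  before \<open>B\<close> is hit. Cut \<open>v\<close> at the height c = v x0. Up to the factor 2 /
  \<epsilon>, the energy of the truncation is at most \<pi> y * c, because the only source of
  \<open>v\<close> is at \<open>y\<close>. On the other hand a function falling from c at
  \<open>x0\<close> to 0 at \<beta> has energy at least c^2 divided by the sum of 1 / \<pi> between
  the two points.\<close>

lemma green_bound:
 assumes x0: "x0 \<in> {a..b}"
 shows "v x0 \<le> 2 / \<epsilon> * \<pi> y * (\<Sum>k\<in>{min x0 \<beta>..<max x0 \<beta>}. 1 / \<pi> k)"
proof (cases "v x0 = 0")
 case True
 have "0 \<le> 2 / \<epsilon> * \<pi> y * (\<Sum>k\<in>{min x0 \<beta>..<max x0 \<beta>}. 1 / \<pi> k)"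
  using eps_pos x0 \<beta> y by (intro mult_nonneg_nonneg sum_nonneg) (auto intro!: less_imp_le[OF invariant_onD(1)[OF inv]])
 then show ?thesis using True by simp
next
 case False
 define c where "c = v x0"
 have c: "0 < c" using False v0[OF x0] by (simp add: c_def)
 define g where "g x = min (v x) c" for x
 define u where "u x = v x - g x" for x
 have p: "0 < \<pi> x" if "x \<in> {a..b}" for x using invariant_onD(1)[OF inv that] .
 have u0: "0 \<le> u x" for x by (simp add: u_def g_def)
 have w0: "0 \<le> g x" if "x \<in> {a..b}" for x using v0[OF that] c by (simp add: g_def)
 have "\<epsilon> / 2 * (\<Sum>x\<in>{a..<b}. \<pi> x * (g x - g (x + 1))\<^sup>2) \<le> (\<Sum>x\<in>{a..b}. \<pi> x * (g x * (g x - Pop a b g x)))"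
  by (rule dirichlet_form[OF inv ab])
 \<comment> \<open>Truncation does not raise the form: \<open>g\<close> is at most c everywhere and
   equals c where u = v - g is not 0, so invariance gives 0 \<le> \<Sum> \<pi> g (u - P u).\<close>
 also have "... \<le> (\<Sum>x\<in>{a..b}. \<pi> x * (g x * (v x - Pop a b v x)))"
 proof -
  have "(\<Sum>x\<in>{a..b}. \<pi> x * (g x * Pop a b u x)) \<le> (\<Sum>x\<in>{a..b}. \<pi> x * (c * Pop a b u x))"
   using p by (intro sum_mono mult_left_mono mult_right_mono Pop_nonneg[OF ab] u0) (auto simp: g_def less_imp_le)
  also have "... = c * (\<Sum>x\<in>{a..b}. \<pi> x * Pop a b u x)" by (simp add: sum_distrib_left mult_ac)
  also have "... = (\<Sum>x\<in>{a..b}. \<pi> x * (c * u x))" by (simp add: invariant_onD(2)[OF inv] sum_distrib_left mult_ac)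
  also have "... = (\<Sum>x\<in>{a..b}. \<pi> x * (g x * u x))" by (intro sum.cong) (auto simp: u_def g_def min_def)
  finally have "0 \<le> (\<Sum>x\<in>{a..b}. \<pi> x * (g x * (u x - Pop a b u x)))"
   by (simp add: right_diff_distrib sum_subtractf)
  also have "... = (\<Sum>x\<in>{a..b}. \<pi> x * (g x * (v x - Pop a b v x))) - (\<Sum>x\<in>{a..b}. \<pi> x * (g x * (g x - Pop a b g x)))"
   unfolding u_def Pop_diff sum_subtractf[symmetric] by (intro sum.cong) (auto simp: algebra_simps)
  finally show ?thesis by simp
 qed
 also have "... \<le> (\<Sum>x\<in>{a..b}. \<pi> x * (if x = y then c else 0))"
 proof (intro sum_mono mult_left_mono)
  fix x assume x: "x \<in> {a..b}"
  show "0 \<le> \<pi> x" using p[OF x] by simp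
  show "g x * (v x - Pop a b v x) \<le> (if x = y then c else 0)"
  proof (cases "x \<in> B")
   case True
   then have "g x = 0" using vB[OF x] c by (simp add: g_def)
   then show ?thesis using c by simp
  next
   case False
   have "g x * (v x - Pop a b v x) \<le> g x * (if x = y then 1 else 0)"
    using green[OF x False] by (intro mult_left_mono w0[OF x]) simp
   then show ?thesis using c by (auto simp: g_def split: if_splits)
  qed
 qed
 also have "... = \<pi> y * c" using y by (simp add: if_distrib cong: if_cong)
 finally have D: "\<epsilon> / 2 * (\<Sum>x\<in>{a..<b}. \<pi> x * (g x - g (x + 1))\<^sup>2) \<le> \<pi> y * c" .
 define lo hi where "lo = min x0 \<beta>" and "hi = max x0 \<beta>"
 have lh: "lo \<le> hi" "a \<le> lo" "hi \<le> b" using x0 \<beta> by (auto simp: lo_def hi_def)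
 have "g x0 = c" "g \<beta> = 0" using vB[OF \<beta>] c by (auto simp: g_def c_def)
 then have "c = \<bar>g lo - g hi\<bar>" using c by (auto simp: lo_def hi_def min_def max_def)
 also have "... \<le> (\<Sum>k\<in>{lo..<hi}. \<bar>g k - g (k + 1)\<bar>)"
  unfolding sum_telescope_int[OF lh(1), symmetric] by (rule sum_abs)
 finally have "c\<^sup>2 \<le> (\<Sum>k\<in>{lo..<hi}. \<bar>g k - g (k + 1)\<bar>)\<^sup>2" using c by (intro power_mono) auto
 also have "... \<le> (\<Sum>k\<in>{lo..<hi}. 1 / \<pi> k) * (\<Sum>k\<in>{lo..<hi}. \<pi> k * (g k - g (k + 1))\<^sup>2)"
  using p lh by (intro Cauchy_Schwarz_weighted) auto
 also have "... \<le> (\<Sum>k\<in>{lo..<hi}. 1 / \<pi> k) * (\<Sum>k\<in>{a..<b}. \<pi> k * (g k - g (k + 1))\<^sup>2)"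
  using p lh by (intro mult_left_mono sum_mono2 sum_nonneg) (auto intro!: mult_nonneg_nonneg simp: less_imp_le)
 also have "... \<le> (\<Sum>k\<in>{lo..<hi}. 1 / \<pi> k) * (2 / \<epsilon> * \<pi> y * c)"
  using D eps_pos p lh by (intro mult_left_mono sum_nonneg) (auto simp: field_simps less_imp_le)
 finally have "c * c \<le> (2 / \<epsilon> * \<pi> y * (\<Sum>k\<in>{lo..<hi}. 1 / \<pi> k)) * c" by (simp add: power2_eq_square mult_ac)
 then show ?thesis using c unfolding c_def lo_def hi_def by (meson mult_right_le_imp_le)
qed

text \<open>The positive part of v - v y vanishes at the source \<open>y\<close>. Its form is
  therefore at most 0, which makes it constant, and it is 0 at \<beta>.\<close>

lemma green_max:
 assumes x0: "x0 \<in> {a..b}"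
 shows "v x0 \<le> v y"
proof -
 define u where "u x = max 0 (v x - v y)" for x
 have p: "0 < \<pi> x" if "x \<in> {a..b}" for x using invariant_onD(1)[OF inv that] .
 have "\<epsilon> / 2 * (\<Sum>x\<in>{a..<b}. \<pi> x * (u x - u (x + 1))\<^sup>2) \<le> (\<Sum>x\<in>{a..b}. \<pi> x * (u x * (u x - Pop a b u x)))"
  by (rule dirichlet_form[OF inv ab])
 also have "... \<le> 0"
 proof (rule sum_nonpos)
  fix x assume x: "x \<in> {a..b}"
  have "u x * (u x - Pop a b u x) \<le> 0"
  proof (cases "u x = 0")
   case False
   then have gt: "v y < v x" "u x = v x - v y" by (auto simp: u_def max_def split: if_splits)
   have "x \<notin> B" using vB[OF x] gt v0[OF y] by auto
   then have "v x \<le> Pop a b v x" using green[OF x] gt by (cases "x = y") auto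
   then have "u x \<le> Pop a b (\<lambda>z. v z - v y) x" using gt by (simp add: Pop_diff Pop_const)
   also have "... \<le> Pop a b u x" by (rule Pop_mono[OF ab]) (simp add: u_def)
   finally show ?thesis using gt by (simp add: mult_nonneg_nonpos)
  qed simp
  then show "\<pi> x * (u x * (u x - Pop a b u x)) \<le> 0" using p[OF x] by (simp add: mult_nonneg_nonpos)
 qed
 finally have "(\<Sum>x\<in>{a..<b}. \<pi> x * (u x - u (x + 1))\<^sup>2) \<le> 0" using eps_pos by (simp add: mult_le_0_iff)
 moreover have nn: "0 \<le> \<pi> x * (u x - u (x + 1))\<^sup>2" if "x \<in> {a..<b}" for x using p[of x] that by simp
 ultimately have "(\<Sum>x\<in>{a..<b}. \<pi> x * (u x - u (x + 1))\<^sup>2) = 0" by (intro antisym sum_nonneg) auto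
 then have "\<pi> x * (u x - u (x + 1))\<^sup>2 = 0" if "x \<in> {a..<b}" for x using nn that by (subst (asm) sum_nonneg_eq_0_iff) auto
 then have du: "u x = u (x + 1)" if "x \<in> {a..<b}" for x using p[of x] that by fastforce
 have const: "u s = u t" if "s \<le> t" "a \<le> s" "t \<le> b" for s t
 proof -
  have "u s - u t = (\<Sum>k\<in>{s..<t}. u k - u (k + 1))" by (rule sum_telescope_int[OF that(1), symmetric])
  also have "... = 0" using du that by (intro sum.neutral) auto
  finally show ?thesis by simp
 qed
 have "u x0 = u \<beta>" using x0 \<beta> by (cases "x0 \<le> \<beta>") (auto intro: const const[symmetric])
 also have "u \<beta> = 0" using vB[OF \<beta>] v0[OF y] by (simp add: u_def)
 finally show ?thesis by (simp add: u_def)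
qed

end
end

subsection \<open>Environments with a drift\<close>

lemma exp_le_quadratic:
 fixes u :: real assumes "u \<le> 1" shows "exp u \<le> 1 + u + u\<^sup>2"
proof (cases "0 \<le> u")
 case True then show ?thesis using exp_bound[of u] assms by simp
next
 case False
 have "1 \<le> (1 + u + u\<^sup>2) * (1 - u)"
 proof -
  have "(1 + u + u\<^sup>2) * (1 - u) = 1 - u ^ 3" by (simp add: algebra_simps power2_eq_square power3_eq_cube)
  moreover have "u ^ 3 \<le> 0" using False by (simp add: power3_eq_cube mult_nonneg_nonpos mult_nonpos_nonneg mult_le_0_iff)
  ultimately show ?thesis by simp
 qed
 moreover have "1 - u \<le> exp (- u)" using exp_ge_add_one_self[of "- u"] by simp
 moreover have "0 \<le> 1 + u + u\<^sup>2"
 proof -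
  have "1 + u + u\<^sup>2 = (u + 1 / 2)\<^sup>2 + 3 / 4" by (simp add: power2_eq_square algebra_simps)
  then show ?thesis by simp
 qed
 ultimately have "1 \<le> (1 + u + u\<^sup>2) * exp (- u)" by (meson mult_left_mono order_trans)
 then show ?thesis by (simp add: exp_minus field_simps)
qed

text \<open>Under one free step the exponential f x = exp (- \<theta> (x - a)) shrinks by the factor
  1 - \<theta> d / 2. The second condition on \<theta> admits the quadratic bound for exp, the third
  keeps the quadratic term below half of the gain \<theta> d. Clipping at \<open>a\<close> lowers f
  further, and clipping at \<open>b\<close> is felt only within distance \<open>m\<close> of
  \<open>b\<close>. By invariance the loss, in particular the one at \<open>a\<close>, is paid by
  the mass near \<open>b\<close>, which Harnack expresses by \<pi> b.\<close>

lemma (in elliptic_env) drift_right: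
 assumes inv: "invariant_on m w a b \<pi>" and ab: "a \<le> b" and d: "0 < d"
  and drift: "\<And>x. x \<in> {a..b} \<Longrightarrow> d \<le> (\<Sum>j\<in>{-m..m}. of_int j * w x j)"
  and \<theta>: "0 < \<theta>" "\<theta> * of_int m \<le> 1" "\<theta> * (of_int m)\<^sup>2 \<le> d / 2"
 shows "\<theta> * d / 2 * \<pi> a \<le> exp (- \<theta> * of_int (b - a)) * (of_int m * \<pi> b / \<epsilon> ^ nat m)"
proof -
 define f :: path where "f x = exp (- \<theta> * of_int (x - a))" for x
 define \<eta> where "\<eta> = \<theta> * d / 2"
 have f0: "0 < f x" for x by (simp add: f_def)
 have fdec: "f y \<le> f x" if "x \<le> y" for x y using that \<theta>(1) by (simp add: f_def)
 have p: "0 < \<pi> x" if "x \<in> {a..b}" for x by (rule invariant_onD(1)[OF inv that])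
 have free: "(\<Sum>j\<in>{-m..m}. w x j * f (x + j)) \<le> (1 - \<eta>) * f x" if x: "x \<in> {a..b}" for x
 proof -
  have "(\<Sum>j\<in>{-m..m}. w x j * f (x + j)) = f x * (\<Sum>j\<in>{-m..m}. w x j * exp (- \<theta> * of_int j))"
   unfolding sum_distrib_left f_def by (intro sum.cong refl) (simp add: algebra_simps flip: exp_add)
  also have "(\<Sum>j\<in>{-m..m}. w x j * exp (- \<theta> * of_int j)) \<le> (\<Sum>j\<in>{-m..m}. w x j * (1 - \<theta> * of_int j + \<theta>\<^sup>2 * (of_int m)\<^sup>2))"
  proof (intro sum_mono mult_left_mono nonneg)
   fix j assume j: "j \<in> {-m..m}"
   have "\<bar>of_int j :: real\<bar> \<le> of_int m" using j by auto
   then have 1: "\<theta> * \<bar>of_int j\<bar> \<le> \<theta> * of_int m" using \<theta>(1) by simp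
   have "- \<theta> * of_int j \<le> \<theta> * \<bar>of_int j\<bar>" using \<theta>(1) by (auto simp: abs_if mult_le_0_iff zero_le_mult_iff)
   then have "exp (- \<theta> * of_int j) \<le> 1 + (- \<theta> * of_int j) + (- \<theta> * of_int j)\<^sup>2"
    using 1 \<theta>(2) by (intro exp_le_quadratic) linarith
   also have "(- \<theta> * of_int j)\<^sup>2 \<le> (\<theta> * of_int m)\<^sup>2"
    using 1 \<theta>(1) m_pos by (intro abs_le_square_iff[THEN iffD1]) (simp add: abs_mult)
   finally show "exp (- \<theta> * of_int j) \<le> 1 - \<theta> * of_int j + \<theta>\<^sup>2 * (of_int m)\<^sup>2" by (simp add: power_mult_distrib)
  qed
  also have "... = (1 + \<theta>\<^sup>2 * (of_int m)\<^sup>2) * (\<Sum>j\<in>{-m..m}. w x j) - \<theta> * (\<Sum>j\<in>{-m..m}. of_int j * w x j)"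
   unfolding sum_distrib_left sum_subtractf[symmetric] by (intro sum.cong refl) (simp add: algebra_simps)
  also have "... \<le> 1 + \<theta> * (\<theta> * (of_int m)\<^sup>2) - \<theta> * d"
   using drift[OF x] \<theta>(1) by (simp add: total power2_eq_square)
  also have "... \<le> 1 - \<eta>" using mult_left_mono[OF \<theta>(3), of \<theta>] \<theta>(1) by (simp add: \<eta>_def field_simps)
  finally show ?thesis using f0[of x] by (simp add: mult.commute)
 qed
 have bound: "Pop a b f x \<le> (1 - \<eta>) * f x + (if b - m < x then f b else 0)" if x: "x \<in> {a..b}" for x
 proof -
  have "Pop a b f x \<le> (\<Sum>j\<in>{-m..m}. w x j * (f (x + j) + (if b - m < x then f b else 0)))" unfolding clip_op_def
  proof (intro sum_mono mult_left_mono nonneg)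
   fix j assume "j \<in> {-m..m}"
   then show "f (clip a b (x + j)) \<le> f (x + j) + (if b - m < x then f b else 0)"
    using f0[of "x + j"] f0[of b] fdec[of "x + j" "a"] fdec[of "x + j" b] x ab by (auto simp: clip_def max_def min_def less_imp_le)
  qed
  also have "... = (\<Sum>j\<in>{-m..m}. w x j * f (x + j)) + (if b - m < x then f b else 0)"
   by (simp add: distrib_left sum.distrib total flip: sum_distrib_right)
  finally show ?thesis using free[OF x] by simp
 qed
 have "0 = (\<Sum>x\<in>{a..b}. \<pi> x * (Pop a b f x - f x))"
  by (simp add: right_diff_distrib sum_subtractf invariant_onD(2)[OF inv])
 also have "... \<le> (\<Sum>x\<in>{a..b}. \<pi> x * ((if b - m < x then f b else 0) - \<eta> * f x))"
  using bound p by (intro sum_mono mult_left_mono) (auto simp: algebra_simps less_imp_le)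
 also have "... = (\<Sum>x\<in>{a..b}. \<pi> x * (if b - m < x then f b else 0)) - \<eta> * (\<Sum>x\<in>{a..b}. \<pi> x * f x)"
  by (simp add: right_diff_distrib sum_subtractf sum_distrib_left mult_ac)
 finally have "\<eta> * (\<Sum>x\<in>{a..b}. \<pi> x * f x) \<le> (\<Sum>x\<in>{a..b}. \<pi> x * (if b - m < x then f b else 0))" by simp
 moreover have "\<pi> a * f a \<le> (\<Sum>x\<in>{a..b}. \<pi> x * f x)"
  by (rule member_le_sum[where f="\<lambda>x. \<pi> x * f x"]) (use ab f0 p in \<open>auto intro!: mult_nonneg_nonneg simp: less_imp_le\<close>)
 moreover have "(\<Sum>x\<in>{a..b}. \<pi> x * (if b - m < x then f b else 0)) \<le> f b * (of_int m * \<pi> b / \<epsilon> ^ nat m)"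
 proof -
  have "(\<Sum>x\<in>{a..b}. \<pi> x * (if b - m < x then f b else 0)) = (\<Sum>x\<in>{max a (b - m + 1)..b}. \<pi> x * f b)"
   by (intro sum.mono_neutral_cong_right) auto
  also have "... \<le> (\<Sum>x\<in>{max a (b - m + 1)..b}. \<pi> b / \<epsilon> ^ nat m * f b)"
  proof (intro sum_mono mult_right_mono)
   fix x assume x: "x \<in> {max a (b - m + 1)..b}"
   have "\<epsilon> ^ nat m * \<pi> x \<le> \<pi> b" by (rule Harnack[OF inv]) (use x in auto)
   then show "\<pi> x \<le> \<pi> b / \<epsilon> ^ nat m" using eps_pos by (simp add: field_simps)
  qed (use f0[of b] in simp)
  also have "... = of_nat (nat (b - max a (b - m + 1) + 1)) * (\<pi> b / \<epsilon> ^ nat m * f b)" by (simp add: algebra_simps)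
  also have "... \<le> of_int m * (\<pi> b / \<epsilon> ^ nat m * f b)"
  proof (rule mult_right_mono)
   show "real (nat (b - max a (b - m + 1) + 1)) \<le> of_int m" using m_pos by (simp add: of_nat_nat)
   show "0 \<le> \<pi> b / \<epsilon> ^ nat m * f b" using p[of b] ab eps_pos f0[of b] by simp
  qed
  finally show ?thesis by (simp add: mult_ac)
 qed
 moreover have "0 < \<eta>" using \<theta>(1) d by (simp add: \<eta>_def)
 ultimately have "\<eta> * (\<pi> a * f a) \<le> f b * (of_int m * \<pi> b / \<epsilon> ^ nat m)"
  by (meson mult_left_mono less_imp_le order_trans)
 then show ?thesis by (simp add: f_def \<eta>_def)
qed

lemma drift_uniform:
 assumes "1 \<le> m" "0 < \<epsilon>" "0 < d"
 obtains \<theta> C where "0 < \<theta>" "\<And>s w a b \<pi>. s = 1 \<or> s = (-1 :: real) \<Longrightarrow> elliptic_env m \<epsilon> w \<Longrightarrow> a \<le> b \<Longrightarrow> invariant_on m w a b \<pi> \<Longrightarrow>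
   \<forall>x\<in>{a..b}. d \<le> s * (\<Sum>j\<in>{-m..m}. of_int j * w x j) \<Longrightarrow> s * ln (\<pi> a / \<pi> b) \<le> C - \<theta> * of_int (b - a)"
proof -
 define \<theta> where "\<theta> = min (1 / of_int m) (d / (2 * (of_int m)\<^sup>2))"
 have m: "0 < (of_int m :: real)" using assms by simp
 have \<theta>: "0 < \<theta>" "\<theta> * of_int m \<le> 1" "\<theta> * (of_int m)\<^sup>2 \<le> d / 2"
  using m assms by (auto simp: \<theta>_def min_def field_simps power2_eq_square split: if_splits)
 define C where "C = ln (of_int m / \<epsilon> ^ nat m / (\<theta> * d / 2))"
 have right: "ln (\<pi> a / \<pi> b) \<le> C - \<theta> * of_int (b - a)"
  if "elliptic_env m \<epsilon> w" "a \<le> b" "invariant_on m w a b \<pi>" "\<forall>x\<in>{a..b}. d \<le> (\<Sum>j\<in>{-m..m}. of_int j * w x j)" for w a b \<pi>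
 proof -
  interpret elliptic_env m \<epsilon> w by fact
  have p: "0 < \<pi> a" "0 < \<pi> b" by (rule invariant_onD(1)[OF that(3)], use that(2) in simp)+
  have "\<theta> * d / 2 * \<pi> a \<le> exp (- \<theta> * of_int (b - a)) * (of_int m * \<pi> b / \<epsilon> ^ nat m)"
   by (rule drift_right) (use that assms \<theta> in auto)
  then have "\<pi> a / \<pi> b \<le> of_int m / \<epsilon> ^ nat m / (\<theta> * d / 2) * exp (- \<theta> * of_int (b - a))"
   using p \<theta> assms by (simp add: field_simps)
  then have "ln (\<pi> a / \<pi> b) \<le> ln (of_int m / \<epsilon> ^ nat m / (\<theta> * d / 2) * exp (- \<theta> * of_int (b - a)))"
   using p m \<theta> assms by (subst ln_le_cancel_iff) (auto intro!: mult_pos_pos divide_pos_pos)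
  also have "... = C + - \<theta> * of_int (b - a)"
   unfolding C_def using m \<theta> assms by (subst ln_mult) (auto intro!: mult_pos_pos divide_pos_pos)
  finally show ?thesis by simp
 qed
 have "- ln (\<pi> a / \<pi> b) \<le> C - \<theta> * of_int (b - a)"
  if e: "elliptic_env m \<epsilon> w" and ab: "a \<le> b" and inv: "invariant_on m w a b \<pi>"
   and dr: "\<forall>x\<in>{a..b}. d \<le> - (\<Sum>j\<in>{-m..m}. of_int j * w x j)" for w a b \<pi>
 proof -
  have "d \<le> (\<Sum>j\<in>{-m..m}. of_int j * reflect_env w x j)" if "x \<in> {- b..- a}" for x
   using bspec[OF dr, of "- x"] that sum_uminus_int[of "\<lambda>j. of_int j * w (- x) j" m "- m"]
   by (simp add: reflect_env_def sum_negf)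
  then have "ln (\<pi> (- (- b)) / \<pi> (- (- a))) \<le> C - \<theta> * of_int (- a - - b)"
   by (intro right[OF elliptic_env_reflect[OF e] _ invariant_on_reflect[OF ab inv]]) (use ab in auto)
  moreover have "0 < \<pi> a" "0 < \<pi> b" by (rule invariant_onD(1)[OF inv], use ab in simp)+
  ultimately show ?thesis by (simp add: ln_div algebra_simps)
 qed
 note left = this
 show ?thesis by (rule that[OF \<theta>(1)]) (use left right in auto)
qed

subsection \<open>Marginals of the walk\<close>

definition free_op :: "int \<Rightarrow> env \<Rightarrow> path \<Rightarrow> int \<Rightarrow> real" where
 "free_op m w f x = (\<Sum>j\<in>{-m..m}. w x j * f (x + j))"

lemma walk_law_measurable_coord [measurable]: "(\<lambda>\<xi>. \<xi> t) \<in> walk_law w \<rightarrow>\<^sub>M count_space UNIV"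
 unfolding measurable_cong_sets[OF sets_walk_law refl] by (rule measurable_component_singleton) simp

text \<open>This is the Markov property at time \<open>t\<close>. The cylinder is split by the next
  jump; the part \<open>N\<close> where that jump leaves {-m..m} is null because the jump
  probabilities add up to 1.\<close>

lemma walk_law_marginal_from_cylinder:
 assumes w: "\<And>x. w x \<in> jump_vectors m"
 shows "measure (walk_law w) {\<xi>. (\<forall>i\<le>t. \<xi> i = x i) \<and> \<xi> (t + k) \<in> S}
  = measure (walk_law w) {\<xi>. \<forall>i\<le>t. \<xi> i = x i} * (free_op m w ^^ k) (indicat_real S) (x t)"
proof (induction k arbitrary: t x)
 case 0
 show ?case
 proof (cases "x t \<in> S")
  case True
  then have "{\<xi>. (\<forall>i\<le>t. \<xi> i = x i) \<and> \<xi> (t + 0) \<in> S} = {\<xi>. \<forall>i\<le>t. \<xi> i = x i}" by auto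
  then show ?thesis using True by simp
 next
  case False
  then have e: "{\<xi>. (\<forall>i\<le>t. \<xi> i = x i) \<and> \<xi> (t + 0) \<in> S} = {}" by auto
  show ?thesis unfolding e using False by simp
 qed
next
 case (Suc k)
 interpret W: prob_space "walk_law w" by (rule prob_space_walk_law)
 note sp [simp] = space_walk_law[of w]
 have meas: "{\<xi>. (\<forall>i\<le>t. \<xi> i = x i)} \<in> W.events" for t x
 proof -
  have "{\<xi> \<in> space (walk_law w). \<forall>i\<in>{..t}. \<xi> i = x i} \<in> W.events" by measurable
  then show ?thesis by (simp add: Ball_def)
 qed
 have measS: "{\<xi>. \<xi> u \<in> S'} \<in> W.events" for u S'
 proof -
  have "(\<lambda>\<xi>. \<xi> u) -` S' \<inter> space (walk_law w) \<in> W.events" by (rule measurable_sets[OF walk_law_measurable_coord]) simp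
  then show ?thesis by (simp add: vimage_def)
 qed
 define C where "C = {\<xi>. \<forall>i\<le>t. \<xi> i = x i}"
 define x' where "x' j i = (if i \<le> t then x i else x t + j)" for j i
 define C' where "C' j = {\<xi>. \<forall>i\<le>Suc t. \<xi> i = x' j i}" for j
 have C'_eq: "C' j = C \<inter> {\<xi>. \<xi> (Suc t) = x t + j}" for j by (auto simp: C'_def C_def x'_def le_Suc_eq)
 have w': "w \<in> space (env_space m)" using w by (simp add: space_env_space)
 have C'_measure: "W.prob (C' j) = W.prob C * w (x t) j" for j
 proof -
  have "(\<Prod>i<t. w (x' j i) (x' j (Suc i) - x' j i)) = (\<Prod>i<t. w (x i) (x (Suc i) - x i))"
   by (intro prod.cong) (auto simp: x'_def)
  then show ?thesis unfolding C'_def C_def measure_walk_law_cylinder[OF w'] by (simp add: x'_def)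
 qed
 have tot: "(\<Sum>j\<in>{-m..m}. w (x t) j) = 1" using w[of "x t"] by (simp add: jump_vectors_def)
 define N where "N = C - (\<Union>j\<in>{-m..m}. C' j)"
 have C'_ev: "C' j \<in> W.events" for j unfolding C'_def by (rule meas)
 have C_ev: "C \<in> W.events" unfolding C_def by (rule meas)
 have disj: "disjoint_family_on C' {-m..m}" by (auto simp: disjoint_family_on_def C'_eq)
 have "W.prob N = W.prob C - W.prob (\<Union>j\<in>{-m..m}. C' j)"
  unfolding N_def by (rule W.finite_measure_Diff) (use C_ev C'_ev C'_eq in auto)
 also have "W.prob (\<Union>j\<in>{-m..m}. C' j) = (\<Sum>j\<in>{-m..m}. W.prob (C' j))"
  by (rule W.finite_measure_finite_Union) (use C'_ev disj in auto)
 also have "... = W.prob C" by (simp add: C'_measure tot flip: sum_distrib_left)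
 finally have N0: "W.prob N = 0" by simp
 let ?S = "{\<xi>. \<xi> (t + Suc k) \<in> S}"
 have N_ev: "N \<in> W.events" unfolding N_def using C_ev C'_ev by auto
 have split: "C \<inter> ?S = (\<Union>j\<in>{-m..m}. C' j \<inter> ?S) \<union> (N \<inter> ?S)"
  unfolding N_def using C'_eq by auto
 have "W.prob (C \<inter> ?S) = W.prob (\<Union>j\<in>{-m..m}. C' j \<inter> ?S) + W.prob (N \<inter> ?S)" unfolding split
  by (rule W.finite_measure_Union) (use C'_ev N_ev measS in \<open>auto simp: N_def\<close>)
 also have "W.prob (N \<inter> ?S) = 0"
  using W.finite_measure_mono[of "N \<inter> ?S" N] N0 N_ev by (simp add: measure_le_0_iff)
 also have "W.prob (\<Union>j\<in>{-m..m}. C' j \<inter> ?S) = (\<Sum>j\<in>{-m..m}. W.prob (C' j \<inter> ?S))"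
  by (rule W.finite_measure_finite_Union) (use C'_ev disj measS in \<open>auto simp: disjoint_family_on_def\<close>)
 also have "... = (\<Sum>j\<in>{-m..m}. W.prob C * w (x t) j * (free_op m w ^^ k) (indicat_real S) (x t + j))"
 proof (rule sum.cong[OF refl])
  fix j assume "j \<in> {-m..m}"
  have "C' j \<inter> ?S = {\<xi>. (\<forall>i\<le>Suc t. \<xi> i = x' j i) \<and> \<xi> (Suc t + k) \<in> S}" by (auto simp: C'_def)
  then show "W.prob (C' j \<inter> ?S) = W.prob C * w (x t) j * (free_op m w ^^ k) (indicat_real S) (x t + j)"
   using Suc.IH[of "Suc t" "x' j"] by (simp add: C'_measure flip: C'_def) (simp add: x'_def)
 qed
 also have "... = W.prob C * (free_op m w ^^ Suc k) (indicat_real S) (x t)"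
  by (simp add: free_op_def sum_distrib_left mult_ac)
 finally show ?case by (simp add: C_def Int_def)
qed

lemma walk_law_marginal:
 assumes w: "\<And>x. w x \<in> jump_vectors m"
 shows "measure (walk_law w) {\<xi>. \<xi> t \<in> S} = (free_op m w ^^ t) (indicat_real S) 0"
proof -
 interpret W: prob_space "walk_law w" by (rule prob_space_walk_law)
 note sp [simp] = space_walk_law[of w]
 have measS: "{\<xi>. \<xi> u \<in> S'} \<in> W.events" for u S'
 proof -
  have "(\<lambda>\<xi>. \<xi> u) -` S' \<inter> space (walk_law w) \<in> W.events" by (rule measurable_sets[OF walk_law_measurable_coord]) simp
  then show ?thesis by (simp add: vimage_def)
 qed
 have w': "w \<in> space (env_space m)" using w by (simp add: space_env_space)
 have start: "W.prob {\<xi>. \<forall>i\<le>0. \<xi> i = 0} = 1"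
  using measure_walk_law_cylinder[OF w', of 0 "\<lambda>_. 0"] by simp
 have ae: "AE \<xi> in walk_law w. \<xi> 0 = 0" using start W.prob_eq_1[OF measS[of 0 "{0}"]] by simp
 have "W.prob {\<xi>. \<xi> t \<in> S} = W.prob {\<xi>. (\<forall>i\<le>0. \<xi> i = 0) \<and> \<xi> (0 + t) \<in> S}"
  by (rule W.finite_measure_eq_AE) (use ae measS[of t S] measS[of 0 "{0}"] in \<open>auto simp: Collect_conj_eq\<close>)
 also have "... = (free_op m w ^^ t) (indicat_real S) 0"
  using walk_law_marginal_from_cylinder[OF w, where t=0 and x="\<lambda>_. 0" and k=t and S=S] start by simp
 finally show ?thesis .
qed

subsection \<open>Localization at the bottom of a valley\<close>

lemma free_op_Suc: "(free_op m w ^^ Suc n) f x = (\<Sum>j\<in>{-m..m}. w x j * (free_op m w ^^ n) f (x + j))"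
proof -
 have "(free_op m w ^^ Suc n) f x = free_op m w ((free_op m w ^^ n) f) x" by simp
 then show ?thesis by (simp only: free_op_def)
qed

lemma free_op_reflect: "free_op m (reflect_env w) f (- x) = free_op m w (\<lambda>z. f (- z)) x"
 unfolding free_op_def by (rule sum.reindex_bij_witness[of _ uminus uminus]) (auto simp: reflect_env_def)

lemma free_op_iter_reflect: "(free_op m (reflect_env w) ^^ n) f (- x) = (free_op m w ^^ n) (\<lambda>z. f (- z)) x"
proof (induction n arbitrary: x)
 case (Suc n)
 have "(free_op m (reflect_env w) ^^ Suc n) f (- x) = free_op m (reflect_env w) ((free_op m (reflect_env w) ^^ n) f) (- x)" by simp
 also have "... = free_op m w (\<lambda>z. (free_op m (reflect_env w) ^^ n) f (- z)) x" by (rule free_op_reflect)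
 also have "... = (free_op m w ^^ Suc n) (\<lambda>z. f (- z)) x" by (simp add: Suc.IH)
 finally show ?case .
qed simp

context elliptic_env begin

lemma free_op_iter_bounds:
 assumes "\<And>x. 0 \<le> f x" "\<And>x. f x \<le> 1"
 shows "0 \<le> (free_op m w ^^ n) f x \<and> (free_op m w ^^ n) f x \<le> 1"
proof (induction n arbitrary: x)
 case (Suc n)
 let ?g = "(free_op m w ^^ n) f"
 have "(\<Sum>j\<in>{-m..m}. w x j * ?g (x + j)) \<le> (\<Sum>j\<in>{-m..m}. w x j * 1)"
  using Suc by (intro sum_mono mult_left_mono nonneg) auto
 moreover have "0 \<le> (\<Sum>j\<in>{-m..m}. w x j * ?g (x + j))"
  using Suc by (intro sum_nonneg mult_nonneg_nonneg nonneg) auto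
 ultimately show ?case by (simp add: free_op_Suc total del: funpow.simps)
qed (use assms in auto)

lemma Pop_iter_invariant:
 assumes inv: "invariant_on m w a b \<pi>"
 shows "(\<Sum>x\<in>{a..b}. \<pi> x * (Pop a b ^^ n) f x) = (\<Sum>x\<in>{a..b}. \<pi> x * f x)"
 by (induction n) (simp_all add: invariant_onD(2)[OF inv])

lemma Pop_iter_nonneg:
 assumes "a \<le> b" "\<And>x. 0 \<le> f x"
 shows "0 \<le> (Pop a b ^^ n) f x"
 by (induction n arbitrary: x) (auto intro!: Pop_nonneg assms)

lemma Pop_iter_le:
 assumes inv: "invariant_on m w a b \<pi>" and ab: "a \<le> b" and f: "\<And>x. 0 \<le> f x" and z: "z \<in> {a..b}"
 shows "(Pop a b ^^ n) f z \<le> (\<Sum>x\<in>{a..b}. \<pi> x * f x) / \<pi> z"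
proof -
 have p: "0 < \<pi> x" if "x \<in> {a..b}" for x by (rule invariant_onD(1)[OF inv that])
 have "\<pi> z * (Pop a b ^^ n) f z \<le> (\<Sum>x\<in>{a..b}. \<pi> x * (Pop a b ^^ n) f x)"
  by (rule member_le_sum[where f="\<lambda>x. \<pi> x * (Pop a b ^^ n) f x"])
   (use z p Pop_iter_nonneg[OF ab f] in \<open>auto intro!: mult_nonneg_nonneg simp: less_imp_le\<close>)
 then show ?thesis using p[OF z] by (simp add: Pop_iter_invariant[OF inv] field_simps)
qed

context
 fixes a b :: int and B E :: "int set"
 assumes ab: "a \<le> b" and E_def: "E = {x\<in>{a..b}. x - m < a \<or> b < x + m}"
begin

lemma free_op_eq_Pop:
 assumes "x \<in> {a..b}" "x \<notin> E"
 shows "free_op m w f x = Pop a b f x"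
 unfolding free_op_def clip_op_def using assms by (intro sum.cong refl) (auto simp: E_def clip_id)

text \<open>The free and the clipped step agree off the edge layer \<open>E\<close>. The probability
  of standing in \<open>E\<close> at some time up to s is bounded by the expected number of visits,
  which the invariant measure controls.\<close>

lemma free_op_iter_le_clipped:
 assumes f: "\<And>x. 0 \<le> f x" "\<And>x. f x \<le> 1" and z: "z \<in> {a..b}"
 shows "(free_op m w ^^ s) f z \<le> (Pop a b ^^ s) f z + (\<Sum>r<Suc s. (Pop a b ^^ r) (indicat_real E) z)"
 using z
proof (induction s arbitrary: z)
 case (Suc s)
 have nn: "0 \<le> (Pop a b ^^ r) (indicat_real E) x" for r x by (rule Pop_iter_nonneg[OF ab]) simp
 have S: "(\<Sum>r<Suc (Suc s). (Pop a b ^^ r) (indicat_real E) z) = indicat_real E z + Pop a b (\<lambda>x. \<Sum>r<Suc s. (Pop a b ^^ r) (indicat_real E) x) z"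
  by (subst sum.lessThan_Suc_shift) (simp add: Pop_sum Pop_add)
 show ?case
 proof (cases "z \<in> E")
  case True
  have "(free_op m w ^^ Suc s) f z \<le> 1" using free_op_iter_bounds[of f "Suc s" z] f by simp
  moreover have "0 \<le> (Pop a b ^^ Suc s) f z" by (rule Pop_iter_nonneg[OF ab f(1)])
  moreover have "0 \<le> Pop a b (\<lambda>x. \<Sum>r<Suc s. (Pop a b ^^ r) (indicat_real E) x) z"
   by (intro Pop_nonneg ab sum_nonneg nn)
  ultimately show ?thesis unfolding S using True by simp
 next
  case False
  have "(free_op m w ^^ Suc s) f z = Pop a b ((free_op m w ^^ s) f) z" using free_op_eq_Pop[OF Suc.prems False] by simp
  also have "... \<le> Pop a b (\<lambda>z. (Pop a b ^^ s) f z + (\<Sum>r<Suc s. (Pop a b ^^ r) (indicat_real E) z)) z"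
   by (rule Pop_mono[OF ab Suc.IH])
  finally show ?thesis unfolding S using False by (simp add: Pop_add)
 qed
qed simp

text \<open>One step of the clipped chain killed on \<open>B\<close>. The function at the final time
  is not cut off on \<open>B\<close>, so the functions of interest are those vanishing
  there.\<close>

definition killed :: "path \<Rightarrow> int \<Rightarrow> real" where
 "killed f x = (if x \<in> {a..b} - B then Pop a b f x else 0)"

definition green_sum :: "nat \<Rightarrow> int \<Rightarrow> int \<Rightarrow> real" where
 "green_sum n y x = (\<Sum>s<n. (killed ^^ s) (indicat_real {y}) x)"

lemma killed_mono: "(\<And>z. z \<in> {a..b} \<Longrightarrow> f z \<le> g z) \<Longrightarrow> killed f x \<le> killed g x"
 unfolding killed_def using Pop_mono[OF ab] by auto

lemma killed_iter_nonneg: "(\<And>x. 0 \<le> f x) \<Longrightarrow> 0 \<le> (killed ^^ n) f x"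
 by (induction n arbitrary: x) (auto simp: killed_def intro!: Pop_nonneg ab)

lemma killed_sum: "killed (\<lambda>z. \<Sum>i\<in>I. f i z) x = (\<Sum>i\<in>I. killed (f i) x)"
 by (cases "x \<in> {a..b} - B") (simp_all add: killed_def Pop_sum del: atLeastAtMost_iff Diff_iff)

lemma killed_iter_sum: "(killed ^^ n) (\<lambda>z. \<Sum>i\<in>I. f i z) = (\<lambda>x. \<Sum>i\<in>I. (killed ^^ n) (f i) x)"
proof (induction n)
 case (Suc n) show ?case by (rule ext) (simp add: Suc killed_sum)
qed simp

lemma green_sum_Suc: "green_sum (Suc n) y x = indicat_real {y} x + killed (green_sum n y) x"
 unfolding green_sum_def by (subst sum.lessThan_Suc_shift) (simp add: killed_sum)

lemma green_sum_nonneg: "0 \<le> green_sum n y x"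
 unfolding green_sum_def by (intro sum_nonneg killed_iter_nonneg) simp

lemma green_sum_le_Suc: "green_sum n y x \<le> green_sum (Suc n) y x"
 unfolding green_sum_def using killed_iter_nonneg[of "indicat_real {y}" n x] by simp

text \<open>By \<open>green_max\<close> the starting point may be moved to the pole, so the sum of 1
  / \<pi> may run to \<beta> either from \<open>x\<close> or from \<open>y\<close>, whichever way
  meets the lower barrier.\<close>

lemma green_sum_bound:
 assumes inv: "invariant_on m w a b \<pi>" and \<beta>: "\<beta> \<in> {a..b}" "\<beta> \<in> B" and y: "y \<in> {a..b} - B" and x: "x \<in> {a..b}" "z = x \<or> z = y"
 shows "green_sum n y x \<le> 2 / \<epsilon> * \<pi> y * (\<Sum>k\<in>{min z \<beta>..<max z \<beta>}. 1 / \<pi> k)"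
proof -
 have g1: "green_sum n y x = 0" if "x \<in> {a..b}" "x \<in> B" for x
 proof (cases n)
  case 0 then show ?thesis by (simp add: green_sum_def)
 next
  case (Suc k) then show ?thesis using that y by (auto simp: green_sum_Suc killed_def indicator_def)
 qed
 have g2: "green_sum n y x \<le> (if x = y then 1 else 0) + Pop a b (green_sum n y) x" if "x \<in> {a..b}" "x \<notin> B" for x
  using green_sum_le_Suc[of n y x] that by (cases "x = y") (simp_all add: green_sum_Suc killed_def)
 have y': "y \<in> {a..b}" using y by simp
 have "green_sum n y x \<le> green_sum n y z" using x(2) green_max[OF inv ab green_sum_nonneg g1 g2 \<beta> y' x(1)] by auto
 also have "... \<le> 2 / \<epsilon> * \<pi> y * (\<Sum>k\<in>{min z \<beta>..<max z \<beta>}. 1 / \<pi> k)"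
  by (rule green_bound[OF inv ab green_sum_nonneg g1 g2 \<beta> y']) (use x y' in auto)
 finally show ?thesis .
qed

text \<open>Survival probabilities decrease in time, so n times the last one is at most the expected
  lifetime up to time n, and this is a sum of Green functions.\<close>

lemma survival_bound:
 assumes "0 < n"
 shows "(killed ^^ n) (indicat_real ({a..b} - B)) x \<le> (\<Sum>y\<in>{a..b} - B. green_sum n y x) / n"
proof -
 let ?r = "\<lambda>n. (killed ^^ n) (indicat_real ({a..b} - B))"
 have dec: "?r (Suc n) x \<le> ?r n x" for n x
 proof (induction n arbitrary: x)
  case 0
  have "Pop a b (indicat_real ({a..b} - B)) x \<le> Pop a b (\<lambda>_. 1) x" by (rule Pop_mono[OF ab]) (simp add: indicator_def)
  then show ?case by (cases "x \<in> {a..b} - B") (simp_all add: killed_def Pop_const del: atLeastAtMost_iff Diff_iff)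
 next
  case (Suc n) then show ?case by (simp add: killed_mono)
 qed
 have dec': "?r n x \<le> ?r s x" if "s \<le> n" for s
  using that dec by (rule lift_Suc_antimono_le[of "\<lambda>n. ?r n x", rotated])
 have ind: "indicat_real ({a..b} - B) = (\<lambda>x. \<Sum>y\<in>{a..b} - B. indicat_real {y} x)"
  by (rule ext) (auto simp: indicator_def)
 have "real n * ?r n x = (\<Sum>s<n. ?r n x)" by simp
 also have "... \<le> (\<Sum>s<n. ?r s x)" by (intro sum_mono dec') simp
 also have "... = (\<Sum>y\<in>{a..b} - B. green_sum n y x)" unfolding green_sum_def ind killed_iter_sum by (rule sum.swap)
 finally show ?thesis using assms by (simp add: field_simps)
qed

text \<open>The three terms stand for three fates: surviving in the window outside \<open>B\<close>,
  reaching the edge \<open>E\<close> before \<open>B\<close>, and entering \<open>B\<close>. Since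
  jumps are bounded, the entrance lies in a thin set \<open>B0\<close>, from where \<kappa> bounds
  what happens in the time that is left.\<close>

lemma free_op_iter_split:
 assumes f: "\<And>x. 0 \<le> f x" "\<And>x. f x \<le> 1" and \<kappa>: "0 \<le> \<kappa>"
  and enter: "\<And>x j. x \<in> {a..b} - B \<Longrightarrow> x \<notin> E \<Longrightarrow> j \<in> {-m..m} \<Longrightarrow> x + j \<in> B \<Longrightarrow> x + j \<in> B0"
  and B0: "\<And>s z. s \<le> t \<Longrightarrow> z \<in> B0 \<Longrightarrow> (free_op m w ^^ s) f z \<le> \<kappa>"
  and x: "x \<in> {a..b} - B" and s: "s \<le> t"
 shows "(free_op m w ^^ s) f x \<le> (killed ^^ s) (indicat_real ({a..b} - B)) x + (\<Sum>y\<in>E - B. green_sum (Suc s) y x) + \<kappa>"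
 using x s
proof (induction s arbitrary: x)
 case 0
 have "0 \<le> (\<Sum>y\<in>E - B. green_sum (Suc 0) y x)" by (intro sum_nonneg green_sum_nonneg)
 moreover have "indicat_real ({a..b} - B) x = 1" using 0 by simp
 ultimately show ?case unfolding funpow.simps id_apply using f(2)[of x] \<kappa> by linarith
next
 case (Suc s)
 let ?r = "\<lambda>n. (killed ^^ n) (indicat_real ({a..b} - B))"
 have finE: "finite E" by (rule finite_subset[of _ "{a..b}"]) (auto simp: E_def)
 have r0: "0 \<le> ?r n z" for n z by (rule killed_iter_nonneg) simp
 have V0: "0 \<le> (\<Sum>y\<in>E - B. green_sum n y z)" for n z by (intro sum_nonneg green_sum_nonneg)
 have V: "(\<Sum>y\<in>E - B. green_sum (Suc (Suc s)) y x) = indicat_real (E - B) x + killed (\<lambda>z. \<Sum>y\<in>E - B. green_sum (Suc s) y z) x"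
  unfolding green_sum_Suc[of "Suc s"] killed_sum sum.distrib using finE by (auto simp: indicator_def)
 show ?case
 proof (cases "x \<in> E")
  case True
  have "(free_op m w ^^ Suc s) f x \<le> 1" using free_op_iter_bounds[of f "Suc s" x] f by simp
  moreover have "0 \<le> killed (\<lambda>z. \<Sum>y\<in>E - B. green_sum (Suc s) y z) x"
   using V0 by (auto simp: killed_def intro!: Pop_nonneg ab)
  ultimately show ?thesis unfolding V using True Suc.prems r0[of "Suc s" x] \<kappa> by simp
 next
  case False
  let ?h = "\<lambda>z. ?r s z + (\<Sum>y\<in>E - B. green_sum (Suc s) y z) + \<kappa>"
  have "(free_op m w ^^ Suc s) f x = (\<Sum>j\<in>{-m..m}. w x j * (free_op m w ^^ s) f (x + j))" by (rule free_op_Suc)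
  also have "... \<le> (\<Sum>j\<in>{-m..m}. w x j * ?h (x + j))"
  proof (intro sum_mono mult_left_mono nonneg)
   fix j assume j: "j \<in> {-m..m}"
   have mem: "x + j \<in> {a..b}" using j Suc.prems(1) False by (auto simp: E_def)
   show "(free_op m w ^^ s) f (x + j) \<le> ?h (x + j)"
   proof (cases "x + j \<in> B")
    case True
    then have "(free_op m w ^^ s) f (x + j) \<le> \<kappa>" using Suc.prems by (intro B0 enter[OF Suc.prems(1) False j]) auto
    then show ?thesis using r0[of s "x + j"] V0[of "Suc s" "x + j"] by linarith
   next
    case False
    then show ?thesis using Suc.prems mem by (intro Suc.IH) auto
   qed
  qed
  also have "... = free_op m w ?h x" by (simp add: free_op_def)
  also have "... = Pop a b ?h x" using Suc.prems False by (intro free_op_eq_Pop) auto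
  also have "... = ?r (Suc s) x + killed (\<lambda>z. \<Sum>y\<in>E - B. green_sum (Suc s) y z) x + \<kappa>"
   using Suc.prems by (simp add: Pop_add Pop_const killed_def)
  finally show ?thesis unfolding V using False by simp
 qed
qed

lemma free_op_iter_le_killed:
 assumes f: "\<And>x. 0 \<le> f x" and "\<And>x. x \<in> {a..b} \<Longrightarrow> x \<in> B \<Longrightarrow> f x = 0"
  and "\<And>z. \<bar>z - x\<bar> \<le> m * int s \<Longrightarrow> z \<in> {a..b} - B - E"
 shows "(free_op m w ^^ s) f x \<le> (killed ^^ s) f x"
 using assms(3)
proof (induction s arbitrary: x)
 case (Suc s)
 have x: "x \<in> {a..b} - B - E" using Suc.prems[of x] m_pos by simp
 have "(free_op m w ^^ Suc s) f x = (\<Sum>j\<in>{-m..m}. w x j * (free_op m w ^^ s) f (x + j))" by (rule free_op_Suc)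
 also have "... \<le> (\<Sum>j\<in>{-m..m}. w x j * (killed ^^ s) f (x + j))"
 proof (intro sum_mono mult_left_mono nonneg Suc.IH)
  fix j z assume "j \<in> {-m..m}" "\<bar>z - (x + j)\<bar> \<le> m * int s"
  then have "\<bar>z - x\<bar> \<le> m * int s + m" by auto
  then show "z \<in> {a..b} - B - E" by (intro Suc.prems) (simp add: algebra_simps)
 qed
 also have "... = Pop a b ((killed ^^ s) f) x" using free_op_eq_Pop[of x "(killed ^^ s) f"] x by (simp add: free_op_def)
 also have "... = (killed ^^ Suc s) f x" using x by (simp add: killed_def)
 finally show ?case .
qed simp

end
end

context elliptic_env begin

text \<open>The start 0 lies left of the bottom \<beta>. Until [\<beta>, b] is reached, Green
  function bounds dispose of long survival, by \<open>rise\<close>, and of an exit on the left, by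
  \<open>wall\<close>. After the entrance near \<beta>, the law of the clipped walk at any time has
  density at most 1 / \<pi> z with respect to \<pi>. So it is rarely at height d T above the bottom,
  by \<open>far\<close>, and rarely at the edge, by \<open>deep\<close>, even after summation over t
  = exp T times. Each term is exp (- d T) up to a polynomial in the window size.\<close>

lemma valley_localization_right:
 assumes inv: "invariant_on m w a b \<pi>" and a0: "a \<le> 0" and \<beta>: "0 \<le> \<beta>" "\<beta> + m \<le> b"
  and f: "\<And>x. 0 \<le> f x" "\<And>x. f x \<le> 1" and t: "1 \<le> t" "exp T = real t" and u_def: "\<And>x. u x = - ln (\<pi> x)"
  and rise: "\<And>i k. a \<le> i \<Longrightarrow> i \<le> k \<Longrightarrow> 0 \<le> k \<Longrightarrow> k \<le> \<beta> \<Longrightarrow> u k - u i \<le> (1 - d) * T"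
  and wall: "\<And>y k. a \<le> y \<Longrightarrow> y < a + m \<Longrightarrow> 0 \<le> k \<Longrightarrow> k \<le> \<beta> \<Longrightarrow> u k + d * T \<le> u y"
  and deep: "\<And>y. y \<in> {a..b} \<Longrightarrow> y < a + m \<or> b - m < y \<Longrightarrow> u \<beta> + (1 + d) * T \<le> u y"
  and far: "\<And>x. x \<in> {a..b} \<Longrightarrow> f x \<noteq> 0 \<Longrightarrow> u \<beta> + d * T \<le> u x"
 shows "(free_op m w ^^ t) f 0 \<le> (4 / \<epsilon> + 3 / \<epsilon> ^ nat m) * (of_int (b - a + 1))\<^sup>2 * exp (- d * T)"
proof -
 have ab: "a \<le> b" using a0 \<beta> m_pos by simp
 define E where "E = {x\<in>{a..b}. x - m < a \<or> b < x + m}"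
 define B where "B = {\<beta>..b}"
 define B0 where "B0 = {\<beta>..<\<beta> + m}"
 define N :: real where "N = of_int (b - a + 1)"
 define e where "e = exp (- d * T)"
 have N: "1 \<le> N" using ab by (simp add: N_def)
 have cardN: "real (card {a..b}) = N" using ab by (simp add: N_def)
 have e0: "0 < e" by (simp add: e_def)
 have p: "0 < \<pi> x" if "x \<in> {a..b}" for x by (rule invariant_onD(1)[OF inv that])
 have ratio: "\<pi> x / \<pi> y = exp (u y - u x)" if "x \<in> {a..b}" "y \<in> {a..b}" for x y
  using p[OF that(1)] p[OF that(2)] by (simp add: u_def exp_diff)
 have \<beta>m: "\<beta> \<in> {a..b}" "\<beta> \<in> B" using a0 \<beta> m_pos by (auto simp: B_def)
 have finE: "finite E" by (rule finite_subset[of _ "{a..b}"]) (auto simp: E_def)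
 have cardE: "real (card E) \<le> N" unfolding cardN[symmetric] by (intro of_nat_mono card_mono) (auto simp: E_def)
 have T1: "exp T * exp (- (1 + d) * T) = e" unfolding e_def exp_add[symmetric] by (simp add: algebra_simps)
 have T2: "exp ((1 - d) * T) = e * real t" unfolding e_def t(2)[symmetric] exp_add[symmetric] by (simp add: algebra_simps)
 \<comment> \<open>3 = 1 + 2: one share for the stationary mass of f, two for the edge, where at
   most t + 1 \<le> 2 t times are summed. The power of \<epsilon> compares \<pi> at the entrance
   with \<pi> \<beta>.\<close>
 define \<kappa> where "\<kappa> = 3 * N * e / \<epsilon> ^ nat m"
 have \<kappa>0: "0 \<le> \<kappa>" using N e0 eps_pos by (simp add: \<kappa>_def)
 have f_sum: "(\<Sum>x\<in>{a..b}. \<pi> x * f x) \<le> N * e * \<pi> \<beta>"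
 proof -
  have "(\<Sum>x\<in>{a..b}. \<pi> x * f x) \<le> (\<Sum>x\<in>{a..b}. e * \<pi> \<beta>)"
  proof (rule sum_mono)
   fix x assume x: "x \<in> {a..b}"
   show "\<pi> x * f x \<le> e * \<pi> \<beta>"
   proof (cases "f x = 0")
    case False
    have "\<pi> x * f x \<le> \<pi> x" using p[OF x] f[of x] by (simp add: mult_left_le)
    also have "... = exp (u \<beta> - u x) * \<pi> \<beta>" using ratio[OF x \<beta>m(1)] p[OF \<beta>m(1)] by (simp add: field_simps)
    also have "... \<le> e * \<pi> \<beta>" using far[OF x False] p[OF \<beta>m(1)] by (simp add: e_def)
    finally show ?thesis .
   qed (use p[OF \<beta>m(1)] e0 in simp)
  qed
  then show ?thesis using cardN by (simp add: mult_ac)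
 qed
 have E_sum: "(\<Sum>x\<in>{a..b}. \<pi> x * indicat_real E x) \<le> N * exp (- (1 + d) * T) * \<pi> \<beta>"
 proof -
  have "(\<Sum>x\<in>{a..b}. \<pi> x * indicat_real E x) = (\<Sum>x\<in>E. \<pi> x)"
   by (intro sum.mono_neutral_cong_right) (auto simp: E_def)
  also have "... \<le> (\<Sum>x\<in>E. exp (- (1 + d) * T) * \<pi> \<beta>)"
  proof (rule sum_mono)
   fix x assume xE: "x \<in> E"
   then have x: "x \<in> {a..b}" by (auto simp: E_def)
   have "\<pi> x = exp (u \<beta> - u x) * \<pi> \<beta>" using ratio[OF x \<beta>m(1)] p[OF \<beta>m(1)] by (simp add: field_simps)
   moreover have "u \<beta> + (1 + d) * T \<le> u x" using xE by (intro deep x) (auto simp: E_def)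
   ultimately show "\<pi> x \<le> exp (- (1 + d) * T) * \<pi> \<beta>" using p[OF \<beta>m(1)] by (simp add: algebra_simps)
  qed
  also have "... = card E * (exp (- (1 + d) * T) * \<pi> \<beta>)" by simp
  also have "... \<le> N * (exp (- (1 + d) * T) * \<pi> \<beta>)" using cardE p[OF \<beta>m(1)] by (intro mult_right_mono) auto
  finally show ?thesis by (simp add: mult_ac)
 qed
 have enter_bound: "(free_op m w ^^ s) f z \<le> \<kappa>" if "s \<le> t" "z \<in> B0" for s z
 proof -
  have z: "z \<in> {a..b}" using that a0 \<beta> by (auto simp: B0_def)
  have pz: "\<epsilon> ^ nat m * \<pi> \<beta> \<le> \<pi> z" using that z \<beta>m m_pos by (intro Harnack[OF inv]) (auto simp: B0_def)
  have pos: "0 < \<epsilon> ^ nat m * \<pi> \<beta>" using eps_pos p[OF \<beta>m(1)] by simp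
  have le: "X / \<pi> z \<le> X / (\<epsilon> ^ nat m * \<pi> \<beta>)" if "0 \<le> X" for X
   by (rule divide_left_mono[OF pz that]) (use pos p[OF z] in simp)
  have "(free_op m w ^^ s) f z \<le> (Pop a b ^^ s) f z + (\<Sum>r<Suc s. (Pop a b ^^ r) (indicat_real E) z)"
   by (rule free_op_iter_le_clipped[OF ab E_def f z])
  also have "(Pop a b ^^ s) f z \<le> (\<Sum>x\<in>{a..b}. \<pi> x * f x) / \<pi> z" by (rule Pop_iter_le[OF inv ab f(1) z])
  also have "... \<le> (\<Sum>x\<in>{a..b}. \<pi> x * f x) / (\<epsilon> ^ nat m * \<pi> \<beta>)"
   by (rule le) (use p f in \<open>auto intro!: sum_nonneg mult_nonneg_nonneg simp: less_imp_le\<close>)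
  also have "... \<le> N * e * \<pi> \<beta> / (\<epsilon> ^ nat m * \<pi> \<beta>)" by (rule divide_right_mono[OF f_sum less_imp_le[OF pos]])
  also have "... = N * e / \<epsilon> ^ nat m" using p[OF \<beta>m(1)] by simp
  also have "(\<Sum>r<Suc s. (Pop a b ^^ r) (indicat_real E) z) \<le> (\<Sum>r<Suc s. (\<Sum>x\<in>{a..b}. \<pi> x * indicat_real E x) / \<pi> z)"
   by (intro sum_mono Pop_iter_le[OF inv ab _ z]) simp
  also have "... = real (Suc s) * ((\<Sum>x\<in>{a..b}. \<pi> x * indicat_real E x) / \<pi> z)" by simp
  also have "... \<le> (2 * real t) * ((\<Sum>x\<in>{a..b}. \<pi> x * indicat_real E x) / (\<epsilon> ^ nat m * \<pi> \<beta>))"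
   by (rule mult_mono[OF _ le]) (use that t p pz pos in \<open>auto intro!: sum_nonneg mult_nonneg_nonneg divide_nonneg_nonneg simp: less_imp_le p[OF z]\<close>)
  also have "... \<le> (2 * real t) * (N * exp (- (1 + d) * T) * \<pi> \<beta> / (\<epsilon> ^ nat m * \<pi> \<beta>))"
   using E_sum pos by (intro mult_left_mono divide_right_mono) auto
  also have "... = 2 * N * (exp T * exp (- (1 + d) * T)) / \<epsilon> ^ nat m" using p[OF \<beta>m(1)] t(2) by simp
  also have "... = 2 * N * e / \<epsilon> ^ nat m" unfolding T1 ..
  finally show ?thesis by (simp add: \<kappa>_def field_simps)
 qed
 have K: "\<kappa> \<le> 3 / \<epsilon> ^ nat m * (N\<^sup>2 * e)"
 proof -
  have "N * e \<le> N\<^sup>2 * e" using N e0 by (simp add: power2_eq_square)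
  then have "3 / \<epsilon> ^ nat m * (N * e) \<le> 3 / \<epsilon> ^ nat m * (N\<^sup>2 * e)" using eps_pos by (intro mult_left_mono) auto
  then show ?thesis by (simp add: \<kappa>_def)
 qed
 show ?thesis
 proof (cases "\<beta> = 0")
  case True
  then have "(free_op m w ^^ t) f 0 \<le> \<kappa>" using m_pos by (intro enter_bound) (auto simp: B0_def)
  also note K
  also have "3 / \<epsilon> ^ nat m * (N\<^sup>2 * e) \<le> (4 / \<epsilon> + 3 / \<epsilon> ^ nat m) * (N\<^sup>2 * e)"
   using eps_pos e0 by (intro mult_right_mono) auto
  finally show ?thesis by (simp add: N_def e_def mult_ac)
 next
  case False
  have D: "{a..b} - B = {a..<\<beta>}" using \<beta>m by (auto simp: B_def)
  have x0: "0 \<in> {a..b} - B" using False \<beta> a0 by (simp add: D)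
  have green: "green_sum a b B n y 0 \<le> 2 / \<epsilon> * (N * M)"
   if y: "y \<in> {a..<\<beta>}" and z: "z = 0 \<or> z = y" "z \<le> \<beta>" "a \<le> z" and M: "\<And>k. k \<in> {z..<\<beta>} \<Longrightarrow> exp (u k - u y) \<le> M" "0 \<le> M" for n y z M
  proof -
   have yab: "y \<in> {a..b}" using y \<beta>m by auto
   have "green_sum a b B n y 0 \<le> 2 / \<epsilon> * \<pi> y * (\<Sum>k\<in>{min z \<beta>..<max z \<beta>}. 1 / \<pi> k)"
    by (rule green_sum_bound[OF ab E_def inv \<beta>m]) (use y z x0 D in auto)
   also have "... = 2 / \<epsilon> * (\<Sum>k\<in>{z..<\<beta>}. \<pi> y / \<pi> k)" using z by (simp add: sum_distrib_left min_def max_def)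
   also have "(\<Sum>k\<in>{z..<\<beta>}. \<pi> y / \<pi> k) \<le> (\<Sum>k\<in>{z..<\<beta>}. M)"
    using z \<beta>m M(1) yab by (intro sum_mono) (simp add: ratio)
   also have "... = real (card {z..<\<beta>}) * M" by simp
   also have "... \<le> N * M"
    unfolding cardN[symmetric] using z \<beta>m by (intro mult_right_mono M(2) of_nat_mono card_mono) auto
   finally show ?thesis using eps_pos by (simp add: mult_left_mono divide_right_mono)
  qed
  have "(free_op m w ^^ t) f 0 \<le> (killed a b B ^^ t) (indicat_real ({a..b} - B)) 0 + (\<Sum>y\<in>E - B. green_sum a b B (Suc t) y 0) + \<kappa>"
  proof (rule free_op_iter_split[OF ab E_def f \<kappa>0 _ enter_bound x0 order_refl])
   fix x j assume "x \<in> {a..b} - B" "j \<in> {-m..m}" "x + j \<in> B"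
   then show "x + j \<in> B0" unfolding D by (auto simp: B_def B0_def)
  qed
  also have "(killed a b B ^^ t) (indicat_real ({a..b} - B)) 0 \<le> (\<Sum>y\<in>{a..b} - B. green_sum a b B t y 0) / t"
   by (rule survival_bound[OF ab E_def]) (use t in simp)
  also have "(\<Sum>y\<in>{a..b} - B. green_sum a b B t y 0) \<le> (\<Sum>y\<in>{a..b} - B. 2 / \<epsilon> * (N * (e * real t)))"
  proof (rule sum_mono)
   fix y assume "y \<in> {a..b} - B"
   then have y: "y \<in> {a..<\<beta>}" by (simp only: D)
   show "green_sum a b B t y 0 \<le> 2 / \<epsilon> * (N * (e * real t))"
   \<comment> \<open>For y > 0 the path to \<beta> is started at the pole, so that only k \<ge> y
     occurs, as \<open>rise\<close> demands.\<close>
   proof (rule green[OF y, of "max 0 y"])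
    fix k assume k: "k \<in> {max 0 y..<\<beta>}"
    have "u k - u y \<le> (1 - d) * T" by (rule rise) (use k y in auto)
    then show "exp (u k - u y) \<le> e * real t" unfolding T2[symmetric] by simp
   qed (use y \<beta> a0 e0 in auto)
  qed
  also have "... = real (card ({a..b} - B)) * (2 / \<epsilon> * (N * (e * real t)))" by simp
  also have "... \<le> N * (2 / \<epsilon> * (N * (e * real t)))"
   unfolding cardN[symmetric] using e0 eps_pos by (intro mult_right_mono of_nat_mono card_mono) auto
  also have "N * (2 / \<epsilon> * (N * (e * real t))) / real t = 2 / \<epsilon> * (N\<^sup>2 * e)" using t by (simp add: power2_eq_square)
  also have "(\<Sum>y\<in>E - B. green_sum a b B (Suc t) y 0) \<le> (\<Sum>y\<in>E - B. 2 / \<epsilon> * (N * e))"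
  proof (rule sum_mono)
   fix y assume yE: "y \<in> E - B"
   then have y: "y \<in> {a..<\<beta>}" unfolding D[symmetric] by (auto simp: E_def)
   have y': "a \<le> y" "y < a + m" using yE y \<beta> by (auto simp: E_def)
   show "green_sum a b B (Suc t) y 0 \<le> 2 / \<epsilon> * (N * e)"
   \<comment> \<open>Here the path starts at 0: between 0 and \<beta> the heights stay below those
     of the left edge by \<open>wall\<close>.\<close>
   proof (rule green[OF y, of 0])
    fix k assume "k \<in> {0..<\<beta>}"
    then have "u k + d * T \<le> u y" by (intro wall y') auto
    then show "exp (u k - u y) \<le> e" by (simp add: e_def)
   qed (use \<beta> a0 e0 in auto)
  qed
  also have "... = real (card (E - B)) * (2 / \<epsilon> * (N * e))" by simp
  also have "... \<le> N * (2 / \<epsilon> * (N * e))"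
  proof (rule mult_right_mono)
   have "card (E - B) \<le> card E" using finE by (intro card_mono) auto
   then show "real (card (E - B)) \<le> N" using cardE by linarith
   show "0 \<le> 2 / \<epsilon> * (N * e)" using N e0 eps_pos by simp
  qed
  also have "... = 2 / \<epsilon> * (N\<^sup>2 * e)" by (simp add: power2_eq_square)
  also note K
  finally have "(free_op m w ^^ t) f 0 \<le> 2 / \<epsilon> * (N\<^sup>2 * e) + 2 / \<epsilon> * (N\<^sup>2 * e) + 3 / \<epsilon> ^ nat m * (N\<^sup>2 * e)"
   by (simp add: divide_right_mono t)
  also have "... = (4 / \<epsilon> + 3 / \<epsilon> ^ nat m) * (N\<^sup>2 * e)" by (simp add: field_simps)
  finally show ?thesis by (simp add: N_def e_def mult_ac)
 qed
qed

text \<open>The Green function at 0, killed at one end of a large window, bounds the expected number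
  of visits to 0 up to time n. If it stays bounded, the return probabilities are summable and
  Borel-Cantelli contradicts recurrence.\<close>

lemma not_recurrentI:
 assumes s: "s = 1 \<or> s = (-1 :: int)"
  and bound: "\<And>N. 1 \<le> N \<Longrightarrow> \<exists>\<pi>. invariant_on m w (- N) N \<pi> \<and> \<pi> 0 * (\<Sum>k\<in>{min 0 (s * N)..<max 0 (s * N)}. 1 / \<pi> k) \<le> M"
 shows "\<not> recurrent_walk w"
proof
 assume rec: "recurrent_walk w"
 interpret W: prob_space "walk_law w" by (rule prob_space_walk_law)
 note sp = space_walk_law[of w]
 let ?p = "\<lambda>t. measure (walk_law w) {\<xi>. \<xi> t \<in> {0}}"
 have ev: "{\<xi>. \<xi> u \<in> S'} \<in> W.events" for u S'
  using measurable_sets[OF walk_law_measurable_coord, of S' u w] by (simp add: sp vimage_def)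
 have bd: "(\<Sum>t<n. ?p t) \<le> 2 / \<epsilon> * M" for n
 proof -
  \<comment> \<open>Before time n the walk moves by at most m (n - 1), so it stays out of the edge
    layer of width \<open>m\<close> and does not notice the window.\<close>
  define N where "N = m * (int n + 1)"
  have N: "1 \<le> N" using mult_mono[of 1 m 1 "int n + 1"] m_pos by (simp add: N_def)
  obtain \<pi> where inv: "invariant_on m w (- N) N \<pi>" and M: "\<pi> 0 * (\<Sum>k\<in>{min 0 (s * N)..<max 0 (s * N)}. 1 / \<pi> k) \<le> M"
   using bound[OF N] by auto
  define E where "E = {x\<in>{- N..N}. x - m < - N \<or> N < x + m}"
  define B where "B = {s * N}"
  have ab: "- N \<le> N" using N by simp
  have zB: "0 \<in> {- N..N} - B" using N s by (auto simp: B_def)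
  have "(\<Sum>t<n. ?p t) = (\<Sum>t<n. (free_op m w ^^ t) (indicat_real {0}) 0)"
   by (intro sum.cong refl walk_law_marginal jumps)
  also have "... \<le> (\<Sum>t<n. (killed (- N) N B ^^ t) (indicat_real {0}) 0)"
  proof (rule sum_mono)
   fix r assume "r \<in> {..<n}"
   then have r: "m * int r \<le> m * (int n - 1)" using m_pos by (intro mult_left_mono) auto
   show "(free_op m w ^^ r) (indicat_real {0}) 0 \<le> (killed (- N) N B ^^ r) (indicat_real {0}) 0"
   proof (rule free_op_iter_le_killed[OF ab E_def])
    fix z assume "\<bar>z - 0\<bar> \<le> m * int r"
    then have "\<bar>z\<bar> \<le> N - 2 * m" using r by (simp add: N_def algebra_simps)
    then show "z \<in> {- N..N} - B - E" using m_pos s by (auto simp: B_def E_def)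
   qed (use zB in \<open>auto simp: indicator_def\<close>)
  qed
  also have "... = green_sum (- N) N B n 0 0" using green_sum_def[OF ab E_def] by simp
  also have "... \<le> 2 / \<epsilon> * \<pi> 0 * (\<Sum>k\<in>{min 0 (s * N)..<max 0 (s * N)}. 1 / \<pi> k)"
   by (rule green_sum_bound[OF ab E_def inv]) (use s N zB in \<open>auto simp: B_def\<close>)
  also have "... \<le> 2 / \<epsilon> * M" using mult_left_mono[OF M, of "2 / \<epsilon>"] eps_pos by (simp add: mult_ac)
  finally show ?thesis .
 qed
 have "summable ?p" by (rule summableI_nonneg_bounded[OF measure_nonneg bd])
 then have "AE \<xi> in walk_law w. eventually (\<lambda>t. \<xi> \<in> space (walk_law w) - {\<xi>. \<xi> t \<in> {0}}) sequentially"
  using ev[of _ "{0}"] by (intro borel_cantelli_AE1) (auto simp: W.emeasure_eq_measure)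
 moreover have "AE \<xi> in walk_law w. infinite {t. \<xi> t = 0}" using rec by (simp add: recurrent_walk_def)
 ultimately have "AE \<xi> in walk_law w. False"
 proof (rule AE_mp[OF AE_conjI], intro AE_I2 impI)
  fix \<xi> :: "nat \<Rightarrow> int"
  assume A: "eventually (\<lambda>t. \<xi> \<in> space (walk_law w) - {\<xi>. \<xi> t \<in> {0}}) sequentially \<and> infinite {t. \<xi> t = 0}"
  then obtain n0 where "\<And>t. n0 \<le> t \<Longrightarrow> \<xi> t \<noteq> 0" by (auto simp: eventually_sequentially)
  then have "{t. \<xi> t = 0} \<subseteq> {..<n0}" by (auto simp: not_le[symmetric])
  then show False using A finite_subset by blast
 qed
 then show False using W.AE_False by simp
qed

end

text \<open>Halve n and run the induction with the bound 32 C sqrt n - 8 C. The halves a and b are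
  at least n / 3, so sqrt a + sqrt b \<ge> 5 / 4 * sqrt n; through the mixed terms of the squares
  the subtracted constant then gains enough to pay for the additive error \<open>C\<close>.\<close>

lemma sqrt_recursion_bound:
 fixes e :: "nat \<Rightarrow> real"
 assumes e0: "\<And>n. 0 \<le> e n" and e1: "e 1 \<le> C"
  and rec: "\<And>a b. 1 \<le> a \<Longrightarrow> 1 \<le> b \<Longrightarrow> e (a + b) \<le> sqrt ((e a)\<^sup>2 + (e b)\<^sup>2) + C"
  and n: "1 \<le> n"
 shows "e n \<le> 32 * C * sqrt n"
proof -
 have C: "0 \<le> C" using e0[of 1] e1 by simp
 have "e n \<le> 32 * C * sqrt n - 8 * C" using n
 proof (induction n rule: less_induct)
  case (less n)
  show ?case
  proof (cases "n = 1")
   case True then show ?thesis using e1 C by simp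
  next
   case False
   define a b where "a = n div 2" and "b = n - n div 2"
   have ab: "1 \<le> a" "1 \<le> b" "a < n" "b < n" "n = a + b" using less.prems False by (auto simp: a_def b_def)
   have third: "n \<le> 3 * a" "n \<le> 3 * b" using less.prems False by (auto simp: a_def b_def)
   define x y z where "x = sqrt a" and "y = sqrt b" and "z = sqrt n"
   have xyz: "x\<^sup>2 + y\<^sup>2 = z\<^sup>2" "1 \<le> x" "1 \<le> y" "1 \<le> z"
   proof -
    have "real n = real a + real b" using ab(5) by linarith
    then show "x\<^sup>2 + y\<^sup>2 = z\<^sup>2" by (simp add: x_def y_def z_def)
   qed (use ab(1,2) less.prems in \<open>auto simp: x_def y_def z_def\<close>)
   have "(z\<^sup>2 / 3)\<^sup>2 \<le> (x * y)\<^sup>2"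
   proof -
    have "z\<^sup>2 / 3 \<le> x\<^sup>2" "z\<^sup>2 / 3 \<le> y\<^sup>2" 
     using of_nat_mono[OF third(1), where 'a=real] of_nat_mono[OF third(2), where 'a=real] by (auto simp: x_def y_def z_def)
    then have "(z\<^sup>2 / 3) * (z\<^sup>2 / 3) \<le> x\<^sup>2 * y\<^sup>2" by (intro mult_mono) auto
    then show ?thesis by (simp add: power2_eq_square mult_ac)
   qed
   then have xy: "z\<^sup>2 / 3 \<le> x * y" by (rule power2_le_imp_le) (use xyz(2,3) in simp)
   have "(5 / 4 * z)\<^sup>2 \<le> (x + y)\<^sup>2"
   proof -
    have "(x + y)\<^sup>2 = z\<^sup>2 + 2 * (x * y)" using xyz(1) by (simp add: power2_sum)
    moreover have "(5 / 4 * z)\<^sup>2 = 25 / 16 * z\<^sup>2" by (simp add: power_mult_distrib power_divide)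
    moreover have "0 \<le> z\<^sup>2" by simp
    ultimately show ?thesis using xy by linarith
   qed
   then have s: "5 / 4 * z \<le> x + y" by (rule power2_le_imp_le) (use xyz(2,3) in simp)
   have ia: "(e a)\<^sup>2 \<le> (32 * C * x - 8 * C)\<^sup>2" using less.IH[of a] ab e0[of a] by (intro power_mono) (auto simp: x_def)
   have ib: "(e b)\<^sup>2 \<le> (32 * C * y - 8 * C)\<^sup>2" using less.IH[of b] ab e0[of b] by (intro power_mono) (auto simp: y_def)
   have "(32 * C * x - 8 * C)\<^sup>2 + (32 * C * y - 8 * C)\<^sup>2 \<le> (32 * C * z - 9 * C)\<^sup>2"
   proof -
    have "(32 * C * z - 9 * C)\<^sup>2 - ((32 * C * x - 8 * C)\<^sup>2 + (32 * C * y - 8 * C)\<^sup>2)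
      = C\<^sup>2 * (1024 * (z\<^sup>2 - x\<^sup>2 - y\<^sup>2) - 576 * z + 512 * (x + y) - 47)"
     by (simp add: power2_eq_square algebra_simps)
    also have "... = C\<^sup>2 * (512 * (x + y) - 576 * z - 47)" using xyz(1) by simp
    also have "0 \<le> ..." using s xyz(4) by (intro mult_nonneg_nonneg) auto
    finally show ?thesis by simp
   qed
   then have "sqrt ((e a)\<^sup>2 + (e b)\<^sup>2) \<le> sqrt ((32 * C * z - 9 * C)\<^sup>2)"
    using ia ib by (intro real_sqrt_le_mono) linarith
   also have "... = 32 * C * z - 9 * C" using C mult_left_mono[OF xyz(4), of "32 * C"] by simp
   finally show ?thesis using rec[of a b] ab C by (simp add: z_def)
  qed
 qed
 then show ?thesis using C by simp
qed

subsection \<open>Functionals of an i.i.d. field\<close>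

context prob_space begin

text \<open>Boundedness is closed under all operations used here and settles every integrability
  condition. The functionals below are bounded, though not uniformly in their length.\<close>

definition bdd_rv :: "('a \<Rightarrow> real) \<Rightarrow> bool" where
 "bdd_rv F \<longleftrightarrow> F \<in> borel_measurable M \<and> (\<exists>B. \<forall>x\<in>space M. \<bar>F x\<bar> \<le> B)"

lemma bdd_rvI: "F \<in> borel_measurable M \<Longrightarrow> (\<And>x. x \<in> space M \<Longrightarrow> \<bar>F x\<bar> \<le> B) \<Longrightarrow> bdd_rv F"
 by (auto simp: bdd_rv_def)

lemma bdd_rv_measurable: "bdd_rv F \<Longrightarrow> F \<in> borel_measurable M" by (simp add: bdd_rv_def)

lemma bdd_rv_bound: assumes "bdd_rv F" obtains B where "0 \<le> B" "\<And>x. x \<in> space M \<Longrightarrow> \<bar>F x\<bar> \<le> B"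
proof -
 obtain B where B: "\<And>x. x \<in> space M \<Longrightarrow> \<bar>F x\<bar> \<le> B" using assms by (auto simp: bdd_rv_def)
 show ?thesis by (rule that[of "\<bar>B\<bar>"]) (use B in force)+
qed

lemma bdd_rv_integrable: assumes "bdd_rv F" shows "integrable M F"
 by (rule bdd_rv_bound[OF assms], rule integrable_const_bound) (auto simp: bdd_rv_measurable assms)

lemma bdd_rv_const: "bdd_rv (\<lambda>_. c)" by (rule bdd_rvI[where B="\<bar>c\<bar>"]) auto

lemma bdd_rv_add: assumes "bdd_rv F" "bdd_rv G" shows "bdd_rv (\<lambda>x. F x + G x)"
proof -
 obtain B B' where "\<And>x. x \<in> space M \<Longrightarrow> \<bar>F x\<bar> \<le> B" "\<And>x. x \<in> space M \<Longrightarrow> \<bar>G x\<bar> \<le> B'"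
  using assms by (auto simp: bdd_rv_def)
 then show ?thesis using assms[THEN bdd_rv_measurable] by (intro bdd_rvI[where B="B + B'"]) (auto intro: abs_triangle_ineq[THEN order_trans] add_mono)
qed

lemma bdd_rv_mult: assumes "bdd_rv F" "bdd_rv G" shows "bdd_rv (\<lambda>x. F x * G x)"
proof -
 obtain B where B: "0 \<le> B" "\<And>x. x \<in> space M \<Longrightarrow> \<bar>F x\<bar> \<le> B" using bdd_rv_bound[OF assms(1)] by metis
 obtain B' where B': "0 \<le> B'" "\<And>x. x \<in> space M \<Longrightarrow> \<bar>G x\<bar> \<le> B'" using bdd_rv_bound[OF assms(2)] by metis
 show ?thesis using assms[THEN bdd_rv_measurable] B B' by (intro bdd_rvI[where B="B * B'"]) (auto simp: abs_mult intro!: mult_mono)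
qed

lemma bdd_rv_diff: "bdd_rv F \<Longrightarrow> bdd_rv G \<Longrightarrow> bdd_rv (\<lambda>x. F x - G x)"
 using bdd_rv_add[of F "\<lambda>x. (-1) * G x"] bdd_rv_mult[OF bdd_rv_const[of "-1"], of G] by simp

lemma bdd_rv_power: "bdd_rv F \<Longrightarrow> bdd_rv (\<lambda>x. F x ^ n)"
 by (induction n) (auto intro: bdd_rv_const bdd_rv_mult)

lemma bdd_rv_sum: "(\<And>i. i \<in> I \<Longrightarrow> bdd_rv (F i)) \<Longrightarrow> bdd_rv (\<lambda>x. \<Sum>i\<in>I. F i x)"
 by (induction I rule: infinite_finite_induct) (auto intro: bdd_rv_const bdd_rv_add)

lemma bdd_rv_abs: "bdd_rv F \<Longrightarrow> bdd_rv (\<lambda>x. \<bar>F x\<bar>)"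
 by (auto simp: bdd_rv_def)

lemma bdd_rv_max: assumes "bdd_rv F" "bdd_rv G" shows "bdd_rv (\<lambda>x. max (F x) (G x))"
proof -
 have "(\<lambda>x. max (F x) (G x)) = (\<lambda>x. (1 / 2) * ((F x + G x) + \<bar>F x - G x\<bar>))" by (auto simp: max_def)
 then show ?thesis using assms by (simp only:) (intro bdd_rv_mult bdd_rv_const bdd_rv_add bdd_rv_abs bdd_rv_diff)
qed

lemmas bdd_rv_intros = bdd_rv_const bdd_rv_add bdd_rv_mult bdd_rv_diff bdd_rv_power bdd_rv_sum bdd_rv_abs bdd_rv_max

lemma expectation_Cauchy_Schwarz:
 assumes F: "bdd_rv F" and G: "bdd_rv G"
 shows "(expectation (\<lambda>x. F x * G x))\<^sup>2 \<le> expectation (\<lambda>x. (F x)\<^sup>2) * expectation (\<lambda>x. (G x)\<^sup>2)"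
proof -
 define A B C where "A = expectation (\<lambda>x. (F x)\<^sup>2)" and "B = expectation (\<lambda>x. F x * G x)" and "C = expectation (\<lambda>x. (G x)\<^sup>2)"
 have int: "integrable M (\<lambda>x. (F x)\<^sup>2)" "integrable M (\<lambda>x. F x * G x)" "integrable M (\<lambda>x. (G x)\<^sup>2)"
  by (intro bdd_rv_integrable bdd_rv_intros F G)+
 have q: "0 \<le> A + 2 * t * B + t\<^sup>2 * C" for t
 proof -
  have "0 \<le> expectation (\<lambda>x. (F x + t * G x)\<^sup>2)" by (rule Bochner_Integration.integral_nonneg) simp
  also have "(\<lambda>x. (F x + t * G x)\<^sup>2) = (\<lambda>x. (F x)\<^sup>2 + (2 * t) * (F x * G x) + t\<^sup>2 * (G x)\<^sup>2)"
   by (auto simp: power2_eq_square algebra_simps)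
  also have "expectation ... = A + 2 * t * B + t\<^sup>2 * C" unfolding A_def B_def C_def using int by simp
  finally show ?thesis .
 qed
 show ?thesis
 proof (cases "C = 0")
  case True
  have "B = 0"
  proof (rule ccontr)
   assume "B \<noteq> 0"
   then show False using q[of "- (A + 1) / (2 * B)"] True by (simp add: field_simps)
  qed
  then show ?thesis using True by (simp add: A_def B_def C_def)
 next
  case False
  have "0 \<le> C" unfolding C_def by (rule Bochner_Integration.integral_nonneg) simp
  then have C: "0 < C" using False by simp
  have "0 \<le> A + 2 * (- B / C) * B + (- B / C)\<^sup>2 * C" by (rule q)
  also have "... = A - B\<^sup>2 / C" using C by (simp add: power2_eq_square field_simps)
  finally have "B\<^sup>2 \<le> A * C" using C by (simp add: field_simps)
  then show ?thesis by (simp add: A_def B_def C_def)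
 qed
qed

definition sdev :: "('a \<Rightarrow> real) \<Rightarrow> real" where "sdev F = sqrt (variance F)"

lemma sdev_nonneg: "0 \<le> sdev F" by (simp add: sdev_def variance_positive)

lemma sdev_power2: "(sdev F)\<^sup>2 = variance F" by (simp add: sdev_def variance_positive)

lemma variance_add:
 assumes F: "bdd_rv F" and G: "bdd_rv G"
 shows "variance (\<lambda>x. F x + G x) = variance F + variance G + 2 * expectation (\<lambda>x. (F x - expectation F) * (G x - expectation G))"
proof -
 define F' G' where "F' = (\<lambda>x. F x - expectation F)" and "G' = (\<lambda>x. G x - expectation G)"
 have b: "bdd_rv F'" "bdd_rv G'" unfolding F'_def G'_def by (intro bdd_rv_intros F G)+
 have "variance (\<lambda>x. F x + G x) = expectation (\<lambda>x. (F' x)\<^sup>2 + (G' x)\<^sup>2 + 2 * (F' x * G' x))"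
  using bdd_rv_integrable[OF F] bdd_rv_integrable[OF G]
  by (intro Bochner_Integration.integral_cong refl) (simp add: F'_def G'_def power2_eq_square algebra_simps)
 also have "... = expectation (\<lambda>x. (F' x)\<^sup>2) + expectation (\<lambda>x. (G' x)\<^sup>2) + 2 * expectation (\<lambda>x. F' x * G' x)"
  using b by (simp add: bdd_rv_integrable bdd_rv_intros)
 finally show ?thesis by (simp add: F'_def G'_def)
qed

lemma sdev_triangle:
 assumes F: "bdd_rv F" and G: "bdd_rv G"
 shows "sdev (\<lambda>x. F x + G x) \<le> sdev F + sdev G"
proof -
 define c where "c = expectation (\<lambda>x. (F x - expectation F) * (G x - expectation G))"
 have "c\<^sup>2 \<le> variance F * variance G"
  unfolding c_def by (rule expectation_Cauchy_Schwarz) (intro bdd_rv_intros F G)+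
 then have "\<bar>c\<bar>\<^sup>2 \<le> (sdev F * sdev G)\<^sup>2" by (simp add: power_mult_distrib sdev_power2)
 then have "c \<le> sdev F * sdev G" using power2_le_imp_le[of "\<bar>c\<bar>" "sdev F * sdev G"] sdev_nonneg by auto
 then have "(sdev (\<lambda>x. F x + G x))\<^sup>2 \<le> (sdev F + sdev G)\<^sup>2"
  unfolding sdev_power2 variance_add[OF F G] by (simp add: power2_sum sdev_power2 c_def)
 then show ?thesis using sdev_nonneg by (intro power2_le_imp_le[OF _ add_nonneg_nonneg]) auto
qed

lemma sdev_uminus: "sdev (\<lambda>x. - F x) = sdev F"
proof -
 have "(- F x + expectation F)\<^sup>2 = (F x - expectation F)\<^sup>2" for x by (simp add: power2_commute)
 then show ?thesis by (simp add: sdev_def)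
qed

lemma sdev_triangle_diff:
 assumes F: "bdd_rv F" and G: "bdd_rv G"
 shows "\<bar>sdev F - sdev G\<bar> \<le> sdev (\<lambda>x. F x - G x)"
proof -
 have D: "bdd_rv (\<lambda>x. F x - G x)" "bdd_rv (\<lambda>x. G x - F x)" by (intro bdd_rv_intros F G)+
 have "sdev F \<le> sdev (\<lambda>x. F x - G x) + sdev G" using sdev_triangle[OF D(1) G] by simp
 moreover have "sdev G \<le> sdev (\<lambda>x. G x - F x) + sdev F" using sdev_triangle[OF D(2) F] by simp
 moreover have "sdev (\<lambda>x. G x - F x) = sdev (\<lambda>x. F x - G x)" using sdev_uminus[of "\<lambda>x. F x - G x"] by simp
 ultimately show ?thesis by linarith
qed

lemma sdev_le_bound:
 assumes F: "bdd_rv F" and B: "\<And>x. x \<in> space M \<Longrightarrow> \<bar>F x\<bar> \<le> B" "0 \<le> B"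
 shows "sdev F \<le> B"
proof -
 have "variance F = expectation (\<lambda>x. (F x)\<^sup>2) - (expectation F)\<^sup>2"
  by (rule variance_eq) (intro bdd_rv_integrable bdd_rv_intros F)+
 also have "... \<le> expectation (\<lambda>x. (F x)\<^sup>2)" by simp
 also have "... \<le> expectation (\<lambda>x. B\<^sup>2)"
  using B by (intro integral_mono bdd_rv_integrable bdd_rv_intros F) (metis abs_ge_zero power2_abs power_mono)
 also have "... = B\<^sup>2" by (simp add: prob_space)
 finally show ?thesis unfolding sdev_def using B(2) by (metis real_sqrt_le_mono real_sqrt_abs abs_of_nonneg)
qed

lemma sdev_indep:
 assumes F: "bdd_rv F" and G: "bdd_rv G" and ind: "indep_var borel F borel G"
 shows "sdev (\<lambda>x. F x + G x) = sqrt ((sdev F)\<^sup>2 + (sdev G)\<^sup>2)"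
proof -
 have "expectation (\<lambda>x. (F x - expectation F) * (G x - expectation G))
   = expectation (\<lambda>x. F x - expectation F) * expectation (\<lambda>x. G x - expectation G)"
 proof (rule indep_var_lebesgue_integral)
  show "indep_var borel (\<lambda>x. F x - expectation F) borel (\<lambda>x. G x - expectation G)"
   using indep_var_compose[OF ind, of "\<lambda>u. u - expectation F" borel "\<lambda>u. u - expectation G" borel]
   by (simp add: comp_def)
 qed (intro bdd_rv_integrable bdd_rv_intros F G)+
 also have "... = 0" using bdd_rv_integrable[OF F] by (simp add: prob_space)
 finally show ?thesis unfolding sdev_def[of "\<lambda>x. F x + G x"] variance_add[OF F G] by (simp add: sdev_power2)
qed

end

section \<open>Product fields, shifts and functions of a set of sites\<close>

locale iid_field =
 fixes \<nu> :: "'b measure"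
 assumes prob_nu: "prob_space \<nu>" and space_nu: "space \<nu> = UNIV"
begin

definition Q :: "(int \<Rightarrow> 'b) measure" where "Q = (\<Pi>\<^sub>M x\<in>UNIV. \<nu>)"

definition shift :: "int \<Rightarrow> (int \<Rightarrow> 'b) \<Rightarrow> int \<Rightarrow> 'b" where "shift c w x = w (x + c)"

definition depends :: "int set \<Rightarrow> ((int \<Rightarrow> 'b) \<Rightarrow> 'c) \<Rightarrow> bool" where
 "depends I F \<longleftrightarrow> (\<forall>w w'. (\<forall>x\<in>I. w x = w' x) \<longrightarrow> F w = F w')"

sublocale Q: prob_space Q
 unfolding Q_def by (rule prob_space_PiM[OF prob_nu])

abbreviation mean :: "((int \<Rightarrow> 'b) \<Rightarrow> real) \<Rightarrow> real" where "mean \<equiv> Q.expectation"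

lemmas rv_integrable = Q.bdd_rv_integrable and rv_meas = Q.bdd_rv_measurable and rv_intros = Q.bdd_rv_intros

lemma space_Q: "space Q = UNIV" by (simp add: Q_def space_PiM space_nu PiE_UNIV_domain)

lemma coordinate_measurable: "(\<lambda>w. w x) \<in> Q \<rightarrow>\<^sub>M \<nu>"
 unfolding Q_def by (rule measurable_component_singleton) simp

lemma shift_measurable: "shift c \<in> Q \<rightarrow>\<^sub>M Q"
proof -
 have "(\<lambda>w. \<lambda>x\<in>UNIV. w (x + c)) \<in> Q \<rightarrow>\<^sub>M (\<Pi>\<^sub>M x\<in>UNIV. \<nu>)"
  by (rule measurable_restrict) (rule coordinate_measurable)
 then show ?thesis by (simp add: shift_def[abs_def] Q_def restrict_def)
qed

lemma distr_shift: "distr Q Q (shift c) = Q"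
proof -
 have "distr (\<Pi>\<^sub>M x\<in>UNIV. \<nu>) (\<Pi>\<^sub>M x\<in>UNIV. \<nu>) (\<lambda>w. \<lambda>x\<in>UNIV. w (x + c)) = (\<Pi>\<^sub>M x\<in>UNIV. \<nu>)"
  by (rule distr_PiM_reindex) (use prob_nu in auto)
 then show ?thesis by (simp add: shift_def[abs_def] Q_def restrict_def)
qed

lemma integral_shift: "F \<in> borel_measurable Q \<Longrightarrow> integral\<^sup>L Q (\<lambda>w. F (shift c w)) = (integral\<^sup>L Q F :: real)"
 using integral_distr[OF shift_measurable[of c], of F] by (simp add: distr_shift)

lemma distr_comp_shift: "F \<in> borel_measurable Q \<Longrightarrow> distr Q borel (\<lambda>w. F (shift c w)) = distr Q borel F"
 using distr_distr[OF _ shift_measurable[of c], of F borel] by (simp add: distr_shift comp_def)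

lemma bdd_rv_shift: "Q.bdd_rv F \<Longrightarrow> Q.bdd_rv (\<lambda>w. F (shift c w))"
 unfolding Q.bdd_rv_def using measurable_compose[OF shift_measurable, of F borel] by (auto simp: space_Q)

lemma sdev_shift: "F \<in> borel_measurable Q \<Longrightarrow> Q.sdev (\<lambda>w. F (shift c w)) = Q.sdev F"
 unfolding Q.sdev_def using integral_shift[of "\<lambda>w. (F w - mean F)\<^sup>2" c] by (simp add: integral_shift)

lemma depends_shift: "depends I F \<Longrightarrow> depends ((\<lambda>x. x + c) ` I) (\<lambda>w. F (shift c w))"
 unfolding depends_def shift_def by auto

lemma depends_mono: "depends I F \<Longrightarrow> I \<subseteq> J \<Longrightarrow> depends J F"
 unfolding depends_def by blast

lemma depends_comp2: "depends I F \<Longrightarrow> depends I G \<Longrightarrow> depends I (\<lambda>w. h (F w) (G w))"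
 unfolding depends_def by metis

lemma depends_comp: "depends I F \<Longrightarrow> depends I (\<lambda>w. h (F w))"
 unfolding depends_def by metis

lemma depends_sum: "(\<And>i. i \<in> A \<Longrightarrow> depends I (F i)) \<Longrightarrow> depends I (\<lambda>w. \<Sum>i\<in>A. F i w)"
 unfolding depends_def by (auto intro!: sum.cong)

lemma coordinates_indep: "Q.indep_vars (\<lambda>_. \<nu>) (\<lambda>x w. w x) UNIV"
proof -
 have "distr Q \<nu> (\<lambda>w. w x) = \<nu>" for x unfolding Q_def by (rule distr_PiM_component) (use prob_nu in auto)
 moreover have "(\<lambda>w. \<lambda>x\<in>UNIV. w x) = (\<lambda>w. w :: int \<Rightarrow> 'b)" by (auto simp: restrict_def)
 moreover have "distr Q (\<Pi>\<^sub>M x\<in>UNIV. \<nu>) (\<lambda>w. w) = Q" unfolding Q_def by (rule distr_id)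
 ultimately show ?thesis by (subst Q.indep_vars_iff_distr_eq_PiM) (auto simp: coordinate_measurable Q_def)
qed

text \<open>Filling the coordinates outside \<open>K j\<close> with a fixed value shows that
  \<open>F j\<close> factors measurably through the restriction to \<open>K j\<close>. Restrictions
  of a product to disjoint index sets are independent.\<close>

lemma depends_indep_vars:
 assumes meas: "\<And>j. j \<in> L \<Longrightarrow> F j \<in> Q \<rightarrow>\<^sub>M N j" and dep: "\<And>j. j \<in> L \<Longrightarrow> depends (K j) (F j)"
  and disj: "disjoint_family_on K L"
 shows "Q.indep_vars N F L"
proof -
 define emb where "emb j \<eta> = (\<lambda>x. if x \<in> K j then \<eta> x else (undefined :: 'b))" for j and \<eta> :: "int \<Rightarrow> 'b"
 have emb: "emb j \<in> (\<Pi>\<^sub>M x\<in>K j. \<nu>) \<rightarrow>\<^sub>M Q" for j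
 proof -
  have "(\<lambda>\<eta>. \<lambda>x\<in>UNIV. if x \<in> K j then \<eta> x else undefined) \<in> (\<Pi>\<^sub>M x\<in>K j. \<nu>) \<rightarrow>\<^sub>M (\<Pi>\<^sub>M x\<in>UNIV. \<nu>)"
  proof (rule measurable_restrict)
   fix x show "(\<lambda>\<eta>. if x \<in> K j then \<eta> x else undefined) \<in> (\<Pi>\<^sub>M x\<in>K j. \<nu>) \<rightarrow>\<^sub>M \<nu>"
    by (cases "x \<in> K j") (auto intro!: measurable_component_singleton measurable_const simp: space_nu)
  qed
  then show ?thesis by (simp add: emb_def[abs_def] Q_def restrict_def)
 qed
 have "Q.indep_vars (\<lambda>j. \<Pi>\<^sub>M x\<in>K j. \<nu>) (\<lambda>j w. restrict (\<lambda>x. w x) (K j)) L"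
  by (rule Q.indep_vars_restrict[OF coordinates_indep _ disj]) auto
 then have "Q.indep_vars N (\<lambda>j w. F j (emb j (restrict (\<lambda>x. w x) (K j)))) L"
  by (rule Q.indep_vars_compose2) (auto intro!: measurable_compose[OF emb meas])
 moreover have "F j (emb j (restrict (\<lambda>x. w x) (K j))) = F j w" if "j \<in> L" for j w
  using dep[OF that] unfolding depends_def by (rule allE[of _ "emb j (restrict (\<lambda>x. w x) (K j))"]) (auto simp: emb_def)
 ultimately show ?thesis by (simp cong: Q.indep_vars_cong)
qed

lemma depends_indep_var:
 assumes "F \<in> borel_measurable Q" "G \<in> borel_measurable Q" "depends I F" "depends J G" "I \<inter> J = {}"
 shows "Q.indep_var borel F borel (G :: _ \<Rightarrow> real)"
 unfolding Q.indep_var_def by (rule depends_indep_vars[where K="case_bool I J"])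
  (use assms in \<open>auto split: bool.splits simp: disjoint_family_on_def\<close>)

text \<open>Adjacent stretches are independent, so variances add up to an error of norm
  \<open>C\<close>, and \<open>sqrt_recursion_bound\<close> applies. The unit \<open>l\<close> is a
  parameter because the estimate serves the functional itself and also its deviation from a sum of
  independent blocks.\<close>

lemma sdev_additive_growth:
 assumes Z: "\<And>n. 1 \<le> n \<Longrightarrow> Q.bdd_rv (Z n)" and dep: "\<And>n. 1 \<le> n \<Longrightarrow> depends {0..<int n * l} (Z n)"
  and l: "0 < l" and Z1: "\<And>w. \<bar>Z 1 w\<bar> \<le> C"
  and add: "\<And>a b w. 1 \<le> a \<Longrightarrow> 1 \<le> b \<Longrightarrow> \<bar>Z (a + b) w - Z a w - Z b (shift (int a * l) w)\<bar> \<le> C"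
  and n: "1 \<le> n"
 shows "Q.sdev (Z n) \<le> 32 * C * sqrt n"
proof (rule sqrt_recursion_bound[OF _ _ _ n])
 have C: "0 \<le> C" using Z1[of undefined] by simp
 show "Q.sdev (Z 1) \<le> C" by (rule Q.sdev_le_bound[OF Z]) (use Z1 C in auto)
 fix a b :: nat assume ab: "1 \<le> a" "1 \<le> b"
 define U where "U w = Z a w + Z b (shift (int a * l) w)" for w
 have bs: "Q.bdd_rv (\<lambda>w. Z b (shift (int a * l) w))" by (rule bdd_rv_shift[OF Z[OF ab(2)]])
 have bU: "Q.bdd_rv U" unfolding U_def by (intro Q.bdd_rv_add Z ab bs)
 have bW: "Q.bdd_rv (\<lambda>w. Z (a + b) w - U w)" using ab by (intro Q.bdd_rv_diff Z bU) auto
 have "depends {int a * l..<int (a + b) * l} (\<lambda>w. Z b (shift (int a * l) w))"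
  by (rule depends_mono[OF depends_shift[OF dep[OF ab(2)]]]) (auto simp: algebra_simps)
 then have "Q.indep_var borel (Z a) borel (\<lambda>w. Z b (shift (int a * l) w))"
  using dep[OF ab(1)] by (intro depends_indep_var rv_meas Z ab bs) auto
 then have "Q.sdev U = sqrt ((Q.sdev (Z a))\<^sup>2 + (Q.sdev (Z b))\<^sup>2)"
  unfolding U_def using Q.sdev_indep[OF Z[OF ab(1)] bs] rv_meas[OF Z[OF ab(2)]] by (simp add: sdev_shift)
 moreover have "Q.sdev (Z (a + b)) \<le> Q.sdev U + Q.sdev (\<lambda>w. Z (a + b) w - U w)"
  using Q.sdev_triangle[OF bU bW] by simp
 moreover have "Q.sdev (\<lambda>w. Z (a + b) w - U w) \<le> C"
 proof (rule Q.sdev_le_bound[OF bW _ C])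
  fix w show "\<bar>Z (a + b) w - U w\<bar> \<le> C" using add[OF ab, of w] by (simp add: U_def algebra_simps)
 qed
 ultimately show "Q.sdev (Z (a + b)) \<le> sqrt ((Q.sdev (Z a))\<^sup>2 + (Q.sdev (Z b))\<^sup>2) + C" by simp
qed (rule Q.sdev_nonneg)

end

text \<open>Two applications of the inequality \<open>sq\<close>; (9 / 8) ^ 3 = 729 / 512 < 3 / 2.
  What matters is a coefficient of p ^ 4 below 2: in a recursion over halves of n it must beat the
  factor 2 between twice (n / 2)^2 and n^2.\<close>

lemma power4_add_le: "(p + q) ^ 4 \<le> 3 / 2 * p ^ 4 + 729 * q ^ 4" for p q :: real
proof -
 have sq: "(a + b)\<^sup>2 \<le> 9 / 8 * a\<^sup>2 + 9 * b\<^sup>2" for a b :: real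
 proof -
  have "0 \<le> (a - 8 * b)\<^sup>2" by simp
  then show ?thesis by (simp add: power2_eq_square algebra_simps)
 qed
 have "(p + q) ^ 4 = ((p + q)\<^sup>2)\<^sup>2" by simp
 also have "... \<le> (9 / 8 * p\<^sup>2 + 9 * q\<^sup>2)\<^sup>2" by (intro power_mono sq) simp
 also have "... \<le> 9 / 8 * (9 / 8 * p\<^sup>2)\<^sup>2 + 9 * (9 * q\<^sup>2)\<^sup>2" by (rule sq)
 also have "... = 729 / 512 * p ^ 4 + 729 * q ^ 4" by (simp add: power_mult_distrib power_divide)
 also have "... \<le> 3 / 2 * p ^ 4 + 729 * q ^ 4" by simp
 finally show ?thesis .
qed

context prob_space begin

lemma expectation_power4_indep_add:
 assumes F: "bdd_rv F" and G: "bdd_rv G" and ind: "indep_var borel F borel G"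
  and F0: "expectation F = 0" and G0: "expectation G = 0"
 shows "expectation (\<lambda>x. (F x + G x) ^ 4) =
   expectation (\<lambda>x. F x ^ 4) + 6 * (expectation (\<lambda>x. (F x)\<^sup>2) * expectation (\<lambda>x. (G x)\<^sup>2)) + expectation (\<lambda>x. G x ^ 4)"
proof -
 have m: "expectation (\<lambda>x. F x ^ i * G x ^ j) = expectation (\<lambda>x. F x ^ i) * expectation (\<lambda>x. G x ^ j)" for i j
 proof (rule indep_var_lebesgue_integral)
  show "indep_var borel (\<lambda>x. F x ^ i) borel (\<lambda>x. G x ^ j)"
   using indep_var_compose[OF ind, of "\<lambda>u. u ^ i" borel "\<lambda>u. u ^ j" borel] by (simp add: comp_def)
 qed (intro bdd_rv_integrable bdd_rv_power F G)+
 have int: "integrable M (\<lambda>x. F x ^ i * G x ^ j)" for i j by (intro bdd_rv_integrable bdd_rv_mult bdd_rv_power F G)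
 have "(F x + G x) ^ 4 = F x ^ 4 * G x ^ 0 + 4 * (F x ^ 3 * G x ^ 1) + 6 * (F x ^ 2 * G x ^ 2) + 4 * (F x ^ 1 * G x ^ 3) + F x ^ 0 * G x ^ 4" for x
  by (simp add: power4_eq_xxxx power2_eq_square power3_eq_cube algebra_simps)
 then have "expectation (\<lambda>x. (F x + G x) ^ 4) = expectation (\<lambda>x. F x ^ 4 * G x ^ 0) + 4 * expectation (\<lambda>x. F x ^ 3 * G x ^ 1)
   + 6 * expectation (\<lambda>x. F x ^ 2 * G x ^ 2) + 4 * expectation (\<lambda>x. F x ^ 1 * G x ^ 3) + expectation (\<lambda>x. F x ^ 0 * G x ^ 4)"
  using int by (simp del: power_0 power_one_right One_nat_def)
 then show ?thesis unfolding m using F0 G0 by (simp add: prob_space)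
qed

lemma abs_expectation_le:
 assumes F: "bdd_rv F" and B: "\<And>x. x \<in> space M \<Longrightarrow> \<bar>F x\<bar> \<le> B"
 shows "\<bar>expectation F\<bar> \<le> B"
proof -
 have "\<bar>expectation F\<bar> \<le> expectation (\<lambda>x. \<bar>F x\<bar>)" by (rule integral_abs_bound)
 also have "... \<le> B" using B by (intro integral_le_const bdd_rv_integrable bdd_rv_abs F) auto
 finally show ?thesis .
qed

lemma fourth_moment_tail:
 assumes F: "bdd_rv F" and a: "0 < a"
 shows "prob {x \<in> space M. a \<le> \<bar>F x\<bar>} \<le> expectation (\<lambda>x. F x ^ 4) / a ^ 4"
proof -
 have [measurable]: "F \<in> borel_measurable M" using F by (rule bdd_rv_measurable)
 have "prob {x \<in> space M. a \<le> \<bar>F x\<bar>} \<le> prob {x \<in> space M. a ^ 4 \<le> F x ^ 4}"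
 proof (rule finite_measure_mono)
  show "{x \<in> space M. a \<le> \<bar>F x\<bar>} \<subseteq> {x \<in> space M. a ^ 4 \<le> F x ^ 4}"
   using a power_mono[of a "\<bar>F x\<bar>" 4 for x] by auto
  show "{x \<in> space M. a ^ 4 \<le> F x ^ 4} \<in> events" by measurable
 qed
 also have "... \<le> expectation (\<lambda>x. F x ^ 4) / a ^ 4"
  by (rule integral_Markov_inequality_measure[of _ _ "{}"]) (use a bdd_rv_integrable[OF bdd_rv_power[OF F]] in auto)
 finally show ?thesis .
qed

end

section \<open>Moments and linear growth of quasi-additive functionals\<close>

locale quasi_additive = iid_field \<nu> for \<nu> :: "'b measure" +
 fixes Y :: "int \<Rightarrow> int \<Rightarrow> (int \<Rightarrow> 'b) \<Rightarrow> real" and C :: real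
 assumes Y_meas: "a < b \<Longrightarrow> Y a b \<in> borel_measurable Q"
  and Y_dep: "a < b \<Longrightarrow> depends {a..<b} (Y a b)"
  and Y_shift: "a < b \<Longrightarrow> Y (a + c) (b + c) w = Y a b (shift c w)"
  and Y_quasi: "a < b \<Longrightarrow> b < c \<Longrightarrow> \<bar>Y a c w - Y a b w - Y b c w\<bar> \<le> C"
  and Y_lin: "a < b \<Longrightarrow> \<bar>Y a b w\<bar> \<le> C * of_int (b - a)"
begin

lemma C_nonneg: "0 \<le> C"
 using Y_lin[of 0 1 undefined] by simp

lemma Y_bdd: "a < b \<Longrightarrow> Q.bdd_rv (Y a b)"
 by (rule Q.bdd_rvI[OF Y_meas Y_lin])

lemma Y_distr: assumes "a < b" shows "distr Q borel (Y (a + c) (b + c)) = distr Q borel (Y a b)"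
proof -
 have "Y (a + c) (b + c) = (\<lambda>w. Y a b (shift c w))" using Y_shift[OF assms] by auto
 then show ?thesis using distr_comp_shift[OF Y_meas[OF assms]] by simp
qed

definition y :: "nat \<Rightarrow> (int \<Rightarrow> 'b) \<Rightarrow> real" where "y n = Y 0 (int n)"

lemma y_bdd: "1 \<le> n \<Longrightarrow> Q.bdd_rv (y n)" unfolding y_def by (rule Y_bdd) simp

lemma Y_eq_y_shift: "1 \<le> n \<Longrightarrow> Y a (a + int n) w = y n (shift a w)"
 using Y_shift[of 0 "int n" a w] by (simp add: y_def add.commute)

lemma y_quasi: "1 \<le> a \<Longrightarrow> 1 \<le> b \<Longrightarrow> \<bar>y (a + b) w - y a w - y b (shift (int a) w)\<bar> \<le> C"
 using Y_quasi[of 0 "int a" "int a + int b" w] Y_eq_y_shift[of b "int a" w] by (simp add: y_def)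

lemma y_dep: "1 \<le> n \<Longrightarrow> depends {0..<int n} (y n)"
 unfolding y_def by (rule Y_dep) simp

lemma y_shift_dep: "1 \<le> n \<Longrightarrow> depends {a..<a + int n} (\<lambda>w. y n (shift a w))"
 by (rule depends_mono[OF depends_shift[OF y_dep]]) auto

lemma sdev_y: assumes "1 \<le> n" shows "Q.sdev (y n) \<le> 32 * C * sqrt n"
 by (rule sdev_additive_growth[where Z=y and l=1])
  (use assms y_bdd y_dep y_quasi Y_lin[of 0 1] in \<open>auto simp: y_def\<close>)

lemma variance_y: assumes "1 \<le> n" shows "Q.variance (y n) \<le> (32 * C)\<^sup>2 * n"
proof -
 have "(Q.sdev (y n))\<^sup>2 \<le> (32 * C * sqrt n)\<^sup>2" by (rule power_mono[OF sdev_y[OF assms] Q.sdev_nonneg])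
 then show ?thesis by (simp add: Q.sdev_power2 power_mult_distrib)
qed

text \<open>Chosen to solve the halving recursion: the factor 3 / 2 of \<open>power4_add_le\<close>
  times 5 / 8, the bound for a^2 + b^2 relative to n^2, uses 15 / 16 of \<open>M4\<close>. The
  remaining sixteenth covers the cross term and the error term.\<close>

definition M4 :: real where "M4 = 16 * (9 / 4 * ((32 * C)\<^sup>2)\<^sup>2 + 11664 * C ^ 4)"

lemma fourth_moment_y:
 assumes "1 \<le> n" shows "mean (\<lambda>w. (y n w - mean (y n)) ^ 4) \<le> M4 * (real n)\<^sup>2"
 using assms
proof (induction n rule: less_induct)
 case (less n)
 have C4: "0 \<le> C ^ 4" by simp
 show ?case
 proof (cases "n = 1")
  case True
  have "\<bar>y 1 w\<bar> \<le> C" for w using Y_lin[of 0 1 w] by (simp add: y_def)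
  then have b: "\<bar>mean (y 1)\<bar> \<le> C" "\<And>w. \<bar>y 1 w\<bar> \<le> C"
   using Q.abs_expectation_le[OF y_bdd[of 1]] by auto
  have "(y 1 w - mean (y 1)) ^ 4 \<le> (2 * C) ^ 4" for w
  proof -
   have "\<bar>y 1 w - mean (y 1)\<bar> \<le> 2 * C" using b(1) b(2)[of w] by linarith
   then have "\<bar>y 1 w - mean (y 1)\<bar> ^ 4 \<le> (2 * C) ^ 4" by (rule power_mono) simp
   then show ?thesis by simp
  qed
  then have "mean (\<lambda>w. (y 1 w - mean (y 1)) ^ 4) \<le> (2 * C) ^ 4"
   by (intro Q.integral_le_const rv_integrable rv_intros y_bdd) auto
  also have "... \<le> M4" using C4 by (simp add: M4_def power_mult_distrib)
  finally show ?thesis using True by simp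
 next
  case False
  define a b where "a = n div 2" and "b = n - n div 2"
  have ab: "1 \<le> a" "1 \<le> b" "a < n" "b < n" "n = a + b" "b = a \<or> b = a + 1"
   using less.prems False by (auto simp: a_def b_def)
  define F where "F w = y a w - mean (y a)" for w
  define G where "G w = y b (shift (int a) w) - mean (y b)" for w
  define W where "W w = (y n w - mean (y n)) - (F w + G w)" for w
  note ya = y_bdd[OF ab(1)] and yb = y_bdd[OF ab(2)] and yn = y_bdd[OF less.prems]
  note ybs = bdd_rv_shift[OF yb, of "int a"]
  have bF: "Q.bdd_rv F" and bG: "Q.bdd_rv G" and bW: "Q.bdd_rv W"
   unfolding W_def F_def G_def by (intro rv_intros ya yb yn ybs)+
  have EF: "mean F = 0" unfolding F_def using rv_integrable[OF ya] by (simp add: Q.prob_space)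
  have EG: "mean G = 0" unfolding G_def using rv_integrable[OF ybs] rv_meas[OF yb] by (simp add: Q.prob_space integral_shift)
  have dF: "depends {0..<int a} F"
   using depends_comp[OF y_dep[OF ab(1)], of "\<lambda>u. u - mean (y a)"] by (simp add: F_def[abs_def])
  have dG: "depends {int a..<int a + int b} G"
   using depends_comp[OF y_shift_dep[OF ab(2), of "int a"], of "\<lambda>u. u - mean (y b)"] by (simp add: G_def[abs_def])
  have ind: "Q.indep_var borel F borel G" by (rule depends_indep_var[OF rv_meas[OF bF] rv_meas[OF bG] dF dG]) auto
  have VF: "mean (\<lambda>w. (F w)\<^sup>2) \<le> (32 * C)\<^sup>2 * a" using variance_y[OF ab(1)] by (simp add: F_def)
  have VG: "mean (\<lambda>w. (G w)\<^sup>2) \<le> (32 * C)\<^sup>2 * b"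
   using variance_y[OF ab(2)] integral_shift[of "\<lambda>w. (y b w - mean (y b))\<^sup>2" "int a"] rv_meas[OF yb]
   by (simp add: G_def)
  have MF: "mean (\<lambda>w. F w ^ 4) \<le> M4 * (real a)\<^sup>2" using less.IH[of a] ab by (simp add: F_def)
  have MG: "mean (\<lambda>w. G w ^ 4) \<le> M4 * (real b)\<^sup>2"
   using less.IH[of b] ab integral_shift[of "\<lambda>w. (y b w - mean (y b)) ^ 4" "int a"] rv_meas[OF yb]
   by (simp add: G_def)
  have Wb: "\<bar>W w\<bar> \<le> 2 * C" for w
  proof -
   have 1: "\<bar>y n w - y a w - y b (shift (int a) w)\<bar> \<le> C" for w using y_quasi[OF ab(1,2)] ab(5) by simp
   have "mean (y n) - mean (y a) - mean (y b) = mean (\<lambda>w. y n w - y a w - y b (shift (int a) w))"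
    using rv_integrable[OF ya] rv_integrable[OF yn] rv_integrable[OF ybs] rv_meas[OF yb] by (simp add: integral_shift)
   also have "\<bar>...\<bar> \<le> C"

    by (rule Q.abs_expectation_le) (intro rv_intros yn ya ybs, rule 1)
   finally show ?thesis using 1[of w] by (simp add: W_def F_def G_def abs_le_iff)
  qed
  have W4: "W w ^ 4 \<le> 16 * C ^ 4" for w using power_mono[OF Wb[of w], of 4] by (simp add: power_mult_distrib)
  have "mean (\<lambda>w. (y n w - mean (y n)) ^ 4) = mean (\<lambda>w. ((F w + G w) + W w) ^ 4)" by (simp add: W_def)
  also have "... \<le> mean (\<lambda>w. 3 / 2 * (F w + G w) ^ 4 + 729 * (16 * C ^ 4))"
  proof (rule integral_mono)
   fix w show "((F w + G w) + W w) ^ 4 \<le> 3 / 2 * (F w + G w) ^ 4 + 729 * (16 * C ^ 4)"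
    using power4_add_le[of "F w + G w" "W w"] W4[of w] by linarith
  qed (intro rv_integrable rv_intros bF bG bW)+
  also have "... = 3 / 2 * mean (\<lambda>w. (F w + G w) ^ 4) + 729 * (16 * C ^ 4)"
  proof -
   have "integrable Q (\<lambda>w. (F w + G w) ^ 4)" by (intro rv_integrable rv_intros bF bG)
   then show ?thesis by (simp add: Q.prob_space)
  qed
  also have "mean (\<lambda>w. (F w + G w) ^ 4) \<le> M4 * (real a)\<^sup>2 + 6 * (((32 * C)\<^sup>2 * a) * ((32 * C)\<^sup>2 * b)) + M4 * (real b)\<^sup>2"
   unfolding Q.expectation_power4_indep_add[OF bF bG ind EF EG]
   by (intro add_mono mult_left_mono mult_mono MF MG VF VG) (auto intro!: Bochner_Integration.integral_nonneg)
  also have "3 / 2 * (M4 * (real a)\<^sup>2 + 6 * (((32 * C)\<^sup>2 * a) * ((32 * C)\<^sup>2 * b)) + M4 * (real b)\<^sup>2) + 729 * (16 * C ^ 4)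
    \<le> M4 * (real n)\<^sup>2"
  proof -
   define V where "V = ((32 * C)\<^sup>2)\<^sup>2"
   have V0: "0 \<le> V" by (simp add: V_def)
   have n2: "2 \<le> n" using less.prems False by simp
   have r: "real n = real a + real b" using ab(5) by simp
   have n4: "4 \<le> (real n)\<^sup>2" using power_mono[of 2 "real n" 2] n2 by simp
   have s: "(real a)\<^sup>2 + (real b)\<^sup>2 \<le> 5 / 8 * (real n)\<^sup>2"
   proof -
    have "(real a - real b)\<^sup>2 \<le> 1" using ab(6) by auto
    then have "(real a)\<^sup>2 + (real b)\<^sup>2 \<le> ((real n)\<^sup>2 + 1) / 2" unfolding r by (simp add: power2_eq_square algebra_simps)
    then show ?thesis using n4 by simp
   qed
   have p: "4 * (real a * real b) \<le> (real n)\<^sup>2"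
    using zero_le_power2[of "real a - real b"] unfolding r by (simp add: power2_eq_square algebra_simps)
   have M0: "0 \<le> M4" unfolding M4_def using C4 by simp
   have "3 / 2 * (M4 * (real a)\<^sup>2 + 6 * (((32 * C)\<^sup>2 * a) * ((32 * C)\<^sup>2 * b)) + M4 * (real b)\<^sup>2) + 729 * (16 * C ^ 4)
     = 3 / 2 * M4 * ((real a)\<^sup>2 + (real b)\<^sup>2) + 9 / 4 * V * (4 * (real a * real b)) + 11664 * C ^ 4"
    by (simp add: V_def power2_eq_square algebra_simps)
   also have "... \<le> 3 / 2 * M4 * (5 / 8 * (real n)\<^sup>2) + 9 / 4 * V * (real n)\<^sup>2 + 11664 * C ^ 4 * (real n)\<^sup>2"
    using s p M0 V0 C4 n4 by (intro add_mono mult_left_mono) (auto simp: mult_le_cancel_left1)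
   also have "... = M4 * (real n)\<^sup>2" unfolding M4_def V_def by (simp add: algebra_simps)
   finally show ?thesis .
  qed
  finally show ?thesis by simp
 qed
qed

text \<open>Joining two stretches loses at most \<open>C\<close>, so a block mean beyond
  \<open>C\<close> forces linear growth of the means. Fourth moments of order n^2 make deviations of
  order n summable. Borel-Cantelli then applies on both half-lines, because by stationarity the left
  one has the same laws.\<close>

lemma linear_growth:
 assumes L: "1 \<le> L" and s: "s = 1 \<or> s = (-1 :: real)" and gt: "C < s * mean (y L)"
 shows "\<exists>c>0. AE w in Q. \<forall>\<^sub>F k in sequentially. c * real k \<le> s * Y 0 (int (k * L)) w \<and> c * real k \<le> s * Y (- int (k * L)) 0 w"
proof -
 define c where "c = s * mean (y L) - C"
 have c: "0 < c" using gt by (simp add: c_def)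
 have mean: "real k * c + C \<le> s * mean (y (k * L))" if "1 \<le> k" for k using that
 proof (induction k rule: nat_induct_at_least)
  case base then show ?case by (simp add: c_def)
 next
  case (Suc k)
  have kL: "1 \<le> k * L" "1 \<le> Suc k * L" using Suc.hyps L by (auto simp: Suc_le_eq)
  note i1 = rv_integrable[OF y_bdd[OF kL(1)]] and i2 = rv_integrable[OF y_bdd[OF kL(2)]]
   and i3 = rv_integrable[OF bdd_rv_shift[OF y_bdd[OF L], of "int (k * L)"]]
  have "s * y (k * L) w + s * y L (shift (int (k * L)) w) - C \<le> s * y (Suc k * L) w" for w
   using y_quasi[OF kL(1) L, of w] s by (auto simp: algebra_simps abs_le_iff)
  then have "mean (\<lambda>w. s * y (k * L) w + s * y L (shift (int (k * L)) w) - C) \<le> mean (\<lambda>w. s * y (Suc k * L) w)"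
   using i1 i2 i3 by (intro integral_mono) auto
  then have "s * mean (y (k * L)) + s * mean (y L) - C \<le> s * mean (y (Suc k * L))"
   using i1 i2 i3 rv_meas[OF y_bdd[OF L]] by (simp add: Q.prob_space integral_shift del: mult_Suc)
  then show ?case using Suc.IH by (simp add: c_def algebra_simps)
 qed
 define B where "B X k = {w \<in> space Q. s * X k w < c / 2 * real (k :: nat)}" for X :: "nat \<Rightarrow> (int \<Rightarrow> 'b) \<Rightarrow> real" and k
 have tail: "Q.prob (B (\<lambda>k. y (k * L)) k) \<le> 16 * M4 * (real L)\<^sup>2 / c ^ 4 * (1 / (real k)\<^sup>2)" if k: "1 \<le> k" for k
 proof -
  have kL: "1 \<le> k * L" using k L by (auto simp: Suc_le_eq)
  define F where "F w = y (k * L) w - mean (y (k * L))" for w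
  have bF: "Q.bdd_rv F" unfolding F_def by (intro rv_intros y_bdd kL)
  note [measurable] = rv_meas[OF bF]
  have "Q.prob (B (\<lambda>k. y (k * L)) k) \<le> Q.prob {w \<in> space Q. c / 2 * real k \<le> \<bar>F w\<bar>}"
  proof (rule Q.finite_measure_mono)
   show "B (\<lambda>k. y (k * L)) k \<subseteq> {w \<in> space Q. c / 2 * real k \<le> \<bar>F w\<bar>}"
   proof
    fix w assume "w \<in> B (\<lambda>k. y (k * L)) k"
    then have "s * y (k * L) w < c / 2 * real k" "w \<in> space Q" by (auto simp: B_def)
    then show "w \<in> {w \<in> space Q. c / 2 * real k \<le> \<bar>F w\<bar>}"
     using mean[OF k] s C_nonneg by (auto simp: F_def abs_if algebra_simps)
   qed
   show "{w \<in> space Q. c / 2 * real k \<le> \<bar>F w\<bar>} \<in> Q.events" by measurable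
  qed
  also have "... \<le> mean (\<lambda>w. F w ^ 4) / (c / 2 * real k) ^ 4"
   by (rule Q.fourth_moment_tail[OF bF]) (use c k in simp)
  also have "... \<le> M4 * (real (k * L))\<^sup>2 / (c / 2 * real k) ^ 4"
   using fourth_moment_y[OF kL] c k by (intro divide_right_mono) (auto simp: F_def)
  also have "... = 16 * M4 * (real L)\<^sup>2 / c ^ 4 * (1 / (real k)\<^sup>2)"
   using c k by (simp add: power_mult_distrib power_divide field_simps power4_eq_xxxx power2_eq_square)
  finally show ?thesis .
 qed
 have ae: "AE w in Q. \<forall>\<^sub>F k in sequentially. w \<in> space Q - B X k"
  if X: "\<And>k. 1 \<le> k \<Longrightarrow> distr Q borel (X k) = distr Q borel (y (k * L))" "\<And>k. X k \<in> borel_measurable Q" "\<And>w. X 0 w = 0" for X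
 proof (rule borel_cantelli_AE1)
  have m [measurable]: "X k \<in> borel_measurable Q" for k by (rule X(2))
  show ev: "B X k \<in> sets Q" for k unfolding B_def by measurable
  show "emeasure Q (B X k) < \<infinity>" for k by (simp add: Q.emeasure_eq_measure)
  have eq: "Q.prob (B X k) = Q.prob (B (\<lambda>k. y (k * L)) k)" if "1 \<le> k" for k
  proof -
   have kL: "1 \<le> k * L" using that L by (auto simp: Suc_le_eq)
   note [measurable] = rv_meas[OF y_bdd[OF kL]]
   have S: "{u. s * u < c / 2 * real k} \<in> sets (borel :: real measure)" by measurable
   have "Q.prob (B X k) = measure (distr Q borel (X k)) {u. s * u < c / 2 * real k}"
    by (subst measure_distr[OF m S]) (auto simp: B_def vimage_def space_Q)
   also have "... = measure (distr Q borel (y (k * L))) {u. s * u < c / 2 * real k}" by (simp only: X(1)[OF that])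
   also have "... = Q.prob (B (\<lambda>k. y (k * L)) k)"
    by (subst measure_distr[OF _ S]) (auto simp: B_def vimage_def space_Q)
   finally show ?thesis .
  qed
  have "summable (\<lambda>k. 16 * M4 * (real L)\<^sup>2 / c ^ 4 * (1 / (real k)\<^sup>2))"
   by (intro summable_mult) (use inverse_power_summable[of 2, where 'a=real] in \<open>simp add: divide_inverse power_inverse\<close>)
  moreover have "\<forall>\<^sub>F k in sequentially. norm (Q.prob (B X k)) \<le> 16 * M4 * (real L)\<^sup>2 / c ^ 4 * (1 / (real k)\<^sup>2)"
   using eventually_ge_at_top[of 1] by eventually_elim (use eq tail in simp)
  ultimately show "summable (\<lambda>k. Q.prob (B X k))" by (rule summable_comparison_test_ev[rotated])
 qed
 define X1 where "X1 k = (if k = 0 then (\<lambda>_. 0) else y (k * L))" for k :: nat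
 define X2 where "X2 k = (if k = 0 then (\<lambda>_. 0) else Y (- int (k * L)) 0)" for k :: nat
 have "AE w in Q. \<forall>\<^sub>F k in sequentially. w \<in> space Q - B X1 k"
  by (rule ae) (use L in \<open>auto simp: X1_def Suc_le_eq intro!: rv_meas[OF y_bdd]\<close>)
 moreover have "AE w in Q. \<forall>\<^sub>F k in sequentially. w \<in> space Q - B X2 k"
 proof (rule ae)
  fix k :: nat assume "1 \<le> k"
  then show "distr Q borel (X2 k) = distr Q borel (y (k * L))"
   using Y_distr[of "- int (k * L)" 0 "int (k * L)"] L by (simp add: X2_def y_def)
 qed (use L in \<open>auto simp: X2_def intro!: Y_meas\<close>)
 ultimately have "AE w in Q. \<forall>\<^sub>F k in sequentially. c / 2 * real k \<le> s * Y 0 (int (k * L)) w \<and> c / 2 * real k \<le> s * Y (- int (k * L)) 0 w"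
 proof eventually_elim
  case (elim w)
  show ?case using eventually_conj[OF elim(1) eventually_conj[OF elim(2) eventually_ge_at_top[of 1]]]
   by eventually_elim (auto simp: B_def X1_def X2_def y_def)
 qed
 then show ?thesis using c by (intro exI[of _ "c / 2"]) simp
qed

end

section \<open>Characteristic functions of nearby variables, and sums over shifts\<close>

lemma iexp_diff_le: "cmod (iexp x - iexp y) \<le> \<bar>x - y\<bar>"
proof -
 have "iexp x - iexp y = iexp y * (iexp (x - y) - 1)" by (simp add: right_diff_distrib exp_diff ring_distribs)
 then have "cmod (iexp x - iexp y) = cmod (iexp (x - y) - 1)" by (simp add: norm_mult)
 also have "... \<le> \<bar>x - y\<bar>" using iexp_approx1[of "x - y" 0] by simp
 finally show ?thesis .
qed

context prob_space begin

lemma char_diff_le: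
 assumes X: "X \<in> borel_measurable M" and Y: "Y \<in> borel_measurable M" and h: "integrable M h"
  and le: "\<And>w. w \<in> space M \<Longrightarrow> cmod (iexp (u * X w) - iexp (u * Y w)) \<le> h w"
 shows "cmod (char (distr M borel X) u - char (distr M borel Y) u) \<le> expectation h"
proof -
 note [measurable] = X Y
 have i: "integrable M (\<lambda>w. iexp (u * X w))" "integrable M (\<lambda>w. iexp (u * Y w))"
  by (rule integrable_const_bound[where B=1]; simp)+
 have "char (distr M borel X) u - char (distr M borel Y) u = (CLINT w|M. iexp (u * X w) - iexp (u * Y w))"
  using i by (simp add: char_def integral_distr)
 also have "cmod ... \<le> expectation (\<lambda>w. cmod (iexp (u * X w) - iexp (u * Y w)))" by (rule integral_norm_bound)
 also have "... \<le> expectation h" by (rule integral_mono[OF _ h le]) (use i in simp)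
 finally show ?thesis .
qed

lemma cmod_iexp_diff_le: "cmod (iexp (u * x) - iexp (u * y)) \<le> \<bar>u\<bar> * \<bar>x - y\<bar>"
 using iexp_diff_le[of "u * x" "u * y"] by (simp add: abs_mult flip: right_diff_distrib)

lemma char_distr_diff_le:
 assumes X: "bdd_rv X" and X': "bdd_rv X'"
 shows "cmod (char (distr M borel X) u - char (distr M borel X') u) \<le> \<bar>u\<bar> * expectation (\<lambda>x. \<bar>X x - X' x\<bar>)"
proof -
 have "integrable M (\<lambda>x. \<bar>X x - X' x\<bar>)" by (intro bdd_rv_integrable bdd_rv_intros X X')
 then show ?thesis using char_diff_le[OF bdd_rv_measurable[OF X] bdd_rv_measurable[OF X'] _ cmod_iexp_diff_le, of u] by simp
qed

lemma expectation_abs_le_sdev: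
 assumes F: "bdd_rv F"
 shows "expectation (\<lambda>x. \<bar>F x - expectation F\<bar>) \<le> sdev F"
proof -
 have "(expectation (\<lambda>x. \<bar>F x - expectation F\<bar> * 1))\<^sup>2 \<le> expectation (\<lambda>x. \<bar>F x - expectation F\<bar>\<^sup>2) * expectation (\<lambda>x. 1\<^sup>2)"
  by (rule expectation_Cauchy_Schwarz) (intro bdd_rv_intros F)+
 then show ?thesis by (simp add: sdev_def real_le_rsqrt prob_space)
qed

end

lemma (in iid_field) shift_shift: "shift a (shift b w) = shift (a + b) w"
 by (simp add: shift_def fun_eq_iff add.assoc)

lemma (in iid_field) shift_0: "shift 0 w = w" by (simp add: shift_def fun_eq_iff)

lemma (in iid_field) sdev_iid_sum:
 assumes Z: "Q.bdd_rv Z" and dep: "depends {0..<l} Z" and l: "0 < l"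
 shows "Q.sdev (\<lambda>w. \<Sum>i<r. Z (shift (int i * l) w)) = sqrt r * Q.sdev Z"
proof (induction r)
 case 0
 show ?case by (simp add: Q.sdev_def)
next
 case (Suc r)
 define S where "S w = (\<Sum>i<r. Z (shift (int i * l) w))" for w
 have bS: "Q.bdd_rv S" unfolding S_def by (intro Q.bdd_rv_sum bdd_rv_shift Z)
 have bZ: "Q.bdd_rv (\<lambda>w. Z (shift (int r * l) w))" by (rule bdd_rv_shift[OF Z])
 have "depends {0..<int r * l} S" unfolding S_def
 proof (rule depends_sum)
  fix i assume "i \<in> {..<r}"
  then have "(int i + 1) * l \<le> int r * l" using l by (intro mult_right_mono) auto
  then show "depends {0..<int r * l} (\<lambda>w. Z (shift (int i * l) w))"
   using l by (intro depends_mono[OF depends_shift[OF dep]]) (auto simp: algebra_simps)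
 qed
 moreover have "depends {int r * l..<int r * l + l} (\<lambda>w. Z (shift (int r * l) w))"
  by (rule depends_mono[OF depends_shift[OF dep]]) auto
 ultimately have "Q.indep_var borel S borel (\<lambda>w. Z (shift (int r * l) w))"
  by (intro depends_indep_var rv_meas bS bZ) auto
 then have "Q.sdev (\<lambda>w. S w + Z (shift (int r * l) w)) = sqrt ((Q.sdev S)\<^sup>2 + (Q.sdev Z)\<^sup>2)"
  using Q.sdev_indep[OF bS bZ] rv_meas[OF Z] by (simp add: sdev_shift)
 also have "(Q.sdev S)\<^sup>2 = r * (Q.sdev Z)\<^sup>2" using Suc by (simp add: S_def[abs_def] power_mult_distrib)
 also have "sqrt (r * (Q.sdev Z)\<^sup>2 + (Q.sdev Z)\<^sup>2) = sqrt (real (Suc r) * (Q.sdev Z)\<^sup>2)" by (simp add: algebra_simps)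
 also have "... = sqrt (Suc r) * Q.sdev Z" using Q.sdev_nonneg[of Z] by (simp add: real_sqrt_mult)
 finally show ?case by (simp add: S_def)
qed

section \<open>Comparison with independent blocks and the asymptotic variance\<close>

context quasi_additive begin

definition blocks :: "nat \<Rightarrow> nat \<Rightarrow> (int \<Rightarrow> 'b) \<Rightarrow> real" where
 "blocks l r w = (\<Sum>i<r. y l (shift (int i * int l) w))"

lemma blocks_bdd: "1 \<le> l \<Longrightarrow> Q.bdd_rv (blocks l r)"
 unfolding blocks_def by (intro Q.bdd_rv_sum bdd_rv_shift y_bdd)

lemma sdev_blocks: assumes "1 \<le> l" shows "Q.sdev (blocks l r) = sqrt r * Q.sdev (y l)"
 unfolding blocks_def[abs_def] using sdev_iid_sum[OF y_bdd[OF assms] y_dep[OF assms], of r] assms by simp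

text \<open>As a function of \<open>r\<close> the error is itself quasi-additive with constant
  \<open>C\<close>. Its deviation therefore grows like sqrt r, although r errors of size
  \<open>C\<close> are made.\<close>

lemma sdev_block_error:
 assumes l: "1 \<le> l" and r: "1 \<le> r"
 shows "Q.sdev (\<lambda>w. y (r * l) w - blocks l r w) \<le> 32 * C * sqrt r"
proof (rule sdev_additive_growth[where Z="\<lambda>r w. y (r * l) w - blocks l r w" and l="int l"])
 have nl: "1 \<le> n * l" if "1 \<le> n" for n using that l by (auto simp: Suc_le_eq)
 fix n :: nat assume n: "1 \<le> n"
 show "Q.bdd_rv (\<lambda>w. y (n * l) w - blocks l n w)" by (intro Q.bdd_rv_diff y_bdd nl n blocks_bdd l)
 have "depends {0..<int n * int l} (blocks l n)" unfolding blocks_def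
 proof (rule depends_sum)
  fix i assume "i \<in> {..<n}"
  then have "(int i + 1) * int l \<le> int n * int l" by (intro mult_right_mono) auto
  then show "depends {0..<int n * int l} (\<lambda>w. y l (shift (int i * int l) w))"
   by (intro depends_mono[OF y_shift_dep[OF l]]) (auto simp: algebra_simps)
 qed
 moreover have "depends {0..<int n * int l} (y (n * l))" using y_dep[OF nl[OF n]] by simp
 ultimately show "depends {0..<int n * int l} (\<lambda>w. y (n * l) w - blocks l n w)"
  using depends_comp2[of "{0..<int n * int l}" "y (n * l)" "blocks l n" "(-)"] by simp
next
 show "\<bar>y (1 * l) w - blocks l 1 w\<bar> \<le> C" for w using C_nonneg by (simp add: blocks_def shift_0)
next
 fix a b :: nat and w assume ab: "1 \<le> a" "1 \<le> b"
 have al: "1 \<le> a * l" "1 \<le> b * l" using ab l by (auto simp: Suc_le_eq)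
 have "blocks l (a + b) w = blocks l a w + (\<Sum>i<b. y l (shift (int (a + i) * int l) w))"
  unfolding blocks_def by (induction b) (simp_all add: add.assoc)
 also have "(\<Sum>i<b. y l (shift (int (a + i) * int l) w)) = blocks l b (shift (int a * int l) w)"
  unfolding blocks_def shift_shift by (simp add: algebra_simps)
 finally show "\<bar>(y ((a + b) * l) w - blocks l (a + b) w) - (y (a * l) w - blocks l a w)
   - (y (b * l) (shift (int a * int l) w) - blocks l b (shift (int a * int l) w))\<bar> \<le> C"
  using y_quasi[OF al, of w] by (simp add: add_mult_distrib)
qed (use l r in auto)

definition nsdev :: "nat \<Rightarrow> real" where "nsdev n = Q.sdev (y n) / sqrt n"

lemma nsdev_multiple: assumes l: "1 \<le> l" and r: "1 \<le> r" shows "\<bar>nsdev (r * l) - nsdev l\<bar> \<le> 32 * C / sqrt l"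
proof -
 have rl: "1 \<le> r * l" using l r by (auto simp: Suc_le_eq)
 have "\<bar>Q.sdev (y (r * l)) - sqrt r * Q.sdev (y l)\<bar> \<le> 32 * C * sqrt r"
  using Q.sdev_triangle_diff[OF y_bdd[OF rl] blocks_bdd[OF l, of r]] sdev_block_error[OF l r] by (simp add: sdev_blocks[OF l])
 then have "\<bar>Q.sdev (y (r * l)) - sqrt r * Q.sdev (y l)\<bar> / (sqrt r * sqrt l) \<le> 32 * C * sqrt r / (sqrt r * sqrt l)"
  by (intro divide_right_mono) auto
 also have "\<bar>Q.sdev (y (r * l)) - sqrt r * Q.sdev (y l)\<bar> / (sqrt r * sqrt l) = \<bar>(Q.sdev (y (r * l)) - sqrt r * Q.sdev (y l)) / (sqrt r * sqrt l)\<bar>"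
  by (simp add: abs_mult)
 also have "(Q.sdev (y (r * l)) - sqrt r * Q.sdev (y l)) / (sqrt r * sqrt l) = nsdev (r * l) - nsdev l"
  using l r by (simp add: nsdev_def diff_divide_distrib real_sqrt_mult)
 finally show ?thesis using r by simp
qed

text \<open>Both values are compared with the one at the common multiple a * b.\<close>

lemma nsdev_diff: assumes "1 \<le> a" "1 \<le> b" shows "\<bar>nsdev a - nsdev b\<bar> \<le> 32 * C / sqrt a + 32 * C / sqrt b"
 using nsdev_multiple[OF assms] nsdev_multiple[OF assms(2,1)] by (simp add: mult.commute)

lemma nsdev_converges: "\<exists>\<sigma>. nsdev \<longlonglongrightarrow> \<sigma>"
proof -
 have lim: "(\<lambda>n. 32 * C / sqrt (real n)) \<longlonglongrightarrow> 0" by real_asymp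
 have "Cauchy nsdev"
 proof (rule metric_CauchyI)
  fix e :: real assume e: "0 < e"
  then have "\<forall>\<^sub>F n in sequentially. 32 * C / sqrt (real n) < e / 2" using order_tendstoD(2)[OF lim, of "e / 2"] by simp
  then obtain N where N: "\<And>n. N \<le> n \<Longrightarrow> 32 * C / sqrt (real n) < e / 2" by (auto simp: eventually_sequentially)
  show "\<exists>M. \<forall>m\<ge>M. \<forall>n\<ge>M. dist (nsdev m) (nsdev n) < e"
  proof (intro exI allI impI)
   fix a b assume "max N 1 \<le> a" "max N 1 \<le> b"
   then show "dist (nsdev a) (nsdev b) < e" using nsdev_diff[of a b] N[of a] N[of b] by (simp add: dist_real_def)
  qed
 qed
 then show ?thesis by (simp add: Cauchy_convergent_iff convergent_def)
qed

definition \<sigma> :: real where "\<sigma> = lim nsdev"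

lemma nsdev_tendsto: "nsdev \<longlonglongrightarrow> \<sigma>"
 using nsdev_converges unfolding \<sigma>_def by (auto simp: convergent_def convergent_LIMSEQ_iff[symmetric])

text \<open>
 The function \<open>\<phi>\<close> depends only on the first \<open>L\<close> sites and every shift of it to one of \<open>N\<close> disjoint
 blocks has covariance at least \<open>1\<close> with \<open>y (N * L)\<close>.  Cauchy-Schwarz, applied to the sum of these shifts,
 bounds the variance of \<open>y (N * L)\<close> below by a multiple of \<open>N\<close>.
\<close>

lemma \<sigma>_positive:
 assumes L: "1 \<le> L" and hi: "0 < Q.prob {w. hi \<le> y L w}" and lo: "0 < Q.prob {w. y L w \<le> lo}"
  and gap: "4 * C + 1 \<le> hi - lo"
 shows "0 < \<sigma>"
proof -
 note [measurable] = rv_meas[OF y_bdd[OF L]]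
 define U V where "U = {w. hi \<le> y L w}" and "V = {w. y L w \<le> lo}"
 define p q where "p = Q.prob U" and "q = Q.prob V"
 have pq: "0 < p" "0 < q" using hi lo by (auto simp: p_def q_def U_def V_def)
 \<comment> \<open>This normalisation gives mean 0, mean absolute value at most 2 and covariance at
   least hi - lo with \<open>y L\<close>. Cutting one block out of \<open>y (N * L)\<close> leaves
   an error of at most 2 C, which costs 4 C in the covariance; the assumed gap leaves 1.\<close>
 define \<phi> where "\<phi> w = indicat_real U w / p - indicat_real V w / q" for w
 have ev: "U \<in> Q.events" "V \<in> Q.events"
  using measurable_sets[OF rv_meas[OF y_bdd[OF L]], of "{hi..}"] measurable_sets[OF rv_meas[OF y_bdd[OF L]], of "{..lo}"]
  by (auto simp: vimage_def space_Q U_def V_def)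
 note [measurable] = ev
 have b\<phi>: "Q.bdd_rv \<phi>"
 proof (rule Q.bdd_rvI)
  show "\<phi> \<in> borel_measurable Q" unfolding \<phi>_def[abs_def] by measurable
  show "\<bar>\<phi> w\<bar> \<le> 1 / p + 1 / q" for w
  proof -
   have "0 < 1 / p" "0 < 1 / q" using pq by auto
   then show ?thesis by (auto simp: \<phi>_def indicator_def abs_le_iff)
  qed
 qed
 have d\<phi>: "depends {0..<int L} \<phi>"
  using depends_comp[OF y_dep[OF L], of "\<lambda>u. (if hi \<le> u then 1 else 0) / p - (if u \<le> lo then 1 else 0) / q"]
  by (simp add: \<phi>_def[abs_def] indicator_def of_bool_def U_def V_def)
 have ind: "mean (indicat_real U) = p" "mean (indicat_real V) = q" using ev by (simp_all add: p_def q_def)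
 have inti: "integrable Q (indicat_real U)" "integrable Q (indicat_real V)"
  using ev by (auto intro!: integrable_real_indicator simp: Q.emeasure_eq_measure)
 have E0: "mean \<phi> = 0" unfolding \<phi>_def using inti ind pq by simp
 have Eabs: "mean (\<lambda>w. \<bar>\<phi> w\<bar>) \<le> 2"
 proof -
  have "mean (\<lambda>w. \<bar>\<phi> w\<bar>) \<le> mean (\<lambda>w. indicat_real U w / p + indicat_real V w / q)"
  proof (rule integral_mono)
   show "integrable Q (\<lambda>w. \<bar>\<phi> w\<bar>)" by (intro rv_integrable Q.bdd_rv_abs b\<phi>)
   show "integrable Q (\<lambda>w. indicat_real U w / p + indicat_real V w / q)" using inti by simp
   have "0 < 1 / p" "0 < 1 / q" using pq by auto
   then show "\<bar>\<phi> w\<bar> \<le> indicat_real U w / p + indicat_real V w / q" for w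
    by (auto simp: \<phi>_def indicator_def abs_le_iff)
  qed
  also have "... = 2" using inti ind pq by simp
  finally show ?thesis .
 qed
 have Ey: "hi - lo \<le> mean (\<lambda>w. y L w * \<phi> w)"
 proof -
  have "mean (\<lambda>w. hi / p * indicat_real U w - lo / q * indicat_real V w)
    \<le> mean (\<lambda>w. y L w * \<phi> w)"
  proof (rule integral_mono)
   show "integrable Q (\<lambda>w. hi / p * indicat_real U w - lo / q * indicat_real V w)" using inti by simp
   show "integrable Q (\<lambda>w. y L w * \<phi> w)" by (intro rv_integrable Q.bdd_rv_mult b\<phi> y_bdd L)
   fix w
   have "\<not> (hi \<le> y L w \<and> y L w \<le> lo)" using gap C_nonneg by auto
   then show "hi / p * indicat_real U w - lo / q * indicat_real V w \<le> y L w * \<phi> w"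
    using pq by (cases "hi \<le> y L w"; cases "y L w \<le> lo") (auto simp: \<phi>_def divide_right_mono U_def V_def)
  qed
  then show ?thesis using inti ind pq by simp
 qed
 define c where "c = mean (\<lambda>w. (\<phi> w)\<^sup>2)"
 have vc: "Q.variance \<phi> = c" using E0 by (simp add: c_def)
 have main: "real N \<le> c * Q.variance (y (N * L))" if N: "1 \<le> N" for N
 proof -
  have NL: "1 \<le> N * L" using N L by (auto simp: Suc_le_eq)
  define G where "G w = (\<Sum>i<N. \<phi> (shift (int i * int L) w))" for w
  have bG: "Q.bdd_rv G" unfolding G_def by (intro Q.bdd_rv_sum bdd_rv_shift b\<phi>)
  have EG: "mean G = 0" unfolding G_def
   using rv_integrable[OF bdd_rv_shift[OF b\<phi>]] rv_meas[OF b\<phi>] E0 by (simp add: integral_shift)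
  have "(Q.sdev G)\<^sup>2 = N * c"
   unfolding G_def using sdev_iid_sum[OF b\<phi> d\<phi>, of N] L Q.sdev_power2[of \<phi>] by (simp add: power_mult_distrib vc)
  then have VG: "mean (\<lambda>w. (G w)\<^sup>2) = N * c" using EG by (simp add: Q.sdev_power2)
  define F where "F w = y (N * L) w - mean (y (N * L))" for w
  have bF: "Q.bdd_rv F" unfolding F_def by (intro rv_intros y_bdd NL)
  have one: "1 \<le> mean (\<lambda>w. y (N * L) w * \<phi> (shift (int i * int L) w))" if i: "i < N" for i
  proof -
   define P where "P w = \<phi> (shift (int i * int L) w)" for w
   define A where "A = (if i = 0 then (\<lambda>_. 0) else Y 0 (int i * int L))"
   define B where "B w = y L (shift (int i * int L) w)" for w
   define D where "D = (if i = N - 1 then (\<lambda>_. 0) else Y (int i * int L + int L) (int N * int L))"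
   define W where "W w = y (N * L) w - (A w + B w + D w)" for w
   have bP: "Q.bdd_rv P" unfolding P_def by (rule bdd_rv_shift[OF b\<phi>])
   have dP: "depends {int i * int L..<int i * int L + int L} P"
    unfolding P_def by (rule depends_mono[OF depends_shift[OF d\<phi>]]) auto
   have EP: "mean P = 0" unfolding P_def using E0 rv_meas[OF b\<phi>] by (simp add: integral_shift)
   have iL: "0 < int i * int L" if "i \<noteq> 0" using that L by simp
   have lt: "int i * int L + int L < int N * int L" if "i \<noteq> N - 1"
   proof -
    have "int i + 1 < int N" using that i by linarith
    then have "(int i + 1) * int L < int N * int L" using L by (intro mult_strict_right_mono) auto
    then show ?thesis by (simp add: algebra_simps)
   qed
   have eqN: "int i * int L + int L = int N * int L" if "i = N - 1"
   proof -
    have "int N = int i + 1" using that i by linarith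
    then show ?thesis by (simp add: algebra_simps)
   qed
   have bA: "Q.bdd_rv A" and bD: "Q.bdd_rv D" using iL lt by (auto simp: A_def D_def intro!: Y_bdd Q.bdd_rv_const)
   have bB: "Q.bdd_rv B" unfolding B_def by (intro bdd_rv_shift y_bdd L)
   have bW: "Q.bdd_rv W" unfolding W_def by (intro rv_intros y_bdd NL bA bB bD)
   have dA: "depends {0..<int i * int L} A" using Y_dep[OF iL] by (auto simp: A_def depends_def)
   have dD: "depends {int i * int L + int L..<int N * int L} D" using Y_dep[OF lt] by (auto simp: D_def depends_def)
   have Wb: "\<bar>W w\<bar> \<le> 2 * C" for w
   proof -
    have BY: "B w = Y (int i * int L) (int i * int L + int L) w" unfolding B_def by (rule Y_eq_y_shift[OF L, symmetric])
    have 1: "\<bar>Y 0 (int i * int L + int L) w - A w - B w\<bar> \<le> C"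
     using Y_quasi[OF iL, of "int i * int L + int L" w] L C_nonneg by (cases "i = 0") (auto simp: A_def BY)
    have 2: "\<bar>y (N * L) w - Y 0 (int i * int L + int L) w - D w\<bar> \<le> C"
    proof (cases "i = N - 1")
     case True then show ?thesis using eqN C_nonneg by (simp add: D_def y_def)
    next
     case False
     have "0 < int i * int L + int L" using L by (simp add: add_nonneg_pos)
     then show ?thesis using Y_quasi[OF _ lt[OF False], of 0 w] False by (simp add: D_def y_def)
    qed
    show ?thesis using 1 2 by (simp add: W_def abs_le_iff)
   qed
   have EA: "mean (\<lambda>w. A w * P w) = 0"
    using Q.indep_var_lebesgue_integral[OF depends_indep_var[OF rv_meas[OF bA] rv_meas[OF bP] dA dP] rv_integrable[OF bA] rv_integrable[OF bP]] EP by auto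
   have ED: "mean (\<lambda>w. D w * P w) = 0"
    using Q.indep_var_lebesgue_integral[OF depends_indep_var[OF rv_meas[OF bD] rv_meas[OF bP] dD dP] rv_integrable[OF bD] rv_integrable[OF bP]] EP by auto
   have EB: "hi - lo \<le> mean (\<lambda>w. B w * P w)" unfolding B_def P_def
    using Ey integral_shift[of "\<lambda>w. y L w * \<phi> w" "int i * int L"] rv_meas[OF b\<phi>] by simp
   have EW: "- (4 * C) \<le> mean (\<lambda>w. W w * P w)"
   proof -
    have "mean (\<lambda>w. - (2 * C) * \<bar>P w\<bar>) \<le> mean (\<lambda>w. W w * P w)"
    proof (rule integral_mono)
     fix w
     have "\<bar>W w * P w\<bar> \<le> 2 * C * \<bar>P w\<bar>" unfolding abs_mult by (rule mult_right_mono[OF Wb]) simp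
     then show "- (2 * C) * \<bar>P w\<bar> \<le> W w * P w" by linarith
    qed (intro rv_integrable rv_intros bP bW)+
    moreover have "mean (\<lambda>w. \<bar>P w\<bar>) \<le> 2"
     unfolding P_def using Eabs integral_shift[of "\<lambda>w. \<bar>\<phi> w\<bar>" "int i * int L"] rv_meas[OF b\<phi>] by simp
    ultimately show ?thesis using mult_left_mono[of "mean (\<lambda>w. \<bar>P w\<bar>)" 2 "2 * C"] C_nonneg by simp
   qed
   have int: "integrable Q (\<lambda>w. A w * P w)" "integrable Q (\<lambda>w. B w * P w)" "integrable Q (\<lambda>w. D w * P w)" "integrable Q (\<lambda>w. W w * P w)"
    by (intro rv_integrable rv_intros bA bB bD bW bP)+
   have "mean (\<lambda>w. y (N * L) w * P w) = mean (\<lambda>w. A w * P w + B w * P w + D w * P w + W w * P w)"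
    by (intro Bochner_Integration.integral_cong) (auto simp: W_def algebra_simps)
   also have "... = mean (\<lambda>w. A w * P w) + mean (\<lambda>w. B w * P w) + mean (\<lambda>w. D w * P w) + mean (\<lambda>w. W w * P w)"
    using int by simp
   finally show ?thesis using EA EB ED EW gap by (simp add: P_def)
  qed
  have "real N \<le> (\<Sum>i<N. mean (\<lambda>w. y (N * L) w * \<phi> (shift (int i * int L) w)))"
   using sum_mono[of "{..<N}" "\<lambda>_. 1" "\<lambda>i. mean (\<lambda>w. y (N * L) w * \<phi> (shift (int i * int L) w))"] one by simp
  also have "... = mean (\<lambda>w. y (N * L) w * G w)" unfolding G_def sum_distrib_left
   by (rule Bochner_Integration.integral_sum[symmetric]) (intro rv_integrable Q.bdd_rv_mult y_bdd NL bdd_rv_shift b\<phi>)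
  also have "... = mean (\<lambda>w. F w * G w)"
  proof -
   have "mean (\<lambda>w. F w * G w) = mean (\<lambda>w. y (N * L) w * G w - mean (y (N * L)) * G w)"
    by (simp add: F_def left_diff_distrib)
   also have "... = mean (\<lambda>w. y (N * L) w * G w)"
    using rv_integrable[OF Q.bdd_rv_mult[OF y_bdd[OF NL] bG]] rv_integrable[OF bG] by (simp add: EG)
   finally show ?thesis by simp
  qed
  finally have "(real N)\<^sup>2 \<le> (mean (\<lambda>w. F w * G w))\<^sup>2" by (intro power_mono) auto
  also have "... \<le> mean (\<lambda>w. (F w)\<^sup>2) * mean (\<lambda>w. (G w)\<^sup>2)"
   by (rule Q.expectation_Cauchy_Schwarz[OF bF bG])
  also have "... = Q.variance (y (N * L)) * (N * c)" by (simp add: VG F_def)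
  finally have "real N * real N \<le> real N * (c * Q.variance (y (N * L)))" by (simp add: power2_eq_square mult_ac)
  then show ?thesis using N by simp
 qed
 have c: "0 < c"
 proof (rule ccontr)
  assume "\<not> 0 < c"
  then have "c * Q.variance (y (1 * L)) \<le> 0" by (simp add: mult_nonpos_nonneg Q.variance_positive)
  then show False using main[of 1] by simp
 qed
 have "sqrt (1 / (c * L)) \<le> \<sigma>"
 proof (rule LIMSEQ_le_const)
  show "(\<lambda>N. nsdev (Suc N * L)) \<longlonglongrightarrow> \<sigma>"
   by (rule filterlim_compose[OF nsdev_tendsto], rule filterlim_subseq) (use L in \<open>auto simp: strict_mono_def\<close>)
  have "sqrt (1 / (c * L)) \<le> nsdev (Suc N * L)" for N
  proof -
   have "(1 / (c * L)) * (Suc N * L) \<le> Q.variance (y (Suc N * L))"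
   proof -
    have "(1 / (c * L)) * (Suc N * L) = Suc N / c" using c L by (simp add: of_nat_mult del: of_nat_Suc mult_Suc)
    also have "... \<le> Q.variance (y (Suc N * L))"
     using main[of "Suc N"] c by (simp add: pos_divide_le_eq mult.commute del: mult_Suc of_nat_Suc)
    finally show ?thesis .
   qed
   then have "sqrt ((1 / (c * L)) * (Suc N * L)) \<le> Q.sdev (y (Suc N * L))"
    unfolding Q.sdev_def by (rule real_sqrt_le_mono)
   moreover have K: "0 < sqrt (real (Suc N * L))" using L by (simp add: add_pos_nonneg)
   ultimately show ?thesis by (simp only: nsdev_def pos_le_divide_eq[OF K] real_sqrt_mult[symmetric])
  qed
  then show "\<exists>N. \<forall>n\<ge>N. sqrt (1 / (c * real L)) \<le> nsdev (Suc n * L)" by blast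
 qed
 moreover have "0 < sqrt (1 / (c * L))" using c L by simp
 ultimately show ?thesis by linarith
qed

end

lemma (in prob_space) char_distr_eq:
 "F \<in> borel_measurable M \<Longrightarrow> char (distr M borel F) u = (CLINT x|M. iexp (u * F x))"
 by (simp add: char_def integral_distr)

section \<open>Fourth moments of running maxima\<close>

locale centered_additive = quasi_additive \<nu> Y C
 for \<nu> :: "'b measure" and Y :: "int \<Rightarrow> int \<Rightarrow> (int \<Rightarrow> 'b) \<Rightarrow> real" and C :: real +
 assumes mean_bd: "1 \<le> n \<Longrightarrow> \<bar>mean (y n)\<bar> \<le> C"
begin

lemma y_lin: "1 \<le> n \<Longrightarrow> \<bar>y n w\<bar> \<le> C * real n"
 using Y_lin[of 0 "int n" w] by (simp add: y_def)

definition N4 :: real where "N4 = 3 / 2 * M4 + 729 * C ^ 4"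

lemma M4_nonneg: "0 \<le> M4" using C_nonneg by (simp add: M4_def)

lemma raw_fourth_moment_y:
 assumes n: "1 \<le> n" shows "mean (\<lambda>w. y n w ^ 4) \<le> N4 * (real n)\<^sup>2"
proof -
 let ?e = "mean (y n)"
 have "mean (\<lambda>w. y n w ^ 4) \<le> mean (\<lambda>w. 3 / 2 * (y n w - ?e) ^ 4 + 729 * C ^ 4)"
 proof (rule integral_mono)
  fix w
  have "\<bar>?e\<bar> ^ 4 \<le> C ^ 4" by (rule power_mono[OF mean_bd[OF n]]) simp
  then show "y n w ^ 4 \<le> 3 / 2 * (y n w - ?e) ^ 4 + 729 * C ^ 4" using power4_add_le[of "y n w - ?e" ?e] by simp
 qed (intro rv_integrable rv_intros y_bdd n)+
 also have "... = 3 / 2 * mean (\<lambda>w. (y n w - ?e) ^ 4) + 729 * C ^ 4"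
 proof -
  have "integrable Q (\<lambda>w. (y n w - ?e) ^ 4)" by (intro rv_integrable rv_intros y_bdd n)
  then show ?thesis by (simp add: Q.prob_space)
 qed
 also have "... \<le> 3 / 2 * (M4 * (real n)\<^sup>2) + 729 * C ^ 4 * (real n)\<^sup>2"
  using fourth_moment_y[OF n] n C_nonneg by (intro add_mono mult_left_mono) (auto simp: mult_le_cancel_left1)
 finally show ?thesis by (simp add: N4_def algebra_simps)
qed

definition H :: "nat \<Rightarrow> (int \<Rightarrow> 'b) \<Rightarrow> real" where
 "H n w = Max ((\<lambda>i. \<bar>y i w\<bar>) ` {1..n})"

lemma H_ge: "1 \<le> i \<Longrightarrow> i \<le> n \<Longrightarrow> \<bar>y i w\<bar> \<le> H n w"
 unfolding H_def by (intro Max_ge) auto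

lemma H_le: "1 \<le> n \<Longrightarrow> (\<And>i. 1 \<le> i \<Longrightarrow> i \<le> n \<Longrightarrow> \<bar>y i w\<bar> \<le> B) \<Longrightarrow> H n w \<le> B"
 unfolding H_def by (intro Max.boundedI) auto

lemma H_nonneg: "1 \<le> n \<Longrightarrow> 0 \<le> H n w"
 using H_ge[of 1 n w] abs_ge_zero[of "y 1 w"] by linarith

lemma H_bdd: assumes n: "1 \<le> n" shows "Q.bdd_rv (H n)"
proof (rule Q.bdd_rvI)
 show "H n \<in> borel_measurable Q"
  unfolding H_def[abs_def] using n by (intro borel_measurable_Max borel_measurable_abs rv_meas y_bdd) auto
 fix w
 have "H n w \<le> C * real n"
 proof (rule H_le[OF n])
  fix i assume i: "1 \<le> i" "i \<le> n"
  have "\<bar>y i w\<bar> \<le> C * real i" by (rule y_lin[OF i(1)])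
  also have "... \<le> C * real n" using i C_nonneg by (intro mult_left_mono) auto
  finally show "\<bar>y i w\<bar> \<le> C * real n" .
 qed
 then show "\<bar>H n w\<bar> \<le> C * real n" using H_nonneg[OF n, of w] by simp
qed

definition h4 :: real where "h4 = 729 * (3 / 2 * N4 + 729 * C ^ 4)"

lemma N4_nonneg: "0 \<le> N4" using M4_nonneg by (simp add: N4_def)

lemma h4_nonneg: "0 \<le> h4" using N4_nonneg by (simp add: h4_def)

text \<open>The maximum over 2 N sites is at most the larger of two maxima with the same law plus
  \<bar>y N\<bar> + C. A fourth power of a maximum is at most a sum, so the recursion has the factor
  2 * 3 / 2 = 3, one less than the required 4; \<open>h4\<close> is the coefficient of the remaining
  term.\<close>

lemma H_fourth_moment_power2: "mean (\<lambda>w. H (2 ^ k) w ^ 4) \<le> h4 * 4 ^ k"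
proof (induction k)
 case 0
 have "H 1 w ^ 4 \<le> C ^ 4" for w
 proof -
  have "H 1 w \<le> C" using Y_lin[of 0 1 w] by (intro H_le) (auto simp: y_def dest: order_antisym)
  then show ?thesis using H_nonneg[of 1 w] by (intro power_mono) auto
 qed
 then have "mean (\<lambda>w. H 1 w ^ 4) \<le> C ^ 4" by (intro Q.integral_le_const rv_integrable rv_intros H_bdd) auto
 also have "... \<le> h4" using N4_nonneg by (simp add: h4_def)
 finally show ?case by simp
next
 case (Suc k)
 define N where "N = (2 :: nat) ^ k"
 have N: "1 \<le> N" by (simp add: N_def)
 define H' where "H' w = H N (shift (int N) w)" for w
 have bH: "Q.bdd_rv (H N)" and bH': "Q.bdd_rv H'" and b2: "Q.bdd_rv (H (2 * N))"
  using N by (auto simp: H'_def[abs_def] intro!: H_bdd bdd_rv_shift)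
 have step: "H (2 * N) w \<le> max (H N w) (H' w) + (\<bar>y N w\<bar> + C)" for w
 proof (rule H_le)
  fix i assume i: "1 \<le> i" "i \<le> 2 * N"
  show "\<bar>y i w\<bar> \<le> max (H N w) (H' w) + (\<bar>y N w\<bar> + C)"
  proof (cases "i \<le> N")
   case True
   then show ?thesis using H_ge[of i N w] i C_nonneg by (simp add: le_max_iff_disj)
  next
   case False
   have "\<bar>y (i - N) (shift (int N) w)\<bar> \<le> H' w" unfolding H'_def using False i by (intro H_ge) auto
   moreover have "\<bar>y i w - y N w - y (i - N) (shift (int N) w)\<bar> \<le> C"
    using y_quasi[of N "i - N" w] False N by simp
   ultimately show ?thesis by linarith
  qed
 qed (use N in simp)
 have int: "integrable Q (\<lambda>w. H N w ^ 4)" "integrable Q (\<lambda>w. H' w ^ 4)" "integrable Q (\<lambda>w. y N w ^ 4)"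
  by (intro rv_integrable rv_intros bH bH' y_bdd N)+
 have "mean (\<lambda>w. H (2 * N) w ^ 4)
   \<le> mean (\<lambda>w. 3 / 2 * (H N w ^ 4 + H' w ^ 4) + 729 * (3 / 2 * y N w ^ 4 + 729 * C ^ 4))"
 proof (rule integral_mono)
  show "integrable Q (\<lambda>w. H (2 * N) w ^ 4)" by (intro rv_integrable rv_intros b2)
  show "integrable Q (\<lambda>w. 3 / 2 * (H N w ^ 4 + H' w ^ 4) + 729 * (3 / 2 * y N w ^ 4 + 729 * C ^ 4))"
   using int by simp
  fix w
  have "H (2 * N) w ^ 4 \<le> (max (H N w) (H' w) + (\<bar>y N w\<bar> + C)) ^ 4"
   using step[of w] H_nonneg[of "2 * N" w] N by (intro power_mono) auto
  also have "... \<le> 3 / 2 * max (H N w) (H' w) ^ 4 + 729 * (\<bar>y N w\<bar> + C) ^ 4" by (rule power4_add_le)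
  also have "max (H N w) (H' w) ^ 4 \<le> H N w ^ 4 + H' w ^ 4" by (auto simp: max_def)
  also have "(\<bar>y N w\<bar> + C) ^ 4 \<le> 3 / 2 * y N w ^ 4 + 729 * C ^ 4"
   using power4_add_le[of "\<bar>y N w\<bar>" C] by simp
  finally show "H (2 * N) w ^ 4 \<le> 3 / 2 * (H N w ^ 4 + H' w ^ 4) + 729 * (3 / 2 * y N w ^ 4 + 729 * C ^ 4)" by simp
 qed
 also have "... = 3 / 2 * (mean (\<lambda>w. H N w ^ 4) + mean (\<lambda>w. H' w ^ 4)) + 729 * (3 / 2 * mean (\<lambda>w. y N w ^ 4) + 729 * C ^ 4)"
  using int by (simp add: Q.prob_space)
 also have "mean (\<lambda>w. H' w ^ 4) = mean (\<lambda>w. H N w ^ 4)"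
  unfolding H'_def using integral_shift[of "\<lambda>w. H N w ^ 4" "int N"] rv_meas[OF bH] by simp
 also have "3 / 2 * (mean (\<lambda>w. H N w ^ 4) + mean (\<lambda>w. H N w ^ 4)) \<le> 3 * (h4 * 4 ^ k)"
  using Suc by (simp add: N_def)
 also have "729 * (3 / 2 * mean (\<lambda>w. y N w ^ 4) + 729 * C ^ 4) \<le> h4 * 4 ^ k"
 proof -
  have N2: "(real N)\<^sup>2 = 4 ^ k" using power_mult_distrib[of "2 :: real" 2 k] by (simp add: N_def power2_eq_square)
  have "729 * (3 / 2 * mean (\<lambda>w. y N w ^ 4) + 729 * C ^ 4) \<le> 729 * (3 / 2 * (N4 * 4 ^ k) + 729 * (C ^ 4 * 4 ^ k))"
   using raw_fourth_moment_y[OF N] unfolding N2 by (intro mult_left_mono add_mono) (auto simp: mult_le_cancel_left1)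
  also have "... = h4 * 4 ^ k" by (simp add: h4_def algebra_simps)
  finally show ?thesis .
 qed
 finally show ?case by (simp add: N_def)
qed

lemma H_fourth_moment: assumes n: "1 \<le> n" shows "mean (\<lambda>w. H n w ^ 4) \<le> 4 * h4 * (real n)\<^sup>2"
proof -
 define k where "k = (LEAST k. n \<le> 2 ^ k)"
 have k: "n \<le> 2 ^ k" "2 ^ k < 2 * n"
 proof -
  show "n \<le> 2 ^ k" unfolding k_def by (rule LeastI[of _ n]) (simp add: less_imp_le)
  show "2 ^ k < 2 * n" using n not_less_Least[of "k - 1" "\<lambda>k. n \<le> 2 ^ k"] by (cases k) (auto simp: k_def[symmetric])
 qed
 have n2: "1 \<le> (2 :: nat) ^ k" by simp
 have "mean (\<lambda>w. H n w ^ 4) \<le> mean (\<lambda>w. H (2 ^ k) w ^ 4)"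
 proof (rule integral_mono)
  fix w show "H n w ^ 4 \<le> H (2 ^ k) w ^ 4" using k(1) H_nonneg[OF n, of w] by (intro power_mono H_le[OF n] H_ge) auto
 qed (intro rv_integrable rv_intros H_bdd n n2)+
 also have "... \<le> h4 * 4 ^ k" by (rule H_fourth_moment_power2)
 also have "(4 :: real) ^ k = (2 ^ k)\<^sup>2" using power_mult_distrib[of "2 :: real" 2 k] by (simp add: power2_eq_square)
 also have "h4 * (2 ^ k)\<^sup>2 \<le> h4 * (2 * real n)\<^sup>2"
 proof (intro mult_left_mono power_mono h4_nonneg)
  have "real (2 ^ k) \<le> real (2 * n)" using k(2) by (subst of_nat_le_iff) simp
  then show "2 ^ k \<le> 2 * real n" by simp
 qed simp
 finally show ?thesis by (simp add: power_mult_distrib)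
qed

lemma oscillation_tail:
 assumes n: "1 \<le> n" and c: "0 < c"
 shows "Q.prob {w. \<exists>i\<in>{1..n}. c \<le> \<bar>Y a (a + int i) w\<bar>} \<le> 4 * h4 * (real n)\<^sup>2 / c ^ 4"
proof -
 note [measurable] = rv_meas[OF H_bdd[OF n]] shift_measurable
 have "Q.prob {w. \<exists>i\<in>{1..n}. c \<le> \<bar>Y a (a + int i) w\<bar>} = Q.prob {w \<in> space Q. c \<le> H n (shift a w)}"
 proof (rule arg_cong[where f=Q.prob], safe)
  fix w i assume "i \<in> {1..n}" "c \<le> \<bar>Y a (a + int i) w\<bar>"
  then show "c \<le> H n (shift a w)" using H_ge[of i n "shift a w"] Y_eq_y_shift[of i a w] by auto
 next
  fix w assume A: "c \<le> H n (shift a w)"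
  have "H n (shift a w) \<in> (\<lambda>i. \<bar>y i (shift a w)\<bar>) ` {1..n}" unfolding H_def using n by (intro Max_in) auto
  then obtain i where i: "i \<in> {1..n}" "H n (shift a w) = \<bar>y i (shift a w)\<bar>" by auto
  then show "\<exists>i\<in>{1..n}. c \<le> \<bar>Y a (a + int i) w\<bar>" using A Y_eq_y_shift[of i a w] by (intro bexI[of _ i]) auto
 qed (simp add: space_Q)
 also have "... \<le> Q.prob {w \<in> space Q. c \<le> \<bar>H n (shift a w)\<bar>}" by (rule Q.finite_measure_mono) auto
 also have "... \<le> mean (\<lambda>w. H n (shift a w) ^ 4) / c ^ 4"
  by (rule Q.fourth_moment_tail[OF bdd_rv_shift[OF H_bdd[OF n]] c])
 also have "mean (\<lambda>w. H n (shift a w) ^ 4) = mean (\<lambda>w. H n w ^ 4)"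
  using integral_shift[of "\<lambda>w. H n w ^ 4" a] by simp
 also have "... / c ^ 4 \<le> 4 * h4 * (real n)\<^sup>2 / c ^ 4" using c by (intro divide_right_mono H_fourth_moment n) auto
 finally show ?thesis .
qed

subsection \<open>Central limit theorem\<close>

lemma blocks_clt:
 assumes l: "1 \<le> l" and wl: "0 < nsdev l"
 shows "(\<lambda>r. char (distr Q borel (\<lambda>w. (blocks l r w - r * mean (y l)) / sqrt (r * l))) u) \<longlonglongrightarrow> exp (- (nsdev l)\<^sup>2 * u\<^sup>2 / 2)"
proof -
 define X where "X i w = y l (shift (int i * int l) w) - mean (y l)" for i :: nat and w
 note [measurable] = rv_meas[OF y_bdd[OF l]] shift_measurable
 have sd: "Q.sdev (y l) = nsdev l * sqrt l" using l by (simp add: nsdev_def)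
 have sdpos: "0 < Q.sdev (y l)" using wl l by (simp add: sd)
 have bX: "Q.bdd_rv (X i)" for i unfolding X_def by (intro rv_intros bdd_rv_shift y_bdd l)
 have EX: "mean (X i) = 0" for i
  unfolding X_def using rv_integrable[OF bdd_rv_shift[OF y_bdd[OF l], of "int i * int l"]] by (simp add: integral_shift Q.prob_space)
 define Z where "Z n x = (\<Sum>i<n. X i x) / sqrt (n * (Q.sdev (y l))\<^sup>2)" for n x
 have "weak_conv_m (\<lambda>n. distr Q borel (Z n)) std_normal_distribution" unfolding Z_def
 proof (rule Q.central_limit_theorem_zero_mean[where \<mu>="distr Q borel (X 0)"])
  show "Q.indep_vars (\<lambda>i. borel) X UNIV"
  proof (rule depends_indep_vars[where K="\<lambda>i. {int i * int l..<int i * int l + int l}"])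
   show "X j \<in> borel_measurable Q" for j by (rule rv_meas[OF bX])
   show "depends {int j * int l..<int j * int l + int l} (X j)" for j
    using depends_comp[OF y_shift_dep[OF l, of "int j * int l"], of "\<lambda>u. u - mean (y l)"] by (simp add: X_def[abs_def])
   have "{int i * int l..<int i * int l + int l} \<inter> {int j * int l..<int j * int l + int l} = {}" if "i < j" for i j
   proof -
    have "(int i + 1) * int l \<le> int j * int l" using that by (intro mult_right_mono) auto
    then show ?thesis by (auto simp: algebra_simps)
   qed
   then show "disjoint_family (\<lambda>i. {int i * int l..<int i * int l + int l})"
    unfolding disjoint_family_on_def by (metis Int_commute linorder_neqE_nat)
  qed
  show "mean (X n) = 0" for n by (rule EX)
  show "0 < Q.sdev (y l)" by (rule sdpos)
  show "integrable Q (\<lambda>x. (X n x)\<^sup>2)" for n by (intro rv_integrable Q.bdd_rv_power bX)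
  show "Q.variance (X n) = (Q.sdev (y l))\<^sup>2" for n
   using integral_shift[of "\<lambda>w. (y l w - mean (y l))\<^sup>2" "int n * int l"] EX[of n]
   by (simp add: X_def Q.sdev_power2)
  show "distr Q borel (X n) = distr Q borel (X 0)" for n
   using distr_comp_shift[of "\<lambda>w. y l w - mean (y l)"] by (simp add: X_def[abs_def])
 qed
 moreover have "real_distribution (distr Q borel (Z n))" for n
  using rv_meas[OF bX] unfolding Z_def by (intro Q.real_distribution_distr) auto
 ultimately have "(\<lambda>n. char (distr Q borel (Z n)) (nsdev l * u)) \<longlonglongrightarrow> char std_normal_distribution (nsdev l * u)"
  by (intro levy_continuity1 real_dist_normal_dist)
 moreover have "char (distr Q borel (Z n)) (nsdev l * u)
   = char (distr Q borel (\<lambda>w. (blocks l n w - n * mean (y l)) / sqrt (n * l))) u" for n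
 proof -
  note [measurable] = rv_meas[OF bX] rv_meas[OF blocks_bdd[OF l]]
  have "nsdev l * u * Z n x = u * ((blocks l n x - n * mean (y l)) / sqrt (n * l))" for x
  proof -
   have "(\<Sum>i<n. X i x) = blocks l n x - n * mean (y l)" by (simp add: X_def blocks_def sum_subtractf)
   moreover have "sqrt (n * (Q.sdev (y l))\<^sup>2) = nsdev l * sqrt (n * l)" using wl by (simp add: sd real_sqrt_mult power_mult_distrib)
   ultimately show ?thesis using wl by (simp add: Z_def)
  qed
  note eq = this
  have "Z n \<in> borel_measurable Q"
   "(\<lambda>w. (blocks l n w - n * mean (y l)) / sqrt (n * l)) \<in> borel_measurable Q" unfolding Z_def[abs_def] by measurable
  then show ?thesis by (simp only: Q.char_distr_eq eq)
 qed
 ultimately show ?thesis by (simp add: char_std_normal_distribution power_mult_distrib)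
qed

text \<open>There are two scales: first a block length l with 32 C / sqrt l small and
  \<open>nsdev l\<close> close to \<sigma>, then n to infinity. By \<open>sdev_block_error\<close>
  the functional differs from its centred block sum by order sqrt r in mean, that is by 1 / sqrt l
  after normalisation, uniformly in n. The block sum obeys the classical theorem.\<close>

lemma y_char_limit:
 assumes \<sigma>: "0 < \<sigma>"
 shows "(\<lambda>n. char (distr Q borel (\<lambda>w. y (Suc n) w / sqrt (Suc n))) u) \<longlonglongrightarrow> exp (- \<sigma>\<^sup>2 * u\<^sup>2 / 2)"
proof (rule tendstoI)
 define G where "G x = complex_of_real (exp (- x\<^sup>2 * u\<^sup>2 / 2))" for x
 fix e :: real assume e: "0 < e"
 have l1: "(\<lambda>l. \<bar>u\<bar> * (32 * C / sqrt (real l))) \<longlonglongrightarrow> 0" by real_asymp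
 have l2: "(\<lambda>l. G (nsdev l)) \<longlonglongrightarrow> G \<sigma>"
  unfolding G_def by (intro tendsto_intros nsdev_tendsto) simp
 have "\<forall>\<^sub>F l in sequentially. 1 \<le> l \<and> 0 < nsdev l \<and> \<bar>u\<bar> * (32 * C / sqrt (real l)) < e / 4
   \<and> dist (G (nsdev l)) (G \<sigma>) < e / 4"
  using eventually_ge_at_top[of 1] order_tendstoD(1)[OF nsdev_tendsto \<sigma>] order_tendstoD(2)[OF l1, of "e / 4"] tendstoD[OF l2, of "e / 4"] e
  by (auto simp: eventually_conj_iff)
 then obtain l where l: "1 \<le> l" and wl: "0 < nsdev l" and b1: "\<bar>u\<bar> * (32 * C / sqrt (real l)) < e / 4"
  and b2: "dist (G (nsdev l)) (G \<sigma>) < e / 4"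
  using eventually_happens by (metis (mono_tags, lifting) sequentially_bot)
 define T where "T r w = (blocks l r w - real r * mean (y l)) / sqrt (real r * real l)" for r :: nat and w
 have clt: "(\<lambda>r. char (distr Q borel (T r)) u) \<longlonglongrightarrow> G (nsdev l)"
  unfolding T_def[abs_def] G_def using blocks_clt[OF l wl, of u] by simp
 have divlim: "filterlim (\<lambda>n. Suc n div l) at_top sequentially" unfolding filterlim_at_top
 proof
  fix Z
  show "\<forall>\<^sub>F n in sequentially. Z \<le> Suc n div l" using eventually_ge_at_top[of "Z * l"]
  proof eventually_elim
   case (elim n)
   have "Z * l div l \<le> Suc n div l" using elim by (intro div_le_mono) auto
   then show ?case using l by simp
  qed
 qed
 have clt': "\<forall>\<^sub>F n in sequentially. dist (char (distr Q borel (T (Suc n div l))) u) (G (nsdev l)) < e / 4"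
  using tendstoD[OF filterlim_compose[OF clt divlim], of "e / 4"] e by simp
 have small: "(\<lambda>n. \<bar>u\<bar> * (C * (2 + real l) / sqrt (Suc n) + nsdev l * real l / Suc n)) \<longlonglongrightarrow> 0"
 proof -
  have "(\<lambda>n. k / sqrt (Suc n)) \<longlonglongrightarrow> 0" "(\<lambda>n. k / Suc n) \<longlonglongrightarrow> 0" for k :: real by real_asymp+
  then have "(\<lambda>n. \<bar>u\<bar> * (C * (2 + real l) / sqrt (Suc n) + nsdev l * real l / Suc n)) \<longlonglongrightarrow> \<bar>u\<bar> * (0 + 0)"
   by (intro tendsto_mult tendsto_const tendsto_add)
  then show ?thesis by simp
 qed
 have small': "\<forall>\<^sub>F n in sequentially. \<bar>u\<bar> * (C * (2 + real l) / sqrt (Suc n) + nsdev l * real l / Suc n) < e / 4"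
  using order_tendstoD(2)[OF small, of "e / 4"] e by simp
 have "\<forall>\<^sub>F n in sequentially. dist (char (distr Q borel (\<lambda>w. y (Suc n) w / sqrt (Suc n))) u) (G \<sigma>) < e"
  using clt' small' eventually_ge_at_top[of l]
 proof eventually_elim
  case (elim n)
  define N where "N = Suc n"
  define r where "r = N div l"
  define \<mu> where "\<mu> = mean (y l)"
  define X where "X w = y N w / sqrt N" for w
  have r: "1 \<le> r" using elim(3) l by (simp add: r_def N_def Suc_le_eq div_greater_zero_iff)
  have rl: "1 \<le> r * l" "r * l \<le> N" "N \<le> r * l + l"
  proof -
   show "1 \<le> r * l" using r l by (simp add: Suc_le_eq)
   show "r * l \<le> N" by (simp add: r_def)
   have "N = r * l + N mod l" by (simp add: r_def)
   moreover have "N mod l < l" using l by simp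
   ultimately show "N \<le> r * l + l" by linarith
  qed
  have N: "1 \<le> N" by (simp add: N_def)
  define S where "S w = blocks l r w - real r * \<mu>" for w
  have bS: "Q.bdd_rv S" unfolding S_def by (intro rv_intros blocks_bdd l)
  have bX: "Q.bdd_rv X" and bT: "Q.bdd_rv (T r)"
   unfolding X_def T_def divide_inverse by (intro rv_intros y_bdd N blocks_bdd l)+
  have ES: "mean S = 0" unfolding S_def blocks_def \<mu>_def
   using rv_integrable[OF bdd_rv_shift[OF y_bdd[OF l]]] rv_meas[OF y_bdd[OF l]] by (simp add: integral_shift Q.prob_space)
  have "Q.sdev S = Q.sdev (blocks l r)"
   unfolding Q.sdev_def S_def using rv_integrable[OF blocks_bdd[OF l]] by (simp add: Q.prob_space)
  also have "... = nsdev l * sqrt (real r * real l)" using l by (simp add: sdev_blocks nsdev_def real_sqrt_mult)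
  finally have sdS: "Q.sdev S = nsdev l * sqrt (real r * real l)" .
  have absS: "mean (\<lambda>w. \<bar>S w\<bar>) \<le> nsdev l * sqrt (real r * real l)"
   using Q.expectation_abs_le_sdev[OF bS] by (simp add: ES sdS)
  define R where "R w = y (r * l) w - blocks l r w" for w
  have bR: "Q.bdd_rv R" unfolding R_def by (intro rv_intros y_bdd rl blocks_bdd l)
  have ER: "\<bar>mean R + real r * \<mu>\<bar> \<le> C"
  proof -
   have "mean (\<lambda>w. R w + S w) = mean R" using ES rv_integrable[OF bR] rv_integrable[OF bS] by simp
   moreover have "mean (\<lambda>w. R w + S w) = mean (y (r * l)) - real r * \<mu>"
    unfolding R_def S_def using rv_integrable[OF y_bdd[OF rl(1)]] by (simp add: Q.prob_space)
   ultimately show ?thesis using mean_bd[OF rl(1)] by simp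
  qed
  have near: "\<bar>y N w - y (r * l) w\<bar> \<le> C * (1 + real l)" for w
  proof (cases "N = r * l")
   case True then show ?thesis using C_nonneg by simp
  next
   case False
   have d: "1 \<le> N - r * l" "N - r * l \<le> l" using False rl by auto
   have "\<bar>y (r * l + (N - r * l)) w - y (r * l) w - y (N - r * l) (shift (int (r * l)) w)\<bar> \<le> C"
    by (rule y_quasi[OF rl(1) d(1)])
   moreover have "\<bar>y (N - r * l) (shift (int (r * l)) w)\<bar> \<le> C * real (N - r * l)" by (rule y_lin[OF d(1)])
   moreover have "C * real (N - r * l) \<le> C * real l" by (rule mult_left_mono[OF of_nat_mono[OF d(2)] C_nonneg])
   ultimately show ?thesis using rl by (simp add: algebra_simps abs_le_iff)
  qed
  have diffS: "mean (\<lambda>w. \<bar>y N w - S w\<bar>) \<le> 32 * C * sqrt r + C * (2 + real l)"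
  proof -
   have "mean (\<lambda>w. \<bar>y N w - S w\<bar>) \<le> mean (\<lambda>w. \<bar>R w - mean R\<bar> + C * (2 + real l))"
   proof (rule integral_mono)
    fix w
    have "y N w - S w = (y N w - y (r * l) w) + (R w - mean R) + (mean R + real r * \<mu>)" by (simp add: S_def R_def)
    then show "\<bar>y N w - S w\<bar> \<le> \<bar>R w - mean R\<bar> + C * (2 + real l)" using near[of w] ER by (simp add: algebra_simps)
   qed (intro rv_integrable rv_intros y_bdd N bS bR)+
   also have "... = mean (\<lambda>w. \<bar>R w - mean R\<bar>) + C * (2 + real l)"
   proof -
    have "integrable Q (\<lambda>w. \<bar>R w - mean R\<bar>)" by (intro rv_integrable rv_intros bR)
    then show ?thesis by (simp add: Q.prob_space)
   qed
   also have "mean (\<lambda>w. \<bar>R w - mean R\<bar>) \<le> 32 * C * sqrt r"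
    using Q.expectation_abs_le_sdev[OF bR] sdev_block_error[OF l r] by (simp add: R_def[abs_def])
   finally show ?thesis by simp
  qed
  have pos: "0 < sqrt (real r * real l)" "0 < sqrt N" "0 < sqrt (real l)" using r l N by auto
  have EXT: "mean (\<lambda>w. \<bar>X w - T r w\<bar>) \<le> 32 * C / sqrt l + (C * (2 + real l) / sqrt N + nsdev l * real l / N)"
  proof -
   \<comment> \<open>The cost of replacing the norming constant sqrt (r l) by sqrt N.\<close>
   define \<delta> where "\<delta> = 1 / sqrt (real r * real l) - 1 / sqrt N"
   have rlN: "sqrt (real r * real l) \<le> sqrt N" using rl(2) by (metis of_nat_le_iff of_nat_mult real_sqrt_le_mono)
   have \<delta>0: "0 \<le> \<delta>" unfolding \<delta>_def using rlN pos by (simp add: frac_le)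
   have "mean (\<lambda>w. \<bar>X w - T r w\<bar>) \<le> mean (\<lambda>w. (1 / sqrt N) * \<bar>y N w - S w\<bar> + \<delta> * \<bar>S w\<bar>)"
   proof (rule integral_mono)
    fix w
    have "X w - T r w = (1 / sqrt N) * (y N w - S w) - \<delta> * S w"
    proof -
     have "T r w = S w / sqrt (real r * real l)" by (simp add: T_def S_def \<mu>_def)
     then show ?thesis by (simp add: X_def \<delta>_def algebra_simps)
    qed
    then have "\<bar>X w - T r w\<bar> \<le> \<bar>(1 / sqrt N) * (y N w - S w)\<bar> + \<bar>\<delta> * S w\<bar>" by linarith
    then show "\<bar>X w - T r w\<bar> \<le> (1 / sqrt N) * \<bar>y N w - S w\<bar> + \<delta> * \<bar>S w\<bar>" using \<delta>0 by (simp add: abs_mult)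
   qed (intro rv_integrable rv_intros bX bT y_bdd N bS)+
   also have "... = (1 / sqrt N) * mean (\<lambda>w. \<bar>y N w - S w\<bar>) + \<delta> * mean (\<lambda>w. \<bar>S w\<bar>)"
   proof -
    have "integrable Q (\<lambda>w. \<bar>y N w - S w\<bar>)" "integrable Q (\<lambda>w. \<bar>S w\<bar>)" by (intro rv_integrable rv_intros y_bdd N bS)+
    then show ?thesis by simp
   qed
   also have "... \<le> (1 / sqrt N) * (32 * C * sqrt r + C * (2 + real l)) + \<delta> * (nsdev l * sqrt (real r * real l))"
    using \<delta>0 by (intro add_mono mult_left_mono diffS absS) auto
   also have "(1 / sqrt N) * (32 * C * sqrt r + C * (2 + real l)) \<le> 32 * C / sqrt l + C * (2 + real l) / sqrt N"
   proof -
    have "sqrt r / sqrt N \<le> 1 / sqrt l" using rlN pos by (simp add: field_simps real_sqrt_mult)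
    then have "32 * C * (sqrt r / sqrt N) \<le> 32 * C * (1 / sqrt l)" using C_nonneg by (intro mult_left_mono) auto
    then show ?thesis by (simp add: add_divide_distrib)
   qed
   also have "\<delta> * (nsdev l * sqrt (real r * real l)) \<le> nsdev l * real l / N"
   proof -
    define q where "q = sqrt (real r * real l) / sqrt N"
    have q: "0 \<le> q" "q \<le> 1" using rlN pos by (auto simp: q_def)
    have q2: "q\<^sup>2 = real r * real l / N" unfolding q_def power_divide by simp
    have "real N \<le> real r * real l + real l" using rl(3) by (metis of_nat_add of_nat_le_iff of_nat_mult)
    then have "(real N - real l) / N \<le> (real r * real l) / N" by (intro divide_right_mono) auto
    then have "1 - real l / N \<le> q\<^sup>2" using N by (simp add: q2 diff_divide_distrib)
    moreover have "q\<^sup>2 \<le> q" using q by (simp add: power2_eq_square mult_left_le)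
    ultimately have "1 - q \<le> real l / N" by linarith
    then have "nsdev l * (1 - q) \<le> nsdev l * (real l / N)" using wl by (intro mult_left_mono) auto
    moreover have "\<delta> * (nsdev l * sqrt (real r * real l)) = nsdev l * (1 - q)"
    proof -
     have "(1 / s1 - 1 / s2) * (nsdev l * s1) = nsdev l * (1 - s1 / s2)" if "0 < s1" "0 < s2" for s1 s2 :: real
      using that by (simp add: field_simps)
     from this[OF pos(1,2)] show ?thesis by (simp only: \<delta>_def q_def)
    qed
    ultimately show ?thesis by (simp only: times_divide_eq_right)
   qed
   finally show ?thesis by simp
  qed
  have "cmod (char (distr Q borel X) u - char (distr Q borel (T r)) u) \<le> \<bar>u\<bar> * mean (\<lambda>w. \<bar>X w - T r w\<bar>)"
   by (rule Q.char_distr_diff_le[OF bX bT])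
  also have "... \<le> \<bar>u\<bar> * (32 * C / sqrt l + (C * (2 + real l) / sqrt N + nsdev l * real l / N))"
   using EXT by (rule mult_left_mono) simp
  also have "... < e / 4 + e / 4" unfolding N_def distrib_left[of "\<bar>u\<bar>" "32 * C / sqrt (real l)"] by (rule add_strict_mono[OF b1 elim(2)])
  finally have "dist (char (distr Q borel X) u) (char (distr Q borel (T r)) u) < e / 2" by (simp add: dist_norm)
  moreover have "dist (char (distr Q borel (T r)) u) (G (nsdev l)) < e / 4" using elim(1) by (simp add: r_def N_def)
  ultimately have "dist (char (distr Q borel X) u) (G \<sigma>) < e"
   using b2 dist_triangle[of "char (distr Q borel X) u" "G \<sigma>" "G (nsdev l)"]
    dist_triangle[of "char (distr Q borel X) u" "G (nsdev l)" "char (distr Q borel (T r)) u"] by linarith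
  then show ?case by (simp add: X_def[abs_def] N_def)
 qed
 then show "\<forall>\<^sub>F n in sequentially. dist (char (distr Q borel (\<lambda>w. y (Suc n) w / sqrt (Suc n))) u) (exp (- \<sigma>\<^sup>2 * u\<^sup>2 / 2)) < e"
  by (simp only: G_def)
qed

lemma y_clt:
 assumes \<sigma>: "0 < \<sigma>"
 shows "weak_conv_m (\<lambda>n. distr Q borel (\<lambda>w. y (Suc n) w / (\<sigma> * sqrt (Suc n)))) std_normal_distribution"
proof (rule levy_continuity)
 have m [measurable]: "y (Suc n) \<in> borel_measurable Q" for n by (rule rv_meas[OF y_bdd]) simp
 show "real_distribution (distr Q borel (\<lambda>w. y (Suc n) w / (\<sigma> * sqrt (Suc n))))" for n
  by (rule Q.real_distribution_distr) measurable
 show "real_distribution std_normal_distribution" by (rule real_dist_normal_dist)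
 fix u
 have "char (distr Q borel (\<lambda>w. y (Suc n) w / (\<sigma> * sqrt (Suc n)))) u = char (distr Q borel (\<lambda>w. y (Suc n) w / sqrt (Suc n))) (u / \<sigma>)" for n
  by (simp add: char_def integral_distr mult.commute)
 then show "(\<lambda>n. char (distr Q borel (\<lambda>w. y (Suc n) w / (\<sigma> * sqrt (Suc n)))) u) \<longlonglongrightarrow> char std_normal_distribution u"
  using y_char_limit[OF \<sigma>, of "u / \<sigma>"] \<sigma> by (simp add: char_std_normal_distribution power_divide)
qed

lemma isCont_cdf_std_normal: "isCont (cdf std_normal_distribution) x"
proof -
 interpret real_distribution std_normal_distribution by (rule real_dist_normal_dist)
 have "emeasure std_normal_distribution {x} = 0" by (subst emeasure_density) (auto simp: nn_integral_indicator_singleton)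
 then show ?thesis by (simp add: isCont_cdf measure_def)
qed

text \<open>The threshold moves with the index; it is caught between two fixed ones near x0 /
  \<sigma>, where the normal distribution function is continuous.\<close>

lemma y_clt_moving:
 fixes N :: "'d \<Rightarrow> nat" and x :: "'d \<Rightarrow> real"
 assumes \<sigma>: "0 < \<sigma>" and N: "filterlim N at_top F" and x: "(x \<longlongrightarrow> x0) F"
 shows "((\<lambda>t. Q.prob {w. y (N t) w < x t * sqrt (N t)}) \<longlongrightarrow> cdf std_normal_distribution (x0 / \<sigma>)) F"
proof (rule tendstoI)
 fix e :: real assume e: "0 < e"
 let ?\<Phi> = "cdf std_normal_distribution"
 have m [measurable]: "y (Suc n) \<in> borel_measurable Q" for n by (rule rv_meas[OF y_bdd]) simp
 obtain d where d: "0 < d" and dc: "\<And>z. dist z (x0 / \<sigma>) < d \<Longrightarrow> dist (?\<Phi> z) (?\<Phi> (x0 / \<sigma>)) < e / 2"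
  using isCont_cdf_std_normal[of "x0 / \<sigma>"] e unfolding continuous_at_eps_delta by (metis half_gt_zero)
 have lim: "(\<lambda>n. cdf (distr Q borel (\<lambda>w. y (Suc n) w / (\<sigma> * sqrt (Suc n)))) z) \<longlonglongrightarrow> ?\<Phi> z" for z
  using y_clt[OF \<sigma>] isCont_cdf_std_normal[of z] by (auto simp: weak_conv_m_def weak_conv_def)
 have cdf_eq: "cdf (distr Q borel (\<lambda>w. y (Suc n) w / (\<sigma> * sqrt (Suc n)))) z = Q.prob {w. y (Suc n) w \<le> z * \<sigma> * sqrt (Suc n)}" for n z
 proof -
  have "y (Suc n) w / (\<sigma> * sqrt (Suc n)) \<le> z \<longleftrightarrow> y (Suc n) w \<le> z * \<sigma> * sqrt (Suc n)" for w
   using \<sigma> by (simp add: pos_divide_le_eq mult.assoc)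
  then show ?thesis unfolding cdf_def by (subst measure_distr) (auto simp: vimage_def space_Q)
 qed
 define z1 z2 where "z1 = x0 / \<sigma> - d / 2" and "z2 = x0 / \<sigma> + d / 2"
 have ev: "\<forall>\<^sub>F n in sequentially. \<bar>Q.prob {w. y (Suc n) w \<le> z * \<sigma> * sqrt (Suc n)} - ?\<Phi> z\<bar> < e / 2" for z
  using tendstoD[OF lim, of "e / 2" z] e unfolding cdf_eq by (simp add: dist_real_def)
 have pred: "filterlim (\<lambda>t. N t - 1) at_top F" by (rule filterlim_compose[OF filterlim_minus_const_nat_at_top N])
 have ev': "\<forall>\<^sub>F t in F. \<bar>Q.prob {w. y (Suc (N t - 1)) w \<le> z * \<sigma> * sqrt (Suc (N t - 1))} - ?\<Phi> z\<bar> < e / 2" for z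
  using eventually_compose_filterlim[OF ev pred] .
 have N1: "\<forall>\<^sub>F t in F. 1 \<le> N t" using N by (simp add: filterlim_at_top)
 have xe: "\<forall>\<^sub>F t in F. z1 * \<sigma> < x t \<and> x t < z2 * \<sigma>"
  using order_tendstoD(1)[OF x, of "z1 * \<sigma>"] order_tendstoD(2)[OF x, of "z2 * \<sigma>"] d \<sigma>
  by (auto simp: z1_def z2_def algebra_simps eventually_conj_iff)
 show "\<forall>\<^sub>F t in F. dist (Q.prob {w. y (N t) w < x t * sqrt (N t)}) (?\<Phi> (x0 / \<sigma>)) < e"
  using ev'[of z1] ev'[of z2] N1 xe
 proof eventually_elim
  case (elim t)
  define n where "n = N t - 1"
  have Nn: "N t = Suc n" using elim(3) by (simp add: n_def)
  have s: "0 < sqrt (Suc n)" by simp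
  have ms: "{w. y (Suc n) w < c} \<in> Q.events" "{w. y (Suc n) w \<le> c} \<in> Q.events" for c
   using measurable_sets[OF m[of n], of "{..<c}"] measurable_sets[OF m[of n], of "{..c}"] by (auto simp: vimage_def space_Q)
  have lt1: "z1 * \<sigma> * sqrt (Suc n) < x t * sqrt (Suc n)" and lt2: "x t * sqrt (Suc n) \<le> z2 * \<sigma> * sqrt (Suc n)"
   using elim(4) s by (auto simp del: of_nat_Suc)
  have "Q.prob {w. y (Suc n) w \<le> z1 * \<sigma> * sqrt (Suc n)} \<le> Q.prob {w. y (Suc n) w < x t * sqrt (Suc n)}"
   by (intro Q.finite_measure_mono ms Collect_mono impI) (rule order.strict_trans1[OF _ lt1])
  moreover have "Q.prob {w. y (Suc n) w < x t * sqrt (Suc n)} \<le> Q.prob {w. y (Suc n) w \<le> z2 * \<sigma> * sqrt (Suc n)}"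
   by (intro Q.finite_measure_mono ms Collect_mono impI) (rule order_trans[OF less_imp_le lt2])
  moreover have "dist (?\<Phi> z1) (?\<Phi> (x0 / \<sigma>)) < e / 2" "dist (?\<Phi> z2) (?\<Phi> (x0 / \<sigma>)) < e / 2"
   by (rule dc, use d in \<open>simp add: z1_def z2_def dist_real_def\<close>)+
  ultimately show ?case using elim(1,2) unfolding Nn diff_Suc_1 dist_real_def by linarith
 qed
qed

end

subsection \<open>Valleys of a path\<close>

text \<open>
 Heights are measured in units of \<open>ln t\<close>: up to time \<open>t\<close> the walk crosses barriers lower than \<open>1\<close>
 and does not cross barriers higher than \<open>1\<close>.
\<close>

definition valley_right :: "path \<Rightarrow> int \<Rightarrow> real \<Rightarrow> int \<Rightarrow> int \<Rightarrow> bool" where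
 "valley_right s N d r \<beta> \<longleftrightarrow> 0 \<le> \<beta> \<and> (\<exists>L R. - N \<le> L \<and> L < 0 \<and> \<beta> < R \<and> R < N \<and>
   (\<forall>i k. L \<le> i \<longrightarrow> i \<le> k \<longrightarrow> 0 \<le> k \<longrightarrow> k \<le> \<beta> \<longrightarrow> s k - s i \<le> 1 - d) \<and>
   (\<forall>k. 0 \<le> k \<longrightarrow> k \<le> \<beta> \<longrightarrow> s k + d \<le> s L) \<and>
   s \<beta> + 1 + d \<le> s L \<and> s \<beta> + 1 + d \<le> s R \<and>
   (\<forall>k. L \<le> k \<longrightarrow> k \<le> R \<longrightarrow> r < \<bar>k - \<beta>\<bar> \<longrightarrow> s \<beta> + d \<le> s k))"

text \<open>The reflection k -> -1 - k, unlike k -> -k, maps half-open blocks [i q, (i + 1) q) to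
  blocks; the same holds for the cells of sites that the integers will stand for.\<close>

definition mirror :: "path \<Rightarrow> int \<Rightarrow> real" where "mirror s k = s (- 1 - k)"

definition valley :: "path \<Rightarrow> int \<Rightarrow> real \<Rightarrow> int \<Rightarrow> int \<Rightarrow> bool" where
 "valley s N d r \<beta> \<longleftrightarrow> valley_right s N d r \<beta> \<or> valley_right (mirror s) N d r (- 1 - \<beta>)"

definition lo :: "int \<Rightarrow> path \<Rightarrow> int \<Rightarrow> real" where
 "lo q s i = Min (s ` {i * q..<(i + 1) * q})"

definition hi :: "int \<Rightarrow> path \<Rightarrow> int \<Rightarrow> real" where
 "hi q s i = Max (s ` {i * q..<(i + 1) * q})"

text \<open>Blocks at distance at least 2 have a whole block of independent increments between them,
  which is what makes near ties unlikely. The last inequality excludes height differences close to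
  the critical size 1.\<close>

definition separated :: "int \<Rightarrow> int \<Rightarrow> real \<Rightarrow> path \<Rightarrow> bool" where
 "separated q K d s \<longleftrightarrow> (\<forall>i j. i \<in> {-K..<K} \<longrightarrow> j \<in> {-K..<K} \<longrightarrow> 2 \<le> \<bar>i - j\<bar> \<longrightarrow>
   d < \<bar>lo q s i - lo q s j\<bar> \<and> d < \<bar>hi q s i - hi q s j\<bar> \<and> d < \<bar>hi q s i - lo q s j - 1\<bar>)"

definition ascent :: "int \<Rightarrow> int \<Rightarrow> real \<Rightarrow> path \<Rightarrow> bool" where
 "ascent q K c s \<longleftrightarrow> (\<exists>i j. 0 \<le> i \<and> i \<le> j \<and> j < K \<and> c \<le> hi q s j - lo q s i)"

text \<open>Blocks 0 and -1 are adjacent, so \<open>separated\<close> does not tell their extrema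
  apart. This condition keeps the extrema of the right half that decide between the two sides out of
  block 0.\<close>

definition off_center :: "int \<Rightarrow> int \<Rightarrow> path \<Rightarrow> bool" where
 "off_center q S s \<longleftrightarrow> (\<exists>i\<in>{2..<S}. hi q s 0 < hi q s i) \<and> (\<exists>i\<in>{2..<S}. lo q s i < lo q s 0)"

text \<open>The bounds are small fractions of 1: an ascent of size 1 fits neither into two adjacent
  blocks nor into the first \<open>S\<close> blocks.\<close>

definition tame :: "int \<Rightarrow> int \<Rightarrow> int \<Rightarrow> path \<Rightarrow> bool" where
 "tame q K S s \<longleftrightarrow> (\<forall>i\<in>{-K..<K}. \<forall>k\<in>{i * q..(i + 1) * q}. \<bar>s k - s (i * q)\<bar> \<le> 1 / 8) \<and>
   (\<forall>k\<in>{0..<S * q}. \<bar>s k\<bar> \<le> 1 / 4)"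

context
 fixes q :: int assumes q: "0 < q"
begin

lemma block_nonempty: "{i * q..<(i + 1) * q} \<noteq> {}" using q by (auto simp: algebra_simps)

lemma mem_block: "k \<in> {(k div q) * q..<(k div q + 1) * q}"
proof -
 have "k - k div q * q = k mod q" by (rule minus_div_mult_eq_mod)
 moreover have "0 \<le> k mod q" "k mod q < q" using q by auto
 moreover have "(k div q + 1) * q = k div q * q + q" by (simp add: distrib_right)
 ultimately show ?thesis unfolding atLeastLessThan_iff by linarith
qed

lemma div_block: "k \<in> {i * q..<(i + 1) * q} \<Longrightarrow> k div q = i"
 by (rule int_div_pos_eq[of k q i "k - i * q"]) (auto simp: algebra_simps)

lemma lo_le: "lo q s (k div q) \<le> s k"
 unfolding lo_def by (rule Min_le) (use mem_block in auto)

lemma hi_ge: "s k \<le> hi q s (k div q)"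
 unfolding hi_def by (rule Max_ge) (use mem_block in auto)

lemma lo_attained: obtains k where "k div q = i" "s k = lo q s i"
proof -
 have "lo q s i \<in> s ` {i * q..<(i + 1) * q}" unfolding lo_def using block_nonempty by (intro Min_in) auto
 then obtain k where "k \<in> {i * q..<(i + 1) * q}" "s k = lo q s i" by auto
 then show ?thesis using that div_block by blast
qed

lemma hi_attained: obtains k where "k div q = i" "s k = hi q s i"
proof -
 have "hi q s i \<in> s ` {i * q..<(i + 1) * q}" unfolding hi_def using block_nonempty by (intro Max_in) auto
 then obtain k where "k \<in> {i * q..<(i + 1) * q}" "s k = hi q s i" by auto
 then show ?thesis using that div_block by blast
qed

lemma mirror_div: "(- 1 - k) div q = - 1 - k div q"
proof -
 have "- 1 - k \<in> {(- 1 - k div q) * q..<(- 1 - k div q + 1) * q}" using mem_block[of k] by (auto simp: algebra_simps)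
 then show ?thesis by (rule div_block)
qed

lemma lo_mirror: "lo q (mirror s) i = lo q s (- 1 - i)"
proof (rule antisym)
 obtain k where "k div q = - 1 - i" "s k = lo q s (- 1 - i)" by (rule lo_attained)
 then show "lo q (mirror s) i \<le> lo q s (- 1 - i)" using lo_le[of "mirror s" "- 1 - k"] mirror_div[of k] by (simp add: mirror_def)
 obtain k where "k div q = i" "mirror s k = lo q (mirror s) i" by (rule lo_attained)
 then show "lo q s (- 1 - i) \<le> lo q (mirror s) i" using lo_le[of s "- 1 - k"] mirror_div[of k] by (simp add: mirror_def)
qed

lemma hi_mirror: "hi q (mirror s) i = hi q s (- 1 - i)"
proof (rule antisym)
 obtain k where "k div q = - 1 - i" "s k = hi q s (- 1 - i)" by (rule hi_attained)
 then show "hi q s (- 1 - i) \<le> hi q (mirror s) i" using hi_ge[of "mirror s" "- 1 - k"] mirror_div[of k] by (simp add: mirror_def)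
 obtain k where "k div q = i" "mirror s k = hi q (mirror s) i" by (rule hi_attained)
 then show "hi q (mirror s) i \<le> hi q s (- 1 - i)" using hi_ge[of s "- 1 - k"] mirror_div[of k] by (simp add: mirror_def)
qed

lemma mirror_mirror: "mirror (mirror s) = s" by (simp add: mirror_def fun_eq_iff)

lemma separated_mirror: assumes "separated q K d s" shows "separated q K d (mirror s)"
 unfolding separated_def lo_mirror hi_mirror
proof (intro allI impI)
 fix i j assume "i \<in> {-K..<K}" "j \<in> {-K..<K}" "2 \<le> \<bar>i - j\<bar>"
 then have "- 1 - i \<in> {-K..<K}" "- 1 - j \<in> {-K..<K}" "2 \<le> \<bar>(- 1 - i) - (- 1 - j)\<bar>" by auto
 then show "d < \<bar>lo q s (- 1 - i) - lo q s (- 1 - j)\<bar> \<and> d < \<bar>hi q s (- 1 - i) - hi q s (- 1 - j)\<bar> \<and>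
   d < \<bar>hi q s (- 1 - i) - lo q s (- 1 - j) - 1\<bar>"
  using assms unfolding separated_def by blast
qed

lemma tame_near:
 assumes t: "tame q K S s" and i: "k div q \<in> {-K..<K}" "k' div q \<in> {-K..<K}" "\<bar>k div q - k' div q\<bar> \<le> 1"
 shows "\<bar>s k - s k'\<bar> \<le> 3 / 8"
proof -
 have own: "\<bar>s k - s (k div q * q)\<bar> \<le> 1 / 8" if "k div q \<in> {-K..<K}" for k
  using t that mem_block[of k] unfolding tame_def by (auto dest!: bspec[of _ _ "k div q"])
 have next_block: "\<bar>s ((i + 1) * q) - s (i * q)\<bar> \<le> 1 / 8" if "i \<in> {-K..<K}" for i
 proof -
  have "(i + 1) * q \<in> {i * q..(i + 1) * q}" using q by (auto simp: algebra_simps)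
  then show ?thesis using t that unfolding tame_def by blast
 qed
 consider "k div q = k' div q" | "k div q = k' div q + 1" | "k' div q = k div q + 1" using i(3) by linarith
 then show ?thesis
 proof cases
  case 1 then show ?thesis using own[OF i(1), unfolded 1] own[OF i(2)] by linarith
 next
  case 2 then show ?thesis using own[OF i(1), unfolded 2] own[OF i(2)] next_block[OF i(2)] by linarith
 next
  case 3 then show ?thesis using own[OF i(1)] own[OF i(2), unfolded 3] next_block[OF i(1)] by linarith
 qed
qed

lemma tame_mirror_near:
 assumes t: "tame q K S s" and i: "k div q \<in> {-K..<K}" "k' div q \<in> {-K..<K}" "\<bar>k div q - k' div q\<bar> \<le> 1"
 shows "\<bar>mirror s k - mirror s k'\<bar> \<le> 3 / 8"
 unfolding mirror_def by (rule tame_near[OF t]) (use i in \<open>auto simp: mirror_div\<close>)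

text \<open>
 The bottom \<open>bt\<close> of the first ascent of size \<open>1\<close> to the right of the origin, which is completed in
 block \<open>tp\<close>.
\<close>

definition first_ascent :: "int \<Rightarrow> path \<Rightarrow> int \<Rightarrow> int \<Rightarrow> bool" where
 "first_ascent K s bt tp \<longleftrightarrow> 0 \<le> bt \<and> bt \<le> tp \<and> tp < K \<and>
   (\<forall>i\<in>{0..tp}. lo q s bt \<le> lo q s i) \<and> 1 \<le> hi q s tp - lo q s bt \<and>
   (\<forall>i j. 0 \<le> i \<longrightarrow> i \<le> j \<longrightarrow> j < tp \<longrightarrow> hi q s j - lo q s i < 1)"

text \<open>The level that a wall on the left must exceed for \<open>bt\<close> to be the bottom of
  the valley: it has to top everything on the way from 0 to \<open>bt\<close>, and it has to lie 1
  above the bottom. The half-line with the lower barrier will win.\<close>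

definition barrier :: "path \<Rightarrow> int \<Rightarrow> real" where
 "barrier s bt = max (Max (hi q s ` {0..bt})) (lo q s bt + 1)"

lemma first_ascent_exists:
 assumes "ascent q K 1 s" obtains bt tp where "first_ascent K s bt tp"
proof -
 define P where "P j \<longleftrightarrow> (\<exists>i. 0 \<le> i \<and> i \<le> int j \<and> 1 \<le> hi q s (int j) - lo q s i)" for j
 obtain i0 j0 where ij: "0 \<le> i0" "i0 \<le> j0" "j0 < K" "1 \<le> hi q s j0 - lo q s i0" using assms by (auto simp: ascent_def)
 then have P0: "P (nat j0)" unfolding P_def by (intro exI[of _ i0]) auto
 define tp where "tp = (LEAST j. P j)"
 have Pt: "P tp" unfolding tp_def by (rule LeastI[where P=P, OF P0])
 have least: "\<not> P j" if "j < tp" for j using not_less_Least[of j P] that by (simp add: tp_def)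
 have "tp \<le> nat j0" unfolding tp_def by (rule Least_le[where P=P, OF P0])
 then have topK: "int tp < K" using ij by linarith
 obtain i1 where i1: "0 \<le> i1" "i1 \<le> int tp" "1 \<le> hi q s (int tp) - lo q s i1" using Pt by (auto simp: P_def)
 have "Min (lo q s ` {0..int tp}) \<in> lo q s ` {0..int tp}" by (intro Min_in) auto
 then obtain bt where bt: "bt \<in> {0..int tp}" "Min (lo q s ` {0..int tp}) = lo q s bt" by (elim imageE)
 have min: "lo q s bt \<le> lo q s i" if "i \<in> {0..int tp}" for i
  unfolding bt(2)[symmetric] using that by (intro Min_le) auto
 have "first_ascent K s bt (int tp)" unfolding first_ascent_def
 proof (intro conjI ballI allI impI)
  show "1 \<le> hi q s (int tp) - lo q s bt" using min[of i1] i1 by simp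
  fix i j assume "0 \<le> i" "i \<le> j" "j < int tp"
  then have "\<not> P (nat j)" using least[of "nat j"] by simp
  then show "hi q s j - lo q s i < 1" unfolding P_def using \<open>0 \<le> i\<close> \<open>i \<le> j\<close> by auto
 qed (use bt topK min in auto)
 then show ?thesis using that by blast
qed

lemma div_less_iff_block: "k div q < i \<longleftrightarrow> k < i * q"
proof
 assume "k div q < i"
 then have "(k div q + 1) * q \<le> i * q" using q by (intro mult_right_mono) auto
 then show "k < i * q" using mem_block[of k] by auto
next
 assume "k < i * q"
 show "k div q < i"
 proof (rule ccontr)
  assume "\<not> k div q < i"
  then have "i * q \<le> k div q * q" using q by (intro mult_right_mono) auto
  then show False using mem_block[of k] \<open>k < i * q\<close> by auto
 qed
qed

lemma div_nonneg_iff: "0 \<le> k div q \<longleftrightarrow> 0 \<le> k"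
 using q by (simp add: pos_imp_zdiv_nonneg_iff)

lemma div_mono_block: "k \<le> k' \<Longrightarrow> k div q \<le> k' div q" by (rule zdiv_mono1[OF _ q])

text \<open>Adjacent blocks differ by at most 3 / 8 < 1. The gap makes \<open>separated\<close>
  applicable to the pair \<open>bt\<close>, \<open>tp\<close>.\<close>

lemma first_ascent_gap:
 assumes near: "\<And>k k'. k div q \<in> {-K..<K} \<Longrightarrow> k' div q \<in> {-K..<K} \<Longrightarrow> \<bar>k div q - k' div q\<bar> \<le> 1 \<Longrightarrow> \<bar>s k - s k'\<bar> \<le> 3 / 8"
  and fa: "first_ascent K s bt tp"
 shows "bt + 2 \<le> tp"
proof (rule ccontr)
 assume "\<not> bt + 2 \<le> tp"
 moreover have b: "0 \<le> bt" "bt \<le> tp" "tp < K" "1 \<le> hi q s tp - lo q s bt" using fa by (auto simp: first_ascent_def)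
 moreover obtain k where "k div q = tp" "s k = hi q s tp" by (rule hi_attained)
 moreover obtain k' where "k' div q = bt" "s k' = lo q s bt" by (rule lo_attained)
 ultimately show False using near[of k k'] by auto
qed

text \<open>The bottom and the right wall are those of the first ascent. The left wall
  \<open>L\<close> is the first point met to the left of 0 at height at least J + d; it exists
  before the end of the mirrored ascent because the barrier on the left is higher.\<close>

lemma valley_right_from_ascents:
 assumes near: "\<And>k k'. k div q \<in> {-K..<K} \<Longrightarrow> k' div q \<in> {-K..<K} \<Longrightarrow> \<bar>k div q - k' div q\<bar> \<le> 1 \<Longrightarrow> \<bar>s k - s k'\<bar> \<le> 3 / 8"
  and sep: "separated q K d s" and d: "0 < d" "d \<le> 1 / 2"
  and fa: "first_ascent K s bt tp" and fa': "first_ascent K (mirror s) bt' tp'"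
  and gap: "barrier s bt + d < barrier (mirror s) bt'"
 shows "\<exists>\<beta>. valley_right s (K * q) d (2 * q) \<beta>"
proof -
 define J where "J = barrier s bt"
 have f: "0 \<le> bt" "tp < K" "\<And>i. i \<in> {0..tp} \<Longrightarrow> lo q s bt \<le> lo q s i" "1 \<le> hi q s tp - lo q s bt"
   "\<And>i j. 0 \<le> i \<Longrightarrow> i \<le> j \<Longrightarrow> j < tp \<Longrightarrow> hi q s j - lo q s i < 1"
  using fa by (auto simp: first_ascent_def)
 have g: "bt + 2 \<le> tp" by (rule first_ascent_gap[OF near fa])
 have near': "\<bar>mirror s k - mirror s k'\<bar> \<le> 3 / 8"
  if "k div q \<in> {-K..<K}" "k' div q \<in> {-K..<K}" "\<bar>k div q - k' div q\<bar> \<le> 1" for k k'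
  unfolding mirror_def by (rule near) (use that in \<open>auto simp: mirror_div\<close>)
 have f': "0 \<le> bt'" "tp' < K" "\<And>i. i \<in> {0..tp'} \<Longrightarrow> lo q s (- 1 - bt') \<le> lo q s (- 1 - i)" "1 \<le> hi q s (- 1 - tp') - lo q s (- 1 - bt')"
   "\<And>i j. 0 \<le> i \<Longrightarrow> i \<le> j \<Longrightarrow> j < tp' \<Longrightarrow> hi q s (- 1 - j) - lo q s (- 1 - i) < 1"
  using fa' by (auto simp: first_ascent_def lo_mirror hi_mirror)
 have g': "bt' + 2 \<le> tp'" by (rule first_ascent_gap[OF near' fa'])
 have J_hi: "hi q s i \<le> J" if "i \<in> {0..bt}" for i
  unfolding J_def barrier_def using that by (intro max.coboundedI1 Max_ge) auto
 have J_lo: "lo q s bt + 1 \<le> J" unfolding J_def barrier_def by simp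
 obtain \<beta> where \<beta>: "\<beta> div q = bt" "s \<beta> = lo q s bt" by (rule lo_attained)
 have \<beta>0: "0 \<le> \<beta>" using \<beta>(1) f(1) div_nonneg_iff[of \<beta>] by simp
 obtain R where R: "R div q = tp" "s R = hi q s tp" by (rule hi_attained)
 have \<beta>R: "\<beta> < R" using div_mono_block[of R \<beta>] \<beta>(1) R(1) g by linarith
 have RN: "R < K * q" using div_less_iff_block[of R K] R(1) f(2) by simp
 define A where "A = {k. - (K * q) \<le> k \<and> k < 0 \<and> - 1 - tp' \<le> k div q \<and> J + d \<le> s k}"
 have finA: "finite A" unfolding A_def by (rule finite_subset[of _ "{- (K * q)..0}"]) auto
 have inA: "k \<in> A" if "- 1 - tp' \<le> k div q" "k div q < 0" "J + d \<le> s k" for k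
 proof -
  have "\<not> k div q < - K" using that(1) f'(2) by simp
  then have "\<not> k < - K * q" by (simp only: div_less_iff_block not_False_eq_True)
  moreover have "k < 0" using that(2) div_nonneg_iff[of k] by linarith
  ultimately show ?thesis using that unfolding A_def by simp
 qed
 have "A \<noteq> {}"
 proof (cases "barrier (mirror s) bt' = lo q (mirror s) bt' + 1")
  case True
  obtain k where k: "k div q = - 1 - tp'" "s k = hi q s (- 1 - tp')" by (rule hi_attained)
  then have "J + d \<le> s k" using gap f'(4) True by (simp add: J_def lo_mirror)
  then show ?thesis using inA[of k] k(1) f'(1) g' by auto
 next
  case False
  then have "barrier (mirror s) bt' = Max (hi q (mirror s) ` {0..bt'})" by (auto simp: barrier_def max_def)
  moreover have "Max (hi q (mirror s) ` {0..bt'}) \<in> hi q (mirror s) ` {0..bt'}" using f'(1) by (intro Max_in) auto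
  ultimately obtain i where i: "i \<in> {0..bt'}" "barrier (mirror s) bt' = hi q s (- 1 - i)" by (auto simp: hi_mirror)
  obtain k where k: "k div q = - 1 - i" "s k = hi q s (- 1 - i)" by (rule hi_attained)
  then have "J + d \<le> s k" using gap i(2) by (simp add: J_def)
  then show ?thesis using inA[of k] k(1) i(1) g' by auto
 qed
 define L where "L = Max A"
 have LA: "L \<in> A" unfolding L_def by (rule Max_in[OF finA \<open>A \<noteq> {}\<close>])
 have L: "- (K * q) \<le> L" "L < 0" "- 1 - tp' \<le> L div q" "J + d \<le> s L" using LA by (auto simp: A_def)
 have Lmax: "s k < J + d" if "L < k" "k < 0" for k
 proof (rule ccontr)
  assume "\<not> s k < J + d"
  moreover have "- 1 - tp' \<le> k div q" using div_mono_block[of L k] L(3) that by linarith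
  ultimately have "k \<in> A" using that L(1) by (auto simp: A_def)
  then have "k \<le> L" unfolding L_def by (rule Max_ge[OF finA])
  then show False using that by simp
 qed
 have sL_neg: "k div q < 0" if "k < 0" for k using that div_nonneg_iff[of k] by linarith
 \<comment> \<open>A lower point would make the rise from it to \<open>L\<close> an ascent of size 1
   for the mirrored path, which by minimality can only end in block \<open>tp'\<close>. Then all
   blocks up to \<open>bt'\<close> lie between \<open>L\<close> and 0, hence below J + d, and so
   does the mirrored barrier, against \<open>gap\<close>.\<close>
 have low: "J - 1 + d \<le> s i" if i: "L \<le> i" "i < 0" for i
 proof (rule ccontr)
  assume c: "\<not> J - 1 + d \<le> s i"
  define a b where "a = - 1 - i div q" and "b = - 1 - L div q"
  have ab: "0 \<le> a" "a \<le> b" "b \<le> tp'" using sL_neg[OF i(2)] div_mono_block[OF i(1)] L(3) by (auto simp: a_def b_def)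
  have "1 \<le> hi q s (- 1 - b) - lo q s (- 1 - a)" using hi_ge[of s L] lo_le[of s i] L(4) c by (simp add: a_def b_def)
  then have bt: "b = tp'" using f'(5)[OF ab(1,2)] ab(3) by force
  have l1: "lo q s (- 1 - bt') + 1 < J + d" using f'(3)[of a] ab lo_le[of s i] c by (simp add: a_def)
  have "hi q s (- 1 - j) < J + d" if j: "j \<in> {0..bt'}" for j
  proof -
   obtain k where k: "k div q = - 1 - j" "s k = hi q s (- 1 - j)" by (rule hi_attained)
   have "L < k" using div_mono_block[of k L] k(1) bt j g' by (auto simp: b_def not_le[symmetric])
   moreover have "k < 0" using k(1) j div_nonneg_iff[of k] by auto
   ultimately show ?thesis using Lmax[of k] k(2) by simp
  qed
  then have "Max (hi q (mirror s) ` {0..bt'}) < J + d" using f'(1) by (subst Max_less_iff) (auto simp: hi_mirror)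
  then have "barrier (mirror s) bt' < J + d" using l1 by (simp add: barrier_def lo_mirror)
  then show False using gap by (simp add: J_def)
 qed
 have sepD: "d < \<bar>lo q s i - lo q s j\<bar>" "d < \<bar>hi q s i - lo q s j - 1\<bar>"
  if "i \<in> {-K..<K}" "j \<in> {-K..<K}" "2 \<le> \<bar>i - j\<bar>" for i j using sep that by (auto simp: separated_def)
 have range: "k div q \<in> {-K..<K}" if "0 \<le> k" "k \<le> R" for k
  using div_mono_block[OF that(2)] that(1) div_nonneg_iff[of k] R(1) f(2) by auto
 have "valley_right s (K * q) d (2 * q) \<beta>" unfolding valley_right_def
 proof (intro conjI exI allI impI)
  fix i k assume ik: "L \<le> i" "i \<le> k" "0 \<le> k" "k \<le> \<beta>"
  have kb: "k div q \<in> {0..bt}" using div_mono_block[OF ik(4)] \<beta>(1) ik(3) div_nonneg_iff[of k] by auto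
  show "s k - s i \<le> 1 - d"
  proof (cases "0 \<le> i")
   case True
   have ri: "i div q \<in> {-K..<K}" and rk: "k div q \<in> {-K..<K}" using range[of i] range[of k] True ik \<beta>R by auto
   have ile: "i div q \<le> k div q" "0 \<le> i div q" using div_mono_block[OF ik(2)] True div_nonneg_iff[of i] by auto
   show ?thesis
   proof (cases "\<bar>k div q - i div q\<bar> \<le> 1")
    case True
    then have "\<bar>s k - s i\<bar> \<le> 3 / 8" by (rule near[OF rk ri])
    then show ?thesis using d by linarith
   next
    case False
    have "hi q s (k div q) - lo q s (i div q) < 1" using f(5)[OF ile(2,1)] kb g by auto
    moreover have "d < \<bar>hi q s (k div q) - lo q s (i div q) - 1\<bar>" using sepD(2)[OF rk ri] False by linarith
    ultimately show ?thesis using hi_ge[of s k] lo_le[of s i] by linarith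
   qed
  next
   case False
   have "s k \<le> J" using hi_ge[of s k] J_hi[OF kb] by linarith
   moreover have "J - 1 + d \<le> s i" using low ik(1) False by simp
   ultimately show ?thesis by linarith
  qed
 next
  fix k assume k: "0 \<le> k" "k \<le> \<beta>"
  have "k div q \<in> {0..bt}" using div_mono_block[OF k(2)] \<beta>(1) k(1) div_nonneg_iff[of k] by auto
  then show "s k + d \<le> s L" using hi_ge[of s k] J_hi[of "k div q"] L(4) by linarith
 next
  show "s \<beta> + 1 + d \<le> s L" using \<beta>(2) J_lo L(4) by linarith
  have "d < \<bar>hi q s tp - lo q s bt - 1\<bar>" using f(1,2) g by (intro sepD(2)) auto
  then show "s \<beta> + 1 + d \<le> s R" using f(4) \<beta>(2) R(2) by linarith
 next
  fix k assume k: "L \<le> k" "k \<le> R" "2 * q < \<bar>k - \<beta>\<bar>"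
  show "s \<beta> + d \<le> s k"
  proof (cases "0 \<le> k")
   case True
   have "2 \<le> \<bar>k div q - bt\<bar>"
   proof (rule ccontr)
    assume "\<not> 2 \<le> \<bar>k div q - bt\<bar>"
    then have c: "k div q - bt = -1 \<or> k div q - bt = 0 \<or> k div q - bt = 1" by linarith
    have e: "k = k div q * q + k mod q" "\<beta> = bt * q + \<beta> mod q" using \<beta>(1) by (metis div_mult_mod_eq)+
    have m: "0 \<le> k mod q" "k mod q < q" "0 \<le> \<beta> mod q" "\<beta> mod q < q" using q by auto
    have "k - \<beta> = (k div q - bt) * q + (k mod q - \<beta> mod q)" using e unfolding left_diff_distrib by linarith
    moreover have False if "x = c * q + (a - b)" "c = -1 \<or> c = 0 \<or> c = 1" "0 \<le> a" "a < q" "0 \<le> b" "b < q" "2 * q < \<bar>x\<bar>" for x c a b :: int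
     using that by auto
    ultimately show False using c m k(3) by blast
   qed
   moreover have rk: "k div q \<in> {-K..<K}" by (rule range[OF True k(2)])
   ultimately have "d < \<bar>lo q s (k div q) - lo q s bt\<bar>" using f(1,2) g by (intro sepD(1)) auto
   moreover have "lo q s bt \<le> lo q s (k div q)"
    using div_mono_block[OF k(2)] True div_nonneg_iff[of k] R(1) by (intro f(3)) auto
   ultimately show ?thesis using lo_le[of s k] \<beta>(2) by linarith
  next
   case False
   then show ?thesis using low[of k] k(1) J_lo \<beta>(2) by simp
  qed
 qed (use \<beta>0 L \<beta>R RN in auto)
 then show ?thesis by blast
qed

text \<open>Each barrier is a value of \<open>hi\<close> or a value of \<open>lo\<close> plus 1. On
  the two sides these values come from blocks at distance at least 2, so \<open>separated\<close>
  forbids a tie of the barriers, and the valley lies on the side of the lower one.\<close>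

lemma valley_exists:
 assumes sep: "separated q K d s" and d: "0 < d" "d \<le> 1 / 2"
  and asc: "ascent q K 1 s" "ascent q K 1 (mirror s)"
  and off: "off_center q S s" and S: "S \<le> K" and tame: "tame q K S s"
 shows "\<exists>\<beta>. valley s (K * q) d (2 * q) \<beta>"
proof -
 obtain bt tp where fa: "first_ascent K s bt tp" by (rule first_ascent_exists[OF asc(1)])
 obtain bt' tp' where fa': "first_ascent K (mirror s) bt' tp'" by (rule first_ascent_exists[OF asc(2)])
 have f: "0 \<le> bt" "bt \<le> tp" "tp < K" "\<And>i. i \<in> {0..tp} \<Longrightarrow> lo q s bt \<le> lo q s i" "1 \<le> hi q s tp - lo q s bt"
  using fa by (auto simp: first_ascent_def)
 have f': "0 \<le> bt'" "bt' \<le> tp'" "tp' < K" using fa' by (auto simp: first_ascent_def)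
 have small: "\<bar>s k\<bar> \<le> 1 / 4" if "k div q \<in> {0..<S}" for k
 proof -
  have "0 \<le> k" "k < S * q" using that div_nonneg_iff[of k] div_less_iff_block[of k S] by auto
  then show ?thesis using tame unfolding tame_def by auto
 qed
 have lo_small: "- (1 / 4) \<le> lo q s i" and hi_small: "hi q s i \<le> 1 / 4" if "i \<in> {0..<S}" for i
 proof -
  obtain k where "k div q = i" "s k = lo q s i" by (rule lo_attained)
  then show "- (1 / 4) \<le> lo q s i" using small[of k] that by auto
  obtain k where "k div q = i" "s k = hi q s i" by (rule hi_attained)
  then show "hi q s i \<le> 1 / 4" using small[of k] that by auto
 qed
 obtain i1 where i1: "i1 \<in> {2..<S}" "hi q s 0 < hi q s i1" using off by (auto simp: off_center_def)
 obtain i2 where i2: "i2 \<in> {2..<S}" "lo q s i2 < lo q s 0" using off by (auto simp: off_center_def)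
 have topS: "S \<le> tp"
 proof (rule ccontr)
  assume "\<not> S \<le> tp"
  then have "hi q s tp \<le> 1 / 4" "- (1 / 4) \<le> lo q s bt" using f by (intro hi_small lo_small; simp)+
  then show False using f(5) by simp
 qed
 have bot1: "1 \<le> bt"
 proof (rule ccontr)
  assume "\<not> 1 \<le> bt"
  then have "bt = 0" using f(1) by simp
  then show False using f(4)[of i2] i2 topS by auto
 qed
 define J J' where "J = barrier s bt" and "J' = barrier (mirror s) bt'"
 \<comment> \<open>On the right, block 0 must be ruled out as the place where the barrier is
   attained, since it is adjacent to block -1.\<close>
 have JJ: "(\<exists>i\<in>{1..bt}. J = hi q s i) \<or> J = lo q s bt + 1"
 proof (cases "J = lo q s bt + 1")
  case False
  then have JM: "J = Max (hi q s ` {0..bt})" "lo q s bt + 1 \<le> J" by (auto simp: J_def barrier_def max_def)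
  have "Max (hi q s ` {0..bt}) \<in> hi q s ` {0..bt}" using f(1) by (intro Max_in) auto
  then obtain i where i: "i \<in> {0..bt}" "J = hi q s i" using JM by auto
  have "i \<noteq> 0"
  proof
   assume i0: "i = 0"
   show False
   proof (cases "S \<le> bt")
    case True
    have "hi q s i1 \<le> J" unfolding JM(1) using True i1 by (intro Max_ge) auto
    then show False using i i0 i1 by simp
   next
    case False
    then have "- (1 / 4) \<le> lo q s bt" using f(1) by (intro lo_small) auto
    moreover have "hi q s 0 \<le> 1 / 4" using i1 by (intro hi_small) auto
    ultimately show False using JM(2) i i0 by simp
   qed
  qed
  then show ?thesis using i by auto
 qed simp
 have JJ': "(\<exists>j\<in>{0..bt'}. J' = hi q s (- 1 - j)) \<or> J' = lo q s (- 1 - bt') + 1"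
 proof (cases "J' = lo q (mirror s) bt' + 1")
  case False
  then have JM: "J' = Max (hi q (mirror s) ` {0..bt'})" by (auto simp: J'_def barrier_def max_def)
  have "Max (hi q (mirror s) ` {0..bt'}) \<in> hi q (mirror s) ` {0..bt'}" using f'(1) by (intro Max_in) auto
  then show ?thesis using JM by (auto simp: hi_mirror)
 qed (simp add: lo_mirror)
 have sepD: "d < \<bar>lo q s i - lo q s j\<bar>" "d < \<bar>hi q s i - hi q s j\<bar>" "d < \<bar>hi q s i - lo q s j - 1\<bar>" "d < \<bar>hi q s j - lo q s i - 1\<bar>"
  if "i \<in> {1..bt}" "j \<in> {-1 - bt'..-1}" for i j
 proof -
  have m: "i \<in> {-K..<K}" "j \<in> {-K..<K}" "2 \<le> \<bar>i - j\<bar>" "2 \<le> \<bar>j - i\<bar>" using that f f' by auto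
  show "d < \<bar>lo q s i - lo q s j\<bar>" "d < \<bar>hi q s i - hi q s j\<bar>" "d < \<bar>hi q s i - lo q s j - 1\<bar>" "d < \<bar>hi q s j - lo q s i - 1\<bar>"
   using sep m unfolding separated_def by blast+
 qed
 have "d < \<bar>J - J'\<bar>" using JJ JJ'
 proof (elim disjE bexE)
  fix i j assume "i \<in> {1..bt}" "J = hi q s i" "j \<in> {0..bt'}" "J' = hi q s (- 1 - j)"
  then show ?thesis using sepD(2)[of i "- 1 - j"] by auto
 next
  fix i assume "i \<in> {1..bt}" "J = hi q s i" "J' = lo q s (- 1 - bt') + 1"
  then show ?thesis using sepD(3)[of i "- 1 - bt'"] f'(1) by auto
 next
  fix j assume "J = lo q s bt + 1" "j \<in> {0..bt'}" "J' = hi q s (- 1 - j)"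
  then show ?thesis using sepD(4)[of bt "- 1 - j"] bot1 by auto
 next
  assume "J = lo q s bt + 1" "J' = lo q s (- 1 - bt') + 1"
  then show ?thesis using sepD(1)[of bt "- 1 - bt'"] bot1 f'(1) by auto
 qed
 then consider "J + d < J'" | "J' + d < J" by linarith
 then show ?thesis
 proof cases
  case 1
  then have "\<exists>\<beta>. valley_right s (K * q) d (2 * q) \<beta>"
   unfolding J_def J'_def by (intro valley_right_from_ascents[OF tame_near[OF tame] sep d fa fa'])
  then show ?thesis by (auto simp: valley_def)
 next
  case 2
  then have "\<exists>\<beta>. valley_right (mirror s) (K * q) d (2 * q) \<beta>" unfolding J_def J'_def using fa
   by (intro valley_right_from_ascents[OF tame_mirror_near[OF tame] separated_mirror[OF sep] d fa']) (simp_all add: mirror_mirror)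
  then obtain \<beta> where "valley_right (mirror s) (K * q) d (2 * q) \<beta>" by blast
  then show ?thesis unfolding valley_def by (intro exI[of _ "- 1 - \<beta>"]) simp
 qed
qed

end

section \<open>Block extrema under perturbation, two-sided paths and Gaussian estimates\<close>

lemma lo_diff_le:
 assumes q: "0 < q" and close: "\<And>k. k \<in> {i * q..<(i + 1) * q} \<Longrightarrow> \<bar>s k - s' k\<bar> \<le> e"
 shows "\<bar>lo q s i - lo q s' i\<bar> \<le> e"
proof -
 have *: "lo q s i \<le> lo q s' i + e" if c: "\<And>k. k \<in> {i * q..<(i + 1) * q} \<Longrightarrow> \<bar>s k - s' k\<bar> \<le> e" for s s'
 proof -
  obtain k where k: "k div q = i" "s' k = lo q s' i" by (rule lo_attained[OF q])
  then show ?thesis using lo_le[OF q, of s k] c[of k] mem_block[OF q, of k] by auto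
 qed
 show ?thesis using *[of s s'] *[of s' s] close by (auto simp: abs_le_iff abs_minus_commute)
qed

lemma hi_diff_le:
 assumes q: "0 < q" and close: "\<And>k. k \<in> {i * q..<(i + 1) * q} \<Longrightarrow> \<bar>s k - s' k\<bar> \<le> e"
 shows "\<bar>hi q s i - hi q s' i\<bar> \<le> e"
proof -
 have *: "hi q s i \<le> hi q s' i + e" if c: "\<And>k. k \<in> {i * q..<(i + 1) * q} \<Longrightarrow> \<bar>s k - s' k\<bar> \<le> e" for s s'
 proof -
  obtain k where k: "k div q = i" "s k = hi q s i" by (rule hi_attained[OF q])
  then show ?thesis using hi_ge[OF q, of s' k] c[of k] mem_block[OF q, of k] by auto
 qed
 show ?thesis using *[of s s'] *[of s' s] close by (auto simp: abs_le_iff abs_minus_commute)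
qed

definition walk_path :: "path \<Rightarrow> int \<Rightarrow> real" where
 "walk_path g k = (if 0 \<le> k then (sum g {0..<k}) else - (sum g {k..<0}))"

lemma walk_path_diff:
 assumes "k \<le> l" shows "walk_path g l - walk_path g k = (sum g {k..<l})"
proof -
 have split: "(sum g {a..<c}) = (sum g {a..<b}) + (sum g {b..<c})" if "a \<le> b" "b \<le> c" for a b c
  using that by (subst sum.union_disjoint[symmetric]) (auto simp: ivl_disj_un)
 show ?thesis using assms split[of 0 k l] split[of k 0 l] split[of k l 0] by (auto simp: walk_path_def)
qed

lemma walk_path_0: "walk_path g 0 = 0" by (simp add: walk_path_def)

lemma walk_path_uminus: "walk_path (\<lambda>x. - g x) k = - walk_path g k"
 by (simp add: walk_path_def sum_negf)

lemma lo_translate: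
 assumes q: "0 < q" and "\<And>k. k div q = i \<Longrightarrow> s k = s' k + c" shows "lo q s i = lo q s' i + c"
proof (rule antisym)
 obtain k where k: "k div q = i" "s' k = lo q s' i" by (rule lo_attained[OF q])
 then show "lo q s i \<le> lo q s' i + c" using lo_le[OF q, of s k] assms(2) by simp
 obtain k where k: "k div q = i" "s k = lo q s i" by (rule lo_attained[OF q])
 then show "lo q s' i + c \<le> lo q s i" using lo_le[OF q, of s' k] assms(2) by simp
qed

lemma hi_translate:
 assumes q: "0 < q" and "\<And>k. k div q = i \<Longrightarrow> s k = s' k + c" shows "hi q s i = hi q s' i + c"
proof (rule antisym)
 obtain k where k: "k div q = i" "s k = hi q s i" by (rule hi_attained[OF q])
 then show "hi q s i \<le> hi q s' i + c" using hi_ge[OF q, of s' k] assms(2) by simp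
 obtain k where k: "k div q = i" "s' k = hi q s' i" by (rule hi_attained[OF q])
 then show "hi q s' i + c \<le> hi q s i" using hi_ge[OF q, of s k] assms(2) by simp
qed

lemma hi_uminus: assumes q: "0 < q" shows "hi q (\<lambda>k. - s k) i = - lo q s i"
proof (rule antisym)
 obtain k where k: "k div q = i" "- s k = hi q (\<lambda>k. - s k) i" using hi_attained[OF q, of i "\<lambda>k. - s k"] by metis
 then show "hi q (\<lambda>k. - s k) i \<le> - lo q s i" using lo_le[OF q, of s k] by simp
 obtain k where k: "k div q = i" "s k = lo q s i" by (rule lo_attained[OF q])
 then show "- lo q s i \<le> hi q (\<lambda>k. - s k) i" using hi_ge[OF q, of "\<lambda>k. - s k" k] by simp
qed

lemma normal_density_le: "0 < \<tau> \<Longrightarrow> normal_density \<mu> \<tau> x \<le> 1 / (2 * \<tau>)"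
proof -
 assume t: "0 < \<tau>"
 have "sqrt 4 \<le> sqrt (2 * pi)" using pi_ge_two by (intro real_sqrt_le_mono) simp
 then have "2 * \<tau> \<le> sqrt (2 * pi) * \<tau>" using t by simp
 also have "... = sqrt (2 * pi * \<tau>\<^sup>2)" using t by (simp add: real_sqrt_mult)
 finally have le: "2 * \<tau> \<le> sqrt (2 * pi * \<tau>\<^sup>2)" .
 have "normal_density \<mu> \<tau> x \<le> 1 / sqrt (2 * pi * \<tau>\<^sup>2) * 1"
  unfolding normal_density_def by (intro mult_left_mono) auto
 also have "... \<le> 1 / (2 * \<tau>)" using le t by (simp add: frac_le)
 finally show ?thesis .
qed

lemma normal_interval_le:
 assumes "0 < \<tau>" "0 \<le> d"
 shows "emeasure (density lborel (normal_density \<mu> \<tau>)) {a - d..a + d} \<le> ennreal (d / \<tau>)"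
proof -
 have "emeasure (density lborel (normal_density \<mu> \<tau>)) {a - d..a + d}
   = (\<integral>\<^sup>+x. ennreal (normal_density \<mu> \<tau> x) * indicator {a - d..a + d} x \<partial>lborel)"
  by (rule emeasure_density) auto
 also have "... \<le> (\<integral>\<^sup>+x. ennreal (1 / (2 * \<tau>)) * indicator {a - d..a + d} x \<partial>lborel)"
  using normal_density_le[OF assms(1)] by (intro nn_integral_mono mult_right_mono ennreal_leI) auto
 also have "... = ennreal (1 / (2 * \<tau>)) * emeasure lborel {a - d..a + d}" by (subst nn_integral_cmult_indicator) auto
 also have "... = ennreal (d / \<tau>)" using assms by (subst emeasure_lborel_Icc) (auto simp: ennreal_mult[symmetric])
 finally show ?thesis .
qed

abbreviation gauss :: "real \<Rightarrow> real measure" where "gauss \<tau> \<equiv> density lborel (normal_density 0 \<tau>)"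

lemma normal_tail_positive: "0 < \<tau> \<Longrightarrow> 0 < measure (gauss \<tau>) {c..}"
proof -
 assume t: "0 < \<tau>"
 interpret prob_space "gauss \<tau>" by (rule prob_space_normal_density[OF t])
 have "emeasure (gauss \<tau>) {c..} \<noteq> 0"
 proof
  assume "emeasure (gauss \<tau>) {c..} = 0"
  then have "(\<integral>\<^sup>+x. ennreal (normal_density 0 \<tau> x) * indicator {c..} x \<partial>lborel) = 0"
   by (subst (asm) emeasure_density) auto
  then have "AE x in lborel. ennreal (normal_density 0 \<tau> x) * indicator {c..} x = 0"
   by (subst (asm) nn_integral_0_iff_AE) auto
  then have "AE x in lborel. x \<notin> {c..}"
  proof eventually_elim
   case (elim x)
   have "ennreal (normal_density 0 \<tau> x) \<noteq> 0" using normal_density_pos[OF t, of 0 x] by simp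
   then show ?case using elim by (auto simp: indicator_def)
  qed
  then have "emeasure lborel {x \<in> space lborel. \<not> x \<notin> {c..}} = 0" by (subst (asm) AE_iff_measurable[OF _ refl]) auto
  then have e0: "emeasure lborel {c..} = 0" by (simp add: atLeast_def)
  have "emeasure lborel {c..c + 1} \<le> emeasure lborel {c..}" by (rule emeasure_mono) auto
  then show False using e0 by simp
 qed
 then show ?thesis by (simp add: emeasure_eq_measure zero_less_measure_iff)
qed

subsection \<open>Gaussian random walks\<close>

locale gaussian_field =
 fixes \<tau> :: real assumes tau: "0 < \<tau>"
begin

abbreviation "\<nu> \<equiv> gauss \<tau>"

sublocale iid_field \<nu>
 by (rule iid_field.intro) (rule prob_space_normal_density[OF tau], simp)

lemma coord_meas [measurable]: "(\<lambda>w. w x) \<in> borel_measurable Q"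
 using coordinate_measurable[of x] by (simp cong: measurable_cong_sets)

lemma coordinate_distributed: "distributed Q lborel (\<lambda>w. w x) (normal_density 0 \<tau>)"
proof -
 have "distr Q lborel (\<lambda>w. w x) = distr Q \<nu> (\<lambda>w. w x)" by (rule distr_cong) auto
 also have "... = \<nu>" unfolding Q_def by (rule distr_PiM_component) (use prob_nu in auto)
 finally show ?thesis by (auto simp: distributed_def)
qed

lemma walk_path_meas [measurable]: "(\<lambda>w. walk_path w k) \<in> borel_measurable Q"
 unfolding walk_path_def by (cases "0 \<le> k") auto

lemma sum_distributed:
 assumes "finite I" "I \<noteq> {}"
 shows "distributed Q lborel (\<lambda>w. \<Sum>j\<in>I. w j) (normal_density 0 (\<tau> * sqrt (card I)))"
proof -
 have ind: "Q.indep_vars (\<lambda>_. borel) (\<lambda>j w. w j) I"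
  by (rule depends_indep_vars[where K="\<lambda>j. {j}"]) (auto simp: depends_def disjoint_family_on_def)
 have "distributed Q lborel (\<lambda>w. \<Sum>j\<in>I. w j) (normal_density (\<Sum>j\<in>I. 0) (sqrt (\<Sum>j\<in>I. \<tau>\<^sup>2)))"
  by (rule Q.sum_indep_normal[OF assms ind]) (use tau coordinate_distributed in auto)
 moreover have "sqrt (\<Sum>j\<in>I. \<tau>\<^sup>2) = \<tau> * sqrt (card I)" using tau by (simp add: real_sqrt_mult mult.commute)
 ultimately show ?thesis by simp
qed

text \<open>Given \<open>R\<close>, the sum over \<open>I\<close> is normal with deviation \<tau>
  sqrt (card I). Its density is at most 1 / (2 \<tau> sqrt (card I)), and the interval has length 2
  d.\<close>

lemma anticoncentration:
 assumes I: "finite I" "I \<noteq> {}" and R: "R \<in> borel_measurable Q" "depends (- I) R" and d: "0 \<le> d"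
 shows "Q.prob {w. \<bar>(sum w I) + R w\<bar> \<le> d} \<le> d / (\<tau> * sqrt (card I))"
proof -
 define Z where "Z w = (sum w I)" for w :: path
 define t where "t = \<tau> * sqrt (card I)"
 have t: "0 < t" using tau I by (simp add: t_def card_gt_0_iff)
 have Zm [measurable]: "Z \<in> borel_measurable Q" unfolding Z_def[abs_def] by measurable
 note R(1)[measurable]
 have dZ: "depends I Z" unfolding Z_def[abs_def] depends_def by (auto intro: sum.cong)
 have ind: "Q.indep_var borel Z borel R" by (rule depends_indep_var[OF Zm R(1) dZ R(2)]) auto
 have dist: "distr Q borel Z = gauss t"
 proof -
  have "distr Q borel Z = distr Q lborel Z" by (rule distr_cong) auto
  then show ?thesis using sum_distributed[OF I] by (simp add: distributed_def Z_def[abs_def] t_def)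
 qed
 interpret DZ: prob_space "distr Q borel Z" by (rule Q.prob_space_distr) measurable
 interpret DR: prob_space "distr Q borel R" by (rule Q.prob_space_distr) measurable
 interpret PR: pair_sigma_finite "distr Q borel Z" "distr Q borel R" ..
 let ?A = "{p :: real \<times> real. \<bar>fst p + snd p\<bar> \<le> d}"
 have A: "?A \<in> sets (borel \<Otimes>\<^sub>M borel)"
 proof -
  have "{p \<in> space (borel \<Otimes>\<^sub>M borel). \<bar>fst p + snd p :: real\<bar> \<le> d} \<in> sets (borel \<Otimes>\<^sub>M borel)" by measurable
  then show ?thesis by (simp add: space_pair_measure)
 qed
 have "emeasure Q {w. \<bar>Z w + R w\<bar> \<le> d} = emeasure (distr Q (borel \<Otimes>\<^sub>M borel) (\<lambda>w. (Z w, R w))) ?A"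
  by (subst emeasure_distr[OF _ A]) (auto simp: vimage_def space_Q)
 also have "distr Q (borel \<Otimes>\<^sub>M borel) (\<lambda>w. (Z w, R w)) = distr Q borel Z \<Otimes>\<^sub>M distr Q borel R"
  using ind by (simp add: Q.indep_var_distribution_eq)
 also have "emeasure (distr Q borel Z \<Otimes>\<^sub>M distr Q borel R) ?A = (\<integral>\<^sup>+r. emeasure (distr Q borel Z) ((\<lambda>z. (z, r)) -` ?A) \<partial>distr Q borel R)"
  by (rule PR.emeasure_pair_measure_alt2) (use A in \<open>simp cong: sets_pair_measure_cong\<close>)
 also have "... \<le> (\<integral>\<^sup>+r. ennreal (d / t) \<partial>distr Q borel R)"
 proof (rule nn_integral_mono)
  fix r
  have "(\<lambda>z. (z, r)) -` ?A = {- r - d..- r + d}" by auto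
  then show "emeasure (distr Q borel Z) ((\<lambda>z. (z, r)) -` ?A) \<le> ennreal (d / t)"
   unfolding dist using normal_interval_le[OF t d, of 0 "- r"] by simp
 qed
 also have "... = ennreal (d / t)" using DR.emeasure_space_1 by simp
 finally show ?thesis using t d by (simp add: Q.emeasure_eq_measure Z_def t_def ennreal_le_iff)
qed

lemma block_functional_meas [measurable]:
 "(\<lambda>w. lo q (walk_path w) i) \<in> borel_measurable Q" "(\<lambda>w. hi q (walk_path w) i) \<in> borel_measurable Q" if "0 < q"
 unfolding lo_def hi_def using block_nonempty[OF that, of i]
 by (intro borel_measurable_Min borel_measurable_Max walk_path_meas; simp)+

text \<open>The increments in block i + 1 shift block j as a whole and leave block i in place. Once
  they are set to 0, the rest \<open>R\<close> no longer depends on them, and their sum provides the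
  anticoncentration.\<close>

lemma block_tie:
 assumes q: "0 < q" and ij: "i + 2 \<le> j" and d: "0 \<le> d"
  and F: "F = lo q \<or> F = hi q" and F': "F' = lo q \<or> F' = hi q"
 shows "Q.prob {w. \<bar>F (walk_path w) j - F' (walk_path w) i - c\<bar> \<le> d} \<le> d / (\<tau> * sqrt (nat q))"
proof -
 define I where "I = {(i + 1) * q..<(i + 2) * q}"
 have cardI: "card I = nat q" by (simp add: I_def algebra_simps)
 have I: "finite I" "I \<noteq> {}" using q cardI by (auto simp: I_def card_gt_0_iff)
 define zero where "zero w x = (if x \<in> I then 0 else w x)" for w :: path and x
 define R where "R w = F (walk_path (zero w)) j - F' (walk_path (zero w)) i - c" for w
 have F_translate: "G s k = G s' k + u" if "G = lo q \<or> G = hi q" "\<And>l. l div q = k \<Longrightarrow> s l = s' l + u" for G s s' k u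
  using that(1) lo_translate[OF q, of k s s' u] hi_translate[OF q, of k s s' u] that(2) by blast
 have eq: "F (walk_path w) j - F' (walk_path w) i - c = (sum w I) + R w" for w
 proof -
  define u where "u = walk_path w (i * q) - walk_path (zero w) (i * q)"
  have d0: "walk_path w l - walk_path (zero w) l = u + (\<Sum>x\<in>{i * q..<l} \<inter> I. w x)" if "i * q \<le> l" for l
  proof -
   have "(sum w {i * q..<l}) - (\<Sum>x\<in>{i * q..<l}. zero w x) = (\<Sum>x\<in>{i * q..<l}. if x \<in> I then w x else 0)"
    unfolding sum_subtractf[symmetric] by (intro sum.cong) (auto simp: zero_def)
   also have "... = (\<Sum>x\<in>{i * q..<l} \<inter> I. w x)" by (simp add: sum.inter_restrict)
   finally show ?thesis using walk_path_diff[OF that, of w] walk_path_diff[OF that, of "zero w"] by (simp add: u_def)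
  qed
  have "walk_path w l = walk_path (zero w) l + u" if "l div q = i" for l
  proof -
   have l: "i * q \<le> l" "l < (i + 1) * q" using mem_block[OF q, of l] that by auto
   then have "{i * q..<l} \<inter> I = {}" by (auto simp: I_def)
   then show ?thesis using d0[OF l(1)] by simp
  qed
  then have 1: "F' (walk_path w) i = F' (walk_path (zero w)) i + u" by (rule F_translate[OF F'])
  have "walk_path w l = walk_path (zero w) l + (u + (sum w I))" if "l div q = j" for l
  proof -
   have "j * q \<le> l" using mem_block[OF q, of l] that by auto
   moreover have "(i + 2) * q \<le> j * q" using ij q by (intro mult_right_mono) auto
   ultimately have l: "(i + 2) * q \<le> l" by simp
   have "i * q \<le> (i + 1) * q" "(i + 1) * q \<le> (i + 2) * q" using q by (auto intro!: mult_right_mono)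
   then have "i * q \<le> l" "{i * q..<l} \<inter> I = I" using l by (auto simp: I_def)
   then show ?thesis using d0[of l] by simp
  qed
  then have 2: "F (walk_path w) j = F (walk_path (zero w)) j + (u + (sum w I))" by (rule F_translate[OF F])
  show ?thesis unfolding R_def 1 2 by simp
 qed
 have "R = (\<lambda>w. F (walk_path w) j - F' (walk_path w) i - c - (sum w I))" using eq by (auto simp: fun_eq_iff)
 then have Rm: "R \<in> borel_measurable Q" using F F' block_functional_meas[OF q] by auto
 have Rd: "depends (- I) R" unfolding depends_def
 proof (intro allI impI)
  fix w w' :: path assume "\<forall>x\<in>- I. w x = w' x"
  then have "zero w = zero w'" by (auto simp: zero_def fun_eq_iff)
  then show "R w = R w'" by (simp add: R_def)
 qed
 show ?thesis unfolding eq using anticoncentration[OF I Rm Rd d] by (simp add: cardI)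
qed

lemma separated_meas: assumes q: "0 < q" shows "{w. separated q K d (walk_path w)} \<in> Q.events"
proof -
 note [measurable] = block_functional_meas[OF q]
 have "{w \<in> space Q. \<forall>i\<in>{-K..<K}. \<forall>j\<in>{-K..<K}. 2 \<le> \<bar>i - j\<bar> \<longrightarrow>
   d < \<bar>lo q (walk_path w) i - lo q (walk_path w) j\<bar> \<and> d < \<bar>hi q (walk_path w) i - hi q (walk_path w) j\<bar> \<and> d < \<bar>hi q (walk_path w) i - lo q (walk_path w) j - 1\<bar>} \<in> Q.events"
  by measurable
 then show ?thesis by (simp add: separated_def space_Q Ball_def)
qed

text \<open>Union bound: at most (2 K)^2 pairs of blocks and three kinds of tie.\<close>

lemma prob_not_separated:
 assumes q: "0 < q" and K: "0 \<le> K" and d: "0 \<le> d"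
 shows "Q.prob {w. \<not> separated q K d (walk_path w)} \<le> 12 * (of_int K)\<^sup>2 * d / (\<tau> * sqrt (nat q))"
proof -
 note [measurable] = block_functional_meas[OF q]
 define t where "t = d / (\<tau> * sqrt (nat q))"
 have t: "0 \<le> t" using tau d by (simp add: t_def)
 define P where "P = {(i, j). i \<in> {-K..<K} \<and> j \<in> {-K..<K} \<and> 2 \<le> \<bar>i - j\<bar>}"
 have finP: "finite P" and cardP: "card P \<le> nat (2 * K) * nat (2 * K)"
 proof -
  have sub: "P \<subseteq> {-K..<K} \<times> {-K..<K}" by (auto simp: P_def)
  then show "finite P" by (rule finite_subset) simp
  have "card P \<le> card ({-K..<K} \<times> {-K..<K})" using sub by (intro card_mono) auto
  then show "card P \<le> nat (2 * K) * nat (2 * K)" using K by (simp add: card_cartesian_product)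
 qed
 define tie where "tie F F' c p = {w. \<bar>F (walk_path w) (fst p) - F' (walk_path w) (snd p) - c\<bar> \<le> d}"
  for F F' :: "path \<Rightarrow> int \<Rightarrow> real" and c and p :: "int \<times> int"
 define B where "B p = tie (lo q) (lo q) 0 p \<union> tie (hi q) (hi q) 0 p \<union> tie (hi q) (lo q) 1 p" for p
 have ev: "tie F F' c p \<in> Q.events" if "F = lo q \<or> F = hi q" "F' = lo q \<or> F' = hi q" for F F' c p
 proof -
  have [measurable]: "(\<lambda>w. F (walk_path w) (fst p)) \<in> borel_measurable Q" "(\<lambda>w. F' (walk_path w) (snd p)) \<in> borel_measurable Q"
   using that by auto
  have "{w \<in> space Q. \<bar>F (walk_path w) (fst p) - F' (walk_path w) (snd p) - c\<bar> \<le> d} \<in> Q.events" by measurable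
  then show ?thesis by (simp add: space_Q tie_def)
 qed
 have one: "Q.prob (tie F F' c p) \<le> t"
  if "F = lo q \<or> F = hi q" "F' = lo q \<or> F' = hi q" "2 \<le> \<bar>fst p - snd p\<bar>" for F F' c p
 proof (cases "snd p + 2 \<le> fst p")
  case True
  then show ?thesis unfolding t_def tie_def by (rule block_tie[OF q _ d that(1,2)])
 next
  case False
  have "tie F F' c p = {w. \<bar>F' (walk_path w) (snd p) - F (walk_path w) (fst p) - (- c)\<bar> \<le> d}"
   by (auto simp: tie_def abs_le_iff)
  then show ?thesis unfolding t_def using False that(3) block_tie[OF q _ d that(2,1), of "fst p" "snd p" "- c"] by simp
 qed
 have evB: "B p \<in> Q.events" for p unfolding B_def by (intro sets.Un ev) auto
 have "Q.prob {w. \<not> separated q K d (walk_path w)} \<le> Q.prob (\<Union>p\<in>P. B p)"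
 proof (rule Q.finite_measure_mono)
  show "{w. \<not> separated q K d (walk_path w)} \<subseteq> (\<Union>p\<in>P. B p)"
   by (auto simp: separated_def P_def B_def tie_def not_less)
 qed (use evB finP in auto)
 also have "... \<le> (\<Sum>p\<in>P. Q.prob (B p))" using finP evB by (intro Q.finite_measure_subadditive_finite) auto
 also have "... \<le> (\<Sum>p\<in>P. 3 * t)"
 proof (rule sum_mono)
  fix p assume "p \<in> P"
  then have "2 \<le> \<bar>fst p - snd p\<bar>" by (auto simp: P_def)
  then have "Q.prob (tie (lo q) (lo q) 0 p) \<le> t" "Q.prob (tie (hi q) (hi q) 0 p) \<le> t" "Q.prob (tie (hi q) (lo q) 1 p) \<le> t"
   by (auto intro!: one)
  moreover have "Q.prob (B p) \<le> Q.prob (tie (lo q) (lo q) 0 p) + Q.prob (tie (hi q) (hi q) 0 p) + Q.prob (tie (hi q) (lo q) 1 p)"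
   unfolding B_def by (rule order_trans[OF measure_Un_le], (intro sets.Un ev; simp)+, rule add_right_mono, rule measure_Un_le; simp add: ev)
  ultimately show "Q.prob (B p) \<le> 3 * t" by linarith
 qed
 also have "... = real (card P) * (3 * t)" by simp
 also have "... \<le> real (nat (2 * K) * nat (2 * K)) * (3 * t)" using cardP t by (intro mult_right_mono of_nat_mono) auto
 also have "... = 12 * (of_int K)\<^sup>2 * t" using K by (simp add: power2_eq_square)
 finally show ?thesis by (simp add: t_def)
qed

end

lemma sum_inverse_sqrt_le: "(\<Sum>k<n. 1 / sqrt (real (k + 1))) \<le> 2 * sqrt n"
proof (induction n)
 case (Suc n)
 define x y where "x = sqrt (real n)" and "y = sqrt (real (Suc n))"
 have y: "0 < y" "x \<le> y" "0 \<le> x" by (auto simp: x_def y_def)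
 have "y\<^sup>2 - x\<^sup>2 = 1" by (simp add: x_def y_def)
 then have "1 = (y - x) * (y + x)" by (simp add: power2_eq_square algebra_simps)
 also have "... \<le> (y - x) * (2 * y)" using y by (intro mult_left_mono) auto
 finally have "1 / y \<le> 2 * (y - x)" using y by (simp add: field_simps)
 then show ?case using Suc by (simp add: x_def y_def)
qed simp

context iid_field begin

lemma prob_invariant:
 assumes T: "T \<in> Q \<rightarrow>\<^sub>M Q" "distr Q Q T = Q" and ev: "{w. P w} \<in> Q.events"
 shows "Q.prob {w. P (T w)} = Q.prob {w. P w}" "{w. P (T w)} \<in> Q.events"
proof -
 have "Q.prob {w. P w} = measure (distr Q Q T) {w. P w}" by (simp add: T(2))
 also have "... = Q.prob {w. P (T w)}" by (subst measure_distr[OF T(1) ev]) (simp add: vimage_def space_Q)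
 finally show "Q.prob {w. P (T w)} = Q.prob {w. P w}" ..
 show "{w. P (T w)} \<in> Q.events" using measurable_sets[OF T(1) ev] by (simp add: vimage_def space_Q)
qed

definition flip :: "int \<Rightarrow> (int \<Rightarrow> 'b) \<Rightarrow> int \<Rightarrow> 'b" where "flip c w x = w (c - x)"

lemma flip_measurable: "flip c \<in> Q \<rightarrow>\<^sub>M Q"
proof -
 have "(\<lambda>w. \<lambda>x\<in>UNIV. w (c - x)) \<in> Q \<rightarrow>\<^sub>M (\<Pi>\<^sub>M x\<in>UNIV. \<nu>)"
  by (rule measurable_restrict) (rule coordinate_measurable)
 then show ?thesis by (simp add: flip_def[abs_def] Q_def restrict_def)
qed

lemma distr_flip: "distr Q Q (flip c) = Q"
proof -
 have "distr (\<Pi>\<^sub>M x\<in>UNIV. \<nu>) (\<Pi>\<^sub>M x\<in>UNIV. \<nu>) (\<lambda>w. \<lambda>x\<in>UNIV. w (c - x)) = (\<Pi>\<^sub>M x\<in>UNIV. \<nu>)"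
  by (rule distr_PiM_reindex) (use prob_nu in \<open>auto simp: inj_on_def\<close>)
 then show ?thesis by (simp add: flip_def[abs_def] Q_def restrict_def)
qed

lemma prob_indep_events:
 assumes A: "A \<in> Q.events" "depends I (\<lambda>w. w \<in> A)" and B: "B \<in> Q.events" "depends J (\<lambda>w. w \<in> B)" and IJ: "I \<inter> J = {}"
 shows "Q.prob (A \<inter> B) = Q.prob A * Q.prob B"
proof -
 have "Q.indep_var borel (indicat_real A) borel (indicat_real B)"
 proof (rule depends_indep_var[OF _ _ _ _ IJ])
  show "depends I (indicat_real A)" using depends_comp[OF A(2), of "\<lambda>u. if u then 1 else 0"] by (simp add: indicator_def[abs_def] of_bool_def)
  show "depends J (indicat_real B)" using depends_comp[OF B(2), of "\<lambda>u. if u then 1 else 0"] by (simp add: indicator_def[abs_def] of_bool_def)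
 qed (use A B in auto)
 then have "mean (\<lambda>w. indicat_real A w * indicat_real B w) = mean (indicat_real A) * mean (indicat_real B)"
  using A B by (intro Q.indep_var_lebesgue_integral) (auto intro!: integrable_real_indicator simp: Q.emeasure_eq_measure)
 moreover have "(\<lambda>w. indicat_real A w * indicat_real B w) = indicat_real (A \<inter> B)" by (auto simp: indicator_def)
 ultimately show ?thesis using A B by simp
qed

end

context gaussian_field begin

definition neg :: "path \<Rightarrow> int \<Rightarrow> real" where "neg w x = - w x"

lemma distr_neg: "neg \<in> Q \<rightarrow>\<^sub>M Q" "distr Q Q neg = Q"
proof -
 have m: "(\<lambda>w. - w x) \<in> Q \<rightarrow>\<^sub>M \<nu>" for x
  using borel_measurable_uminus[OF coord_meas[of x]] by (simp cong: measurable_cong_sets)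
 have eq: "(\<lambda>w. \<lambda>x\<in>UNIV. - w x) = neg" by (auto simp: neg_def fun_eq_iff)
 show meas: "neg \<in> Q \<rightarrow>\<^sub>M Q"
 proof -
  have "(\<lambda>w. \<lambda>x\<in>UNIV. - w x) \<in> Q \<rightarrow>\<^sub>M (\<Pi>\<^sub>M x\<in>UNIV. \<nu>)" by (rule measurable_restrict) (rule m)
  then show ?thesis unfolding eq by (simp add: Q_def)
 qed
 have d: "distr Q \<nu> (\<lambda>w. - w x) = \<nu>" for x
 proof -
  have "distr Q \<nu> (\<lambda>w. - w x) = distr Q lborel (\<lambda>w. - w x)" by (rule distr_cong) auto
  also have "... = density lborel (normal_density (0 + (- 1) * 0) (\<bar>- 1\<bar> * \<tau>))"
   using Q.normal_density_affine[OF coordinate_distributed[of x] tau, of "- 1" 0] by (simp add: distributed_def)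
  finally show ?thesis by simp
 qed
 have "Q.indep_vars (\<lambda>_. \<nu>) (\<lambda>x w. - w x) UNIV"
  by (rule depends_indep_vars[where K="\<lambda>x. {x}"]) (auto simp: depends_def disjoint_family_on_def m)
 then have "distr Q (\<Pi>\<^sub>M x\<in>UNIV. \<nu>) (\<lambda>w. \<lambda>x\<in>UNIV. - w x) = (\<Pi>\<^sub>M x\<in>UNIV. distr Q \<nu> (\<lambda>w. - w x))"
  by (subst (asm) Q.indep_vars_iff_distr_eq_PiM) (auto simp: m)
 then show "distr Q Q neg = Q" unfolding eq d by (simp add: Q_def)
qed

lemma prob_sum_eq_0: "j < k \<Longrightarrow> Q.prob {w. (sum w {j..<k}) = 0} = 0"
 using anticoncentration[of "{j..<k}" "\<lambda>_. 0" 0] measure_nonneg[of Q "{w. (sum w {j..<k}) = 0}"]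
 by (auto simp: depends_def intro: antisym)

definition stay :: "nat \<Rightarrow> real" where
 "stay n = Q.prob {w. \<forall>j\<in>{1..int n}. (sum w {0..<j}) \<le> 0}"

lemma sums_event:
 fixes J :: "int set" and f g :: "int \<Rightarrow> int" and a b :: int assumes "finite J"
 shows "{w. \<forall>j\<in>J. (sum w {f j..<g j}) \<le> 0} \<in> Q.events" "{w. \<forall>j\<in>J. 0 \<le> (sum w {f j..<g j})} \<in> Q.events"
  "{w. \<forall>j\<in>J. 0 < (sum w {f j..<g j})} \<in> Q.events" "{w. (sum w {a..<b}) = 0} \<in> Q.events"
proof -
 note [measurable] = countable_finite[OF assms]
 have "{w \<in> space Q. \<forall>j\<in>J. (sum w {f j..<g j}) \<le> 0} \<in> Q.events"
  using assms by (intro sets.sets_Collect_finite_All) auto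
 moreover have "{w \<in> space Q. \<forall>j\<in>J. 0 \<le> (sum w {f j..<g j})} \<in> Q.events"
  using assms by (intro sets.sets_Collect_finite_All) auto
 moreover have "{w \<in> space Q. \<forall>j\<in>J. 0 < (sum w {f j..<g j})} \<in> Q.events"
  using assms by (intro sets.sets_Collect_finite_All) auto
 moreover have "{w \<in> space Q. (sum w {a..<b}) = 0} \<in> Q.events" by measurable
 ultimately show "{w. \<forall>j\<in>J. (sum w {f j..<g j}) \<le> 0} \<in> Q.events" "{w. \<forall>j\<in>J. 0 \<le> (sum w {f j..<g j})} \<in> Q.events"
  "{w. \<forall>j\<in>J. 0 < (sum w {f j..<g j})} \<in> Q.events" "{w. (sum w {a..<b}) = 0} \<in> Q.events" by (simp_all add: space_Q)
qed

lemma stay_antimono: "k \<le> n \<Longrightarrow> stay n \<le> stay k"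
 unfolding stay_def by (rule Q.finite_measure_mono) (auto intro!: sums_event(1)[where f="\<lambda>_. 0" and g="\<lambda>j. j"])

lemma stay_nonneg: "0 \<le> stay n" by (simp add: stay_def)

lemma stay_shift: "Q.prob {w. \<forall>j\<in>{c<..c + int n}. (sum w {c..<j}) \<le> 0} = stay n"
proof -
 have "Q.prob {w. \<forall>j\<in>{1..int n}. (\<Sum>i\<in>{0..<j}. shift c w i) \<le> 0} = stay n" unfolding stay_def
  by (rule prob_invariant(1)[OF shift_measurable distr_shift]) (rule sums_event(1)[where f="\<lambda>_. 0" and g="\<lambda>j. j"], simp)
 moreover have "(\<Sum>i\<in>{0..<j}. shift c w i) = (sum w {c..<c + j})" for j w
  unfolding shift_def by (rule sum.reindex_bij_witness[of _ "\<lambda>i. i - c" "\<lambda>i. i + c"]) auto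
 moreover have "(\<forall>j\<in>{1..int n}. (sum w {c..<c + j}) \<le> 0) \<longleftrightarrow> (\<forall>j\<in>{c<..c + int n}. (sum w {c..<j}) \<le> 0)" for w :: path
 proof (intro iffI ballI)
  fix j assume "\<forall>j\<in>{1..int n}. (sum w {c..<c + j}) \<le> 0" "j \<in> {c<..c + int n}"
  then show "(sum w {c..<j}) \<le> 0" by (auto dest!: bspec[of _ _ "j - c"])
 qed auto
 ultimately show ?thesis by simp
qed

lemma stay_flip: "Q.prob {w. \<forall>j\<in>{0..<int k}. 0 \<le> (sum w {j..<int k})} = stay k"
proof -
 let ?T = "\<lambda>w. neg (flip (int k - 1) w)"
 have T: "?T \<in> Q \<rightarrow>\<^sub>M Q" by (rule measurable_compose[OF flip_measurable distr_neg(1)])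
 have dT: "distr Q Q ?T = Q"
  using distr_distr[OF distr_neg(1) flip_measurable[of "int k - 1"]] by (simp add: distr_flip distr_neg(2) comp_def)
 have "Q.prob {w. \<forall>j\<in>{1..int k}. (\<Sum>i\<in>{0..<j}. ?T w i) \<le> 0} = stay k" unfolding stay_def
  by (rule prob_invariant(1)[OF T dT]) (rule sums_event(1)[where f="\<lambda>_. 0" and g="\<lambda>j. j"], simp)
 moreover have "(\<Sum>i\<in>{0..<j}. ?T w i) = - (sum w {int k - j..<int k})" for j w unfolding neg_def flip_def sum_negf
  by (rule arg_cong[where f=uminus], rule sum.reindex_bij_witness[of _ "\<lambda>i. int k - 1 - i" "\<lambda>i. int k - 1 - i"]) auto
 moreover have "(\<forall>j\<in>{1..int k}. - (sum w {int k - j..<int k}) \<le> 0) \<longleftrightarrow> (\<forall>j\<in>{0..<int k}. 0 \<le> (sum w {j..<int k}))" for w :: path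
 proof (intro iffI ballI)
  fix j assume "\<forall>j\<in>{1..int k}. - (sum w {int k - j..<int k}) \<le> 0" "j \<in> {0..<int k}"
  then show "0 \<le> (sum w {j..<int k})" by (auto dest!: bspec[of _ _ "int k - j"])
 qed auto
 ultimately show ?thesis by simp
qed

lemma peak_events:
 "{w. \<forall>j\<in>{0..<k}. 0 \<le> (sum w {j..<k})} \<in> Q.events"
 "{w. \<forall>j\<in>{0..<k}. 0 < (sum w {j..<k})} \<in> Q.events"
 "{w. \<forall>j\<in>{k<..n}. (sum w {k..<j}) \<le> 0} \<in> Q.events"
 by (rule sums_event(2)[where f="\<lambda>j. j" and g="\<lambda>_. k"], simp)
  (rule sums_event(3)[where f="\<lambda>j. j" and g="\<lambda>_. k"], simp,
   rule sums_event(1)[where f="\<lambda>_. k" and g="\<lambda>j. j"], simp)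

text \<open>The path on [0, n] attains its maximum at \<open>k\<close>. The two conditions involve
  disjoint increments; reversal with a change of sign turns the first one into the event that a walk
  stays nonpositive.\<close>

definition peak :: "nat \<Rightarrow> nat \<Rightarrow> path set" where
 "peak n k = {w. \<forall>j\<in>{0..<int k}. 0 \<le> (sum w {j..<int k})} \<inter> {w. \<forall>j\<in>{int k<..int n}. (sum w {int k..<j}) \<le> 0}"

lemma peak_event: "peak n k \<in> Q.events"
 unfolding peak_def by (rule sets.Int[OF peak_events(1,3)])

lemma prob_peak: assumes "k \<le> n" shows "Q.prob (peak n k) = stay k * stay (n - k)"
proof -
 have n: "int n = int k + int (n - k)" using assms by simp
 have "Q.prob (peak n k) = Q.prob {w. \<forall>j\<in>{0..<int k}. 0 \<le> (sum w {j..<int k})} * Q.prob {w. \<forall>j\<in>{int k<..int n}. (sum w {int k..<j}) \<le> 0}"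
  unfolding peak_def
 proof (rule prob_indep_events[where I="{0..<int k}" and J="{int k..<int n}"])
  have c: "(sum w {j..<l}) = (sum w' {j..<l})" if "\<forall>x\<in>{a..<b}. w x = w' x" "a \<le> j" "l \<le> b" for w w' :: path and j l a b
   using that by (intro sum.cong) auto
  show "depends {0..<int k} (\<lambda>w. w \<in> {w. \<forall>j\<in>{0..<int k}. 0 \<le> (sum w {j..<int k})})"
   unfolding depends_def mem_Collect_eq
  proof (intro allI impI ball_cong refl)
   fix w w' :: path and j assume A: "\<forall>x\<in>{0..<int k}. w x = w' x" "j \<in> {0..<int k}"
   have "(sum w {j..<int k}) = (sum w' {j..<int k})" by (rule c[OF A(1)]) (use A(2) in auto)
   then show "0 \<le> (sum w {j..<int k}) \<longleftrightarrow> 0 \<le> (sum w' {j..<int k})" by simp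
  qed
  show "depends {int k..<int n} (\<lambda>w. w \<in> {w. \<forall>j\<in>{int k<..int n}. (sum w {int k..<j}) \<le> 0})"
   unfolding depends_def mem_Collect_eq
  proof (intro allI impI ball_cong refl)
   fix w w' :: path and j assume A: "\<forall>x\<in>{int k..<int n}. w x = w' x" "j \<in> {int k<..int n}"
   have "(sum w {int k..<j}) = (sum w' {int k..<j})" by (rule c[OF A(1)]) (use A(2) in auto)
   then show "(sum w {int k..<j}) \<le> 0 \<longleftrightarrow> (sum w' {int k..<j}) \<le> 0" by simp
  qed
 qed (rule peak_events(1), rule peak_events(3), auto)
 then show ?thesis by (simp only: stay_flip[of k] stay_shift[of "int k" "n - k", folded n])
qed

text \<open>
 The position of the maximum of the path of length \<open>n\<close> equals \<open>k\<close> with probability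
 \<open>stay k * stay (n - k) \<ge> (stay n)\<^sup>2\<close>, for each of the \<open>n + 1\<close> values of \<open>k\<close>.
\<close>

lemma stay_le: "stay n \<le> 1 / sqrt (real (n + 1))"
proof -
 \<comment> \<open>Strict inequality on the left selects the first maximum and makes the events
   disjoint; ties have probability 0.\<close>
 define V where "V k = {w :: int \<Rightarrow> real. \<forall>j\<in>{0..<int k}. 0 < (sum w {j..<int k})} \<inter> {w. \<forall>j\<in>{int k<..int n}. (sum w {int k..<j}) \<le> 0}" for k
 have V: "V k \<in> Q.events" for k unfolding V_def by (rule sets.Int[OF peak_events(2,3)])
 have "Q.prob (V k) = Q.prob (peak n k)" for k
 proof (rule Q.finite_measure_eq_AE)
  have "AE w in Q. \<forall>j\<in>{0..<int k}. (sum w {j..<int k}) \<noteq> 0"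
  proof (rule AE_finite_allI)
   fix j assume "j \<in> {0..<int k}"
   then have "{w. (sum w {j..<int k}) = 0} \<in> null_sets Q"
    using sums_event(4)[of "{}"] prob_sum_eq_0[of j "int k"] by (intro null_setsI) (auto simp: Q.emeasure_eq_measure)
   then show "AE w in Q. (sum w {j..<int k}) \<noteq> 0" by (rule AE_I') auto
  qed simp
  then show "AE w in Q. w \<in> V k \<longleftrightarrow> w \<in> peak n k"
   by eventually_elim (auto simp: V_def peak_def less_le)
 qed (rule V peak_event)+
 then have "(\<Sum>k\<in>{..n}. stay k * stay (n - k)) = (\<Sum>k\<in>{..n}. Q.prob (V k))" by (simp add: prob_peak)
 also have "... = Q.prob (\<Union>k\<in>{..n}. V k)"
 proof (rule Q.finite_measure_finite_Union[symmetric])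
  have "V k \<inter> V l = {}" if kl: "k < l" "l \<le> n" for k l
  proof (intro equals0I)
   fix x assume "x \<in> V k \<inter> V l"
   then have "sum x {int k..<int l} \<le> 0" "0 < sum x {int k..<int l}" using kl unfolding V_def by auto
   then show False by simp
  qed
  then show "disjoint_family_on V {..n}" unfolding disjoint_family_on_def by (metis Int_commute atMost_iff linorder_neqE_nat)
 qed (use V in auto)
 also have "... \<le> 1" by simp
 finally have "(\<Sum>k\<in>{..n}. stay k * stay (n - k)) \<le> 1" .
 moreover have "(\<Sum>k\<in>{..n}. stay n * stay n) \<le> (\<Sum>k\<in>{..n}. stay k * stay (n - k))"
  by (intro sum_mono mult_mono stay_antimono stay_nonneg) auto
 ultimately have "real (n + 1) * (stay n)\<^sup>2 \<le> 1" by (simp add: power2_eq_square)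
 then have "(stay n)\<^sup>2 \<le> (1 / sqrt (real (n + 1)))\<^sup>2" by (simp add: power_divide field_simps)
 then show ?thesis by (rule power2_le_imp_le) simp
qed

definition central_max :: "int \<Rightarrow> int \<Rightarrow> path set" where
 "central_max q S = {w. \<forall>i\<in>{2..<S}. hi q (walk_path w) i \<le> hi q (walk_path w) 0}"

text \<open>On this event the maximum over [0, S q) is attained in [0, 2 q), so one of the first 2 q
  positions is a peak. Summing stay k * stay (n - k) gives the order sqrt (2 q) / sqrt ((S - 2) q),
  in which the block size cancels.\<close>

lemma prob_central_max:
 assumes q: "0 < q" and S: "2 < S"
 shows "Q.prob (central_max q S) \<le> 3 / sqrt (of_int (S - 2))"
proof -
 define n where "n = nat (S * q - 1)"
 define h where "h = nat (2 * q)"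
 have Sq: "3 * q \<le> S * q" using S q by (intro mult_right_mono) auto
 have n: "int n = S * q - 1" unfolding n_def by (rule nat_0_le) (use Sq q in linarith)
 have hn: "h \<le> n" "int h = 2 * q"
 proof -
  show "h \<le> n" unfolding h_def nat_le_iff using Sq q n by linarith
  show "int h = 2 * q" using q by (simp add: h_def)
 qed
 have nh: "real (n - h + 1) = of_int (S - 2) * of_int q"
 proof -
  have "int (n - h + 1) = (S - 2) * q" using hn n by (simp add: of_nat_diff algebra_simps)
  then have "real_of_int (int (n - h + 1)) = of_int ((S - 2) * q)" by simp
  then show ?thesis by simp
 qed
 have "Q.prob (central_max q S) \<le> Q.prob (\<Union>k<h. peak n k)"
 proof (rule Q.finite_measure_mono)
  show "central_max q S \<subseteq> (\<Union>k<h. peak n k)"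
  proof
   fix w assume "w \<in> central_max q S"
   then have A: "\<forall>i\<in>{2..<S}. hi q (walk_path w) i \<le> hi q (walk_path w) 0" by (simp add: central_max_def)
   let ?s = "walk_path w"
   have "Max (?s ` {0..<2 * q}) \<in> ?s ` {0..<2 * q}" using q by (intro Max_in) auto
   then obtain k where k: "k \<in> {0..<2 * q}" "?s k = Max (?s ` {0..<2 * q})" by (elim imageE) auto
   have max1: "?s j \<le> ?s k" if "j \<in> {0..<2 * q}" for j unfolding k(2) using that by (intro Max_ge) auto
   have max: "?s j \<le> ?s k" if j: "0 \<le> j" "j \<le> int n" for j
   proof (cases "j < 2 * q")
    case False
    have "2 \<le> j div q" "j div q < S"
     using div_less_iff_block[OF q, of j 2] div_less_iff_block[OF q, of j S] False j n by auto
    then have "?s j \<le> hi q ?s 0" using A hi_ge[OF q, of ?s j] by (auto intro: order_trans)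
    also obtain l where l: "l div q = 0" "?s l = hi q ?s 0" by (rule hi_attained[OF q])
    have "l \<in> {0..<2 * q}" using mem_block[OF q, of l] l(1) q by auto
    then have "hi q ?s 0 \<le> ?s k" using max1[of l] l(2) by simp
    finally show ?thesis .
   qed (use max1 j in auto)
   have kk: "int (nat k) = k" "nat k < h" using k by (auto simp: h_def)
   have "w \<in> peak n (nat k)" unfolding peak_def kk(1)
   proof (intro IntI CollectI ballI)
    fix j assume j: "j \<in> {0..<k}"
    then have "?s j \<le> ?s k" using k(1) by (intro max1) auto
    then show "0 \<le> (sum w {j..<k})" using walk_path_diff[of j k w] j by simp
   next
    fix j assume j: "j \<in> {k<..int n}"
    then have "?s j \<le> ?s k" using k(1) by (intro max) auto
    then show "(sum w {k..<j}) \<le> 0" using walk_path_diff[of k j w] j by simp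
   qed
   then show "w \<in> (\<Union>k<h. peak n k)" using kk by blast
  qed
 qed (use peak_event in auto)
 also have "... \<le> (\<Sum>k<h. Q.prob (peak n k))" by (rule Q.finite_measure_subadditive_finite) (use peak_event in auto)
 also have "... = (\<Sum>k<h. stay k * stay (n - k))" using hn by (intro sum.cong prob_peak) auto
 also have "... \<le> (\<Sum>k<h. 1 / sqrt (real (k + 1)) * stay (n - h))"
  by (intro sum_mono mult_mono stay_le stay_antimono stay_nonneg) auto
 also have "... = (\<Sum>k<h. 1 / sqrt (real (k + 1))) * stay (n - h)" by (simp add: sum_distrib_right)
 also have "... \<le> (2 * sqrt h) * (1 / sqrt (real (n - h + 1)))"
  by (intro mult_mono sum_inverse_sqrt_le stay_le stay_nonneg) auto
 also have "... = 2 * sqrt 2 / sqrt (of_int (S - 2))"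
 proof -
  have "sqrt (real h) = sqrt 2 * sqrt (of_int q)" using hn(2) by (metis of_int_mult of_int_numeral of_int_of_nat_eq real_sqrt_mult)
  then show ?thesis unfolding nh real_sqrt_mult using q by simp
 qed
 also have "... \<le> 3 / sqrt (of_int (S - 2))"
 proof (rule divide_right_mono)
  have "sqrt 2 \<le> sqrt ((3 / 2)\<^sup>2)" by (intro real_sqrt_le_mono) (simp add: power2_eq_square)
  then show "2 * sqrt 2 \<le> 3" by simp
  show "0 \<le> sqrt (real_of_int (S - 2))" using S by simp
 qed
 finally show ?thesis .
qed

lemma central_max_event: assumes q: "0 < q"
 shows "central_max q S \<in> Q.events"
proof -
 note [measurable] = block_functional_meas[OF q]
 have "{w \<in> space Q. \<forall>i\<in>{2..<S}. hi q (walk_path w) i \<le> hi q (walk_path w) 0} \<in> Q.events"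
  by (intro sets.sets_Collect_finite_All borel_measurable_le block_functional_meas q finite_atLeastLessThan_int)
 then show ?thesis by (simp add: space_Q central_max_def)
qed

lemma prob_not_off_center:
 assumes q: "0 < q" and S: "2 < S"
 shows "Q.prob {w. \<not> off_center q S (walk_path w)} \<le> 6 / sqrt (of_int (S - 2))"
proof -
 have wn: "walk_path (neg w) = (\<lambda>k. - walk_path w k)" for w
  using walk_path_uminus[of w] by (auto simp: neg_def[abs_def])
 note inv = prob_invariant[OF distr_neg, where P="\<lambda>w. w \<in> central_max q S", unfolded Collect_mem_eq, OF central_max_event[OF q]]
 have eq: "{w. \<not> off_center q S (walk_path w)} = central_max q S \<union> {w. neg w \<in> central_max q S}"
  unfolding central_max_def mem_Collect_eq wn hi_uminus[OF q] off_center_def by (auto simp: not_less)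
 have "Q.prob {w. \<not> off_center q S (walk_path w)} \<le> Q.prob (central_max q S) + Q.prob {w. neg w \<in> central_max q S}"
  unfolding eq by (rule measure_Un_le) (rule central_max_event[OF q] inv(2))+
 then show ?thesis unfolding inv(1) using prob_central_max[OF q S] by simp
qed

lemma ascent_event: assumes q: "0 < q" shows "{w. \<not> ascent q K c (walk_path w)} \<in> Q.events"
proof -
 note [measurable] = block_functional_meas[OF q]
 have "{w \<in> space Q. \<forall>i\<in>{0..<K}. \<forall>j\<in>{0..<K}. i \<le> j \<longrightarrow> \<not> c \<le> hi q (walk_path w) j - lo q (walk_path w) i} \<in> Q.events"
  by measurable
 moreover have "{w \<in> space Q. \<forall>i\<in>{0..<K}. \<forall>j\<in>{0..<K}. i \<le> j \<longrightarrow> \<not> c \<le> hi q (walk_path w) j - lo q (walk_path w) i}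
   = {w. \<not> ascent q K c (walk_path w)}"
  unfolding ascent_def space_Q by fastforce
 ultimately show ?thesis by simp
qed

text \<open>The stretches of \<open>u\<close> blocks have independent normal increments, and without
  an ascent each increment stays below \<open>c\<close>. The spare stretch in (n + 1) u keeps the
  end block of the last increment below \<open>K\<close>.\<close>

lemma prob_no_ascent:
 assumes q: "0 < q" and u: "0 < u" and K: "(int n + 1) * u \<le> K"
 shows "Q.prob {w. \<not> ascent q K c (walk_path w)} \<le> (1 - measure (gauss (\<tau> * sqrt (nat (u * q)))) {c..}) ^ n"
proof -
 define I where "I a = {int a * (u * q)..<(int a + 1) * (u * q)}" for a :: nat
 define D where "D a w = (\<Sum>j\<in>I a. w j)" for a and w :: path
 define p where "p = measure (gauss (\<tau> * sqrt (nat (u * q)))) {c..}"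
 have uq: "0 < u * q" using q u by simp
 have cardI: "card (I a) = nat (u * q)" for a by (simp add: I_def algebra_simps)
 have finI: "finite (I a)" "I a \<noteq> {}" for a
 proof -
  show "finite (I a)" by (simp add: I_def)
  show "I a \<noteq> {}" using cardI[of a] uq by auto
 qed
 have Dm [measurable]: "D a \<in> borel_measurable Q" for a unfolding D_def[abs_def] by measurable
 have ind: "Q.indep_vars (\<lambda>_. borel) D {..<n}"
 proof (rule depends_indep_vars[where K=I])
  show "depends (I j) (D j)" for j unfolding D_def[abs_def] depends_def by (auto intro: sum.cong)
  have "I a \<inter> I b = {}" if "a < b" for a b
  proof -
   have "(int a + 1) * (u * q) \<le> int b * (u * q)" using that uq by (intro mult_right_mono) auto
   then show ?thesis by (auto simp: I_def)
  qed
  then show "disjoint_family_on I {..<n}" unfolding disjoint_family_on_def by (metis Int_commute linorder_neqE_nat)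
 qed simp
 have pD: "Q.prob (D a -` {..<c} \<inter> space Q) = 1 - p" for a
 proof -
  have dist: "distr Q lborel (D a) = gauss (\<tau> * sqrt (nat (u * q)))"
   using sum_distributed[OF finI[of a]] by (simp add: distributed_def D_def[abs_def] cardI)
  interpret N: prob_space "gauss (\<tau> * sqrt (nat (u * q)))"
  proof (rule prob_space_normal_density)
   have "0 < nat (u * q)" using uq by simp
   then have "0 < sqrt (real (nat (u * q)))" unfolding real_sqrt_gt_0_iff of_nat_0_less_iff .
   then show "0 < \<tau> * sqrt (real (nat (u * q)))" by (rule mult_pos_pos[OF tau])
  qed
  have "Q.prob (D a -` {..<c} \<inter> space Q) = measure (distr Q lborel (D a)) {..<c}"
   by (rule measure_distr[symmetric]) auto
  also have "... = measure (gauss (\<tau> * sqrt (nat (u * q)))) (space (gauss (\<tau> * sqrt (nat (u * q)))) - {c..})"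
   unfolding dist by (rule arg_cong2[where f=measure]) auto
  also have "... = 1 - p" unfolding p_def by (rule N.prob_compl) simp
  finally show ?thesis .
 qed
 show ?thesis
 proof (cases "n = 0")
  case False
  have "Q.prob {w. \<not> ascent q K c (walk_path w)} \<le> Q.prob (\<Inter>a\<in>{..<n}. D a -` {..<c} \<inter> space Q)"
  proof (rule Q.finite_measure_mono)
   show "{w. \<not> ascent q K c (walk_path w)} \<subseteq> (\<Inter>a\<in>{..<n}. D a -` {..<c} \<inter> space Q)"
   proof (intro subsetI INT_I)
    fix w a assume na: "w \<in> {w. \<not> ascent q K c (walk_path w)}" and a: "a \<in> {..<n}"
    define i j where "i = int a * u" and "j = (int a + 1) * u"
    have "j < (int n + 1) * u" using a u unfolding j_def by (intro mult_strict_right_mono) auto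
    then have "j < K" using K by linarith
    moreover have "j = i + u" "0 \<le> i" using u by (auto simp: i_def j_def algebra_simps)
    ultimately have ij: "0 \<le> i" "i \<le> j" "j < K" using u by auto
    have dv: "(i * q) div q = i" "(j * q) div q = j" using q by auto
    have iq: "i * q = int a * (u * q)" "j * q = (int a + 1) * (u * q)" by (simp_all add: i_def j_def)
    have "walk_path w (j * q) - walk_path w (i * q) = D a w"
     unfolding D_def I_def iq[symmetric] using ij q by (intro walk_path_diff mult_right_mono) auto
    moreover have "walk_path w (j * q) \<le> hi q (walk_path w) j" "lo q (walk_path w) i \<le> walk_path w (i * q)"
     using hi_ge[OF q, of "walk_path w" "j * q"] lo_le[OF q, of "walk_path w" "i * q"] dv by auto
    moreover have "hi q (walk_path w) j - lo q (walk_path w) i < c"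
     using na ij unfolding ascent_def mem_Collect_eq not_le[symmetric] by blast
    ultimately show "w \<in> D a -` {..<c} \<inter> space Q" by (simp add: space_Q)
   qed
   show "(\<Inter>a\<in>{..<n}. D a -` {..<c} \<inter> space Q) \<in> Q.events" using False by (intro sets.finite_INT) auto
  qed
  also have "... = (\<Prod>a\<in>{..<n}. Q.prob (D a -` {..<c} \<inter> space Q))"
   by (rule Q.indep_varsD_finite[OF ind]) (use False in auto)
  also have "... = (1 - p) ^ n" by (simp add: pD)
  finally show ?thesis by (simp add: p_def)
 qed simp
qed

lemma prob_no_ascent_mirror:
 assumes q: "0 < q"
 shows "Q.prob {w. \<not> ascent q K c (mirror (walk_path w))} = Q.prob {w. \<not> ascent q K c (walk_path w)}"
  "{w. \<not> ascent q K c (mirror (walk_path w))} \<in> Q.events"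
proof -
 \<comment> \<open>The mirrored path has the increment - w (-2 - k) at k. It differs from the walk
   path of these increments by a constant, which does not affect ascents.\<close>
 let ?T = "\<lambda>w. neg (flip (- 2) w)"
 have T: "?T \<in> Q \<rightarrow>\<^sub>M Q" by (rule measurable_compose[OF flip_measurable distr_neg(1)])
 have dT: "distr Q Q ?T = Q"
  using distr_distr[OF distr_neg(1) flip_measurable[of "- 2"]] by (simp add: distr_flip distr_neg(2) comp_def)
 have z: "mirror (walk_path w) k = walk_path (?T w) k + walk_path w (- 1)" for w k
 proof -
  have r: "(\<Sum>i\<in>{a..<b}. ?T w i) = - (sum w {- 1 - b..<- 1 - a})" for a b unfolding neg_def flip_def sum_negf
   by (rule arg_cong[where f=uminus], rule sum.reindex_bij_witness[of _ "\<lambda>i. - 2 - i" "\<lambda>i. - 2 - i"]) auto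
  show ?thesis
  proof (cases "0 \<le> k")
   case True
   then show ?thesis using walk_path_diff[of "- 1 - k" "- 1" w] r[of 0 k] by (simp add: mirror_def walk_path_def[of "?T w"])
  next
   case False
   then show ?thesis using walk_path_diff[of "- 1" "- 1 - k" w] r[of k 0] by (simp add: mirror_def walk_path_def[of "?T w"])
  qed
 qed
 have "ascent q K c (mirror (walk_path w)) \<longleftrightarrow> ascent q K c (walk_path (?T w))" for w unfolding ascent_def
  using lo_translate[OF q, of _ "mirror (walk_path w)" "walk_path (?T w)" "walk_path w (- 1)"]
   hi_translate[OF q, of _ "mirror (walk_path w)" "walk_path (?T w)" "walk_path w (- 1)"] z by simp
 then show "Q.prob {w. \<not> ascent q K c (mirror (walk_path w))} = Q.prob {w. \<not> ascent q K c (walk_path w)}"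
  "{w. \<not> ascent q K c (mirror (walk_path w))} \<in> Q.events"
  using prob_invariant[OF T dT ascent_event[OF q, of K c]] by simp_all
qed

end

section \<open>Convergence in law of integer vectors\<close>

lemma int_vector_measurable:
 fixes X :: "int \<Rightarrow> 'a \<Rightarrow> int"
 assumes J: "finite J" and X: "\<And>k. k \<in> J \<Longrightarrow> X k \<in> M \<rightarrow>\<^sub>M count_space UNIV"
 shows "{w \<in> space M. E (\<lambda>k\<in>J. X k w)} \<in> sets M"
proof -
 have "(\<lambda>w. \<lambda>k\<in>J. X k w) \<in> M \<rightarrow>\<^sub>M (\<Pi>\<^sub>M k\<in>J. count_space UNIV)" by (rule measurable_restrict[OF X])
 also have "(\<Pi>\<^sub>M k\<in>J. count_space (UNIV :: int set)) = count_space (\<Pi>\<^sub>E k\<in>J. UNIV)"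
  by (rule count_space_PiM_finite[OF J]) auto
 finally have m: "(\<lambda>w. \<lambda>k\<in>J. X k w) \<in> M \<rightarrow>\<^sub>M count_space (\<Pi>\<^sub>E k\<in>J. UNIV)" .
 have "(\<lambda>w. \<lambda>k\<in>J. X k w) -` ({v. E v} \<inter> (\<Pi>\<^sub>E k\<in>J. UNIV)) \<inter> space M \<in> sets M"
  by (rule measurable_sets[OF m]) simp
 moreover have "(\<lambda>w. \<lambda>k\<in>J. X k w) -` ({v. E v} \<inter> (\<Pi>\<^sub>E k\<in>J. UNIV)) \<inter> space M = {w \<in> space M. E (\<lambda>k\<in>J. X k w)}"
  by auto
 ultimately show ?thesis by simp
qed

lemma (in prob_space) prob_int_vector:
 fixes X :: "int \<Rightarrow> 'a \<Rightarrow> int"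
 assumes J: "finite J" "J \<noteq> {}" and ind: "indep_vars (\<lambda>_. count_space UNIV) X J" and W: "finite W" "W \<subseteq> (\<Pi>\<^sub>E k\<in>J. UNIV)"
 shows "prob {w \<in> space M. (\<lambda>k\<in>J. X k w) \<in> W} = (\<Sum>v\<in>W. \<Prod>k\<in>J. prob {w \<in> space M. X k w = v k})"
proof -
 have X: "X k \<in> M \<rightarrow>\<^sub>M count_space UNIV" if "k \<in> J" for k using ind that by (auto simp: indep_vars_def2)
 have "{w \<in> space M. (\<lambda>k\<in>J. X k w) \<in> W} = (\<Union>v\<in>W. {w \<in> space M. (\<lambda>k\<in>J. X k w) = v})" by auto
 then have "prob {w \<in> space M. (\<lambda>k\<in>J. X k w) \<in> W} = prob (\<Union>v\<in>W. {w \<in> space M. (\<lambda>k\<in>J. X k w) = v})" by simp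
 also have "... = (\<Sum>v\<in>W. prob {w \<in> space M. (\<lambda>k\<in>J. X k w) = v})"
  by (rule finite_measure_finite_Union[OF W(1)]) (auto simp: disjoint_family_on_def intro!: int_vector_measurable[OF J(1) X])
 also have "... = (\<Sum>v\<in>W. \<Prod>k\<in>J. prob {w \<in> space M. X k w = v k})"
 proof (rule sum.cong[OF refl])
  fix v assume "v \<in> W"
  then have v: "v \<in> (\<Pi>\<^sub>E k\<in>J. UNIV)" using W(2) by auto
  have "{w \<in> space M. (\<lambda>k\<in>J. X k w) = v} = (\<Inter>k\<in>J. X k -` {v k} \<inter> space M)"
   using v J(2) by (auto simp: fun_eq_iff PiE_iff extensional_def)
  moreover have "prob (\<Inter>k\<in>J. X k -` {v k} \<inter> space M) = (\<Prod>k\<in>J. prob (X k -` {v k} \<inter> space M))"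
   by (rule indep_varsD_finite[OF ind J(2,1)]) simp
  moreover have "X k -` {v k} \<inter> space M = {w \<in> space M. X k w = v k}" for k by auto
  ultimately show "prob {w \<in> space M. (\<lambda>k\<in>J. X k w) = v} = (\<Prod>k\<in>J. prob {w \<in> space M. X k w = v k})" by simp
 qed
 finally show ?thesis .
qed

lemma (in prob_space) prob_truncate:
 assumes ev: "\<And>P. {w \<in> space M. P (V w)} \<in> events"
 shows "\<bar>prob {w \<in> space M. E (V w)} - prob {w \<in> space M. V w \<in> {v \<in> W. E v}}\<bar> \<le> 1 - prob {w \<in> space M. V w \<in> W}"
proof -
 have "prob {w \<in> space M. V w \<in> {v \<in> W. E v}} \<le> prob {w \<in> space M. E (V w)}"
  by (rule finite_measure_mono) (use ev in auto)
 moreover have "prob {w \<in> space M. E (V w)} \<le> prob ({w \<in> space M. V w \<in> {v \<in> W. E v}} \<union> {w \<in> space M. \<not> V w \<in> W})"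
  by (rule finite_measure_mono) (use ev in auto)
 moreover have "... \<le> prob {w \<in> space M. V w \<in> {v \<in> W. E v}} + prob {w \<in> space M. \<not> V w \<in> W}"
  by (rule measure_Un_le) (use ev in auto)
 moreover have "prob {w \<in> space M. \<not> V w \<in> W} = 1 - prob {w \<in> space M. V w \<in> W}"
  by (rule prob_neg) (use ev in auto)
 ultimately show ?thesis by linarith
qed

text \<open>The limit law has almost all its mass on a finite box, where probabilities are finite
  sums of products of marginals; convergence there leaves little mass outside for the approximating
  laws too. Since \<open>E\<close> is arbitrary, even discontinuous functionals of the rounded path
  are covered.\<close>

lemma int_vector_convergence:
 fixes X :: "'t \<Rightarrow> int \<Rightarrow> 'a \<Rightarrow> int" and X' :: "int \<Rightarrow> 'b \<Rightarrow> int"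
 assumes M: "prob_space M" and M': "prob_space M'" and J: "finite J" "J \<noteq> {}"
  and ind: "\<And>t. prob_space.indep_vars M (\<lambda>_. count_space UNIV) (X t) J"
  and ind': "prob_space.indep_vars M' (\<lambda>_. count_space UNIV) X' J"
  and lim: "\<And>k v. k \<in> J \<Longrightarrow> ((\<lambda>t. measure M {w \<in> space M. X t k w = v}) \<longlongrightarrow> measure M' {w \<in> space M'. X' k w = v}) F"
 shows "((\<lambda>t. measure M {w \<in> space M. E (\<lambda>k\<in>J. X t k w)}) \<longlongrightarrow> measure M' {w \<in> space M'. E (\<lambda>k\<in>J. X' k w)}) F"
proof -
 interpret M: prob_space M by fact
 interpret M': prob_space M' by fact
 have X: "X t k \<in> M \<rightarrow>\<^sub>M count_space UNIV" if "k \<in> J" for t k using ind[of t] that by (auto simp: M.indep_vars_def2)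
 have X': "X' k \<in> M' \<rightarrow>\<^sub>M count_space UNIV" if "k \<in> J" for k using ind' that by (auto simp: M'.indep_vars_def2)
 define V where V: "V t w = (\<lambda>k\<in>J. X t k w)" for t w
 define V' where V': "V' w = (\<lambda>k\<in>J. X' k w)" for w
 have ev: "{w \<in> space M. P (V t w)} \<in> sets M" and ev': "{w \<in> space M'. P (V' w)} \<in> sets M'" for P t
  unfolding V V' using int_vector_measurable[OF J(1) X] int_vector_measurable[OF J(1) X'] by auto
 have limW: "((\<lambda>t. M.prob {w \<in> space M. V t w \<in> W}) \<longlongrightarrow> M'.prob {w \<in> space M'. V' w \<in> W}) F"
  if W: "finite W" "W \<subseteq> (\<Pi>\<^sub>E k\<in>J. UNIV)" for W
  unfolding V V' M.prob_int_vector[OF J ind W] M'.prob_int_vector[OF J ind' W] by (intro tendsto_sum tendsto_prod lim)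
 show ?thesis unfolding V[symmetric] V'[symmetric]
 proof (rule tendstoI)
  fix e :: real assume e: "0 < e"
  define W where "W R = (\<Pi>\<^sub>E k\<in>J. {- int R..int R})" for R
  have Wf: "finite (W R)" "W R \<subseteq> (\<Pi>\<^sub>E k\<in>J. UNIV)" for R
   unfolding W_def using J by (auto intro!: finite_PiE)
  have "(\<lambda>R. M'.prob {w \<in> space M'. V' w \<in> W R}) \<longlonglongrightarrow> M'.prob (\<Union>R. {w \<in> space M'. V' w \<in> W R})"
  proof (rule M'.finite_Lim_measure_incseq)
   show "incseq (\<lambda>R. {w \<in> space M'. V' w \<in> W R})"
    unfolding incseq_def W_def by (auto simp: PiE_iff; smt (verit) of_nat_le_iff)
  qed (use ev' in auto)
  also have "(\<Union>R. {w \<in> space M'. V' w \<in> W R}) = space M'"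
  proof (intro equalityI subsetI)
   fix w assume w: "w \<in> space M'"
   define R where "R = nat (Max ((\<lambda>k. \<bar>X' k w\<bar>) ` J))"
   have "\<bar>X' k w\<bar> \<le> int R" if "k \<in> J" for k
   proof -
    have "\<bar>X' k w\<bar> \<le> Max ((\<lambda>k. \<bar>X' k w\<bar>) ` J)" using that J by (intro Max_ge) auto
    then have "\<bar>X' k w\<bar> \<le> int R" unfolding R_def by linarith
    then show ?thesis .
   qed
   then have "V' w \<in> W R" unfolding V' W_def by (auto simp: PiE_iff abs_le_iff minus_le_iff)
   then show "w \<in> (\<Union>R. {w \<in> space M'. V' w \<in> W R})" using w by blast
  qed auto
  also have "M'.prob (space M') = 1" by (rule M'.prob_space)
  finally have "\<forall>\<^sub>F R in sequentially. 1 - e / 4 < M'.prob {w \<in> space M'. V' w \<in> W R}"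
   using e by (intro order_tendstoD(1)) auto
  then obtain R where R: "1 - e / 4 < M'.prob {w \<in> space M'. V' w \<in> W R}" unfolding eventually_sequentially by blast
  define W1 where "W1 = {v \<in> W R. E v}"
  have W1: "finite W1" "W1 \<subseteq> (\<Pi>\<^sub>E k\<in>J. UNIV)" using Wf[of R] by (auto simp: W1_def)
  have "\<forall>\<^sub>F t in F. dist (M.prob {w \<in> space M. V t w \<in> W1}) (M'.prob {w \<in> space M'. V' w \<in> W1}) < e / 4"
   using tendstoD[OF limW[OF W1], of "e / 4"] e by simp
  moreover have "\<forall>\<^sub>F t in F. 1 - e / 4 < M.prob {w \<in> space M. V t w \<in> W R}"
   by (rule order_tendstoD(1)[OF limW[OF Wf] R])
  ultimately show "\<forall>\<^sub>F t in F. dist (M.prob {w \<in> space M. E (V t w)}) (M'.prob {w \<in> space M'. E (V' w)}) < e"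
  proof eventually_elim
   case (elim t)
   have "\<bar>M.prob {w \<in> space M. E (V t w)} - M.prob {w \<in> space M. V t w \<in> W1}\<bar> \<le> 1 - M.prob {w \<in> space M. V t w \<in> W R}"
    unfolding W1_def by (rule M.prob_truncate) (rule ev)
   moreover have "\<bar>M'.prob {w \<in> space M'. E (V' w)} - M'.prob {w \<in> space M'. V' w \<in> W1}\<bar> \<le> 1 - M'.prob {w \<in> space M'. V' w \<in> W R}"
    unfolding W1_def by (rule M'.prob_truncate) (rule ev')
   ultimately show ?case using elim R unfolding dist_real_def by linarith
  qed
 qed
qed

section \<open>Rounded paths and good paths\<close>

lemma floor_path_close:
 assumes \<kappa>: "0 < \<kappa>" and k: "- N \<le> k" "k \<le> N"
 shows "\<bar>walk_path (\<lambda>j. \<kappa> * of_int \<lfloor>g j / \<kappa>\<rfloor>) k - walk_path g k\<bar> \<le> \<kappa> * of_int N"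
proof -
 let ?g' = "\<lambda>j. \<kappa> * of_int \<lfloor>g j / \<kappa>\<rfloor> :: real"
 have one: "\<bar>?g' j - g j\<bar> \<le> \<kappa>" for j
 proof -
  have "\<kappa> * of_int \<lfloor>g j / \<kappa>\<rfloor> \<le> \<kappa> * (g j / \<kappa>)" "\<kappa> * (g j / \<kappa>) \<le> \<kappa> * (of_int \<lfloor>g j / \<kappa>\<rfloor> + 1)"
   using \<kappa> by (intro mult_left_mono; linarith)+
  moreover have "\<kappa> * (g j / \<kappa>) = g j" "\<kappa> * (of_int \<lfloor>g j / \<kappa>\<rfloor> + 1) = \<kappa> * of_int \<lfloor>g j / \<kappa>\<rfloor> + \<kappa>"
   using \<kappa> by (simp_all add: distrib_left)
  ultimately have "\<kappa> * of_int \<lfloor>g j / \<kappa>\<rfloor> \<le> g j" "g j \<le> \<kappa> * of_int \<lfloor>g j / \<kappa>\<rfloor> + \<kappa>" by linarith+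
  then show ?thesis by simp
 qed
 have sum: "\<bar>(sum ?g' {a..<b}) - (sum g {a..<b})\<bar> \<le> \<kappa> * of_int N" if "a \<le> b" "b - a \<le> N" for a b :: int
 proof -
  have "\<bar>(sum ?g' {a..<b}) - (sum g {a..<b})\<bar> \<le> (\<Sum>j\<in>{a..<b}. \<bar>?g' j - g j\<bar>)"
   unfolding sum_subtractf[symmetric] by (rule sum_abs)
  also have "... \<le> (\<Sum>j\<in>{a..<b}. \<kappa>)" by (intro sum_mono one)
  also have "... = of_int (b - a) * \<kappa>" using that by simp
  also have "... \<le> of_int N * \<kappa>" using that \<kappa> by (intro mult_right_mono) auto
  finally show ?thesis by (simp add: mult.commute)
 qed
 show ?thesis using sum[of 0 k] sum[of k 0] k by (cases "0 \<le> k") (auto simp: walk_path_def abs_minus_commute)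
qed

definition good_path :: "int \<Rightarrow> int \<Rightarrow> int \<Rightarrow> real \<Rightarrow> real \<Rightarrow> path \<Rightarrow> bool" where
 "good_path q K S d c s \<longleftrightarrow> separated q K d s \<and> ascent q K c s \<and> ascent q K c (mirror s) \<and> off_center q S s"

text \<open>The passage from the margins d and 2 to d / 2 and 1 is what the rounding error may use
  up.\<close>

lemma good_path_perturb:
 assumes q: "0 < q" and K: "S \<le> K" "0 \<le> K" and good: "good_path q K S d 2 s" and e: "2 * e \<le> d / 2" "2 * e \<le> 1" "0 < d"
  and close: "\<And>k. k \<in> {- (K * q)..<K * q} \<Longrightarrow> \<bar>s k - s' k\<bar> \<le> e"
 shows "good_path q K S (d / 2) 1 s'"
proof -
 have blk: "k \<in> {- (K * q)..<K * q}" if "k \<in> {i * q..<(i + 1) * q}" "i \<in> {-K..<K}" for i k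
 proof -
  have "- K * q \<le> i * q" "(i + 1) * q \<le> K * q" using that(2) q by (auto intro!: mult_right_mono simp del: mult_minus_left)
  then show ?thesis using that(1) by auto
 qed
 have l: "\<bar>lo q s i - lo q s' i\<bar> \<le> e" and h: "\<bar>hi q s i - hi q s' i\<bar> \<le> e" if "i \<in> {-K..<K}" for i
  by (rule lo_diff_le[OF q] hi_diff_le[OF q], rule close, erule blk[OF _ that])+
 have sep: "d < \<bar>lo q s i - lo q s j\<bar>" "d < \<bar>hi q s i - hi q s j\<bar>" "d < \<bar>hi q s i - lo q s j - 1\<bar>"
  if "i \<in> {-K..<K}" "j \<in> {-K..<K}" "2 \<le> \<bar>i - j\<bar>" for i j
  using good that by (auto simp: good_path_def separated_def)
 have perturb: "d / 2 < \<bar>x' - y'\<bar>" if "d < \<bar>x - y\<bar>" "\<bar>x - x'\<bar> \<le> e" "\<bar>y - y'\<bar> \<le> e" for x y x' y' :: real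
  using that e(1) by linarith
 have 1: "separated q K (d / 2) s'" unfolding separated_def
 proof (intro allI impI)
  fix i j assume ij: "i \<in> {-K..<K}" "j \<in> {-K..<K}" "2 \<le> \<bar>i - j\<bar>"
  show "d / 2 < \<bar>lo q s' i - lo q s' j\<bar> \<and> d / 2 < \<bar>hi q s' i - hi q s' j\<bar> \<and> d / 2 < \<bar>hi q s' i - lo q s' j - 1\<bar>"
   using perturb[OF sep(1)[OF ij] l[OF ij(1)] l[OF ij(2)]] perturb[OF sep(2)[OF ij] h[OF ij(1)] h[OF ij(2)]]
    perturb[of "hi q s i" "lo q s j + 1" "hi q s' i" "lo q s' j + 1"] sep(3)[OF ij] h[OF ij(1)] l[OF ij(2)] by (simp add: algebra_simps)
 qed
 have asc: "ascent q K 1 r'" if asc: "ascent q K 2 r" and lr: "\<And>i. i \<in> {0..<K} \<Longrightarrow> \<bar>lo q r i - lo q r' i\<bar> \<le> e"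
  and hr: "\<And>i. i \<in> {0..<K} \<Longrightarrow> \<bar>hi q r i - hi q r' i\<bar> \<le> e" for r r'
 proof -
  obtain i j where ij: "0 \<le> i" "i \<le> j" "j < K" "2 \<le> hi q r j - lo q r i" using asc by (auto simp: ascent_def)
  then have "1 \<le> hi q r' j - lo q r' i" using lr[of i] hr[of j] e(2) by simp
  then show ?thesis using ij unfolding ascent_def by blast
 qed
 have 2: "ascent q K 1 s'" by (rule asc[of s]) (use good l h in \<open>auto simp: good_path_def\<close>)
 have 3: "ascent q K 1 (mirror s')"
  by (rule asc[of "mirror s"]) (use good in \<open>auto simp: good_path_def lo_mirror[OF q] hi_mirror[OF q] intro!: l h\<close>)
 have 4: "off_center q S s'"
 proof -
  obtain i where i: "i \<in> {2..<S}" "hi q s 0 < hi q s i" using good by (auto simp: good_path_def off_center_def)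
  obtain j where j: "j \<in> {2..<S}" "lo q s j < lo q s 0" using good by (auto simp: good_path_def off_center_def)
  have m: "0 \<in> {-K..<K}" "i \<in> {-K..<K}" "j \<in> {-K..<K}" using i j K by auto
  have "hi q s' 0 < hi q s' i" using sep(2)[OF m(2,1)] h[OF m(1)] h[OF m(2)] i e by auto
  moreover have "lo q s' j < lo q s' 0" using sep(1)[OF m(3,1)] l[OF m(1)] l[OF m(3)] j e by auto
  ultimately show ?thesis using i j unfolding off_center_def by blast
 qed
 show ?thesis using 1 2 3 4 by (simp add: good_path_def)
qed

lemma (in gaussian_field) prob_not_good_path:
 assumes q: "0 < q" and S: "2 < S" and u: "0 < u" and K: "(int n + 1) * u \<le> K" and d: "0 \<le> d"
 shows "Q.prob {w. \<not> good_path q K S d c (walk_path w)} \<le> 12 * (of_int K)\<^sup>2 * d / (\<tau> * sqrt (nat q))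
  + 2 * (1 - measure (gauss (\<tau> * sqrt (nat (u * q)))) {c..}) ^ n + 6 / sqrt (of_int (S - 2))"
  "{w. \<not> good_path q K S d c (walk_path w)} \<in> Q.events"
proof -
 let ?E = "{w. \<not> good_path q K S d c (walk_path w)}"
 let ?A = "{w. \<not> separated q K d (walk_path w)}" and ?B = "{w. \<not> ascent q K c (walk_path w)}"
  and ?C = "{w. \<not> ascent q K c (mirror (walk_path w))}" and ?D = "{w. \<not> off_center q S (walk_path w)}"
 have K0: "0 \<le> K" using K u by (meson mult_nonneg_nonneg of_nat_0_le_iff add_nonneg_nonneg zero_le_one less_imp_le order_trans)
 have evA: "?A \<in> Q.events" using sets.compl_sets[OF separated_meas[OF q, of K d]] by (simp add: space_Q Collect_neg_eq Compl_eq_Diff_UNIV)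
 have evD: "?D \<in> Q.events"
 proof -
  note [measurable] = block_functional_meas[OF q]
  have "{w \<in> space Q. \<forall>i\<in>{2..<S}. hi q (walk_path w) i \<le> hi q (walk_path w) 0} \<in> Q.events"
   "{w \<in> space Q. \<forall>i\<in>{2..<S}. lo q (walk_path w) 0 \<le> lo q (walk_path w) i} \<in> Q.events"
   by (intro sets.sets_Collect_finite_All borel_measurable_le block_functional_meas q finite_atLeastLessThan_int)+
  then have "{w \<in> space Q. \<forall>i\<in>{2..<S}. hi q (walk_path w) i \<le> hi q (walk_path w) 0} \<union>
   {w \<in> space Q. \<forall>i\<in>{2..<S}. lo q (walk_path w) 0 \<le> lo q (walk_path w) i} \<in> Q.events" (is "?D' \<in> _") by (rule sets.Un)
  moreover have "?D' = ?D" by (auto simp: space_Q off_center_def not_less)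
  ultimately show ?thesis by simp
 qed
 note evB = ascent_event[OF q, of K c] and evC = prob_no_ascent_mirror(2)[OF q, of K c]
 have eq: "?E = ((?A \<union> ?B) \<union> ?C) \<union> ?D" unfolding good_path_def by auto
 show "?E \<in> Q.events" unfolding eq by (intro sets.Un evA evB evC evD)
 have "Q.prob ?E \<le> Q.prob ?A + Q.prob ?B + Q.prob ?C + Q.prob ?D" unfolding eq
  using measure_Un_le[OF sets.Un[OF sets.Un[OF evA evB] evC] evD] measure_Un_le[OF sets.Un[OF evA evB] evC] measure_Un_le[OF evA evB] by linarith
 then show "Q.prob ?E \<le> 12 * (of_int K)\<^sup>2 * d / (\<tau> * sqrt (nat q))
  + 2 * (1 - measure (gauss (\<tau> * sqrt (nat (u * q)))) {c..}) ^ n + 6 / sqrt (of_int (S - 2))"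
  using prob_not_separated[OF q K0 d] prob_no_ascent[OF q u K, of c] prob_no_ascent_mirror(1)[OF q, of K c] prob_not_off_center[OF q S] by linarith
qed

lemma (in gaussian_field) prob_coordinate_less: "Q.prob {w. w k < x} = cdf std_normal_distribution (x / \<tau>)"
proof -
 have "distributed Q lborel (\<lambda>w. (w k - 0) / \<tau>) std_normal_density"
  using Q.normal_standard_normal_convert[OF tau, of "\<lambda>w. w k" 0] coordinate_distributed[of k] by simp
 then have d: "distr Q lborel (\<lambda>w. w k / \<tau>) = std_normal_distribution" by (simp add: distributed_def)
 have m: "(\<lambda>w. w k / \<tau>) \<in> Q \<rightarrow>\<^sub>M lborel" using coord_meas[of k] by (simp add: measurable_lborel1)
 have eq: "{w. w k < x} = (\<lambda>w. w k / \<tau>) -` {..<x / \<tau>} \<inter> space Q"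
  using tau by (auto simp: space_Q field_simps)
 have "Q.prob {w. w k < x} = measure std_normal_distribution {..<x / \<tau>}"
  unfolding eq d[symmetric] by (rule measure_distr[OF m, symmetric]) simp
 also have "... = cdf std_normal_distribution (x / \<tau>)"
 proof -
  interpret N: real_distribution std_normal_distribution by (rule real_dist_normal_dist)
  have "emeasure std_normal_distribution {x / \<tau>} = 0"
   by (subst emeasure_density) (auto simp: nn_integral_indicator_singleton)
  then have z: "measure std_normal_distribution {x / \<tau>} = 0" by (simp add: measure_def)
  have "measure std_normal_distribution {..x / \<tau>} = measure std_normal_distribution ({..<x / \<tau>} \<union> {x / \<tau>})"
   by (rule arg_cong[where f="measure std_normal_distribution"]) auto
  also have "... = measure std_normal_distribution {..<x / \<tau>} + measure std_normal_distribution {x / \<tau>}"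
   by (rule N.finite_measure_Union) auto
  finally show ?thesis using z by (simp add: cdf_def)
 qed
 finally show ?thesis .
qed

section \<open>The skeleton of the potential\<close>

lemma walk_path_cong:
 assumes "\<And>j. j \<in> {-N..<N} \<Longrightarrow> g j = h j" "- N \<le> k" "k \<le> N"
 shows "walk_path g k = walk_path h k"
 using assms by (auto simp: walk_path_def intro!: sum.cong)

definition skeleton :: "real \<Rightarrow> (int \<Rightarrow> int) \<Rightarrow> int \<Rightarrow> real" where
 "skeleton \<kappa> v = walk_path (\<lambda>j. \<kappa> * of_int (v j))"

lemma drift_bound:
 fixes D :: path
 assumes D0: "D 0 = 0" and step: "\<And>k. \<bar>D (k + 1) - D k\<bar> \<le> c"
 shows "\<bar>D k\<bar> \<le> of_int \<bar>k\<bar> * c"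
proof (induction k rule: int_induct[where k=0])
 case base
 then show ?case by (simp add: D0)
next
 case (step1 i)
 then show ?case using step[of i] by (simp add: algebra_simps)
next
 case (step2 i)
 then show ?case using step[of "i - 1"] by (simp add: algebra_simps)
qed

context quasi_additive
begin

definition potential :: "(int \<Rightarrow> 'b) \<Rightarrow> int \<Rightarrow> real" where
 "potential w x = (if 0 < x then Y 0 x w else if x < 0 then - Y x 0 w else 0)"

lemma potential_diff:
 assumes "a < b" shows "\<bar>potential w b - potential w a - Y a b w\<bar> \<le> C"
 using assms C_nonneg Y_quasi[of 0 a b w] Y_quasi[of a 0 b w] Y_quasi[of a b 0 w]
 by (cases "0 < a"; cases "a = 0"; cases "0 < b"; cases "b = 0") (auto simp: potential_def)

definition rounded_increment :: "real \<Rightarrow> real \<Rightarrow> nat \<Rightarrow> int \<Rightarrow> (int \<Rightarrow> 'b) \<Rightarrow> int" where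
 "rounded_increment \<kappa> T B k w = \<lfloor>Y (k * int B) ((k + 1) * int B) w / (\<kappa> * T)\<rfloor>"

definition rounded_vector :: "real \<Rightarrow> int \<Rightarrow> real \<Rightarrow> nat \<Rightarrow> (int \<Rightarrow> 'b) \<Rightarrow> int \<Rightarrow> int" where
 "rounded_vector \<kappa> N T B w = (\<lambda>k\<in>{-N..<N}. rounded_increment \<kappa> T B k w)"

text \<open>Every cell between 0 and k costs \<open>C\<close> by quasi-additivity, which is C / T
  after scaling, and \<kappa> by rounding.\<close>

lemma skeleton_close:
 assumes T: "0 < T" and \<kappa>: "0 < \<kappa>" and B: "1 \<le> B" and k: "- N \<le> k" "k \<le> N"
 shows "\<bar>potential w (k * int B) / T - skeleton \<kappa> (rounded_vector \<kappa> N T B w) k\<bar> \<le> of_int N * (C / T + \<kappa>)"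
proof -
 define g where "g j = Y (j * int B) ((j + 1) * int B) w / T" for j
 have 1: "\<bar>potential w (k * int B) / T - walk_path g k\<bar> \<le> of_int \<bar>k\<bar> * (C / T)"
 proof (rule drift_bound[where D="\<lambda>k. potential w (k * int B) / T - walk_path g k"])
  show "potential w (0 * int B) / T - walk_path g 0 = 0" by (simp add: potential_def walk_path_0)
  fix i
  have "walk_path g (i + 1) - walk_path g i = g i"
   using walk_path_diff[of i "i + 1" g] by (simp add: atLeastLessThanPlusOne_atLeastAtMost_int)
  then have "(potential w ((i + 1) * int B) / T - walk_path g (i + 1)) - (potential w (i * int B) / T - walk_path g i)
   = (potential w ((i + 1) * int B) - potential w (i * int B) - Y (i * int B) ((i + 1) * int B) w) / T"
   unfolding g_def by (simp add: diff_divide_distrib)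
  moreover have "\<bar>potential w ((i + 1) * int B) - potential w (i * int B) - Y (i * int B) ((i + 1) * int B) w\<bar> \<le> C"
   by (rule potential_diff) (use B in \<open>simp add: distrib_right\<close>)
  ultimately show "\<bar>(potential w ((i + 1) * int B) / T - walk_path g (i + 1)) - (potential w (i * int B) / T - walk_path g i)\<bar> \<le> C / T"
   using T by (simp add: abs_divide divide_right_mono)
 qed
 have "of_int \<bar>k\<bar> * (C / T) \<le> of_int N * (C / T)" using k C_nonneg T by (intro mult_right_mono) auto
 moreover have "\<bar>walk_path (\<lambda>j. \<kappa> * of_int \<lfloor>g j / \<kappa>\<rfloor>) k - walk_path g k\<bar> \<le> \<kappa> * of_int N"
  by (rule floor_path_close[OF \<kappa> k])
 moreover have "walk_path (\<lambda>j. \<kappa> * of_int \<lfloor>g j / \<kappa>\<rfloor>) k = skeleton \<kappa> (rounded_vector \<kappa> N T B w) k"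
  unfolding skeleton_def
  by (rule walk_path_cong[OF _ k]) (simp add: rounded_vector_def rounded_increment_def g_def mult.commute)
 ultimately show ?thesis using 1 by (simp add: distrib_left mult.commute)
qed

lemma tame_skeleton:
 assumes T: "0 < T" and \<kappa>: "0 < \<kappa>" and B: "1 \<le> B" and q: "1 \<le> q" and S: "0 \<le> S" "S \<le> K"
  and e: "of_int (K * q) * (C / T + \<kappa>) \<le> e" "C / T \<le> e" "e \<le> 1 / 64" "e \<le> \<delta> / 4"
  and coarse: "\<And>i j. i \<in> {-K..<K} \<Longrightarrow> j \<in> {1..nat q * B} \<Longrightarrow> \<bar>Y (i * (q * int B)) (i * (q * int B) + int j) w\<bar> < T / 16"
  and center: "\<And>j. j \<in> {1..nat (S * q) * B} \<Longrightarrow> \<bar>Y 0 (int j) w\<bar> < T / 8"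
  and fine: "\<And>k j. k \<in> {-(K * q)..<K * q} \<Longrightarrow> j \<in> {1..B} \<Longrightarrow> \<bar>Y (k * int B) (k * int B + int j) w\<bar> < \<delta> / 2 * T"
 defines "s \<equiv> skeleton \<kappa> (rounded_vector \<kappa> (K * q) T B w)"
 shows "tame q K S s"
  and "k \<in> {-(K * q)..<K * q} \<Longrightarrow> x \<in> {k * int B..(k + 1) * int B} \<Longrightarrow> \<bar>potential w x - T * s k\<bar> \<le> \<delta> * T"
proof -
 have close: "\<bar>potential w (k * int B) / T - s k\<bar> \<le> e" if "- (K * q) \<le> k" "k \<le> K * q" for k
  using skeleton_close[OF T \<kappa> B that, of w] e(1) unfolding s_def by linarith
 have e0: "0 \<le> e" using C_nonneg T e(2) by (meson divide_nonneg_pos order_trans)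
 show "tame q K S s" unfolding tame_def
 proof (intro conjI ballI)
  fix i k assume i: "i \<in> {-K..<K}" and k: "k \<in> {i * q..(i + 1) * q}"
  have r: "- K * q \<le> i * q" "(i + 1) * q \<le> K * q" using i q by (intro mult_right_mono; simp)+
  show "\<bar>s k - s (i * q)\<bar> \<le> 1 / 8"
  proof (cases "k = i * q")
   case False
   define j where "j = nat ((k - i * q) * int B)"
   have kp: "0 < k - i * q" "k - i * q \<le> q" using k False by (auto simp: distrib_right)
   have "0 < (k - i * q) * int B" "(k - i * q) * int B \<le> q * int B" using kp B by (auto intro: mult_right_mono)
   then have j: "int j = k * int B - i * q * int B" by (simp add: j_def left_diff_distrib)
   have "j \<in> {1..nat q * B}"
    using q \<open>0 < (k - i * q) * int B\<close> \<open>(k - i * q) * int B \<le> q * int B\<close> by (auto simp: j_def nat_le_iff nat_mult_distrib)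
   then have "\<bar>Y (i * q * int B) (k * int B) w\<bar> < T / 16" using coarse[OF i, of j] j by (simp add: mult.assoc)
   moreover have "i * q * int B < k * int B" using kp B by (intro mult_strict_right_mono) auto
   ultimately have "\<bar>potential w (k * int B) - potential w (i * q * int B)\<bar> \<le> T / 16 + C"
    using potential_diff[of "i * q * int B" "k * int B" w] by linarith
   then have "\<bar>potential w (k * int B) - potential w (i * q * int B)\<bar> / T \<le> (T / 16 + C) / T"
    using T by (intro divide_right_mono) auto
   then have "\<bar>potential w (k * int B) / T - potential w (i * q * int B) / T\<bar> \<le> 1 / 16 + C / T"
    using T by (simp add: abs_divide add_divide_distrib flip: diff_divide_distrib)
   moreover have "- (K * q) \<le> k" "k \<le> K * q" "- (K * q) \<le> i * q" "i * q \<le> K * q" using k r q i by (auto simp: distrib_right)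
   \<comment> \<open>1 / 16 + C / T + 2 e \<le> 1 / 16 + 3 / 64 < 1 / 8.\<close>
   ultimately show ?thesis using close[of k] close[of "i * q"] e by linarith
  qed auto
 next
  fix k assume k: "k \<in> {0..<S * q}"
  have Sq: "S * q \<le> K * q" using S q by (intro mult_right_mono) auto
  have "\<bar>potential w (k * int B)\<bar> \<le> T / 8"
  proof (cases "k = 0")
   case False
   define j where "j = nat (k * int B)"
   have j: "int j = k * int B" using k by (simp add: j_def)
   have "0 < k * int B" "k * int B \<le> S * q * int B" using k False B by (auto intro: mult_right_mono)
   then have "j \<in> {1..nat (S * q) * B}" using S q by (auto simp: j_def nat_le_iff nat_mult_distrib)
   then show ?thesis using center[of j] j \<open>0 < k * int B\<close> by (simp add: potential_def)
  qed (use T in \<open>simp add: potential_def\<close>)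
  then have "\<bar>potential w (k * int B)\<bar> / T \<le> T / 8 / T" using T by (intro divide_right_mono) auto
  then have "\<bar>potential w (k * int B) / T\<bar> \<le> 1 / 8" using T by (simp add: abs_divide)
  moreover have "0 \<le> K * q" using S q by auto
  with k Sq have "\<bar>potential w (k * int B) / T - s k\<bar> \<le> e" by (intro close) auto
  ultimately show "\<bar>s k\<bar> \<le> 1 / 4" using e(3) by linarith
 qed
 assume k: "k \<in> {-(K * q)..<K * q}" and x: "x \<in> {k * int B..(k + 1) * int B}"
 have "\<bar>potential w x - potential w (k * int B)\<bar> \<le> \<delta> / 2 * T + C"
 proof (cases "x = k * int B")
  case False
  define j where "j = nat (x - k * int B)"
  have j: "int j = x - k * int B" "j \<in> {1..B}" using x False by (auto simp: j_def distrib_right)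
  then show ?thesis using fine[OF k j(2)] potential_diff[of "k * int B" x w] by auto
 next
  case True
  have "0 \<le> \<delta> / 2 * T" using e e0 T by auto
  then show ?thesis using True C_nonneg by simp
 qed
 moreover have "\<bar>potential w (k * int B) - T * s k\<bar> \<le> e * T"
 proof -
  have "\<bar>potential w (k * int B) / T - s k\<bar> * T \<le> e * T" using close[of k] k T by (intro mult_right_mono) auto
  also have "\<bar>potential w (k * int B) / T - s k\<bar> * T = \<bar>(potential w (k * int B) / T - s k) * T\<bar>" using T by (simp add: abs_mult)
  also have "(potential w (k * int B) / T - s k) * T = potential w (k * int B) - T * s k" using T by (simp add: left_diff_distrib)
  finally show ?thesis .
 qed
 moreover have "C \<le> e * T" using e(2) T by (simp add: divide_le_eq)
 moreover have "e * T \<le> \<delta> / 4 * T" using e(4) T by (intro mult_right_mono) auto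
 ultimately show "\<bar>potential w x - T * s k\<bar> \<le> \<delta> * T" by linarith
qed

end

text \<open>A cell has about (ln t)^2 / U sites, so \<open>U\<close> cells make up one unit of
  length. The maximum with 1 keeps cells nonempty for small t.\<close>

definition block_length :: "real \<Rightarrow> nat \<Rightarrow> nat" where
 "block_length U t = nat (max 1 \<lfloor>(ln (real t))\<^sup>2 / U\<rfloor>)"

lemma block_length_ge: "1 \<le> block_length U t" by (simp add: block_length_def le_nat_iff)

lemma filterlim_ln_nat: "filterlim (\<lambda>t::nat. ln (real t)) at_top at_top"
 by (rule filterlim_compose[OF ln_at_top filterlim_real_sequentially])

lemma block_length_le:
 assumes U: "0 < U" and t: "U \<le> (ln (real t))\<^sup>2"
 shows "real (block_length U t) \<le> (ln (real t))\<^sup>2 / U" "(ln (real t))\<^sup>2 / U - 1 \<le> real (block_length U t)"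
proof -
 have "1 \<le> (ln (real t))\<^sup>2 / U" using assms by simp
 then have "1 \<le> \<lfloor>(ln (real t))\<^sup>2 / U\<rfloor>" by simp
 then have "real (block_length U t) = of_int \<lfloor>(ln (real t))\<^sup>2 / U\<rfloor>" by (simp add: block_length_def max_def)
 then show "real (block_length U t) \<le> (ln (real t))\<^sup>2 / U" "(ln (real t))\<^sup>2 / U - 1 \<le> real (block_length U t)" by linarith+
qed

lemma eventually_ln_square_ge: "\<forall>\<^sub>F t::nat in at_top. U \<le> (ln (real t))\<^sup>2"
proof -
 have "filterlim (\<lambda>t::nat. (ln (real t))\<^sup>2) at_top at_top"
  by (rule filterlim_pow_at_top[OF _ filterlim_ln_nat]) simp
 then show ?thesis by (simp add: filterlim_at_top)
qed

lemma block_length_at_top: assumes U: "0 < U" shows "filterlim (block_length U) at_top at_top"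
 unfolding filterlim_at_top
proof
 fix Z
 show "\<forall>\<^sub>F t in at_top. Z \<le> block_length U t"
  using eventually_ln_square_ge[of "(real Z + 1) * U"] eventually_ln_square_ge[of U]
 proof eventually_elim
  case (elim t)
  have "real Z + 1 \<le> (ln (real t))\<^sup>2 / U" using elim(1) U by (simp add: le_divide_eq)
  then show ?case using block_length_le(2)[OF U elim(2)] by linarith
 qed
qed

lemma sqrt_block_length:
 assumes U: "0 < U" shows "(\<lambda>t. ln (real t) / sqrt (block_length U t)) \<longlonglongrightarrow> sqrt U"
proof -
 have "(\<lambda>t. real (block_length U t) / (ln (real t))\<^sup>2) \<longlonglongrightarrow> 1 / U"
 proof (rule tendsto_sandwich)
  have "(\<lambda>t. 1 / U - inverse ((ln (real t))\<^sup>2)) \<longlonglongrightarrow> 1 / U - 0"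
   by (intro tendsto_diff tendsto_const tendsto_inverse_0_at_top filterlim_pow_at_top[OF _ filterlim_ln_nat]) simp
  then show "(\<lambda>t. 1 / U - inverse ((ln (real t))\<^sup>2)) \<longlonglongrightarrow> 1 / U" by simp
  show "\<forall>\<^sub>F t in at_top. 1 / U - inverse ((ln (real t))\<^sup>2) \<le> real (block_length U t) / (ln (real t))\<^sup>2"
   using eventually_ln_square_ge[of U]
  proof eventually_elim
   case (elim t)
   then have p: "0 < (ln (real t))\<^sup>2" using U by linarith
   have "1 / U - inverse ((ln (real t))\<^sup>2) = ((ln (real t))\<^sup>2 / U - 1) / (ln (real t))\<^sup>2"
    using p by (simp add: diff_divide_distrib inverse_eq_divide)
   also have "... \<le> real (block_length U t) / (ln (real t))\<^sup>2"
    using p block_length_le(2)[OF U elim] by (intro divide_right_mono) auto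
   finally show ?case .
  qed
  show "\<forall>\<^sub>F t in at_top. real (block_length U t) / (ln (real t))\<^sup>2 \<le> 1 / U"
   using eventually_ln_square_ge[of U]
  proof eventually_elim
   case (elim t)
   then have p: "0 < (ln (real t))\<^sup>2" using U by linarith
   show ?case using block_length_le(1)[OF U elim] p by (simp add: divide_le_eq mult.commute)
  qed
 qed simp
 then have "(\<lambda>t. sqrt (inverse (real (block_length U t) / (ln (real t))\<^sup>2))) \<longlonglongrightarrow> sqrt (inverse (1 / U))"
  using U by (intro tendsto_real_sqrt tendsto_inverse) auto
 moreover have "\<forall>\<^sub>F t in at_top. sqrt (inverse (real (block_length U t) / (ln (real t))\<^sup>2)) = ln (real t) / sqrt (block_length U t)"
  using eventually_ge_at_top[of 1] by eventually_elim (simp add: real_sqrt_divide)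
 ultimately show ?thesis using filterlim_cong[OF refl refl] by (fastforce simp: filterlim_cong)
qed

section \<open>Limit law of the rounded increments\<close>

lemma floor_divide_eq_iff_real: "0 < c \<Longrightarrow> \<lfloor>x / c\<rfloor> = v \<longleftrightarrow> of_int v * c \<le> x \<and> x < of_int (v + 1) * (c::real)"
 by (simp add: floor_eq_iff pos_le_divide_eq pos_divide_less_eq)

lemma (in prob_space) prob_floor_eq:
 fixes X :: "'a \<Rightarrow> real"
 assumes X: "X \<in> borel_measurable M" and c: "0 < c"
 shows "prob {w \<in> space M. \<lfloor>X w / c\<rfloor> = v} = prob {w \<in> space M. X w < of_int (v + 1) * c} - prob {w \<in> space M. X w < of_int v * c}"
proof -
 have "{w \<in> space M. \<lfloor>X w / c\<rfloor> = v} = {w \<in> space M. X w < of_int (v + 1) * c} - {w \<in> space M. X w < of_int v * c}"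
  unfolding floor_divide_eq_iff_real[OF c] by auto
 moreover have "of_int v * c \<le> of_int (v + 1) * c" using c by simp
 then have "{w \<in> space M. X w < of_int v * c} \<subseteq> {w \<in> space M. X w < of_int (v + 1) * c}" by auto
 ultimately show ?thesis using X by (simp add: finite_measure_Diff)
qed

context centered_additive
begin

text \<open>With B the cell length, ln t / sqrt B tends to sqrt U, so the increment over a cell
  divided by ln t is asymptotically normal with deviation \<sigma> / sqrt U. The normal law has no
  atoms, so the probabilities of the rounding intervals converge.\<close>

lemma rounded_increment_lim:
 assumes \<sigma>: "0 < \<sigma>" and \<kappa>: "0 < \<kappa>" and U: "0 < U" and G: "gaussian_field (\<sigma> / sqrt U)"
 shows "((\<lambda>t. Q.prob {w. rounded_increment \<kappa> (ln (real t)) (block_length U t) k w = v}) \<longlongrightarrow>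
  measure (iid_field.Q (gauss (\<sigma> / sqrt U))) {w. \<lfloor>w k / \<kappa>\<rfloor> = v}) at_top"
proof -
 interpret G: gaussian_field "\<sigma> / sqrt U" by fact
 let ?B = "block_length U"
 define p where "p v t = Q.prob {w. y (?B t) w < (of_int v * (\<kappa> * (ln (real t) / sqrt (?B t)))) * sqrt (?B t)}" for v :: int and t
 have ev: "\<forall>\<^sub>F t in at_top. p (v + 1) t - p v t = Q.prob {w. rounded_increment \<kappa> (ln (real t)) (?B t) k w = v}"
  using eventually_gt_at_top[of 1]
 proof eventually_elim
  case (elim t)
  have T: "0 < \<kappa> * ln (real t)" using elim \<kappa> by simp
  have s: "sqrt (?B t) \<noteq> 0" using block_length_ge[of U t] by simp
  have Yy: "Y (k * int (?B t)) ((k + 1) * int (?B t)) w = y (?B t) (shift (k * int (?B t)) w)" for w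
   using Y_eq_y_shift[OF block_length_ge, of "k * int (?B t)" U t w] by (simp add: distrib_right)
  have m: "y (?B t) \<in> borel_measurable Q" by (rule rv_meas[OF y_bdd[OF block_length_ge]])
  have "Q.prob {w. rounded_increment \<kappa> (ln (real t)) (?B t) k w = v}
   = Q.prob (shift (k * int (?B t)) -` {w. \<lfloor>y (?B t) w / (\<kappa> * ln (real t))\<rfloor> = v} \<inter> space Q)"
   unfolding rounded_increment_def Yy by (simp add: space_Q vimage_def)
  also have "... = measure (distr Q Q (shift (k * int (?B t)))) {w. \<lfloor>y (?B t) w / (\<kappa> * ln (real t))\<rfloor> = v}"
  proof (rule measure_distr[symmetric, OF shift_measurable])
   have "{w \<in> space Q. \<lfloor>y (?B t) w / (\<kappa> * ln (real t))\<rfloor> = v} \<in> Q.events" using m by measurable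
   then show "{w. \<lfloor>y (?B t) w / (\<kappa> * ln (real t))\<rfloor> = v} \<in> Q.events" by (simp add: space_Q)
  qed
  also have "... = Q.prob {w. y (?B t) w < of_int (v + 1) * (\<kappa> * ln (real t))} - Q.prob {w. y (?B t) w < of_int v * (\<kappa> * ln (real t))}"
   using Q.prob_floor_eq[OF m T, of v] by (simp add: distr_shift space_Q)
  finally show ?case using s by (simp add: p_def mult.assoc)
 qed
 have lim: "(p z \<longlongrightarrow> cdf std_normal_distribution ((of_int z * (\<kappa> * sqrt U)) / \<sigma>)) at_top" for z
  unfolding p_def by (rule y_clt_moving[OF \<sigma> block_length_at_top[OF U]]) (intro tendsto_intros sqrt_block_length U)
 have "G.Q.prob {w. \<lfloor>w k / \<kappa>\<rfloor> = v} = cdf std_normal_distribution ((of_int (v + 1) * (\<kappa> * sqrt U)) / \<sigma>) - cdf std_normal_distribution ((of_int v * (\<kappa> * sqrt U)) / \<sigma>)"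
  using G.Q.prob_floor_eq[OF G.coord_meas \<kappa>, of k v] by (simp add: G.space_Q G.prob_coordinate_less mult.assoc)
 with tendsto_diff[OF lim lim, of "v + 1" v] show ?thesis by (simp only: tendsto_cong[OF ev])
qed

lemma rounded_increment_measurable: "1 \<le> B \<Longrightarrow> rounded_increment \<kappa> T B k \<in> Q \<rightarrow>\<^sub>M count_space UNIV"
proof -
 assume B: "1 \<le> B"
 have [measurable]: "Y (k * int B) ((k + 1) * int B) \<in> borel_measurable Q"
  by (rule Y_meas) (use B in \<open>simp add: distrib_right\<close>)
 show ?thesis unfolding rounded_increment_def[abs_def] by measurable
qed

lemma rounded_vector_event: "1 \<le> B \<Longrightarrow> {w. E (rounded_vector \<kappa> N T B w)} \<in> Q.events"
 using int_vector_measurable[of "{-N..<N}" "rounded_increment \<kappa> T B" Q E] rounded_increment_measurable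
 by (simp add: rounded_vector_def space_Q)

lemma rounded_vector_lim:
 assumes \<sigma>: "0 < \<sigma>" and \<kappa>: "0 < \<kappa>" and U: "0 < U" and N: "1 \<le> N"
 shows "((\<lambda>t. Q.prob {w. E (rounded_vector \<kappa> N (ln (real t)) (block_length U t) w)}) \<longlongrightarrow>
  measure (iid_field.Q (gauss (\<sigma> / sqrt U))) {w. E (\<lambda>k\<in>{-N..<N}. \<lfloor>w k / \<kappa>\<rfloor>)}) at_top"
proof -
 interpret G: gaussian_field "\<sigma> / sqrt U" by unfold_locales (use \<sigma> U in simp)
 have ind: "Q.indep_vars (\<lambda>_. count_space UNIV) (\<lambda>k. rounded_increment \<kappa> (ln (real t)) (block_length U t) k) {-N..<N}" (is "Q.indep_vars _ (\<lambda>k. ?X t k) _") for t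
 proof (rule depends_indep_vars[where K="\<lambda>k. {k * int (block_length U t)..<(k + 1) * int (block_length U t)}"])
  show "?X t k \<in> Q \<rightarrow>\<^sub>M count_space UNIV" for k by (rule rounded_increment_measurable[OF block_length_ge])
  show "depends {k * int (block_length U t)..<(k + 1) * int (block_length U t)} (?X t k)" for k
   unfolding rounded_increment_def[abs_def]
   by (rule depends_comp[of _ _ "\<lambda>z. \<lfloor>z / (\<kappa> * ln (real t))\<rfloor>"], rule Y_dep)
    (use block_length_ge[of U t] in \<open>simp add: distrib_right\<close>)
  show "disjoint_family_on (\<lambda>k. {k * int (block_length U t)..<(k + 1) * int (block_length U t)}) {-N..<N}"
   unfolding disjoint_family_on_def
  proof (intro ballI impI)
   fix k l :: int assume "k \<noteq> l"
   have "0 < int (block_length U t)" using block_length_ge[of U t] by simp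
   then show "{k * int (block_length U t)..<(k + 1) * int (block_length U t)} \<inter> {l * int (block_length U t)..<(l + 1) * int (block_length U t)} = {}"
    using \<open>k \<noteq> l\<close> div_block[of "int (block_length U t)"] by blast
  qed
 qed
 have ind': "G.Q.indep_vars (\<lambda>_. count_space UNIV) (\<lambda>k w. \<lfloor>w k / \<kappa>\<rfloor>) {-N..<N}"
  by (rule G.depends_indep_vars[where K="\<lambda>k. {k}"])
   (auto simp: G.depends_def disjoint_family_on_def)
 have "((\<lambda>t. Q.prob {w \<in> space Q. E (\<lambda>k\<in>{-N..<N}. ?X t k w)}) \<longlongrightarrow> G.Q.prob {w \<in> space G.Q. E (\<lambda>k\<in>{-N..<N}. \<lfloor>w k / \<kappa>\<rfloor>)}) at_top"
  by (rule int_vector_convergence[OF Q.prob_space_axioms G.Q.prob_space_axioms _ _ ind ind'])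
   (use N rounded_increment_lim[OF \<sigma> \<kappa> U G.gaussian_field_axioms] in \<open>auto simp: space_Q G.space_Q\<close>)
 then show ?thesis by (simp add: space_Q G.space_Q rounded_vector_def)
qed

lemma oscillation_event:
 assumes J: "finite J" and n: "1 \<le> n" and c: "0 < c"
 shows "{w. \<exists>a\<in>J. \<exists>i\<in>{1..n}. c \<le> \<bar>Y a (a + int i) w\<bar>} \<in> Q.events"
  and "Q.prob {w. \<exists>a\<in>J. \<exists>i\<in>{1..n}. c \<le> \<bar>Y a (a + int i) w\<bar>} \<le> real (card J) * (4 * h4 * (real n)\<^sup>2 / c ^ 4)"
proof -
 let ?E = "\<lambda>a. {w. \<exists>i\<in>{1..n}. c \<le> \<bar>Y a (a + int i) w\<bar>}"
 let ?U = "{w. \<exists>a\<in>J. \<exists>i\<in>{1..n}. c \<le> \<bar>Y a (a + int i) w\<bar>}"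
 have e: "?E a \<in> Q.events" for a
 proof -
  have "{w \<in> space Q. \<exists>i\<in>{1..n}. c \<le> \<bar>Y a (a + int i) w\<bar>} \<in> Q.events"
   by (intro sets.sets_Collect_finite_Ex borel_measurable_le borel_measurable_abs Y_meas borel_measurable_const) auto
  then show ?thesis by (simp add: space_Q)
 qed
 have eq: "?U = (\<Union>a\<in>J. ?E a)" by auto
 show "?U \<in> Q.events" unfolding eq using J e by auto
 have "Q.prob (\<Union>a\<in>J. ?E a) \<le> (\<Sum>a\<in>J. Q.prob (?E a))"
  by (rule Q.finite_measure_subadditive_finite) (use J e in auto)
 also have "... \<le> (\<Sum>a\<in>J. 4 * h4 * (real n)\<^sup>2 / c ^ 4)" by (intro sum_mono oscillation_tail n c)
 finally show "Q.prob ?U \<le> real (card J) * (4 * h4 * (real n)\<^sup>2 / c ^ 4)" unfolding eq by simp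
qed

end

section \<open>Choice of the scales and likelihood of good environments\<close>

lemma exists_large_int:
 fixes A e :: real assumes "0 < e"
 obtains u :: int where "L \<le> u" "A \<le> e * of_int u"
proof
 show "L \<le> max L \<lceil>A / e\<rceil>" by simp
 have "A / e \<le> of_int (max L \<lceil>A / e\<rceil>)" by linarith
 then show "A \<le> e * of_int (max L \<lceil>A / e\<rceil>)" using assms by (simp add: divide_le_eq mult.commute)
qed

context quasi_additive
begin

definition env_path :: "real \<Rightarrow> int \<Rightarrow> real \<Rightarrow> nat \<Rightarrow> (int \<Rightarrow> 'b) \<Rightarrow> int \<Rightarrow> real" where
 "env_path \<kappa> N U t w = skeleton \<kappa> (rounded_vector \<kappa> N (ln (real t)) (block_length U t) w)"

definition tracks :: "real \<Rightarrow> real \<Rightarrow> int \<Rightarrow> real \<Rightarrow> nat \<Rightarrow> (int \<Rightarrow> 'b) \<Rightarrow> bool" where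
 "tracks \<delta> \<kappa> N U t w \<longleftrightarrow> (\<forall>k\<in>{-N..<N}. \<forall>x\<in>{k * int (block_length U t)..(k + 1) * int (block_length U t)}.
   \<bar>potential w x - ln (real t) * env_path \<kappa> N U t w k\<bar> \<le> \<delta> * ln (real t))"

definition good_environment :: "real \<Rightarrow> int \<Rightarrow> int \<Rightarrow> real \<Rightarrow> real \<Rightarrow> nat \<Rightarrow> (int \<Rightarrow> 'b) \<Rightarrow> bool" where
 "good_environment \<kappa> N q d U t w \<longleftrightarrow> (\<exists>\<beta>. valley (env_path \<kappa> N U t w) N d (2 * q) \<beta>) \<and> tracks (d / 8) \<kappa> N U t w"

end

context centered_additive
begin

text \<open>With \<tau> = \<sigma> / sqrt (u q) the deviation over one block of \<open>q\<close>
  cells is \<sigma> / sqrt u, and over \<open>u\<close> blocks it is \<sigma>. The bounds for the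
  Gaussian walk are therefore free of \<open>q\<close>, which may still be taken large
  afterwards.\<close>

lemma rounded_good_path:
 assumes \<sigma>: "0 < \<sigma>" and \<eta>: "0 < \<eta>" and q: "1 \<le> q" and u: "1 \<le> u" and S: "2 < S" "S \<le> K" and K: "(int n + 1) * u \<le> K"
  and d: "0 < d" and \<kappa>: "0 < \<kappa>" "2 * (\<kappa> * of_int (K * q)) \<le> d / 2" "2 * (\<kappa> * of_int (K * q)) \<le> 1"
  and sep: "12 * (of_int K)\<^sup>2 * d * sqrt (of_int u) \<le> \<eta> * \<sigma>"
  and asc: "(1 - measure (gauss \<sigma>) {2..}) ^ n \<le> \<eta>"
  and off: "6 / sqrt (of_int (S - 2)) \<le> \<eta>"
 shows "\<forall>\<^sub>F t in at_top. Q.prob {w. \<not> good_path q K S (d / 2) 1 (env_path \<kappa> (K * q) (of_int (u * q)) t w)} < 5 * \<eta>"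
proof -
 let ?v = "\<lambda>w. \<lambda>k\<in>{-(K * q)..<K * q}. \<lfloor>w k / \<kappa>\<rfloor>"
 define U where "U = (of_int (u * q) :: real)"
 have uq: "1 \<le> u * q" using mult_mono[of 1 u 1 q] u q by simp
 have U: "0 < U" using uq by (simp add: U_def del: of_int_mult)
 have Kq: "1 \<le> K * q" using mult_mono[of 1 K 1 q] S q by simp
 interpret G: gaussian_field "\<sigma> / sqrt U" by unfold_locales (use \<sigma> U in simp)
 define E where "E v = (\<not> good_path q K S (d / 2) 1 (skeleton \<kappa> v))" for v
 have "G.Q.prob {w. E (?v w)} \<le> G.Q.prob {w. \<not> good_path q K S d 2 (walk_path w)}"
 proof (rule G.Q.finite_measure_mono)
  show "{w. \<not> good_path q K S d 2 (walk_path w)} \<in> G.Q.events"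
   by (rule G.prob_not_good_path(2)[where n=n and u=u]) (use q S u K d in auto)
  show "{w. E (?v w)} \<subseteq> {w. \<not> good_path q K S d 2 (walk_path w)}"
  proof (intro subsetI CollectI notI)
   fix w assume E: "w \<in> {w. E (?v w)}" and g: "good_path q K S d 2 (walk_path w)"
   have "good_path q K S (d / 2) 1 (skeleton \<kappa> (?v w))"
   proof (rule good_path_perturb[OF _ S(2) _ g \<kappa>(2,3) d])
    fix k assume "k \<in> {- (K * q)..<K * q}"
    then have k: "- (K * q) \<le> k" "k \<le> K * q" by auto
    have "skeleton \<kappa> (?v w) k = walk_path (\<lambda>j. \<kappa> * of_int \<lfloor>w j / \<kappa>\<rfloor>) k"
     unfolding skeleton_def by (rule walk_path_cong[OF _ k]) simp
    then show "\<bar>walk_path w k - skeleton \<kappa> (?v w) k\<bar> \<le> \<kappa> * of_int (K * q)"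
     using floor_path_close[OF \<kappa>(1) k, of w] by (simp add: abs_minus_commute)
   qed (use q S in auto)
   then show False using E by (simp add: E_def)
  qed
 qed
 also have "... \<le> 12 * (of_int K)\<^sup>2 * d / (\<sigma> / sqrt U * sqrt (nat q))
  + 2 * (1 - measure (gauss (\<sigma> / sqrt U * sqrt (nat (u * q)))) {2..}) ^ n + 6 / sqrt (of_int (S - 2))"
  by (rule G.prob_not_good_path(1)) (use q S u K d in auto)
 also have "\<sigma> / sqrt U * sqrt (nat (u * q)) = \<sigma>" using q u by (simp add: U_def)
 also have "\<sigma> / sqrt U * sqrt (nat q) = \<sigma> / sqrt (of_int u)" using q u by (simp add: U_def real_sqrt_mult)
 also have "12 * (of_int K)\<^sup>2 * d / (\<sigma> / sqrt (of_int u)) \<le> \<eta>"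
  using sep \<sigma> u by (simp add: divide_le_eq)
 finally have "G.Q.prob {w. E (?v w)} < 5 * \<eta>" using asc off \<eta> by linarith
 then have "\<forall>\<^sub>F t in at_top. Q.prob {w. E (rounded_vector \<kappa> (K * q) (ln (real t)) (block_length U t) w)} < 5 * \<eta>"
  by (rule order_tendstoD(2)[OF rounded_vector_lim[OF \<sigma> \<kappa>(1) U Kq]])
 then show ?thesis by (simp only: E_def U_def env_path_def)
qed

text \<open>By fourth moments a stretch of length l oscillates by order T with probability of order
  l^2 / T^4. Up to constants, the 2 K blocks of length T^2 / u contribute K / u^2 = (n + 1) / u, the
  first \<open>S\<close> blocks together S^2 / u^2, and the 2 K q cells at most K / (q \<delta>^4).
  So a large \<open>u\<close> settles the first two and a large \<open>q\<close> the last.\<close>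

lemma tame_event:
 assumes \<eta>: "0 < \<eta>" and q: "1 \<le> q" and u: "1 \<le> u" and S: "2 < S" "S \<le> K" and K: "K = (int n + 1) * u"
  and e: "0 < e" "e \<le> 1 / 64" "e \<le> \<delta> / 4" and \<kappa>: "0 < \<kappa>" "of_int (K * q) * \<kappa> \<le> e / 2"
  and coarse: "8 * (real n + 1) * h4 * 16 ^ 4 \<le> \<eta> * of_int u"
  and center: "4 * h4 * 8 ^ 4 * (of_int S)\<^sup>2 \<le> \<eta> * of_int u"
  and fine: "128 * of_int K * h4 \<le> \<eta> * \<delta> ^ 4 * of_int q"
 shows "\<forall>\<^sub>F t in at_top. \<exists>A\<in>Q.events. 1 - 3 * \<eta> \<le> Q.prob A \<and> (\<forall>w\<in>A.
  tame q K S (env_path \<kappa> (K * q) (of_int (u * q)) t w) \<and> tracks \<delta> \<kappa> (K * q) (of_int (u * q)) t w)"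
proof -
 define U where "U = (of_int (u * q) :: real)"
 define B where "B = block_length U"
 have uq: "1 \<le> u * q" using mult_mono[of 1 u 1 q] u q by simp
 have U: "0 < U" using uq by (simp add: U_def del: of_int_mult)
 have Kq: "1 \<le> K * q" using mult_mono[of 1 K 1 q] S q by simp
 have \<delta>: "0 < \<delta>" using e by simp
 have "\<forall>\<^sub>F t::nat in at_top. 2 * of_int (K * q) * C / e + 1 \<le> ln (real t)"
  using filterlim_ln_nat unfolding filterlim_at_top by blast
 then show ?thesis using eventually_ln_square_ge[of U]
 proof eventually_elim
  case (elim t)
  define T where "T = ln (real t)"
  have "0 \<le> 2 * of_int (K * q) * C / e" using Kq C_nonneg e(1) by (simp del: of_int_mult)
  then have T: "0 < T" "2 * of_int (K * q) * C / e \<le> T" using elim by (auto simp: T_def)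
  have B1: "1 \<le> B t" unfolding B_def by (rule block_length_ge)
  have BT: "real (B t) \<le> T\<^sup>2 / (of_int u * of_int q)"
   using block_length_le(1)[OF U elim(2)] by (simp add: B_def T_def U_def)
  have pos: "0 < real_of_int u" "0 < real_of_int q" "0 < real_of_int K" using u q S by auto
  have C1: "of_int (K * q) * (C / T) \<le> e / 2" using T e(1) by (simp add: field_simps)
  have "1 * (C / T) \<le> of_int (K * q) * (C / T)"
  proof (rule mult_right_mono)
   show "1 \<le> real_of_int (K * q)" using Kq by linarith
  qed (use C_nonneg T in auto)
  then have C2: "C / T \<le> e" using C1 e(1) by linarith
  define J1 J3 where "J1 = (\<lambda>i. i * (q * int (B t))) ` {-K..<K}" and "J3 = (\<lambda>k. k * int (B t)) ` {-(K * q)..<K * q}"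
  have J: "finite J1" "finite J3" by (auto simp: J1_def J3_def)
  define E1 where "E1 = {w. \<exists>a\<in>J1. \<exists>j\<in>{1..nat q * B t}. T / 16 \<le> \<bar>Y a (a + int j) w\<bar>}"
  define E2 where "E2 = {w. \<exists>a\<in>{0}. \<exists>j\<in>{1..nat (S * q) * B t}. T / 8 \<le> \<bar>Y a (a + int j) w\<bar>}"
  define E3 where "E3 = {w. \<exists>a\<in>J3. \<exists>j\<in>{1..B t}. \<delta> / 2 * T \<le> \<bar>Y a (a + int j) w\<bar>}"
  have n1: "1 \<le> nat q * B t" using q B1 by (simp add: Suc_le_eq)
  have n2: "1 \<le> nat (S * q) * B t" using q S B1 by (simp add: Suc_le_eq)
  have ev: "E1 \<in> Q.events" "E2 \<in> Q.events" "E3 \<in> Q.events"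
   unfolding E1_def E2_def E3_def using T \<delta> J by (intro oscillation_event(1) n1 n2 B1; simp)+
  have p1: "Q.prob E1 \<le> \<eta>"
  proof -
   have "Q.prob E1 \<le> real (card J1) * (4 * h4 * (real (nat q * B t))\<^sup>2 / (T / 16) ^ 4)"
    unfolding E1_def using T J by (intro oscillation_event(2) n1) auto
   also have "... \<le> (2 * of_int K) * (4 * h4 * (T\<^sup>2 / of_int u)\<^sup>2 / (T / 16) ^ 4)"
   proof (intro mult_mono divide_right_mono power_mono)
    have "card J1 \<le> card {-K..<K}" unfolding J1_def by (rule card_image_le) simp
    then have "int (card J1) \<le> 2 * K" using S by simp
    then show "real (card J1) \<le> 2 * of_int K" by linarith
    have "of_int q * real (B t) \<le> of_int q * (T\<^sup>2 / (of_int u * of_int q))" using BT pos by (intro mult_left_mono) auto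
    then show "real (nat q * B t) \<le> T\<^sup>2 / of_int u" using q pos by simp
   qed (use h4_nonneg T pos in auto)
   also have "... = 8 * (real n + 1) * h4 * 16 ^ 4 / of_int u"
    using T pos by (simp add: K power_divide power2_eq_square power4_eq_xxxx field_simps)
   also have "... \<le> \<eta>" using coarse pos by (simp add: divide_le_eq)
   finally show ?thesis .
  qed
  have p2: "Q.prob E2 \<le> \<eta>"
  proof -
   have "Q.prob E2 \<le> real (card {0::int}) * (4 * h4 * (real (nat (S * q) * B t))\<^sup>2 / (T / 8) ^ 4)"
    unfolding E2_def using T by (intro oscillation_event(2) n2) auto
   also have "... \<le> 1 * (4 * h4 * (of_int S * T\<^sup>2 / of_int u)\<^sup>2 / (T / 8) ^ 4)"
   proof (intro mult_mono divide_right_mono power_mono)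
    have "of_int (S * q) * real (B t) \<le> of_int (S * q) * (T\<^sup>2 / (of_int u * of_int q))" using BT pos S q by (intro mult_left_mono) auto
    then show "real (nat (S * q) * B t) \<le> of_int S * T\<^sup>2 / of_int u" using q S pos by simp
   qed (use h4_nonneg T pos in auto)
   also have "... = 4 * h4 * 8 ^ 4 * (of_int S)\<^sup>2 / (of_int u)\<^sup>2"
    using T pos by (simp add: power_divide power2_eq_square power4_eq_xxxx field_simps)
   also have "... \<le> \<eta> * of_int u / (of_int u)\<^sup>2" by (rule divide_right_mono[OF center]) simp
   also have "... = \<eta> / of_int u" using pos by (simp add: power2_eq_square)
   also have "... \<le> \<eta>" using u \<eta> by (simp add: divide_le_eq)
   finally show ?thesis .
  qed
  have p3: "Q.prob E3 \<le> \<eta>"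
  proof -
   have "Q.prob E3 \<le> real (card J3) * (4 * h4 * (real (B t))\<^sup>2 / (\<delta> / 2 * T) ^ 4)"
    unfolding E3_def using T \<delta> J by (intro oscillation_event(2) B1) auto
   also have "... \<le> (2 * (of_int K * of_int q)) * (4 * h4 * (T\<^sup>2 / (of_int u * of_int q))\<^sup>2 / (\<delta> / 2 * T) ^ 4)"
   proof (intro mult_mono divide_right_mono power_mono BT)
    have "card J3 \<le> card {-(K * q)..<K * q}" unfolding J3_def by (rule card_image_le) simp
    then have "int (card J3) \<le> 2 * (K * q)" using Kq by simp
    then have "real_of_int (int (card J3)) \<le> of_int (2 * (K * q))" by (simp only: of_int_le_iff)
    then show "real (card J3) \<le> 2 * (of_int K * of_int q)" by simp
   qed (use h4_nonneg T pos \<delta> in auto)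
   also have "... = 128 * of_int K * h4 / (\<delta> ^ 4 * of_int q * (of_int u)\<^sup>2)"
    using T pos \<delta> by (simp add: power_mult_distrib power_divide power2_eq_square power4_eq_xxxx field_simps)
   also have "... \<le> 128 * of_int K * h4 / (\<delta> ^ 4 * of_int q * 1)"
    using pos \<delta> h4_nonneg u by (intro divide_left_mono mult_left_mono) auto
   also have "... \<le> \<eta>" using fine pos \<delta> by (simp add: divide_le_eq mult.assoc)
   finally show ?thesis .
  qed
  define A where "A = space Q - (E1 \<union> E2 \<union> E3)"
  have A: "A \<in> Q.events" using ev by (auto simp: A_def)
  have "Q.prob A = 1 - Q.prob (E1 \<union> E2 \<union> E3)" unfolding A_def using ev by (intro Q.prob_compl) auto
  moreover have "Q.prob (E1 \<union> E2 \<union> E3) \<le> 3 * \<eta>"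
   using measure_Un_le[OF sets.Un[OF ev(1,2)] ev(3)] measure_Un_le[OF ev(1,2)] p1 p2 p3 by linarith
  ultimately have PA: "1 - 3 * \<eta> \<le> Q.prob A" by simp
  have "tame q K S (env_path \<kappa> (K * q) U t w) \<and> tracks \<delta> \<kappa> (K * q) U t w" if w: "w \<in> A" for w
  proof -
   have h1: "\<bar>Y (i * (q * int (B t))) (i * (q * int (B t)) + int j) w\<bar> < T / 16" if "i \<in> {-K..<K}" "j \<in> {1..nat q * B t}" for i j
    using w that by (auto simp: A_def E1_def J1_def not_le)
   have h2: "\<bar>Y 0 (int j) w\<bar> < T / 8" if "j \<in> {1..nat (S * q) * B t}" for j
    using w that by (auto simp: A_def E2_def not_le)
   have h3: "\<bar>Y (k * int (B t)) (k * int (B t) + int j) w\<bar> < \<delta> / 2 * T" if "k \<in> {-(K * q)..<K * q}" "j \<in> {1..B t}" for k j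
    using w that by (auto simp: A_def E3_def J3_def not_le)
   have S0: "0 \<le> S" using S by simp
   have "of_int (K * q) * (C / T + \<kappa>) \<le> e" using C1 \<kappa>(2) unfolding distrib_left by linarith
   note ts = tame_skeleton[OF T(1) \<kappa>(1) B1 q S0 S(2) this C2 e(2,3) h1 h2 h3]
   show ?thesis using ts unfolding env_path_def tracks_def T_def B_def by blast
  qed
  then show ?case using A PA unfolding U_def by blast
 qed
qed

text \<open>The order of the choices matters: n for the ascents, S for the origin, then u and K = (n
  + 1) u, d against ties, q against oscillation inside cells, and last \<kappa> against rounding. No
  condition on a parameter involves a later one; in particular the margin d is fixed before the
  fineness q.\<close>

theorem good_environment_likely:
 assumes \<sigma>: "0 < \<sigma>" and \<eta>: "0 < \<eta>"
 shows "\<exists>\<kappa> N q d U. 0 < \<kappa> \<and> 1 \<le> N \<and> 1 \<le> q \<and> 0 < d \<and> 0 < U \<and> of_int (2 * q + 2) / U \<le> \<eta> \<and>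
  (\<forall>\<^sub>F t in at_top. \<exists>A\<in>Q.events. 1 - \<eta> \<le> Q.prob A \<and> (\<forall>w\<in>A. good_environment \<kappa> N q d U t w))"
proof -
 \<comment> \<open>Five shares go to the Gaussian estimates and three to the oscillation
   bounds.\<close>
 define \<theta> where "\<theta> = \<eta> / 8"
 have \<theta>: "0 < \<theta>" using \<eta> by (simp add: \<theta>_def)
 define p where "p = measure (gauss \<sigma>) {2..}"
 have p: "0 < p" unfolding p_def by (rule normal_tail_positive[OF \<sigma>])
 have p1: "p \<le> 1"
 proof -
  interpret prob_space "gauss \<sigma>" by (rule prob_space_normal_density[OF \<sigma>])
  show ?thesis by (simp add: p_def)
 qed
 obtain n where n: "(1 - p) ^ n < \<theta>" using real_arch_pow_inv[of \<theta> "1 - p"] \<theta> p by auto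
 obtain S0 :: int where S0: "1 \<le> S0" "(6 / \<theta>)\<^sup>2 \<le> 1 * of_int S0" by (rule exists_large_int[of 1 1 "(6 / \<theta>)\<^sup>2"]) auto
 define S where "S = S0 + 2"
 have S: "2 < S" using S0 by (simp add: S_def)
 have off: "6 / sqrt (of_int (S - 2)) \<le> \<theta>"
 proof -
  have "6 / \<theta> \<le> sqrt (of_int S0)" using real_sqrt_le_mono[OF S0(2)] \<theta> by simp
  then show ?thesis using \<theta> S0 by (simp add: S_def divide_le_eq mult.commute)
 qed
 obtain u :: int where u: "S \<le> u" "8 * (real n + 1) * h4 * 16 ^ 4 + 4 * h4 * 8 ^ 4 * (of_int S)\<^sup>2 + 1 \<le> \<theta> * of_int u"
  by (rule exists_large_int[OF \<theta>])
 have u1: "1 \<le> u" using u S by simp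
 have nn: "0 \<le> 8 * (real n + 1) * h4 * 16 ^ 4" "0 \<le> 4 * h4 * 8 ^ 4 * (of_int S)\<^sup>2" using h4_nonneg by auto
 define K where "K = (int n + 1) * u"
 have "1 * u \<le> (int n + 1) * u" using u1 by (intro mult_right_mono) auto
 then have K: "S \<le> K" "1 \<le> K" using u(1) u1 unfolding K_def by linarith+
 define d where "d = min (1 / 2) (\<theta> * \<sigma> / (12 * (of_int K)\<^sup>2 * sqrt (of_int u)))"
 have dpos: "0 < 12 * (of_int K)\<^sup>2 * sqrt (of_int u)" using K u1 by simp
 have d: "0 < d" "d \<le> 1 / 2" using \<theta> \<sigma> dpos by (auto simp: d_def)
 have sep: "12 * (of_int K)\<^sup>2 * d * sqrt (of_int u) \<le> \<theta> * \<sigma>"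
 proof -
  have "d \<le> \<theta> * \<sigma> / (12 * (of_int K)\<^sup>2 * sqrt (of_int u))" by (simp add: d_def)
  then have "d * (12 * (of_int K)\<^sup>2 * sqrt (of_int u)) \<le> \<theta> * \<sigma>" using dpos by (simp only: pos_le_divide_eq)
  then show ?thesis by (simp add: mult_ac)
 qed
 define \<delta> where "\<delta> = d / 2 / 8"
 have \<delta>: "0 < \<delta>" using d by (simp add: \<delta>_def)
 obtain q :: int where q: "1 \<le> q" "128 * of_int K * h4 \<le> (\<theta> * \<delta> ^ 4) * of_int q"
  by (rule exists_large_int[of "\<theta> * \<delta> ^ 4" 1]) (use \<theta> \<delta> in auto)
 have Kq: "1 \<le> K * q" using mult_mono[of 1 K 1 q] K q by simp
 have Kq': "0 < real_of_int (K * q)" using Kq by (simp del: of_int_mult)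
 define e where "e = min (1 / 64) (\<delta> / 4)"
 have e: "0 < e" "e \<le> 1 / 64" "e \<le> \<delta> / 4" using \<delta> by (auto simp: e_def)
 define \<kappa> where "\<kappa> = e / (2 * of_int (K * q))"
 have \<kappa>: "0 < \<kappa>" using e Kq' unfolding \<kappa>_def by (intro divide_pos_pos) auto
 have \<kappa>N: "of_int (K * q) * \<kappa> = e / 2" using K q unfolding \<kappa>_def by simp
 have good: "\<forall>\<^sub>F t in at_top. Q.prob {w. \<not> good_path q K S (d / 2) 1 (env_path \<kappa> (K * q) (of_int (u * q)) t w)} < 5 * \<theta>"
 proof (rule rounded_good_path[OF \<sigma> \<theta> q(1) u1 S K(1) _ d(1) \<kappa> _ _ sep _ off])
  show "(int n + 1) * u \<le> K" by (simp add: K_def)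
  show "2 * (\<kappa> * of_int (K * q)) \<le> d / 2" "2 * (\<kappa> * of_int (K * q)) \<le> 1"
   using \<kappa>N e d unfolding \<delta>_def by (simp_all add: mult.commute[of \<kappa>] del: of_int_mult)
  show "(1 - measure (gauss \<sigma>) {2..}) ^ n \<le> \<theta>" using n by (simp add: p_def)
 qed
 have tame: "\<forall>\<^sub>F t in at_top. \<exists>A\<in>Q.events. 1 - 3 * \<theta> \<le> Q.prob A \<and> (\<forall>w\<in>A.
  tame q K S (env_path \<kappa> (K * q) (of_int (u * q)) t w) \<and> tracks \<delta> \<kappa> (K * q) (of_int (u * q)) t w)"
  by (rule tame_event[OF \<theta> q(1) u1 S K(1) K_def e \<kappa>]) ((use \<kappa>N u nn q in linarith)+)
 have main: "\<forall>\<^sub>F t in at_top. \<exists>A\<in>Q.events. 1 - \<eta> \<le> Q.prob A \<and> (\<forall>w\<in>A. good_environment \<kappa> (K * q) q (d / 2) (of_int (u * q)) t w)"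
  using good tame
 proof eventually_elim
  case (elim t)
  let ?s = "env_path \<kappa> (K * q) (of_int (u * q)) t"
  let ?E = "{w. \<not> good_path q K S (d / 2) 1 (?s w)}"
  obtain A where A: "A \<in> Q.events" "1 - 3 * \<theta> \<le> Q.prob A" and
   tm: "\<And>w. w \<in> A \<Longrightarrow> tame q K S (?s w) \<and> tracks \<delta> \<kappa> (K * q) (of_int (u * q)) t w"
   using elim(2) by blast
  have E: "?E \<in> Q.events" unfolding env_path_def by (rule rounded_vector_event[OF block_length_ge, where E="\<lambda>v. \<not> good_path q K S (d / 2) 1 (skeleton \<kappa> v)"])
  have "Q.prob A \<le> Q.prob ((A - ?E) \<union> ?E)" using A E by (intro Q.finite_measure_mono) auto
  also have "... \<le> Q.prob (A - ?E) + Q.prob ?E" using A E by (intro measure_Un_le) auto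
  finally have "1 - \<eta> \<le> Q.prob (A - ?E)" using A(2) elim(1) by (simp add: \<theta>_def)
  moreover have "good_environment \<kappa> (K * q) q (d / 2) (of_int (u * q)) t w" if "w \<in> A - ?E" for w
  proof -
   have g: "good_path q K S (d / 2) 1 (?s w)" using that by blast
   have "\<exists>\<beta>. valley (?s w) (K * q) (d / 2) (2 * q) \<beta>"
    by (rule valley_exists[where S=S]) (use g q d K tm[of w] that in \<open>auto simp: good_path_def\<close>)
   then show ?thesis using tm[of w] that unfolding good_environment_def \<delta>_def by blast
  qed
  ultimately show ?case using A(1) E by (intro bexI[of _ "A - ?E"]) auto
 qed
 have "of_int (2 * q + 2) / (of_int (u * q) :: real) \<le> of_int (4 * q) / of_int (u * q)"
  using q u1 by (intro divide_right_mono) auto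
 also have "... = 4 / of_int u" using q by simp
 also have "... \<le> \<eta>"
 proof -
  have "1 \<le> \<theta> * of_int u" using u(2) nn by linarith
  then have "4 \<le> \<eta> * of_int u" by (simp add: \<theta>_def)
  then show ?thesis using u1 by (simp add: divide_le_eq)
 qed
 finally have r: "of_int (2 * q + 2) / (of_int (u * q) :: real) \<le> \<eta>" .
 have uq: "0 < (of_int (u * q) :: real)" using u1 q by simp
 have d2: "0 < d / 2" using d by simp
 show ?thesis
  by (rule exI[of _ \<kappa>], rule exI[of _ "K * q"], rule exI[of _ q], rule exI[of _ "d / 2"], rule exI[of _ "of_int (u * q)"])
   (intro conjI \<kappa> Kq q(1) d2 uq r main)
qed

end

section \<open>Locality and shift of the excursion measure\<close>

lemma excursion_mass_cong:
 assumes "\<And>x. x \<in> {a..b} \<Longrightarrow> w x = w' x"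
 shows "excursion_mass m w a b k y = excursion_mass m w' a b k y"
 by (induction k arbitrary: y) (auto simp: clip_op_def assms intro!: sum.cong)

lemma excursion_mass_shift:
 "excursion_mass m w (a + c) (b + c) k (y + c) = excursion_mass m (\<lambda>x. w (x + c)) a b k y"
proof (induction k arbitrary: y)
 case (Suc k)
 have *: "(sum f {a + c..b + c}) = (\<Sum>x\<in>{a..b}. f (x + c))" for f :: path
  by (rule sum.reindex_bij_witness[where i="\<lambda>x. x + c" and j="\<lambda>x. x - c"]) auto
 have "clip (a + c) (b + c) (x + c + j) = y + c \<longleftrightarrow> clip a b (x + j) = y" for x j by (auto simp: clip_def)
 then have "clip_op m w (a + c) (b + c) (\<lambda>z. if z = y + c then 1 else 0) (x + c)
  = clip_op m (\<lambda>x. w (x + c)) a b (\<lambda>z. if z = y then 1 else 0) x" for x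
  by (simp add: clip_op_def)
 then show ?case by (simp add: * Suc)
qed simp

subsection \<open>The potential of a random environment\<close>

definition elliptic_vectors :: "int \<Rightarrow> real \<Rightarrow> path set" where
 "elliptic_vectors m \<epsilon> = {p \<in> jump_vectors m. \<epsilon> \<le> p 1 \<and> \<epsilon> \<le> p (-1)}"

text \<open>
 Replacing the exceptional vectors, which have probability \<open>0\<close>, makes all estimates hold surely.
\<close>

definition make_elliptic :: "int \<Rightarrow> real \<Rightarrow> path \<Rightarrow> int \<Rightarrow> real" where
 "make_elliptic m \<epsilon> p = (if p \<in> elliptic_vectors m \<epsilon> then p else (\<lambda>j. if j = 1 \<or> j = -1 then 1 / 2 else 0))"

lemma make_elliptic_id: "p \<in> elliptic_vectors m \<epsilon> \<Longrightarrow> make_elliptic m \<epsilon> p = p" by (simp add: make_elliptic_def)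

lemma make_elliptic_mem:
 assumes "1 \<le> m" "\<epsilon> \<le> 1 / 2" shows "make_elliptic m \<epsilon> p \<in> elliptic_vectors m \<epsilon>"
proof -
 have "(\<Sum>j\<in>{-m..m}. if j = 1 \<or> j = -1 then 1 / 2 else 0 :: real) = (\<Sum>j\<in>{1, -1 :: int}. 1 / 2)"
  by (rule sum.mono_neutral_cong_right) (use assms in auto)
 then show ?thesis using assms by (auto simp: make_elliptic_def elliptic_vectors_def jump_vectors_def)
qed

lemma jump_vectors_closed: "closed (jump_vectors m)"
 unfolding jump_vectors_def
 by (intro closed_Collect_conj closed_Collect_all closed_Collect_imp closed_Collect_le closed_Collect_eq
   continuous_on_sum continuous_on_const continuous_on_product_coordinates) auto

lemma elliptic_vectors_closed: "closed (elliptic_vectors m \<epsilon>)"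
proof -
 have "closed {p. \<epsilon> \<le> p 1 \<and> \<epsilon> \<le> (p (-1) :: real)}"
  by (intro closed_Collect_conj closed_Collect_le continuous_on_const continuous_on_product_coordinates)
 from closed_Int[OF jump_vectors_closed this] show ?thesis by (simp add: elliptic_vectors_def Int_def)
qed

lemma make_elliptic_measurable: "(\<lambda>p. make_elliptic m \<epsilon> p j) \<in> borel_measurable borel"
proof -
 have [measurable]: "elliptic_vectors m \<epsilon> \<in> sets borel" by (rule borel_closed[OF elliptic_vectors_closed])
 have [measurable]: "(\<lambda>p::int \<Rightarrow> real. p j) \<in> borel_measurable borel"
  by (rule borel_measurable_continuous_onI) (rule continuous_on_product_coordinates)
 have "(\<lambda>p. make_elliptic m \<epsilon> p j) = (\<lambda>p. if p \<in> elliptic_vectors m \<epsilon> then p j else if j = 1 \<or> j = -1 then 1 / 2 else 0)"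
  by (auto simp: make_elliptic_def)
 then show ?thesis by (simp only:) measurable
qed

lemma exp_sum_bounded:
 fixes g :: "nat \<Rightarrow> real" and c :: real
 assumes L: "1 \<le> L" and c: "0 < c" and lin: "\<forall>\<^sub>F j in sequentially. g (j * L) \<le> - c * j"
  and near: "\<And>k r. r < L \<Longrightarrow> g (k + r) \<le> g k + D"
 shows "\<exists>M. \<forall>N. (\<Sum>k<N. exp (g k)) \<le> M"
proof -
 obtain j0 where j0: "\<And>j. j0 \<le> j \<Longrightarrow> g (j * L) \<le> - c * j" using lin by (auto simp: eventually_sequentially)
 define \<rho> where "\<rho> = exp (- c / L)"
 have \<rho>: "0 < \<rho>" "\<rho> < 1" using c L by (auto simp: \<rho>_def)
 have "norm (exp (g k)) \<le> exp (D + c) * \<rho> ^ k" if k: "j0 * L \<le> k" for k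
 proof -
  define j where "j = k div L"
  have r: "k = j * L + k mod L" "k mod L < L" using L by (auto simp: j_def)
  have "j0 \<le> j" using div_le_mono[OF k, of L] L by (simp add: j_def)
  then have 1: "g k \<le> - c * j + D" using near[OF r(2), of "j * L"] j0[of j] r(1) by simp
  have "k \<le> j * L + L" using r by linarith
  then have "real k \<le> real j * L + L" by (simp only: of_nat_le_iff flip: of_nat_mult of_nat_add)
  then have "c / L * real k \<le> c / L * (real j * L + L)" using c L by (intro mult_left_mono) auto
  then have 2: "c / L * k \<le> c * j + c" using L by (simp add: distrib_left)
  have "\<rho> ^ k = exp (- (c / L * k))" by (simp add: \<rho>_def flip: exp_of_nat_mult)
  then have "exp (D + c) * \<rho> ^ k = exp (D + c - c / L * k)" by (simp only: exp_add[symmetric] diff_conv_add_uminus)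
  then show ?thesis using 1 2 by simp
 qed
 then have "\<exists>N. \<forall>k\<ge>N. norm (exp (g k)) \<le> exp (D + c) * \<rho> ^ k" by blast
 moreover have "summable (\<lambda>k. exp (D + c) * \<rho> ^ k)" using \<rho> by (intro summable_mult summable_geometric) simp
 ultimately have "summable (\<lambda>k. exp (g k))" by (rule summable_comparison_test)
 then have "(\<Sum>k<N. exp (g k)) \<le> (\<Sum>k. exp (g k))" for N by (intro sum_le_suminf) auto
 then show ?thesis by blast
qed

locale random_environment =
 fixes m :: int and \<epsilon> :: real and \<nu> :: "path measure"
 assumes m1: "1 \<le> m" and eps: "0 < \<epsilon>" "\<epsilon> \<le> 1 / 2"
  and nu: "prob_space \<nu>" and sets_nu: "sets \<nu> = sets borel"
begin

sublocale iid_field \<nu>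
 by (rule iid_field.intro[OF nu]) (use sets_eq_imp_space_eq[OF sets_nu] in simp)

definition env :: "env \<Rightarrow> int \<Rightarrow> int \<Rightarrow> real" where "env w x = make_elliptic m \<epsilon> (w x)"

lemma elliptic_env: "elliptic_env m \<epsilon> (env w)"
 by unfold_locales (use m1 eps make_elliptic_mem[OF m1 eps(2)] in \<open>auto simp: env_def elliptic_vectors_def\<close>)

text \<open>
 The increment from \<open>a\<close> to \<open>b - 1\<close> of \<open>- ln \<pi>\<close>, where \<open>\<pi>\<close> is the invariant measure on \<open>[a, b - 1]\<close>.
\<close>

definition block_potential :: "int \<Rightarrow> int \<Rightarrow> env \<Rightarrow> real" where
 "block_potential a b w = ln (excursion_measure m (env w) a (b - 1) a / excursion_measure m (env w) a (b - 1) (b - 1))"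

text \<open>This is \<open>loc_const\<close>, for the change of window, plus one Harnack step:
  \<open>block_potential a b\<close> ends at b - 1, so that adjacent increments use disjoint sites,
  whereas the comparison runs to \<open>b\<close>.\<close>

definition defect :: real where "defect = - 4 * of_int m * ln \<epsilon> - ln \<epsilon>"

lemma ln_eps: "ln \<epsilon> < 0" using eps by simp

lemma m_ln_eps: "of_int m * ln \<epsilon> < 0" using m1 ln_eps by (intro mult_pos_neg) auto

lemma defect_pos: "0 < defect" using m_ln_eps ln_eps unfolding defect_def by linarith

lemma defect_eq: "defect = elliptic_env.loc_const m \<epsilon> - ln \<epsilon>"
 by (simp add: defect_def elliptic_env.loc_const_def[OF elliptic_env[of undefined]])

lemma Harnack_ln:
 assumes inv: "invariant_on m (env w) a b \<pi>" and "x \<in> {a..b}" "y \<in> {a..b}" "\<bar>x - y\<bar> \<le> int n"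
 shows "\<bar>ln (\<pi> x / \<pi> y)\<bar> \<le> - (real n * ln \<epsilon>)"
proof -
 interpret elliptic_env m \<epsilon> "env w" by (rule elliptic_env)
 have pos: "0 < \<pi> x" "0 < \<pi> y" using assms invariant_onD(1)[OF inv] by blast+
 have e: "ln (\<epsilon> ^ n) = real n * ln \<epsilon>" using eps by (simp add: ln_realpow)
 have *: "real n * ln \<epsilon> + ln (\<pi> z) \<le> ln (\<pi> v)" if "\<epsilon> ^ n * \<pi> z \<le> \<pi> v" "0 < \<pi> z" "0 < \<pi> v" for z v
  using that eps ln_mono[OF that(1)] by (simp add: ln_mult e)
 have "\<epsilon> ^ n * \<pi> x \<le> \<pi> y" by (rule Harnack[OF inv assms(2,3,4)])
 moreover have "\<epsilon> ^ n * \<pi> y \<le> \<pi> x" by (rule Harnack[OF inv assms(3,2)]) (use assms(4) in auto)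
 ultimately show ?thesis using *[of x y] *[of y x] pos by (simp add: ln_div)
qed

lemma window:
 assumes inv: "invariant_on m (env w) a b \<pi>" and xy: "a \<le> x" "x < y" "y \<le> b"
 shows "\<bar>ln (\<pi> x / \<pi> y) - block_potential x y w\<bar> \<le> defect"
proof -
 interpret elliptic_env m \<epsilon> "env w" by (rule elliptic_env)
 have "\<bar>ln (\<pi> x / \<pi> (y - 1)) - block_potential x y w\<bar> \<le> loc_const"
  unfolding block_potential_def by (rule locality[OF inv excursion_measure_invariant]) (use xy in auto)
 moreover have "\<bar>ln (\<pi> (y - 1) / \<pi> y)\<bar> \<le> - (real 1 * ln \<epsilon>)" by (rule Harnack_ln[OF inv]) (use xy in auto)
 moreover have "ln (\<pi> x / \<pi> y) = ln (\<pi> x / \<pi> (y - 1)) + ln (\<pi> (y - 1) / \<pi> y)"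
 proof -
  have "x \<in> {a..b}" "y \<in> {a..b}" "y - 1 \<in> {a..b}" using xy by auto
  then have "0 < \<pi> x" "0 < \<pi> y" "0 < \<pi> (y - 1)" using invariant_onD(1)[OF inv] by blast+
  then show ?thesis by (simp add: ln_div)
 qed
 ultimately show ?thesis unfolding defect_eq by linarith
qed

lemma block_potential_meas: "a < b \<Longrightarrow> block_potential a b \<in> borel_measurable Q"
proof -
 have [measurable]: "(\<lambda>w. env w x j) \<in> borel_measurable Q" for x j
 proof -
  have "(\<lambda>w. w x) \<in> Q \<rightarrow>\<^sub>M borel" using coordinate_measurable[of x] sets_nu by (simp cong: measurable_cong_sets)
  then show ?thesis unfolding env_def by (rule measurable_compose[OF _ make_elliptic_measurable])
 qed
 have em: "(\<lambda>w. excursion_mass m (env w) a b' k y) \<in> borel_measurable Q" for b' k y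
 proof (induction k arbitrary: y)
  case (Suc k)
  note [measurable] = Suc
  show ?case by (cases "y = a") (simp_all add: clip_op_def)
 qed simp
 show ?thesis unfolding block_potential_def[abs_def] excursion_measure_def using em by measurable
qed

lemma block_potential_dep: "a < b \<Longrightarrow> depends {a..<b} (block_potential a b)"
proof -
 have "excursion_measure m (env w) a (b - 1) y = excursion_measure m (env w') a (b - 1) y"
  if "\<forall>x\<in>{a..<b}. w x = w' x" for w w' y unfolding excursion_measure_def
  by (rule suminf_cong, rule excursion_mass_cong) (use that in \<open>auto simp: env_def\<close>)
 note eq = this
 show ?thesis unfolding depends_def block_potential_def
 proof (intro allI impI)
  fix w w' :: env assume "\<forall>x\<in>{a..<b}. w x = w' x"
  from eq[OF this, of a] eq[OF this, of "b - 1"]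
  show "ln (excursion_measure m (env w) a (b - 1) a / excursion_measure m (env w) a (b - 1) (b - 1)) =
   ln (excursion_measure m (env w') a (b - 1) a / excursion_measure m (env w') a (b - 1) (b - 1))" by (simp only:)
 qed
qed

lemma block_potential_shift: "block_potential (a + c) (b + c) w = block_potential a b (shift c w)"
proof -
 have "env (shift c w) = (\<lambda>x. env w (x + c))" by (auto simp: env_def shift_def)
 then have "excursion_measure m (env w) (a + c) (b + c - 1) (y + c) = excursion_measure m (env (shift c w)) a (b - 1) y" for y
  using excursion_mass_shift[of m "env w" a c "b - 1" _ y] by (simp add: excursion_measure_def algebra_simps)
 from this[of a] this[of "b - 1"] show ?thesis by (simp add: block_potential_def algebra_simps)
qed

text \<open>All three increments are compared with one invariant measure on [a, c], where they add
  up exactly; each comparison costs \<open>defect\<close>.\<close>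

sublocale quasi_additive \<nu> block_potential "3 * defect"
proof
 fix a b :: int and w assume ab: "a < b"
 interpret E: elliptic_env m \<epsilon> "env w" by (rule elliptic_env)
 show "block_potential (a + c) (b + c) w = block_potential a b (shift c w)" for c by (rule block_potential_shift)
 have "\<bar>block_potential a b w\<bar> \<le> - (real (nat (b - a)) * ln \<epsilon>)"
  unfolding block_potential_def by (rule Harnack_ln[OF E.excursion_measure_invariant]) (use ab in auto)
 also have "... = of_int (b - a) * - ln \<epsilon>" using ab by simp
 also have "... \<le> of_int (b - a) * (3 * defect)"
  using ab m1 ln_eps mult_nonneg_nonneg[of "of_int m" "- ln \<epsilon>"] by (intro mult_left_mono) (auto simp: defect_def)
 finally show "\<bar>block_potential a b w\<bar> \<le> 3 * defect * of_int (b - a)" by (simp add: mult.commute)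
 fix c assume bc: "b < c"
 let ?\<pi> = "excursion_measure m (env w) a c"
 have inv: "invariant_on m (env w) a c ?\<pi>" by (rule E.excursion_measure_invariant) (use ab bc in auto)
 have "a \<in> {a..c}" "b \<in> {a..c}" "c \<in> {a..c}" using ab bc by auto
 then have "0 < ?\<pi> a" "0 < ?\<pi> b" "0 < ?\<pi> c" using invariant_onD(1)[OF inv] by blast+
 then have "ln (?\<pi> a / ?\<pi> c) = ln (?\<pi> a / ?\<pi> b) + ln (?\<pi> b / ?\<pi> c)" by (simp add: ln_div)
 moreover have "\<bar>ln (?\<pi> a / ?\<pi> c) - block_potential a c w\<bar> \<le> defect" by (rule window[OF inv]) (use ab bc in auto)
 moreover have "\<bar>ln (?\<pi> a / ?\<pi> b) - block_potential a b w\<bar> \<le> defect" by (rule window[OF inv]) (use ab bc in auto)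
 moreover have "\<bar>ln (?\<pi> b / ?\<pi> c) - block_potential b c w\<bar> \<le> defect" by (rule window[OF inv]) (use ab bc in auto)
 ultimately show "\<bar>block_potential a c w - block_potential a b w - block_potential b c w\<bar> \<le> 3 * defect" by linarith
qed (use block_potential_meas block_potential_dep in auto)

lemma potential_window:
 assumes inv: "invariant_on m (env w) a b \<pi>" and a: "a \<le> 0" "0 \<le> b" and x: "x \<in> {a..b}"
 shows "\<bar>ln (\<pi> 0 / \<pi> x) - potential w x\<bar> \<le> defect"
proof -
 have "0 \<in> {a..b}" using a by simp
 then have pos: "0 < \<pi> 0" "0 < \<pi> x" using invariant_onD(1)[OF inv] x by blast+
 consider "0 < x" | "x < 0" | "x = 0" by linarith
 then show ?thesis
 proof cases
  case 1
  then show ?thesis using window[OF inv a(1), of x] x by (simp add: potential_def)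
 next
  case 2
  then show ?thesis using window[OF inv _ 2 a(2)] x pos by (simp add: potential_def ln_div)
 next
  case 3
  then show ?thesis using pos defect_pos by (simp add: potential_def)
 qed
qed

lemma potential_lipschitz: "\<bar>potential w b - potential w a\<bar> \<le> 3 * defect * (of_int \<bar>b - a\<bar> + 1)"
proof -
 have *: "\<bar>potential w b - potential w a\<bar> \<le> 3 * defect * (of_int \<bar>b - a\<bar> + 1)" if "a < b" for a b
  using potential_diff[OF that, of w] Y_lin[OF that, of w] that by (simp add: distrib_left)
 show ?thesis using *[of a b] *[of b a] defect_pos by (cases a b rule: linorder_cases) (auto simp: abs_minus_commute)
qed

text \<open>Up to a bounded factor, \<pi> 0 / \<pi> k is the exponential of the potential at k. If
  the potential falls linearly in one direction, these ratios are summable there, which keeps the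
  Green function at 0 bounded in all windows.\<close>

lemma transient:
 fixes c :: real
 assumes e: "e = 1 \<or> e = (-1 :: int)" and L: "1 \<le> L" and c: "0 < c"
  and lin: "\<forall>\<^sub>F j in sequentially. potential w (e * int (j * L)) \<le> - c * j"
 shows "\<not> recurrent_walk (env w)"
proof -
 interpret E: elliptic_env m \<epsilon> "env w" by (rule elliptic_env)
 define g where "g k = potential w (e * int k)" for k
 have "\<exists>M. \<forall>N. (\<Sum>k<N. exp (g k)) \<le> M"
 proof (rule exp_sum_bounded[OF L c])
  show "\<forall>\<^sub>F j in sequentially. g (j * L) \<le> - c * j" using lin by (simp add: g_def)
  fix k r assume r: "r < L"
  have "g (k + r) \<le> g k + 3 * defect * (of_int \<bar>e * int (k + r) - e * int k\<bar> + 1)"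
   using potential_lipschitz[of w "e * int (k + r)" "e * int k"] by (simp add: g_def)
  also have "of_int \<bar>e * int (k + r) - e * int k\<bar> = real r" using e by auto
  also have "3 * defect * (real r + 1) \<le> 3 * defect * (real L + 1)" using r defect_pos by (intro mult_left_mono) auto
  finally show "g (k + r) \<le> g k + 3 * defect * (real L + 1)" by simp
 qed
 then obtain M where M: "\<And>N. (\<Sum>k<N. exp (g k)) \<le> M" by blast
 show ?thesis
 proof (rule E.not_recurrentI[OF e])
  fix N :: int assume N: "1 \<le> N"
  let ?\<pi> = "excursion_measure m (env w) (- N) N" and ?J = "{min 0 (e * N)..<max 0 (e * N)}"
  have inv: "invariant_on m (env w) (- N) N ?\<pi>" by (rule E.excursion_measure_invariant) (use N in auto)
  have mem: "k \<in> {- N..N}" if "k \<in> ?J" for k using that e N by auto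
  have "?\<pi> 0 * (1 / ?\<pi> k) \<le> exp defect * exp (potential w k)" if k: "k \<in> ?J" for k
  proof -
   have "0 \<in> {- N..N}" using N by simp
   then have pos: "0 < ?\<pi> 0 / ?\<pi> k" using invariant_onD(1)[OF inv] mem[OF k] by (meson divide_pos_pos)
   have "ln (?\<pi> 0 / ?\<pi> k) \<le> defect + potential w k" using potential_window[OF inv _ _ mem[OF k]] N by auto
   then have "exp (ln (?\<pi> 0 / ?\<pi> k)) \<le> exp (defect + potential w k)" by (simp only: exp_le_cancel_iff)
   then show ?thesis using pos by (simp add: exp_add)
  qed
  then have "?\<pi> 0 * (\<Sum>k\<in>?J. 1 / ?\<pi> k) \<le> (\<Sum>k\<in>?J. exp defect * exp (potential w k))"
   unfolding sum_distrib_left by (rule sum_mono)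
  also have "... \<le> (\<Sum>k\<in>(\<lambda>k. e * int k) ` {..<nat N + 1}. exp defect * exp (potential w k))"
  proof (rule sum_mono2)
   show "?J \<subseteq> (\<lambda>k. e * int k) ` {..<nat N + 1}"
   proof
    fix k assume "k \<in> ?J"
    then show "k \<in> (\<lambda>k. e * int k) ` {..<nat N + 1}" using e N by (intro image_eqI[of _ _ "nat \<bar>k\<bar>"]) auto
   qed
  qed auto
  also have "... = (\<Sum>k<nat N + 1. exp defect * exp (g k))"
   unfolding g_def by (subst sum.reindex) (use e in \<open>auto simp: inj_on_def\<close>)
  also have "... \<le> exp defect * M" unfolding sum_distrib_left[symmetric] by (intro mult_left_mono M) auto
  finally show "\<exists>\<pi>. invariant_on m (env w) (- N) N \<pi> \<and> \<pi> 0 * (\<Sum>k\<in>?J. 1 / \<pi> k) \<le> exp defect * M"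
   using inv by blast
 qed
qed

text \<open>A block mean beyond the quasi-additivity constant makes the potential almost surely grow
  at least linearly towards one end and fall at least linearly towards the other. With the sign
  \<open>s\<close> it falls in the direction - s.\<close>

lemma unbalanced_transient:
 assumes L: "1 \<le> L" and mean: "3 * defect < \<bar>mean (y L)\<bar>"
 shows "AE w in Q. \<not> recurrent_walk (env w)"
proof -
 have "3 * defect < of_int 1 * mean (y L) \<or> 3 * defect < of_int (-1) * mean (y L)" using mean by auto
 then obtain s where s: "s = 1 \<or> s = (-1 :: int)" "3 * defect < of_int s * mean (y L)" by blast
 have s': "real_of_int s = 1 \<or> real_of_int s = - 1" using s by auto
 obtain c where c: "0 < c" and lin: "AE w in Q. \<forall>\<^sub>F k in sequentially. c * real k \<le> of_int s * block_potential 0 (int (k * L)) w \<and> c * real k \<le> of_int s * block_potential (- int (k * L)) 0 w"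
  using linear_growth[OF L s' s(2)] by blast
 show ?thesis using lin
 proof eventually_elim
  case (elim w)
  have "\<forall>\<^sub>F j in sequentially. potential w ((- s) * int (j * L)) \<le> - c * j"
   using elim eventually_gt_at_top[of 0]
  proof eventually_elim
   case (elim j)
   have "0 < int (j * L)" using elim(2) L by simp
   then show ?case using elim(1) s(1) by (auto simp: potential_def)
  qed
  then show ?case by (intro transient[OF _ L c, of "- s"]) (use s in auto)
 qed
qed

end

text \<open>The window runs from the start of the cell of the left wall to the end of the cell of
  the right wall. In units of T, \<open>track\<close> and \<open>pot\<close> cost d / 8 each, so a
  height is known up to d / 4 and a difference of heights up to d / 2. Of the margin d of the path,
  d / 2 survives.\<close>

lemma (in elliptic_env) valley_right_localizes:
 assumes v: "valley_right s N d r \<beta>" and d: "0 < d" and B: "m \<le> B" and t: "1 \<le> t" "exp T = real t"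
  and pot: "\<And>a b \<pi> x. a \<le> 0 \<Longrightarrow> 0 \<le> b \<Longrightarrow> invariant_on m w a b \<pi> \<Longrightarrow> x \<in> {a..b} \<Longrightarrow> \<bar>ln (\<pi> 0 / \<pi> x) - p x\<bar> \<le> D"
  and track: "\<And>k x. k \<in> {-N..<N} \<Longrightarrow> x \<in> {k * B..(k + 1) * B} \<Longrightarrow> \<bar>p x - T * s k\<bar> \<le> d / 8 * T"
  and D: "D \<le> d / 8 * T"
  and f: "\<And>x. 0 \<le> f x" "\<And>x. f x \<le> 1" "\<And>x. f x \<noteq> 0 \<Longrightarrow> (r + 2) * B < \<bar>x - \<beta> * B\<bar>"
 shows "(free_op m w ^^ t) f 0 \<le> (4 / \<epsilon> + 3 / \<epsilon> ^ nat m) * (of_int (2 * N * B + 1))\<^sup>2 * exp (- (d / 2) * T)"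
proof -
 obtain L R where \<beta>0: "0 \<le> \<beta>" and LR: "- N \<le> L" "L < 0" "\<beta> < R" "R < N"
  and c1: "\<And>i k. L \<le> i \<Longrightarrow> i \<le> k \<Longrightarrow> 0 \<le> k \<Longrightarrow> k \<le> \<beta> \<Longrightarrow> s k - s i \<le> 1 - d"
  and c2: "\<And>k. 0 \<le> k \<Longrightarrow> k \<le> \<beta> \<Longrightarrow> s k + d \<le> s L"
  and c3: "s \<beta> + 1 + d \<le> s L" "s \<beta> + 1 + d \<le> s R"
  and c4: "\<And>k. L \<le> k \<Longrightarrow> k \<le> R \<Longrightarrow> r < \<bar>k - \<beta>\<bar> \<Longrightarrow> s \<beta> + d \<le> s k"
  using v unfolding valley_right_def by blast
 have B1: "1 \<le> B" using B m_pos by simp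
 have T0: "0 \<le> T"
 proof -
  have "1 \<le> exp T" using t by simp
  then show ?thesis by simp
 qed
 define a b \<pi> where "a = L * B" and "b = (R + 1) * B" and "\<pi> = excursion_measure m w a b"
 have mono: "i * B \<le> j * B" if "i \<le> j" for i j using that B1 by (intro mult_right_mono) auto
 have ord: "a \<le> - B" "B \<le> b" "\<beta> * B + B \<le> b - B + B" "0 \<le> \<beta> * B"
  using mono[of L "-1"] mono[of 1 "R + 1"] mono[of "\<beta> + 1" R] mono[of "\<beta>" "R"] mono[of 0 \<beta>] mono[of "\<beta> + 1" "R + 1"] LR \<beta>0
  by (auto simp: a_def b_def distrib_right)
 have a0: "a \<le> 0" "0 \<le> b" using ord B1 by auto
 have inv: "invariant_on m w a b \<pi>" unfolding \<pi>_def by (rule excursion_measure_invariant) (use a0 in simp)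
 define u where "u x = - ln (\<pi> x)" for x
 have close: "\<bar>u x + ln (\<pi> 0) - T * s k\<bar> \<le> d / 4 * T" if "k \<in> {-N..<N}" "x \<in> {k * B..(k + 1) * B}" "x \<in> {a..b}" for k x
 proof -
  have "0 \<in> {a..b}" using a0 by simp
  then have "0 < \<pi> 0" "0 < \<pi> x" using invariant_onD(1)[OF inv] that(3) by blast+
  then have "ln (\<pi> 0 / \<pi> x) = u x + ln (\<pi> 0)" by (simp add: u_def ln_div)
  then show ?thesis using pot[OF a0 inv that(3)] track[OF that(1,2)] D by linarith
 qed
 have scale: "T * x + c * T \<le> T * y" if "x + c \<le> y" for x y c
  using mult_left_mono[OF that T0] by (simp add: distrib_left mult.commute)
 have block: "x \<in> {(x div B) * B..(x div B + 1) * B}" "L \<le> x div B" "x < b \<Longrightarrow> x div B \<le> R" if "x \<in> {a..b}" for x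
 proof -
  show "x \<in> {(x div B) * B..(x div B + 1) * B}" using mem_block[of B x] B1 by auto
  show "L \<le> x div B" using zdiv_mono1[of "L * B" x B] that B1 by (simp add: a_def)
  show "x div B \<le> R" if "x < b"
  proof -
   have "x div B * B \<le> x" using mem_block[of B x] B1 by auto
   then have "x div B * B < (R + 1) * B" using that by (simp add: b_def)
   then show ?thesis using B1 by simp
  qed
 qed
 have blockR: "\<exists>k. L \<le> k \<and> k \<le> R \<and> x \<in> {k * B..(k + 1) * B}" if x: "x \<in> {a..b}" for x
 proof (cases "x < b")
  case True
  then show ?thesis using block[OF x] by blast
 next
  case False
  then have "x = (R + 1) * B" using x by (simp add: b_def)
  then show ?thesis using LR \<beta>0 B1 by (intro exI[of _ R]) (auto simp: distrib_right)
 qed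
 have \<beta>c: "\<bar>u (\<beta> * B) + ln (\<pi> 0) - T * s \<beta>\<bar> \<le> d / 4 * T"
 proof (rule close)
  show "\<beta> * B \<in> {a..b}" using ord B1 unfolding atLeastAtMost_iff by linarith
 qed (use LR \<beta>0 B1 in \<open>auto simp: distrib_right\<close>)
 have wallc: "\<bar>u y + ln (\<pi> 0) - T * s L\<bar> \<le> d / 4 * T" if "a \<le> y" "y < a + m" for y
 proof (rule close)
  show "y \<in> {a..b}" using that ord a0 B unfolding atLeastAtMost_iff by linarith
 qed (use that LR B \<beta>0 in \<open>auto simp: a_def distrib_right\<close>)
 have valleyc: "0 \<le> k div B \<and> k div B \<le> \<beta> \<and> \<bar>u k + ln (\<pi> 0) - T * s (k div B)\<bar> \<le> d / 4 * T" if k: "0 \<le> k" "k \<le> \<beta> * B" for k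
 proof -
  have kab: "k \<in> {a..b}" using k ord a0 B1 by auto
  have "0 \<le> k div B" "k div B \<le> \<beta>" using k B1 zdiv_mono1[of k "\<beta> * B" B] by (auto simp: pos_imp_zdiv_nonneg_iff)
  then show ?thesis using close[OF _ block(1)[OF kab] kab] LR by auto
 qed
 have "(free_op m w ^^ t) f 0 \<le> (4 / \<epsilon> + 3 / \<epsilon> ^ nat m) * (of_int (b - a + 1))\<^sup>2 * exp (- (d / 2) * T)"
 proof (rule valley_localization_right[OF inv a0(1) ord(4) _ f(1,2) t u_def])
  show "\<beta> * B + m \<le> b" using ord B by simp
  show "u k - u i \<le> (1 - d / 2) * T" if i: "a \<le> i" "i \<le> k" and k: "0 \<le> k" "k \<le> \<beta> * B" for i k
  proof -
   have iab: "i \<in> {a..b}" using i k ord a0 B1 by auto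
   have "i div B \<le> k div B" using zdiv_mono1[OF i(2), of B] B1 by simp
   moreover have "\<bar>u i + ln (\<pi> 0) - T * s (i div B)\<bar> \<le> d / 4 * T"
    by (rule close[OF _ block(1)[OF iab] iab]) (use block(2)[OF iab] calculation valleyc[OF k] LR in auto)
   moreover have "s (k div B) - s (i div B) \<le> 1 - d"
    by (rule c1) (use block(2)[OF iab] calculation valleyc[OF k] in auto)
   then have "T * s (k div B) + (- (1 - d)) * T \<le> T * s (i div B)" by (intro scale) simp
   moreover have "(- (1 - d)) * T = d * T - T" "(1 - d / 2) * T = T - d / 2 * T" by (simp_all add: left_diff_distrib)
   moreover have "d * T = d / 2 * T + (d / 4 * T + d / 4 * T)" by (simp add: field_simps)
   ultimately show ?thesis using valleyc[OF k] by linarith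
  qed
  show "u k + d / 2 * T \<le> u y" if y: "a \<le> y" "y < a + m" and k: "0 \<le> k" "k \<le> \<beta> * B" for y k
  proof -
   have "T * s (k div B) + d * T \<le> T * s L" by (rule scale[OF c2]) (use valleyc[OF k] in auto)
   moreover have "d * T = d / 2 * T + (d / 4 * T + d / 4 * T)" by (simp add: field_simps)
   ultimately show ?thesis using valleyc[OF k] wallc[OF y] by linarith
  qed
  show "u (\<beta> * B) + (1 + d / 2) * T \<le> u y" if yab: "y \<in> {a..b}" and y: "y < a + m \<or> b - m < y" for y
  proof -
   have "\<exists>k. s \<beta> + (1 + d) \<le> s k \<and> \<bar>u y + ln (\<pi> 0) - T * s k\<bar> \<le> d / 4 * T"
   proof (cases "y < a + m")
    case True
    then show ?thesis using c3(1) wallc[of y] yab by (intro exI[of _ L]) auto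
   next
    case False
    have "\<bar>u y + ln (\<pi> 0) - T * s R\<bar> \<le> d / 4 * T"
     by (rule close[OF _ _ yab]) (use False y yab B LR \<beta>0 in \<open>auto simp: b_def distrib_right\<close>)
    then show ?thesis using c3(2) by (intro exI[of _ R]) auto
   qed
   then obtain k where k: "s \<beta> + (1 + d) \<le> s k" "\<bar>u y + ln (\<pi> 0) - T * s k\<bar> \<le> d / 4 * T" by blast
   have "T * s \<beta> + (1 + d) * T \<le> T * s k" by (rule scale[OF k(1)])
   moreover have "(1 + d) * T = (1 + d / 2) * T + (d / 4 * T + d / 4 * T)" by (simp add: field_simps)
   ultimately show ?thesis using k(2) \<beta>c by linarith
  qed
  show "u (\<beta> * B) + d / 2 * T \<le> u x" if x: "x \<in> {a..b}" and fx: "f x \<noteq> 0" for x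
  proof -
   obtain k where k: "L \<le> k" "k \<le> R" "x \<in> {k * B..(k + 1) * B}" using blockR[OF x] by blast
   have "\<bar>x - \<beta> * B\<bar> \<le> \<bar>x - k * B\<bar> + \<bar>(k - \<beta>) * B\<bar>" by (simp add: left_diff_distrib)
   also have "\<bar>x - k * B\<bar> \<le> B" using k(3) by (auto simp: distrib_right)
   also have "\<bar>(k - \<beta>) * B\<bar> = \<bar>k - \<beta>\<bar> * B" using B1 by (simp add: abs_mult)
   finally have "(r + 2) * B < (\<bar>k - \<beta>\<bar> + 1) * B" using f(3)[OF fx] by (simp add: distrib_right)
   then have "r < \<bar>k - \<beta>\<bar>" using B1 by simp
   then have "T * s \<beta> + d * T \<le> T * s k" by (intro scale c4 k(1,2))
   moreover have "\<bar>u x + ln (\<pi> 0) - T * s k\<bar> \<le> d / 4 * T" by (rule close[OF _ k(3) x]) (use k LR in auto)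
   moreover have "d * T = d / 2 * T + (d / 4 * T + d / 4 * T)" by (simp add: field_simps)
   ultimately show ?thesis using \<beta>c by linarith
  qed
 qed
 also have "... \<le> (4 / \<epsilon> + 3 / \<epsilon> ^ nat m) * (of_int (2 * N * B + 1))\<^sup>2 * exp (- (d / 2) * T)"
 proof (intro mult_right_mono mult_left_mono power_mono)
  have "b - a \<le> 2 * N * B" using mono[of "R + 1 - L" "2 * N"] LR by (simp add: a_def b_def algebra_simps)
  then show "real_of_int (b - a + 1) \<le> of_int (2 * N * B + 1)" by (simp only: of_int_le_iff)
 qed (use eps_pos a0 in auto)
 finally show ?thesis .
qed

lemma (in elliptic_env) valley_localizes:
 assumes v: "valley s N d r \<beta>" and d: "0 < d" and B: "m \<le> B" and t: "1 \<le> t" "exp T = real t"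
  and pot: "\<And>a b \<pi> x. a \<le> 0 \<Longrightarrow> 0 \<le> b \<Longrightarrow> invariant_on m w a b \<pi> \<Longrightarrow> x \<in> {a..b} \<Longrightarrow> \<bar>ln (\<pi> 0 / \<pi> x) - p x\<bar> \<le> D"
  and track: "\<And>k x. k \<in> {-N..<N} \<Longrightarrow> x \<in> {k * B..(k + 1) * B} \<Longrightarrow> \<bar>p x - T * s k\<bar> \<le> d / 8 * T"
  and D: "D \<le> d / 8 * T"
 shows "measure (walk_law w) {\<xi>. (r + 3) * B < \<bar>\<xi> t - \<beta> * B\<bar>}
  \<le> (4 / \<epsilon> + 3 / \<epsilon> ^ nat m) * (of_int (2 * N * B + 1))\<^sup>2 * exp (- (d / 2) * T)"
proof -
 let ?bound = "(4 / \<epsilon> + 3 / \<epsilon> ^ nat m) * (of_int (2 * N * B + 1))\<^sup>2 * exp (- (d / 2) * T)"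
 let ?f = "indicat_real {x. (r + 3) * B < \<bar>x - \<beta> * B\<bar>}"
 have B1: "1 \<le> B" using B m_pos by simp
 have "measure (walk_law w) {\<xi>. (r + 3) * B < \<bar>\<xi> t - \<beta> * B\<bar>} = (free_op m w ^^ t) ?f 0"
  using walk_law_marginal[OF jumps, where t=t and S="{x. (r + 3) * B < \<bar>x - \<beta> * B\<bar>}"] by simp
 also have "... \<le> ?bound" using v unfolding valley_def
 proof
  assume "valley_right s N d r \<beta>"
  then show ?thesis
   by (rule valley_right_localizes[OF _ d B t pot track D]) (use B1 in \<open>auto simp: indicator_def distrib_right split: if_splits\<close>)
 next
  assume v: "valley_right (mirror s) N d r (- 1 - \<beta>)"
  interpret R: elliptic_env m \<epsilon> "reflect_env w" by (rule elliptic_env_reflect) unfold_locales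
  have rr: "reflect_env (reflect_env w) = w" by (intro ext) (simp add: reflect_env_def)
  have "(free_op m (reflect_env w) ^^ t) (\<lambda>x. ?f (- x)) 0 \<le> ?bound"
  proof (rule R.valley_right_localizes[OF v d B t, where p="\<lambda>x. p (- x)" and D=D])
   show "\<bar>ln (\<pi> 0 / \<pi> x) - p (- x)\<bar> \<le> D" if "a \<le> 0" "0 \<le> b" "invariant_on m (reflect_env w) a b \<pi>" "x \<in> {a..b}" for a b \<pi> x
    using pot[of "- b" "- a" "\<lambda>x. \<pi> (- x)" "- x"] invariant_on_reflect[of a b m "reflect_env w" \<pi>] that rr by auto
   show "\<bar>p (- x) - T * mirror s k\<bar> \<le> d / 8 * T" if "k \<in> {- N..<N}" "x \<in> {k * B..(k + 1) * B}" for k x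
    unfolding mirror_def by (rule track) (use that in \<open>auto simp: algebra_simps\<close>)
   \<comment> \<open>The mirrored bottom sits at cell -1 - \<beta> and not at - \<beta>; the third
     unit in r + 3 absorbs this shift by one cell.\<close>
   show "(r + 2) * B < \<bar>x - (- 1 - \<beta>) * B\<bar>" if "?f (- x) \<noteq> 0" for x
    using that B1 by (auto simp: indicator_def algebra_simps split: if_splits)
  qed (use D in \<open>auto simp: indicator_def\<close>)
  then show ?thesis using free_op_iter_reflect[where m=m and w=w and f="\<lambda>x. ?f (- x)" and x=0 and n=t] by simp
 qed
 finally show ?thesis .
qed

lemma (in prob_space) prob_above_positive:
 fixes X :: "'a \<Rightarrow> real"
 assumes X: "integrable M X" and c: "c < expectation X"
 shows "0 < prob {w \<in> space M. c \<le> X w}"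
proof (rule ccontr)
 have ev: "{w \<in> space M. c \<le> X w} \<in> events" using X by (intro borel_measurable_le) auto
 assume "\<not> ?thesis"
 then have "prob {w \<in> space M. c \<le> X w} = 0" by (simp add: zero_less_measure_iff)
 then have "AE w in M. w \<notin> {w \<in> space M. c \<le> X w}" by (simp only: prob_eq_0[OF ev])
 then have "AE w in M. X w \<le> c" using AE_space by eventually_elim auto
 then have "expectation X \<le> c" by (rule integral_le_const[OF X])
 then show False using c by simp
qed

context random_environment
begin

lemma block_event_prob:
 assumes D: "D \<in> sets \<nu>"
 shows "Q.prob {w. \<forall>x\<in>{0..<int n}. w x \<in> D} = measure \<nu> D ^ n" "{w. \<forall>x\<in>{0..<int n}. w x \<in> D} \<in> Q.events"
proof -
 let ?A = "{w. \<forall>x\<in>{0..<int n}. w x \<in> D}"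
 have m: "{w. w x \<in> D} \<in> Q.events" for x
  using measurable_sets[OF coordinate_measurable[of x] D] by (simp add: space_Q vimage_def)
 have p: "Q.prob {w. w x \<in> D} = measure \<nu> D" for x
 proof -
  have "distr Q \<nu> (\<lambda>w. w x) = \<nu>" unfolding Q_def by (rule distr_PiM_component) (use prob_nu in auto)
  then show ?thesis using measure_distr[OF coordinate_measurable[of x] D] by (simp add: space_Q vimage_def)
 qed
 have "{w \<in> space Q. \<forall>x\<in>{0..<int n}. w x \<in> D} \<in> Q.events"
  by (rule sets.sets_Collect_finite_All) (use m in \<open>auto simp: space_Q\<close>)
 then show "?A \<in> Q.events" by (simp add: space_Q)
 show "Q.prob ?A = measure \<nu> D ^ n"
 proof (cases "n = 0")
  case True
  then show ?thesis using Q.prob_space by (simp add: space_Q)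
 next
  case False
  have "?A = (\<Inter>x\<in>{0..<int n}. (\<lambda>w. w x) -` D \<inter> space Q)" using False by (auto simp: space_Q)
  moreover have "Q.prob (\<Inter>x\<in>{0..<int n}. (\<lambda>w. w x) -` D \<inter> space Q) = (\<Prod>x\<in>{0..<int n}. Q.prob ((\<lambda>w. w x) -` D \<inter> space Q))"
   by (rule Q.indep_varsD_finite[OF Q.indep_vars_subset[OF coordinates_indep]]) (use False D in auto)
  ultimately show ?thesis using p by (simp add: space_Q vimage_def)
 qed
qed

lemma y_eq_ln: "1 \<le> n \<Longrightarrow> y n w = ln (excursion_measure m (env w) 0 (int n - 1) 0 / excursion_measure m (env w) 0 (int n - 1) (int n - 1))"
 by (simp add: y_def block_potential_def)

text \<open>A stretch of n sites with vectors in \<open>D\<close> has positive probability and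
  carries \<open>y n\<close> far to one side, while the bounded mean gives positive probability to
  values on the other side of a gap. Its width 12 \<open>defect\<close> + 1 is 4 C + 1 for C = 3
  \<open>defect\<close>, as \<open>\<sigma>_positive\<close> requires; this explains the numbers 15
  and 3.\<close>

lemma sigma_positive:
 assumes mean: "\<And>n. 1 \<le> n \<Longrightarrow> \<bar>mean (y n)\<bar> \<le> 3 * defect"
  and d: "0 < d" and D: "D \<in> sets \<nu>" "0 < measure \<nu> D" and s: "s = 1 \<or> s = (-1 :: real)"
  and drift: "\<And>p. p \<in> D \<Longrightarrow> d \<le> s * (\<Sum>j\<in>{-m..m}. of_int j * make_elliptic m \<epsilon> p j)"
 shows "0 < \<sigma>"
proof -
 obtain \<theta> c0 where \<theta>: "0 < \<theta>" and b: "\<And>s w a b \<pi>. s = 1 \<or> s = -1 \<Longrightarrow> elliptic_env m \<epsilon> w \<Longrightarrow> a \<le> b \<Longrightarrow> invariant_on m w a b \<pi> \<Longrightarrow>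
   \<forall>x\<in>{a..b}. d \<le> s * (\<Sum>j\<in>{-m..m}. of_int j * w x j) \<Longrightarrow> s * ln (\<pi> a / \<pi> b) \<le> c0 - \<theta> * of_int (b - a)"
  by (rule drift_uniform[OF m1 eps(1) d]) blast
 obtain n0 where n0: "(c0 + 15 * defect + 2) / \<theta> \<le> real n0" using real_arch_simple by blast
 have n0': "c0 - \<theta> * real n0 \<le> - (15 * defect + 2)" using n0 \<theta> by (simp add: divide_le_eq mult.commute)
 define n where "n = Suc n0"
 have n: "1 \<le> n" by (simp add: n_def)
 note [measurable] = rv_meas[OF y_bdd[OF n]]
 have "0 < Q.prob {w. \<forall>x\<in>{0..<int n}. w x \<in> D}" using D by (simp add: block_event_prob)
 also have "... \<le> Q.prob {w \<in> space Q. s * y n w \<le> - (15 * defect + 2)}"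
 proof (rule Q.finite_measure_mono)
  show "{w. \<forall>x\<in>{0..<int n}. w x \<in> D} \<subseteq> {w \<in> space Q. s * y n w \<le> - (15 * defect + 2)}"
  proof
   fix w assume w: "w \<in> {w. \<forall>x\<in>{0..<int n}. w x \<in> D}"
   have "s * y n w \<le> c0 - \<theta> * of_int ((int n - 1) - 0)" unfolding y_eq_ln[OF n]
    by (rule b[OF s elliptic_env _ elliptic_env.excursion_measure_invariant[OF elliptic_env]])
     (use w drift n in \<open>auto simp: env_def\<close>)
   then show "w \<in> {w \<in> space Q. s * y n w \<le> - (15 * defect + 2)}" using n0' by (simp add: n_def space_Q)
  qed
 qed measurable
 finally have low: "0 < Q.prob {w. s * y n w \<le> - (15 * defect + 2)}" by (simp add: space_Q)
 have "0 < Q.prob {w \<in> space Q. - (3 * defect + 1) \<le> s * y n w}"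
  by (rule Q.prob_above_positive) (use mean[OF n] s rv_integrable[OF y_bdd[OF n]] in auto)
 then have high: "0 < Q.prob {w. - (3 * defect + 1) \<le> s * y n w}" by (simp add: space_Q)
 show ?thesis using s
 proof
  assume "s = 1"
  then show ?thesis using low high by (intro \<sigma>_positive[OF n, of "- (3 * defect + 1)" "- (15 * defect + 2)"]) auto
 next
  assume "s = -1"
  then have "s * y n w \<le> - (15 * defect + 2) \<longleftrightarrow> 15 * defect + 2 \<le> y n w"
   "- (3 * defect + 1) \<le> s * y n w \<longleftrightarrow> y n w \<le> 3 * defect + 1" for w by auto
  from low[unfolded this] high[unfolded this] show ?thesis by (rule \<sigma>_positive[OF n]) simp
 qed
qed

end

lemma valley_bounds: "valley s N d r \<beta> \<Longrightarrow> - N \<le> \<beta> \<and> \<beta> \<le> N"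
 unfolding valley_def valley_right_def by auto

lemma poly_ln_exp_tendsto_0:
 assumes "0 < d" shows "(\<lambda>t::nat. c * (a * ((ln (real t))\<^sup>2) + 1)\<^sup>2 * exp (- (d / 2) * ln (real t))) \<longlonglongrightarrow> 0"
proof -
 have "(\<lambda>t::nat. c * a\<^sup>2 * ((ln (real t)) ^ 4 * exp (- (d / 2) * ln (real t))) + 2 * c * a * ((ln (real t))\<^sup>2 * exp (- (d / 2) * ln (real t)))
   + c * exp (- (d / 2) * ln (real t))) \<longlonglongrightarrow> c * a\<^sup>2 * 0 + 2 * c * a * 0 + c * 0"
 proof (intro tendsto_add tendsto_mult tendsto_const)
  show "(\<lambda>t::nat. (ln (real t)) ^ 4 * exp (- (d / 2) * ln (real t))) \<longlonglongrightarrow> 0"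
   "(\<lambda>t::nat. (ln (real t))\<^sup>2 * exp (- (d / 2) * ln (real t))) \<longlonglongrightarrow> 0"
   "(\<lambda>t::nat. exp (- (d / 2) * ln (real t))) \<longlonglongrightarrow> 0" using assms by real_asymp+
 qed
 then show ?thesis by (simp add: power2_eq_square power4_eq_xxxx algebra_simps)
qed

context random_environment
begin

text \<open>The bound of \<open>valley_localizes\<close> is a power of ln t times t ^ (- d / 2), so
  it tends to 0 uniformly over good environments.\<close>

lemma good_environment_localized:
 fixes c :: real
 assumes \<kappa>: "0 < d" "0 < U" "1 \<le> N" "1 \<le> q" and \<eta>: "0 < \<eta>"
 shows "\<forall>\<^sub>F t in at_top. \<forall>w \<beta>. good_environment \<kappa> N q d U t w \<longrightarrow>
   valley (env_path \<kappa> N U t w) N d (2 * q) \<beta> \<longrightarrow>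
   measure (walk_law (env w)) {\<xi>. of_int (2 * q + 4) / U < \<bar>of_int (\<xi> t) / (ln (real t))\<^sup>2 - of_int \<beta> / U\<bar>} < \<eta>"
proof -
 define c where "c = 4 / \<epsilon> + 3 / \<epsilon> ^ nat m"
 have c: "0 \<le> c" using eps by (simp add: c_def)
 have "\<forall>\<^sub>F t::nat in at_top. c * (2 * of_int N / U * ((ln (real t))\<^sup>2) + 1)\<^sup>2 * exp (- (d / 2) * ln (real t)) < \<eta>"
  by (rule order_tendstoD(2)[OF poly_ln_exp_tendsto_0[OF \<kappa>(1)] \<eta>])
 moreover have "\<forall>\<^sub>F t in at_top. nat m \<le> block_length U t"
  using block_length_at_top[OF \<kappa>(2)] by (simp add: filterlim_at_top)
 moreover have "\<forall>\<^sub>F t::nat in at_top. 8 * defect / d + 1 \<le> ln (real t)"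
  using filterlim_ln_nat unfolding filterlim_at_top by blast
 ultimately show ?thesis
  using eventually_ln_square_ge[of U] eventually_ln_square_ge[of "of_int N * U"] eventually_ge_at_top[of 1]
 proof eventually_elim
  case (elim t)
  show ?case
  proof (intro allI impI)
   fix w \<beta>
   define s where "s = env_path \<kappa> N U t w"
   define B where "B = int (block_length U t)"
   define T where "T = ln (real t)"
   assume good: "good_environment \<kappa> N q d U t w"
    and v: "valley (env_path \<kappa> N U t w) N d (2 * q) \<beta>"
   let ?far = "{\<xi>. (2 * q + 3) * B < \<bar>\<xi> t - \<beta> * B\<bar>}" and ?far' = "{\<xi>. of_int (2 * q + 4) / U < \<bar>of_int (\<xi> t) / T\<^sup>2 - of_int \<beta> / U\<bar>}"
   have B: "m \<le> B" "1 \<le> B" using elim(2) m1 by (auto simp: B_def)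
   have T0: "0 < T\<^sup>2" using elim(4) \<kappa>(2) unfolding T_def by linarith
   have BT: "of_int B \<le> T\<^sup>2 / U" "T\<^sup>2 / U - 1 \<le> of_int B"
    using block_length_le[OF \<kappa>(2) elim(4)] by (simp_all add: B_def T_def)
   have dT: "defect \<le> d / 8 * T"
   proof -
    have "8 * defect / d \<le> T" using elim(3) by (simp add: T_def)
    then show ?thesis using \<kappa>(1) by (simp add: field_simps)
   qed
   interpret E: elliptic_env m \<epsilon> "env w" by (rule elliptic_env)
   have "measure (walk_law (env w)) ?far
    \<le> (4 / \<epsilon> + 3 / \<epsilon> ^ nat m) * (of_int (2 * N * B + 1))\<^sup>2 * exp (- (d / 2) * T)"
   proof (rule E.valley_localizes[where p="potential w" and s=s and D=defect])
    show "valley s N d (2 * q) \<beta>" using v by (simp add: s_def)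
    show "\<bar>potential w x - T * s k\<bar> \<le> d / 8 * T" if "k \<in> {- N..<N}" "x \<in> {k * B..(k + 1) * B}" for k x
     using good that unfolding good_environment_def tracks_def s_def B_def T_def by blast
    show "exp T = real t" using elim(6) by (simp add: T_def)
   qed (use \<kappa> B elim potential_window dT in auto)
   also have "... \<le> c * (2 * of_int N / U * T\<^sup>2 + 1)\<^sup>2 * exp (- (d / 2) * T)" unfolding c_def[symmetric]
   proof (intro mult_right_mono mult_left_mono power_mono)
    have "2 * of_int N * of_int B \<le> 2 * of_int N * (T\<^sup>2 / U)" using BT \<kappa>(3) by (intro mult_left_mono) auto
    then show "real_of_int (2 * N * B + 1) \<le> 2 * of_int N / U * T\<^sup>2 + 1" by simp
   qed (use c \<kappa> B in auto)
   also have "... < \<eta>" using elim(1) by (simp add: T_def)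
   finally have small: "measure (walk_law (env w)) ?far < \<eta>" .
   interpret W: prob_space "walk_law (env w)" by (rule prob_space_walk_law)
   have "measure (walk_law (env w)) ?far'
    \<le> measure (walk_law (env w)) ?far"
   proof (rule W.finite_measure_mono)
    show "?far \<in> W.events"
     using measurable_sets[OF walk_law_measurable_coord[of t "env w"], of "{x. (2 * q + 3) * B < \<bar>x - \<beta> * B\<bar>}"]
     by (simp add: space_walk_law vimage_def)
    show "?far' \<subseteq> ?far"
    proof (intro subsetI CollectI)
     have triangle: "\<bar>x - z\<bar> \<le> \<bar>x - y\<bar> + \<bar>z - y\<bar>" for x y z :: real by linarith
     fix \<xi> :: "nat \<Rightarrow> int"
     assume "\<xi> \<in> ?far'"
     then have "of_int (2 * q + 4) / U * T\<^sup>2 < \<bar>of_int (\<xi> t) / T\<^sup>2 - of_int \<beta> / U\<bar> * T\<^sup>2"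
      by (intro mult_strict_right_mono T0) simp
     also have "... = \<bar>(of_int (\<xi> t) / T\<^sup>2 - of_int \<beta> / U) * T\<^sup>2\<bar>" using T0 by (simp add: abs_mult)
     also have "(of_int (\<xi> t) / T\<^sup>2 - of_int \<beta> / U) * T\<^sup>2 = of_int (\<xi> t) - of_int \<beta> * (T\<^sup>2 / U)"
      using T0 by (simp add: left_diff_distrib)
     also have "\<bar>of_int (\<xi> t) - of_int \<beta> * (T\<^sup>2 / U)\<bar> \<le> \<bar>of_int (\<xi> t) - of_int \<beta> * of_int B\<bar> + \<bar>of_int \<beta> * (T\<^sup>2 / U - of_int B)\<bar>"
      unfolding right_diff_distrib by (rule triangle)
     also have "\<bar>of_int \<beta> * (T\<^sup>2 / U - of_int B)\<bar> \<le> of_int N * 1"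
      unfolding abs_mult using valley_bounds[OF v] BT by (intro mult_mono) auto
     \<comment> \<open>Replacing the cell length by T^2 / U moves the bottom by at most
       \<open>N\<close> sites, which is less than one cell for large t. This is the passage from 2 q
       + 3 to 2 q + 4.\<close>
     also have "of_int N * 1 \<le> T\<^sup>2 / U" using elim(5) \<kappa>(2) by (simp add: T_def le_divide_eq)
     finally have "of_int (2 * q + 3) * (T\<^sup>2 / U) < \<bar>of_int (\<xi> t) - of_int \<beta> * of_int B\<bar>"
      by (simp add: algebra_simps add_divide_distrib)
     moreover have "of_int (2 * q + 3) * of_int B \<le> of_int (2 * q + 3) * (T\<^sup>2 / U)" using BT \<kappa>(4) by (intro mult_left_mono) auto
     ultimately have "real_of_int ((2 * q + 3) * B) < of_int \<bar>\<xi> t - \<beta> * B\<bar>" by simp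
     then show "(2 * q + 3) * B < \<bar>\<xi> t - \<beta> * B\<bar>" by (simp only: of_int_less_iff)
    qed
   qed
   then show "measure (walk_law (env w)) {\<xi>. of_int (2 * q + 4) / U < \<bar>of_int (\<xi> t) / (ln (real t))\<^sup>2 - of_int \<beta> / U\<bar>} < \<eta>"
    using small by (simp add: T_def)
  qed
 qed
qed

text \<open>Centres for one fixed accuracy \<eta>. With finitely many values, convergence in law
  reduces to convergence of point probabilities. The remaining inaccuracy is removed by the diagonal
  choice.\<close>

definition centred :: "real \<Rightarrow> (nat \<Rightarrow> env \<Rightarrow> real) \<Rightarrow> real set \<Rightarrow> bool" where
 "centred \<eta> c F \<longleftrightarrow> finite F \<and> (\<forall>t w. c t w \<in> F) \<and> (\<forall>t. c t \<in> borel_measurable Q) \<and>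
  (\<forall>v. convergent (\<lambda>t. Q.prob {w. c t w = v})) \<and>
  (\<forall>\<^sub>F t in at_top. \<exists>A\<in>Q.events. 1 - \<eta> \<le> Q.prob A \<and>
    (\<forall>w\<in>A. measure (walk_law (env w)) {\<xi>. \<eta> < \<bar>of_int (\<xi> t) / (ln (real t))\<^sup>2 - c t w\<bar>} < \<eta>))"

theorem localization:
 assumes mean: "\<And>n. 1 \<le> n \<Longrightarrow> \<bar>mean (y n)\<bar> \<le> 3 * defect" and \<sigma>: "0 < \<sigma>" and \<eta>: "0 < \<eta>"
 shows "\<exists>c F. centred \<eta> c F"
proof -
 interpret centered_additive \<nu> block_potential "3 * defect" by unfold_locales (rule mean)
 obtain \<kappa> N q d U where p: "0 < \<kappa>" "1 \<le> N" "1 \<le> q" "0 < d" "0 < U" "of_int (2 * q + 2) / U \<le> \<eta> / 2"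
  and good: "\<forall>\<^sub>F t in at_top. \<exists>A\<in>Q.events. 1 - \<eta> / 2 \<le> Q.prob A \<and> (\<forall>w\<in>A. good_environment \<kappa> N q d U t w)"
  using good_environment_likely[OF \<sigma>, of "\<eta> / 2"] \<eta> by auto
 \<comment> \<open>Any choice of a bottom will do. It is a function of the rounded vector, which is
   discrete and for which the probability of every event converges; this gives measurability and a
   convergent law of the centre.\<close>
 define \<beta> where "\<beta> v = (if \<exists>\<beta>. valley (skeleton \<kappa> v) N d (2 * q) \<beta> then SOME \<beta>. valley (skeleton \<kappa> v) N d (2 * q) \<beta> else 0)" for v
 have \<beta>: "valley (skeleton \<kappa> v) N d (2 * q) (\<beta> v)" if "\<exists>\<beta>. valley (skeleton \<kappa> v) N d (2 * q) \<beta>" for v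
  using someI_ex[OF that] that by (simp add: \<beta>_def)
 have \<beta>N: "\<beta> v \<in> {-N..N}" for v
  using valley_bounds[OF \<beta>[of v]] p by (cases "\<exists>\<beta>. valley (skeleton \<kappa> v) N d (2 * q) \<beta>") (auto simp: \<beta>_def)
 define V where "V t w = rounded_vector \<kappa> N (ln (real t)) (block_length U t) w" for t w
 define c where "c t w = of_int (\<beta> (V t w)) / U" for t w
 define F where "F = (\<lambda>k. of_int k / U) ` {-N..N}"
 have F: "finite F" "c t w \<in> F" for t w using \<beta>N by (auto simp: F_def c_def)
 have ev: "{w. E (c t w)} \<in> Q.events" for E t
  unfolding c_def V_def by (rule rounded_vector_event[OF block_length_ge, where E="\<lambda>v. E (of_int (\<beta> v) / U)"])
 have meas: "c t \<in> borel_measurable Q" for t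
  unfolding measurable_def using ev[of "\<lambda>z. z \<in> _" t] by (auto simp: space_Q vimage_def)
 have conv: "convergent (\<lambda>t. Q.prob {w. c t w = v})" for v
  using rounded_vector_lim[OF \<sigma> p(1,5,2), where E="\<lambda>g. of_int (\<beta> g) / U = v"]
  unfolding c_def V_def convergent_def by blast
 have "of_int (2 * q + 4) / U \<le> of_int (2 * (2 * q + 2)) / U" using p by (intro divide_right_mono) auto
 also have "... = 2 * (of_int (2 * q + 2) / U)" by simp
 also have "... \<le> \<eta>" using p(6) by linarith
 finally have r: "of_int (2 * q + 4) / U \<le> \<eta>" .
 have "\<forall>\<^sub>F t in at_top. \<exists>A\<in>Q.events. 1 - \<eta> \<le> Q.prob A \<and>
    (\<forall>w\<in>A. measure (walk_law (env w)) {\<xi>. \<eta> < \<bar>of_int (\<xi> t) / (ln (real t))\<^sup>2 - c t w\<bar>} < \<eta>)"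
  using good good_environment_localized[OF p(4,5,2,3) \<eta>, of \<kappa>]
 proof eventually_elim
  case (elim t)
  obtain A where A: "A \<in> Q.events" "1 - \<eta> / 2 \<le> Q.prob A" "\<And>w. w \<in> A \<Longrightarrow> good_environment \<kappa> N q d U t w"
   using elim(1) by blast
  have "measure (walk_law (env w)) {\<xi>. \<eta> < \<bar>of_int (\<xi> t) / (ln (real t))\<^sup>2 - c t w\<bar>} < \<eta>" if w: "w \<in> A" for w
  proof -
   interpret W: prob_space "walk_law (env w)" by (rule prob_space_walk_law)
   have "valley (skeleton \<kappa> (V t w)) N d (2 * q) (\<beta> (V t w))"
    using A(3)[OF w] unfolding good_environment_def env_path_def V_def by (intro \<beta>) blast
   then have "measure (walk_law (env w)) {\<xi>. of_int (2 * q + 4) / U < \<bar>of_int (\<xi> t) / (ln (real t))\<^sup>2 - c t w\<bar>} < \<eta>"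
    using elim(2) A(3)[OF w] unfolding c_def V_def env_path_def by blast
   moreover have "measure (walk_law (env w)) {\<xi>. \<eta> < \<bar>of_int (\<xi> t) / (ln (real t))\<^sup>2 - c t w\<bar>}
    \<le> measure (walk_law (env w)) {\<xi>. of_int (2 * q + 4) / U < \<bar>of_int (\<xi> t) / (ln (real t))\<^sup>2 - c t w\<bar>}"
   proof (rule W.finite_measure_mono)
    show "{\<xi>. of_int (2 * q + 4) / U < \<bar>of_int (\<xi> t) / (ln (real t))\<^sup>2 - c t w\<bar>} \<in> W.events"
     using measurable_sets[OF walk_law_measurable_coord[of t "env w"], of "{x. of_int (2 * q + 4) / U < \<bar>of_int x / (ln (real t))\<^sup>2 - c t w\<bar>}"]
     by (simp add: space_walk_law vimage_def)
   qed (use r in auto)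
   ultimately show ?thesis by linarith
  qed
  then show ?case using A \<eta> by (intro bexI[of _ A]) auto
 qed
 then show ?thesis using F meas conv unfolding centred_def by (intro exI[of _ c] exI[of _ F]) blast
qed

end

text \<open>Tightness supplies a limit along a subsequence, and convergence of the characteristic
  functions identifies all such limits, so the limit law need not be known in advance.\<close>

lemma tight_char_convergent:
 assumes dist: "\<And>n. real_distribution (\<mu> n)" and tight: "tight \<mu>" and conv: "\<And>u. convergent (\<lambda>n. char (\<mu> n) u)"
 shows "\<exists>M. real_distribution M \<and> weak_conv_m \<mu> M"
proof -
 obtain r M where r: "strict_mono (r :: nat \<Rightarrow> nat)" and M: "real_distribution M" and q: "weak_conv_m (\<mu> \<circ> id \<circ> r) M"
  using tight_imp_convergent_subsubsequence[OF tight, of id] strict_mono_id by (auto simp: strict_mono_def)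
 have lim: "(\<lambda>n. char (\<mu> n) u) \<longlonglongrightarrow> char M' u" if s: "strict_mono s" and M': "real_distribution M'" and q: "weak_conv_m (\<mu> \<circ> s) M'" for s M' u
 proof -
  obtain l where l: "(\<lambda>n. char (\<mu> n) u) \<longlonglongrightarrow> l" using conv[of u] by (auto simp: convergent_def)
  have "(\<lambda>n. char ((\<mu> \<circ> s) n) u) \<longlonglongrightarrow> char M' u" by (rule levy_continuity1[OF _ M' q]) (simp add: dist)
  moreover have "(\<lambda>n. char ((\<mu> \<circ> s) n) u) \<longlonglongrightarrow> l" using LIMSEQ_subseq_LIMSEQ[OF l s] by (simp add: comp_def)
  ultimately show ?thesis using l LIMSEQ_unique by blast
 qed
 have "weak_conv_m \<mu> M"
 proof (rule tight_subseq_weak_converge[OF dist M tight])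
  fix s M' assume s: "strict_mono s" "real_distribution M'" "weak_conv_m (\<mu> \<circ> s) M'"
  have "char M' = char M"
   by (rule ext, rule LIMSEQ_unique[OF lim[OF s] lim[OF r M]]) (use q in \<open>simp add: comp_def\<close>)
  then show "weak_conv_m (\<mu> \<circ> s) M" using Levy_uniqueness[OF s(2) M] s(3) by simp
 qed
 then show ?thesis using M by blast
qed

section \<open>Characteristic functions of close and of finitely valued variables\<close>

context prob_space
begin

lemma char_diff_le_of_close:
 assumes X: "X \<in> borel_measurable M" and Y: "Y \<in> borel_measurable M" and A: "A \<in> events" "1 - \<delta> \<le> prob A"
  and close: "\<And>w. w \<in> A \<Longrightarrow> \<bar>X w - Y w\<bar> \<le> e" and e: "0 \<le> e"
 shows "cmod (char (distr M borel X) u - char (distr M borel Y) u) \<le> \<bar>u\<bar> * e + 2 * \<delta>"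
proof -
 have ind: "integrable M (indicat_real (space M - A))" using A(1) by (intro integrable_real_indicator) (auto simp: less_top[symmetric])
 have "cmod (iexp (u * X w) - iexp (u * Y w)) \<le> \<bar>u\<bar> * e + 2 * indicat_real (space M - A) w" if w: "w \<in> space M" for w
 proof (cases "w \<in> A")
  case True
  have "\<bar>u\<bar> * \<bar>X w - Y w\<bar> \<le> \<bar>u\<bar> * e" by (intro mult_left_mono close True) auto
  then show ?thesis using True cmod_iexp_diff_le[of u "X w" "Y w"] by simp
 next
  case False
  have "cmod (iexp (u * X w) - iexp (u * Y w)) \<le> cmod (iexp (u * X w)) + cmod (iexp (u * Y w))" by (rule norm_triangle_ineq4)
  then show ?thesis using False w e by (simp add: add_increasing)
 qed
 then have "cmod (char (distr M borel X) u - char (distr M borel Y) u) \<le> expectation (\<lambda>w. \<bar>u\<bar> * e + 2 * indicat_real (space M - A) w)"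
  using ind by (intro char_diff_le X Y) simp_all
 also have "... = \<bar>u\<bar> * e + 2 * prob (space M - A)" using ind prob_space by (simp add: Int_absorb2)
 also have "prob (space M - A) \<le> \<delta>" using prob_compl[OF A(1)] A(2) by simp
 finally show ?thesis by simp
qed

lemma char_finite_valued:
 assumes X: "X \<in> borel_measurable M" and F: "finite F" "\<And>w. w \<in> space M \<Longrightarrow> X w \<in> F"
 shows "char (distr M borel X) u = (\<Sum>v\<in>F. complex_of_real (prob {w \<in> space M. X w = v}) * iexp (u * v))"
proof -
 note [measurable] = X
 have "char (distr M borel X) u = (CLINT w|M. (\<Sum>v\<in>F. complex_of_real (indicator {w \<in> space M. X w = v} w) * iexp (u * v)))"
  unfolding char_distr_eq[OF X]
 proof (rule Bochner_Integration.integral_cong[OF refl])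
  fix w assume w: "w \<in> space M"
  have "(\<Sum>v\<in>F. complex_of_real (indicator {w \<in> space M. X w = v} w) * iexp (u * v)) = (\<Sum>v\<in>{X w}. iexp (u * v))"
   by (rule sum.mono_neutral_cong_right) (use F w in \<open>auto simp: indicator_def\<close>)
  then show "iexp (u * X w) = (\<Sum>v\<in>F. complex_of_real (indicator {w \<in> space M. X w = v} w) * iexp (u * v))" by simp
 qed
 also have "... = (\<Sum>v\<in>F. (CLINT w|M. complex_of_real (indicator {w \<in> space M. X w = v} w) * iexp (u * v)))"
  by (rule Bochner_Integration.integral_sum) (auto intro!: integrable_mult_left integrable_of_real integrable_real_indicator simp: less_top[symmetric])
 also have "... = (\<Sum>v\<in>F. complex_of_real (prob {w \<in> space M. X w = v}) * iexp (u * v))"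
  by (intro sum.cong refl) (simp add: Int_absorb2)
 finally show ?thesis .
qed

end

subsection \<open>Diagonal choice of the centres\<close>

locale localized_family = prob_space M for M :: "'a measure" +
 fixes K :: "'a \<Rightarrow> 'b measure" and X :: "nat \<Rightarrow> 'b \<Rightarrow> real"
  and c :: "nat \<Rightarrow> nat \<Rightarrow> 'a \<Rightarrow> real" and F :: "nat \<Rightarrow> real set" and \<eta> :: "nat \<Rightarrow> real"
 assumes K_prob: "w \<in> space M \<Longrightarrow> prob_space (K w)" and K_space: "space (K w) = UNIV"
  and X_meas: "X t \<in> borel_measurable (K w)"
  and mass_meas: "S \<in> sets borel \<Longrightarrow> (\<lambda>w. measure (K w) {\<xi>. X t \<xi> \<in> S}) \<in> borel_measurable M"
  and c_meas: "c j t \<in> borel_measurable M" and F_fin: "finite (F j)" and c_in: "c j t w \<in> F j"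
  and c_conv: "convergent (\<lambda>t. prob {w \<in> space M. c j t w = v})"
  and \<eta>: "0 < \<eta> j" "\<eta> j < 1 / 2" "antimono \<eta>" "\<eta> \<longlonglongrightarrow> 0"
  and loc: "\<forall>\<^sub>F t in at_top. \<exists>A\<in>events. 1 - \<eta> j \<le> prob A \<and>
    (\<forall>w\<in>A. measure (K w) {\<xi>. \<eta> j < \<bar>X t \<xi> - c j t w\<bar>} < \<eta> j)"
begin

definition localized :: "nat \<Rightarrow> nat \<Rightarrow> bool" where
 "localized j t \<longleftrightarrow> (\<exists>A\<in>events. 1 - \<eta> j \<le> prob A \<and>
   (\<forall>w\<in>A. measure (K w) {\<xi>. \<eta> j < \<bar>X t \<xi> - c j t w\<bar>} < \<eta> j))"

text \<open>The largest index, hence the best accuracy, that is attained at time \<open>t\<close>.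
  Every fixed index is eventually admissible, so the level tends to infinity; the inserted 0 is a
  default for times without an admissible index.\<close>

definition level :: "nat \<Rightarrow> nat" where "level t = Max (insert 0 {j. j \<le> t \<and> localized j t})"

definition b :: "nat \<Rightarrow> 'a \<Rightarrow> real" where "b t = c (level t) t"

lemma eventually_level: "\<forall>\<^sub>F t in at_top. i \<le> level t \<and> localized (level t) t \<and> localized i t"
proof -
 have "\<forall>\<^sub>F t in at_top. localized i t" using loc[of i] by (simp add: localized_def)
 then show ?thesis using eventually_ge_at_top[of i]
 proof eventually_elim
  case (elim t)
  have fin: "finite (insert 0 {j. j \<le> t \<and> localized j t})" by simp
  have le: "i \<le> level t" unfolding level_def by (rule Max_ge[OF fin]) (use elim in simp)
  have "level t \<in> insert 0 {j. j \<le> t \<and> localized j t}" unfolding level_def by (rule Max_in[OF fin]) simp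
  then have "localized (level t) t" using le elim by auto
  then show ?case using le elim by simp
 qed
qed

lemma event_K: "S \<in> sets borel \<Longrightarrow> {\<xi>. X t \<xi> \<in> S} \<in> sets (K w)"
 using measurable_sets[OF X_meas[of t w], of S] by (simp add: K_space vimage_def)

lemma far_event: "{\<xi>. e < \<bar>X t \<xi> - v\<bar>} \<in> sets (K w)"
proof -
 have "{x::real. e < \<bar>x - v\<bar>} \<in> sets borel" by measurable
 then show ?thesis using event_K[of "{x. e < \<bar>x - v\<bar>}" t w] by simp
qed

text \<open>Each neighbourhood carries more than half of the quenched law, so some trajectory lies
  in both.\<close>

lemma centres_close:
 assumes w: "w \<in> space M" and "measure (K w) {\<xi>. e < \<bar>X t \<xi> - v\<bar>} < 1 / 2" "measure (K w) {\<xi>. e' < \<bar>X t \<xi> - v'\<bar>} < 1 / 2"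
 shows "\<bar>v - v'\<bar> \<le> e + e'"
proof -
 interpret W: prob_space "K w" by (rule K_prob[OF w])
 have "measure (K w) ({\<xi>. e < \<bar>X t \<xi> - v\<bar>} \<union> {\<xi>. e' < \<bar>X t \<xi> - v'\<bar>}) < 1"
  using measure_Un_le[OF far_event[of e t v w] far_event[of e' t v' w]] assms by linarith
 then have "{\<xi>. e < \<bar>X t \<xi> - v\<bar>} \<union> {\<xi>. e' < \<bar>X t \<xi> - v'\<bar>} \<noteq> space (K w)" using W.prob_space by auto
 then have "\<exists>\<xi>. \<not> e < \<bar>X t \<xi> - v\<bar> \<and> \<not> e' < \<bar>X t \<xi> - v'\<bar>" unfolding K_space by blast
 then obtain \<xi> where "\<not> e < \<bar>X t \<xi> - v\<bar>" "\<not> e' < \<bar>X t \<xi> - v'\<bar>" by blast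
 then show ?thesis by linarith
qed

lemma b_meas: "b t \<in> borel_measurable M" unfolding b_def by (rule c_meas)

lemma b_close:
 "\<forall>\<^sub>F t in at_top. \<exists>A\<in>events. 1 - 2 * \<eta> i \<le> prob A \<and> (\<forall>w\<in>A. \<bar>b t w - c i t w\<bar> \<le> 2 * \<eta> i)"
 using eventually_level[of i]
proof eventually_elim
 case (elim t)
 obtain A where A: "A \<in> events" "1 - \<eta> i \<le> prob A" "\<And>w. w \<in> A \<Longrightarrow> measure (K w) {\<xi>. \<eta> i < \<bar>X t \<xi> - c i t w\<bar>} < \<eta> i"
  using elim by (auto simp: localized_def)
 obtain A' where A': "A' \<in> events" "1 - \<eta> (level t) \<le> prob A'"
   "\<And>w. w \<in> A' \<Longrightarrow> measure (K w) {\<xi>. \<eta> (level t) < \<bar>X t \<xi> - b t w\<bar>} < \<eta> (level t)"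
  using elim by (auto simp: localized_def b_def)
 have le: "\<eta> (level t) \<le> \<eta> i" using elim \<eta>(3) by (simp add: antimono_def)
 have "prob A + prob A' - 1 \<le> prob (A \<inter> A')"
  using finite_measure_Union'[OF A(1) A'(1)] finite_measure_Diff'[OF A'(1) A(1)] prob_le_1[of "A \<union> A'"] by (simp add: Int_commute)
 then have "1 - 2 * \<eta> i \<le> prob (A \<inter> A')" using A A' le by linarith
 moreover have "\<bar>b t w - c i t w\<bar> \<le> 2 * \<eta> i" if "w \<in> A \<inter> A'" for w
 proof -
  have "\<bar>b t w - c i t w\<bar> \<le> \<eta> (level t) + \<eta> i"
   by (rule centres_close[of w _ t]) (use that A(3)[of w] A'(3)[of w] \<eta>(2)[of i] \<eta>(2)[of "level t"] sets.sets_into_space[OF A(1)] in auto)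
  then show ?thesis using le by linarith
 qed
 ultimately show ?case using A(1) A'(1) by blast
qed

lemma small_\<eta>: assumes "0 < e" obtains i where "\<eta> i < e"
proof -
 have "\<forall>\<^sub>F i in sequentially. \<eta> i < e" by (rule order_tendstoD(2)[OF \<eta>(4) assms])
 then show ?thesis using that by (auto simp: eventually_sequentially)
qed

text \<open>With high probability and for large t, \<open>b t\<close> follows the i-th centre up to
  2 \<eta> i, and the law of that centre converges. The characteristic functions are therefore
  Cauchy.\<close>

lemma b_char_convergent: "convergent (\<lambda>t. char (distr M borel (b t)) u)"
proof (rule Cauchy_convergent, rule CauchyI)
 fix e :: real assume e: "0 < e"
 define k where "k = 2 * \<bar>u\<bar> + 4"
 have k: "0 < k" by (simp add: k_def)
 obtain i where "\<eta> i < e / (3 * k)" by (rule small_\<eta>[of "e / (3 * k)"]) (use e k in auto)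
 then have i: "\<eta> i * k < e / 3" using k by (simp add: field_simps)
 have "convergent (\<lambda>t. char (distr M borel (c i t)) u)"
 proof -
  define p where "p v = lim (\<lambda>t. prob {w \<in> space M. c i t w = v})" for v
  have p: "(\<lambda>t. prob {w \<in> space M. c i t w = v}) \<longlonglongrightarrow> p v" for v
   unfolding p_def using c_conv by (simp only: convergent_LIMSEQ_iff)
  have "(\<lambda>t. \<Sum>v\<in>F i. complex_of_real (prob {w \<in> space M. c i t w = v}) * iexp (u * v)) \<longlonglongrightarrow> (\<Sum>v\<in>F i. complex_of_real (p v) * iexp (u * v))"
   by (intro tendsto_intros p)
  then show ?thesis using char_finite_valued[OF c_meas F_fin c_in] unfolding convergent_def by auto
 qed
 then have "Cauchy (\<lambda>t. char (distr M borel (c i t)) u)" by (rule convergent_Cauchy)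
 then obtain t0 where t0: "\<And>s t. t0 \<le> s \<Longrightarrow> t0 \<le> t \<Longrightarrow> cmod (char (distr M borel (c i s)) u - char (distr M borel (c i t)) u) < e / 3"
  using CauchyD[of "\<lambda>t. char (distr M borel (c i t)) u" "e / 3"] e by auto
 have "\<forall>\<^sub>F t in at_top. cmod (char (distr M borel (b t)) u - char (distr M borel (c i t)) u) < e / 3"
  using b_close[of i]
 proof eventually_elim
  case (elim t)
  then obtain A where A: "A \<in> events" "1 - 2 * \<eta> i \<le> prob A" "\<And>w. w \<in> A \<Longrightarrow> \<bar>b t w - c i t w\<bar> \<le> 2 * \<eta> i" by blast
  have "cmod (char (distr M borel (b t)) u - char (distr M borel (c i t)) u) \<le> \<bar>u\<bar> * (2 * \<eta> i) + 2 * (2 * \<eta> i)"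
   by (rule char_diff_le_of_close[OF b_meas c_meas A]) (use \<eta>(1)[of i] in auto)
  also have "... = \<eta> i * k" by (simp add: k_def algebra_simps)
  finally show ?case using i by linarith
 qed
 then obtain t1 where t1: "\<And>t. t1 \<le> t \<Longrightarrow> cmod (char (distr M borel (b t)) u - char (distr M borel (c i t)) u) < e / 3"
  by (auto simp: eventually_sequentially)
 have "cmod (char (distr M borel (b s)) u - char (distr M borel (b t)) u) < e" if "max t0 t1 \<le> s" "max t0 t1 \<le> t" for s t
 proof -
  have tri: "cmod (q - z) \<le> cmod (q - q') + cmod (q' - z') + cmod (z - z')" for q z q' z'
   using norm_triangle_ineq[of "(q - q') + (q' - z')" "z' - z"] norm_triangle_ineq[of "q - q'" "q' - z'"]
   by (simp add: norm_minus_commute)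
  show ?thesis using tri[of "char (distr M borel (b s)) u" "char (distr M borel (b t)) u" "char (distr M borel (c i s)) u" "char (distr M borel (c i t)) u"]
    t1[of s] t1[of t] t0[of s t] that by auto
 qed
 then show "\<exists>N. \<forall>s\<ge>N. \<forall>t\<ge>N. cmod (char (distr M borel (b s)) u - char (distr M borel (b t)) u) < e" by blast
qed

lemma b_tight: "tight (\<lambda>t. distr M borel (b t))"
 unfolding tight_def
proof (intro conjI allI impI)
 show "real_distribution (distr M borel (b t))" for t by (rule real_distribution_distr[OF b_meas])
 fix \<epsilon> :: real assume \<epsilon>: "0 < \<epsilon>"
 obtain i where i: "\<eta> i < \<epsilon> / 2" by (rule small_\<eta>[of "\<epsilon> / 2"]) (use \<epsilon> in auto)
 obtain t0 where t0: "\<And>t. t0 \<le> t \<Longrightarrow> \<exists>A\<in>events. 1 - 2 * \<eta> i \<le> prob A \<and> (\<forall>w\<in>A. \<bar>b t w - c i t w\<bar> \<le> 2 * \<eta> i)"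
  using b_close[of i] by (auto simp: eventually_sequentially)
 have "finite (F i \<union> (\<Union>t<t0. F (level t)))" using F_fin by auto
 then obtain R where R: "\<And>v. v \<in> F i \<union> (\<Union>t<t0. F (level t)) \<Longrightarrow> \<bar>v\<bar> \<le> R"
  using finite_imp_bounded bounded_real by metis
 define r where "r = \<bar>R\<bar> + 2"
 have "1 - \<epsilon> < measure (distr M borel (b t)) {- r<..r}" for t
 proof -
  note [measurable] = b_meas[of t]
  have d: "measure (distr M borel (b t)) {- r<..r} = prob {w \<in> space M. b t w \<in> {- r<..r}}"
   by (subst measure_distr) (auto intro!: arg_cong[where f=prob])
  show ?thesis
  proof (cases "t < t0")
   case True
   have "\<bar>b t w\<bar> \<le> R" for w by (rule R) (use True c_in in \<open>auto simp: b_def\<close>)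
   then have "- r < b t w \<and> b t w \<le> r" for w unfolding r_def by (smt (verit))
   then have "{w \<in> space M. b t w \<in> {- r<..r}} = space M" by auto
   then show ?thesis using d \<epsilon> prob_space by simp
  next
   case False
   then obtain A where A: "A \<in> events" "1 - 2 * \<eta> i \<le> prob A" "\<And>w. w \<in> A \<Longrightarrow> \<bar>b t w - c i t w\<bar> \<le> 2 * \<eta> i"
    using t0[of t] by auto
   have "prob A \<le> prob {w \<in> space M. b t w \<in> {- r<..r}}"
   proof (rule finite_measure_mono)
    show "A \<subseteq> {w \<in> space M. b t w \<in> {- r<..r}}"
    proof
     fix w assume w: "w \<in> A"
     have "\<bar>c i t w\<bar> \<le> R" using R c_in by blast
     then have "- r < b t w" "b t w \<le> r" using A(3)[OF w] \<eta>(2)[of i] unfolding r_def by linarith+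
     then show "w \<in> {w \<in> space M. b t w \<in> {- r<..r}}" using w sets.sets_into_space[OF A(1)] by auto
    qed
   qed measurable
   then show ?thesis using d A(2) i by linarith
  qed
 qed
 moreover have "- r < r" by (simp add: r_def)
 ultimately show "\<exists>a b'. a < b' \<and> (\<forall>t. 1 - \<epsilon> < measure (distr M borel (b t)) {a<..b'})" by blast
qed

lemma b_weakly_convergent: "\<exists>\<mu>. real_distribution \<mu> \<and> weak_conv_m (\<lambda>t. distr M borel (b t)) \<mu>"
 by (rule tight_char_convergent[OF real_distribution_distr[OF b_meas] b_tight b_char_convergent])

lemma b_localizes:
 assumes \<epsilon>: "0 < \<epsilon>"
 shows "(\<lambda>t. prob {w \<in> space M. 1 - \<epsilon> \<le> measure (K w) {\<xi>. \<bar>X t \<xi> - b t w\<bar> \<le> \<epsilon>}}) \<longlonglongrightarrow> 1"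
proof -
 let ?G = "\<lambda>t. {w \<in> space M. 1 - \<epsilon> \<le> measure (K w) {\<xi>. \<bar>X t \<xi> - b t w\<bar> \<le> \<epsilon>}}"
 have G: "?G t \<in> events" for t
 proof -
  \<comment> \<open>\<open>b t\<close> takes finitely many values, so the event splits into events
    with a fixed centre \<open>v\<close>, to which \<open>mass_meas\<close> applies.\<close>
  have "?G t = (\<Union>v\<in>F (level t). {w \<in> space M. b t w = v} \<inter> {w \<in> space M. 1 - \<epsilon> \<le> measure (K w) {\<xi>. \<bar>X t \<xi> - v\<bar> \<le> \<epsilon>}})"
   using c_in[of "level t" t] by (auto simp: b_def)
  moreover have "... \<in> events"
  proof (intro sets.finite_UN F_fin sets.Int)
   fix v
   note [measurable] = b_meas[of t]
   show "{w \<in> space M. b t w = v} \<in> events" by measurable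
   have "{x::real. \<bar>x - v\<bar> \<le> \<epsilon>} \<in> sets borel" by measurable
   then have [measurable]: "(\<lambda>w. measure (K w) {\<xi>. \<bar>X t \<xi> - v\<bar> \<le> \<epsilon>}) \<in> borel_measurable M"
    using mass_meas[of "{x. \<bar>x - v\<bar> \<le> \<epsilon>}" t] by simp
   show "{w \<in> space M. 1 - \<epsilon> \<le> measure (K w) {\<xi>. \<bar>X t \<xi> - v\<bar> \<le> \<epsilon>}} \<in> events" by measurable
  qed
  ultimately show ?thesis by (simp only:)
 qed
 have low: "\<forall>\<^sub>F t in at_top. 1 - \<eta> i \<le> prob (?G t)" if i: "\<eta> i \<le> \<epsilon>" for i
  using eventually_level[of i]
 proof eventually_elim
  case (elim t)
  obtain A where A: "A \<in> events" "1 - \<eta> (level t) \<le> prob A"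
   "\<And>w. w \<in> A \<Longrightarrow> measure (K w) {\<xi>. \<eta> (level t) < \<bar>X t \<xi> - b t w\<bar>} < \<eta> (level t)"
   using elim by (auto simp: localized_def b_def)
  have le: "\<eta> (level t) \<le> \<eta> i" using elim \<eta>(3) by (simp add: antimono_def)
  have "prob A \<le> prob (?G t)"
  proof (rule finite_measure_mono[OF _ G])
   show "A \<subseteq> ?G t"
   proof
    fix w assume w: "w \<in> A"
    then have sp: "w \<in> space M" using sets.sets_into_space[OF A(1)] by auto
    interpret W: prob_space "K w" by (rule K_prob[OF sp])
    have "W.prob {\<xi>. \<epsilon> < \<bar>X t \<xi> - b t w\<bar>} \<le> W.prob {\<xi>. \<eta> (level t) < \<bar>X t \<xi> - b t w\<bar>}"
     by (rule W.finite_measure_mono[OF _ far_event]) (use le i in auto)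
    then have "W.prob {\<xi>. \<epsilon> < \<bar>X t \<xi> - b t w\<bar>} \<le> \<epsilon>" using A(3)[OF w] le i by linarith
    moreover have "{\<xi>. \<bar>X t \<xi> - b t w\<bar> \<le> \<epsilon>} = space (K w) - {\<xi>. \<epsilon> < \<bar>X t \<xi> - b t w\<bar>}" by (auto simp: K_space)
    ultimately show "w \<in> ?G t" using sp W.prob_compl[OF far_event, of \<epsilon> t "b t w"] by simp
   qed
  qed
  then show ?case using A(2) le by linarith
 qed
 show ?thesis
 proof (rule tendstoI)
  fix e :: real assume e: "0 < e"
  obtain i where i: "\<eta> i < min e \<epsilon>" by (rule small_\<eta>[of "min e \<epsilon>"]) (use e \<epsilon> in auto)
  have "\<forall>\<^sub>F t in at_top. 1 - \<eta> i \<le> prob (?G t)" by (rule low) (use i in simp)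
  then show "\<forall>\<^sub>F t in at_top. dist (prob (?G t)) 1 < e"
  proof eventually_elim
   case (elim t)
   then show ?case using i prob_le_1[of "?G t"] by (simp add: dist_real_def)
  qed
 qed
qed

end

section \<open>Support of a measure, and transfer to the given environment\<close>

lemma dist_support_null:
 fixes M :: "'a::second_countable_topology measure"
 assumes "sets M = sets borel" shows "AE x in M. x \<in> dist_support M"
proof -
 define \<U> where "\<U> = {U. open U \<and> emeasure M U = 0}"
 \<comment> \<open>By the Lindelof property the union of all open null sets is a countable
   union.\<close>
 obtain \<V> where \<V>: "\<V> \<subseteq> \<U>" "countable \<V>" "\<Union>\<V> = \<Union>\<U>"
  by (rule Lindelof[of \<U>]) (auto simp: \<U>_def)
 have "(\<Union>U\<in>\<V>. U) \<in> null_sets M"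
  by (rule null_sets_UN'[OF \<V>(2)]) (use \<V>(1) assms in \<open>auto simp: \<U>_def null_sets_def\<close>)
 then have "AE x in M. x \<notin> \<Union>\<U>" using \<V>(3) AE_not_in by fastforce
 then show ?thesis by eventually_elim (auto simp: dist_support_def \<U>_def zero_less_iff_neq_zero)
qed

lemma dist_support_subset_closed:
 fixes M :: "'a::topological_space measure"
 assumes sets: "sets M = sets borel" and C: "closed C" "AE x in M. x \<in> C"
 shows "dist_support M \<subseteq> C"
proof
 fix x assume x: "x \<in> dist_support M"
 have "emeasure M (- C) = 0"
  using C(2) by (subst AE_iff_measurable[symmetric, where P="\<lambda>x. x \<in> C"]) (use C(1) sets sets_eq_imp_space_eq[OF sets] in auto)
 then show "x \<in> C" using x C(1) by (force simp: dist_support_def open_Compl)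
qed

lemma free_op_iter_measurable:
 assumes [measurable]: "\<And>x j. (\<lambda>w. w x j) \<in> borel_measurable M"
 shows "(\<lambda>w. (free_op m w ^^ t) f x) \<in> borel_measurable M"
proof (induction t arbitrary: x)
 case (Suc t)
 note [measurable] = Suc
 show ?case unfolding free_op_Suc by measurable
qed simp

theorem theorem2:
  fixes m :: int and P :: "(int \<Rightarrow> int \<Rightarrow> real) measure"
  assumes "m > 1"
    and "prob_space P" and "sets P = sets (env_space m)"
    and "prob_space.indep_vars P (\<lambda>_. borel) (\<lambda>x \<omega>. \<omega> x) (UNIV :: int set)"
    and "\<forall>x. distr P borel (\<lambda>\<omega>. \<omega> x) = distr P borel (\<lambda>\<omega>. \<omega> 0)"
    and "\<exists>\<epsilon>>0. \<forall>p \<in> dist_support (distr P borel (\<lambda>\<omega>. \<omega> 0)).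
           p 1 \<ge> \<epsilon> \<and> p (-1) \<ge> \<epsilon> \<and> p m \<ge> \<epsilon> \<and> p (-m) \<ge> \<epsilon>"
    and "AE \<omega> in P. recurrent_walk \<omega>"
    and "\<not> dist_support (distr P borel (\<lambda>\<omega>. \<omega> 0)) \<subseteq> balanced_jump_vectors m"
  shows "\<exists>b :: nat \<Rightarrow> (int \<Rightarrow> int \<Rightarrow> real) \<Rightarrow> real.
           (\<forall>t\<ge>1. b t \<in> borel_measurable P) \<and>
           (\<exists>\<mu>. real_distribution \<mu> \<and> weak_conv_m (\<lambda>t. distr P borel (b t)) \<mu>) \<and>
           (\<forall>\<epsilon>>0. (\<lambda>t. \<P>(\<omega> in P.
                \<P>(\<xi> in walk_law \<omega>. \<bar>of_int (\<xi> t) / (ln (real t))\<^sup>2 - b t \<omega>\<bar> \<le> \<epsilon>) \<ge> 1 - \<epsilon>))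
              \<longlonglongrightarrow> 1)"
proof -
 interpret P: prob_space P by fact
 note indep = assms(4)
 define \<nu> where "\<nu> = distr P borel (\<lambda>w. w 0)"
 have law: "distr P borel (\<lambda>w. w x) = \<nu>" for x using assms(5) unfolding \<nu>_def by blast
 have coord: "(\<lambda>w. w x) \<in> P \<rightarrow>\<^sub>M borel" for x :: int using indep by (auto simp: P.indep_vars_def2)
 have spaceP: "space P = {w. \<forall>x. w x \<in> jump_vectors m}"
  using sets_eq_imp_space_eq[OF assms(3)] by (simp add: space_env_space)
 obtain \<epsilon>0 where \<epsilon>0: "0 < \<epsilon>0" "\<And>p. p \<in> dist_support \<nu> \<Longrightarrow> \<epsilon>0 \<le> p 1 \<and> \<epsilon>0 \<le> p (-1)"
  using assms(6) by (auto simp: \<nu>_def)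
 \<comment> \<open>The cap 1 / 2 is what the default vector of \<open>make_elliptic\<close> can
   satisfy.\<close>
 define \<epsilon> where "\<epsilon> = min \<epsilon>0 (1 / 2)"
 interpret R: random_environment m \<epsilon> \<nu>
 proof (rule random_environment.intro)
  show "prob_space \<nu>" unfolding \<nu>_def by (rule P.prob_space_distr[OF coord])
  show "sets \<nu> = sets borel" by (simp add: \<nu>_def)
 qed (use assms(1) \<epsilon>0(1) in \<open>simp_all add: \<epsilon>_def\<close>)
 have elliptic_\<nu>: "AE p in \<nu>. p \<in> elliptic_vectors m \<epsilon>"
 proof -
  have "AE p in \<nu>. p \<in> jump_vectors m"
  proof -
   have "{p \<in> space borel. p \<in> jump_vectors m} \<in> sets borel" using borel_closed[OF jump_vectors_closed] by simp
   then show ?thesis unfolding \<nu>_def by (subst AE_distr_iff[OF coord]) (auto simp: spaceP)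
  qed
  moreover have "AE p in \<nu>. p \<in> dist_support \<nu>" by (rule dist_support_null[OF R.sets_nu])
  ultimately show ?thesis
  proof eventually_elim
   case (elim p)
   then show ?case using \<epsilon>0(2)[of p] by (auto simp: elliptic_vectors_def \<epsilon>_def)
  qed
 qed
 define E where "E = {w \<in> space P. \<forall>x. w x \<in> elliptic_vectors m \<epsilon>}"
 have E: "E \<in> P.events"
 proof -
  have "(\<Inter>x. (\<lambda>w. w x) -` elliptic_vectors m \<epsilon> \<inter> space P) \<in> P.events"
   using measurable_sets[OF coord borel_closed[OF elliptic_vectors_closed]] by (intro sets.countable_INT') auto
  also have "(\<Inter>x. (\<lambda>w. w x) -` elliptic_vectors m \<epsilon> \<inter> space P) = E" by (auto simp: E_def)
  finally show ?thesis .
 qed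
 have AE_E: "AE w in P. w \<in> E"
 proof -
  have "AE w in P. w x \<in> elliptic_vectors m \<epsilon>" for x
  proof (rule AE_distrD[OF coord])
   show "AE p in distr P borel (\<lambda>w. w x). p \<in> elliptic_vectors m \<epsilon>"
    unfolding law by (rule elliptic_\<nu>)
  qed
  then have "AE w in P. \<forall>x. w x \<in> elliptic_vectors m \<epsilon>" by (simp add: AE_all_countable)
  then show ?thesis using AE_space by eventually_elim (simp add: E_def)
 qed
 have env: "R.env w = w" if "w \<in> E" for w using that by (intro ext) (simp add: E_def R.env_def make_elliptic_id)
 have setsQ: "sets R.Q = sets (\<Pi>\<^sub>M x\<in>UNIV. borel)"
  unfolding R.Q_def by (rule sets_PiM_cong) (auto simp: R.sets_nu)
 have idm: "(\<lambda>w. w) \<in> P \<rightarrow>\<^sub>M R.Q"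
 proof -
  have "(\<lambda>w. \<lambda>x\<in>UNIV. w x) \<in> P \<rightarrow>\<^sub>M (\<Pi>\<^sub>M x\<in>UNIV. borel)" by (rule measurable_restrict) (rule coord)
  then show ?thesis by (simp add: restrict_def measurable_cong_sets[OF refl setsQ])
 qed
 \<comment> \<open>\<open>P\<close> lives on environments and \<open>R.Q\<close> on all functions;
   the identity map carries the first law to the second by independence and equal marginals.\<close>
 have distrQ: "distr P R.Q (\<lambda>w. w) = R.Q"
 proof -
  have "distr P (\<Pi>\<^sub>M x\<in>UNIV. borel) (\<lambda>w. \<lambda>x\<in>UNIV. w x) = (\<Pi>\<^sub>M x\<in>UNIV. distr P borel (\<lambda>w. w x))"
   using indep by (subst (asm) P.indep_vars_iff_distr_eq_PiM) (use coord in auto)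
  also have "... = R.Q" unfolding R.Q_def law ..
  also have "distr P (\<Pi>\<^sub>M x\<in>UNIV. borel) (\<lambda>w. \<lambda>x\<in>UNIV. w x) = distr P R.Q (\<lambda>w. w)"
   by (rule distr_cong) (auto simp: setsQ restrict_def)
  finally show ?thesis .
 qed
 have prob_eq: "P.prob (A \<inter> space P) = R.Q.prob A" if "A \<in> sets R.Q" for A
  using measure_distr[OF idm that] by (simp add: distrQ)
 have measP: "f \<in> borel_measurable P" if "f \<in> borel_measurable R.Q" for f :: "_ \<Rightarrow> real"
  using measurable_compose[OF idm that] by simp
 \<comment> \<open>This is where recurrence enters: a larger mean would make almost every
   environment transient.\<close>
 have mean: "\<bar>R.mean (R.y n)\<bar> \<le> 3 * R.defect" if n: "1 \<le> n" for n
 proof (rule ccontr)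
  assume "\<not> ?thesis"
  then have "AE w in R.Q. \<not> recurrent_walk (R.env w)" using R.unbalanced_transient[OF n] by simp
  then have "AE w in distr P R.Q (\<lambda>w. w). \<not> recurrent_walk (R.env w)" by (simp only: distrQ)
  then have "AE w in P. \<not> recurrent_walk (R.env w)" by (rule AE_distrD[OF idm])
  then have "AE w in P. False" using assms(7) AE_E
  proof eventually_elim
   case (elim w)
   then show ?case by (simp add: env)
  qed
  then show False by simp
 qed
 have \<sigma>: "0 < R.\<sigma>"
 proof -
  let ?drift = "\<lambda>p. \<Sum>j\<in>{-m..m}. of_int j * p j :: real"
  obtain p where p: "p \<in> dist_support \<nu>" "p \<notin> balanced_jump_vectors m" using assms(8) by (auto simp: \<nu>_def)
  have "p \<in> elliptic_vectors m \<epsilon>"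
   using dist_support_subset_closed[OF R.sets_nu elliptic_vectors_closed elliptic_\<nu>] p(1) by auto
  then have drift: "?drift p \<noteq> 0" using p(2) by (auto simp: balanced_jump_vectors_def elliptic_vectors_def)
  \<comment> \<open>By continuity, half the drift of an unbalanced point of the support persists in
    a neighbourhood, which has positive measure because the point lies in the support.\<close>
  define d where "d = \<bar>?drift p\<bar> / 2"
  have cont: "continuous_on UNIV ?drift"
   by (intro continuous_on_sum continuous_on_mult continuous_on_const continuous_on_product_coordinates)
  define s :: real where "s = (if 0 < ?drift p then 1 else - 1)"
  define U where "U = {p. d < s * ?drift p}"
  have U: "open U" "p \<in> U"
   unfolding U_def by (intro open_Collect_less continuous_on_mult cont continuous_on_const) (use drift in \<open>auto simp: d_def s_def\<close>)
  then have "0 < emeasure \<nu> U" using p(1) by (auto simp: dist_support_def)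
  define D where "D = U \<inter> elliptic_vectors m \<epsilon>"
  have D: "D \<in> sets \<nu>" unfolding D_def R.sets_nu using U elliptic_vectors_closed by (intro sets.Int) auto
  have "emeasure \<nu> U = emeasure \<nu> D"
   by (rule emeasure_eq_AE) (use elliptic_\<nu> D U R.sets_nu in \<open>auto simp: D_def\<close>)
  then have "0 < emeasure \<nu> D" using \<open>0 < emeasure \<nu> U\<close> by simp
  interpret N: prob_space \<nu> by (rule R.nu)
  have "0 < measure \<nu> D" using \<open>0 < emeasure \<nu> D\<close> by (simp add: N.emeasure_eq_measure)
  then show ?thesis by (intro R.sigma_positive[OF mean _ D, of d s])
    (use drift in \<open>auto simp: d_def D_def U_def s_def make_elliptic_id\<close>)
 qed
 \<comment> \<open>The 3 keeps every accuracy below 1 / 2, as the comparison of two centres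
   requires.\<close>
 define \<eta> where "\<eta> j = 1 / (real j + 3)" for j
 have \<eta>: "0 < \<eta> j" "\<eta> j < 1 / 2" for j by (auto simp: \<eta>_def field_simps)
 have "\<forall>j. \<exists>c F. R.centred (\<eta> j) c F" using R.localization[OF mean \<sigma> \<eta>(1)] by blast
 from choice[OF this] obtain c where "\<forall>j. \<exists>F. R.centred (\<eta> j) (c j) F" by blast
 from choice[OF this] obtain F where cF: "R.centred (\<eta> j) (c j) (F j)" for j by blast
 note cF = cF[unfolded R.centred_def]
 have F: "finite (F j)" "c j t w \<in> F j" and c: "c j t \<in> borel_measurable R.Q" "convergent (\<lambda>t. R.Q.prob {w. c j t w = v})"
  and loc: "\<forall>\<^sub>F t in at_top. \<exists>A\<in>R.Q.events. 1 - \<eta> j \<le> R.Q.prob A \<and>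
    (\<forall>w\<in>A. measure (walk_law (R.env w)) {\<xi>. \<eta> j < \<bar>of_int (\<xi> t) / (ln (real t))\<^sup>2 - c j t w\<bar>} < \<eta> j)" for j t w v
  using cF[of j] by blast+
 interpret L: localized_family P walk_law "\<lambda>t \<xi>. of_int (\<xi> t) / (ln (real t))\<^sup>2" c F \<eta>
 proof (rule localized_family.intro[OF P.prob_space_axioms], rule localized_family_axioms.intro)
  fix j t :: nat and w :: env
  show "prob_space (walk_law w)" by (rule prob_space_walk_law)
  show "space (walk_law w) = UNIV" by (rule space_walk_law)
  show "(\<lambda>\<xi>. of_int (\<xi> t) / (ln (real t))\<^sup>2) \<in> borel_measurable (walk_law w)"
   using walk_law_measurable_coord[of t w] by measurable
  show "c j t \<in> borel_measurable P" by (rule measP[OF c(1)])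
  show "finite (F j)" "c j t w \<in> F j" by (rule F)+
  show "0 < \<eta> j" "\<eta> j < 1 / 2" by (rule \<eta>)+
  show "antimono \<eta>" by (auto simp: antimono_def \<eta>_def field_simps)
  show "\<eta> \<longlonglongrightarrow> 0" unfolding \<eta>_def by real_asymp
 next
  fix S :: "real set" and t :: nat assume "S \<in> sets borel"
  have "(\<lambda>w. (\<lambda>p. p j) (w x)) \<in> borel_measurable P" for x j :: int
   by (rule measurable_compose[OF coord]) (rule borel_measurable_continuous_onI, rule continuous_on_product_coordinates)
  then have "(\<lambda>w. (free_op m w ^^ t) (indicat_real {x. of_int x / (ln (real t))\<^sup>2 \<in> S}) 0) \<in> borel_measurable P"
   by (intro free_op_iter_measurable) simp
  moreover have "measure (walk_law w) {\<xi>. of_int (\<xi> t) / (ln (real t))\<^sup>2 \<in> S}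
    = (free_op m w ^^ t) (indicat_real {x. of_int x / (ln (real t))\<^sup>2 \<in> S}) 0" if "w \<in> space P" for w
   using walk_law_marginal[where w=w and m=m and t=t and S="{x. of_int x / (ln (real t))\<^sup>2 \<in> S}"] that by (simp add: spaceP)
  ultimately show "(\<lambda>w. measure (walk_law w) {\<xi>. of_int (\<xi> t) / (ln (real t))\<^sup>2 \<in> S}) \<in> borel_measurable P"
   by (simp cong: measurable_cong)
 next
  fix j :: nat and v :: real
  have "P.prob {w \<in> space P. c j t w = v} = R.Q.prob {w. c j t w = v}" for t
  proof -
   have "{w \<in> space R.Q. c j t w = v} \<in> sets R.Q" using c(1) by measurable
   then show ?thesis using prob_eq[of "{w. c j t w = v}"] by (simp add: R.space_Q Int_def conj_commute)
  qed
  then show "convergent (\<lambda>t. P.prob {w \<in> space P. c j t w = v})" using c(2) by simp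
 next
  fix j
  show "\<forall>\<^sub>F t in at_top. \<exists>A\<in>P.events. 1 - \<eta> j \<le> P.prob A \<and>
    (\<forall>w\<in>A. measure (walk_law w) {\<xi>. \<eta> j < \<bar>of_int (\<xi> t) / (ln (real t))\<^sup>2 - c j t w\<bar>} < \<eta> j)"
   using loc[of j]
  proof eventually_elim
   case (elim t)
   then obtain A where A: "A \<in> sets R.Q" "1 - \<eta> j \<le> R.Q.prob A"
    "\<And>w. w \<in> A \<Longrightarrow> measure (walk_law (R.env w)) {\<xi>. \<eta> j < \<bar>of_int (\<xi> t) / (ln (real t))\<^sup>2 - c j t w\<bar>} < \<eta> j" by blast
   have A': "A \<inter> space P \<in> P.events" using measurable_sets[OF idm A(1)] by simp
   \<comment> \<open>On the almost sure event \<open>E\<close> the modified environment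
     \<open>R.env w\<close> is \<open>w\<close> itself, so the localization carries over.\<close>
   have "P.prob (A \<inter> space P \<inter> E) = P.prob (A \<inter> space P)"
    by (rule P.finite_measure_eq_AE) (use AE_E A' E in auto)
   then have "1 - \<eta> j \<le> P.prob (A \<inter> space P \<inter> E)" using prob_eq[OF A(1)] A(2) by simp
   moreover have "measure (walk_law w) {\<xi>. \<eta> j < \<bar>of_int (\<xi> t) / (ln (real t))\<^sup>2 - c j t w\<bar>} < \<eta> j" if "w \<in> A \<inter> space P \<inter> E" for w
    using A(3)[of w] env[of w] that by simp
   ultimately show ?case using A' E by (intro bexI[of _ "A \<inter> space P \<inter> E"]) auto
  qed
 qed
 show ?thesis using L.b_meas L.b_weakly_convergent L.b_localizes by (intro exI[of _ L.b]) (simp add: space_walk_law)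
qed

end
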